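(* Let $d$ be either the metric on $\mathbb{R}^3$ induced by the norm $\|(x_1,x_2,t)\|_{JM}=\sqrt{x_1^2+x_2^2}+|t|$, or the Euclidean metric on $\mathbb{R}^3$. Let $\mathcal{P}$ be a homogeneous Poisson process of intensity $1$ on $\mathbb{R}^2\times[0,\infty)$, each point of which is independently coloured black with probability $p$ and white otherwise; write $\mathbb{P}_p$ for the resulting measure. For $z\in\mathcal{P}$ let $V_z=\{x\in\mathbb{R}^2: d((x,0),z)=\inf_{z'\in\mathcal{P}}d((x,0),z')\}$, and call $x\in\mathbb{R}^2$ black if it lies in $V_z$ for some black $z$. For a rectangle $R\subset\mathbb{R}^2$ let $H(R)$ be the event that there is a piecewise-linear path contained in $R$, joining the left and right sides of $R$, every point of which is black, and let $f_p(\rho,s)=\mathbb{P}_p\bigl(H([0,\rho s]\times[0,s])\bigr)$. Let $\rho>1$, $p>1/2$, $c_1<1$ and $s_1$ be given. Then there is an $s>s_1$ such that $f_p(\rho,s)>c_1$. *)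

theory Defs
  imports "HOL-Probability.Probability"
begin

type_synonym pt3 = "real \<times> real \<times> real"
type_synonym pt2 = "real \<times> real"

definition dist_JM :: "pt3 \<Rightarrow> pt3 \<Rightarrow> real" where
  "dist_JM z w = sqrt ((fst z - fst w)^2 + (fst (snd z) - fst (snd w))^2)
                 + \<bar>snd (snd z) - snd (snd w)\<bar>"

definition halfspace :: "pt3 set" where
  "halfspace = {z. snd (snd z) \<ge> 0}"

text \<open>Intensity measure of the independently p-marked Poisson process of intensity 1
  on R^2 x [0,oo): Lebesgue measure times Bernoulli(p) on the marks (True = black).\<close>
definition mark_intensity :: "real \<Rightarrow> (pt3 \<times> bool) set \<Rightarrow> real" where
  "mark_intensity p B =
     p * measure lborel ({z. (z, True) \<in> B} \<inter> halfspace)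
     + (1 - p) * measure lborel ({z. (z, False) \<in> B} \<inter> halfspace)"

definition marked_poisson_process ::
  "'w measure \<Rightarrow> real \<Rightarrow> ('w \<Rightarrow> (pt3 \<times> bool) set) \<Rightarrow> bool" where
  "marked_poisson_process M p Q \<longleftrightarrow>
     prob_space M \<and>
     (\<forall>\<omega>\<in>space M. Q \<omega> \<subseteq> halfspace \<times> UNIV) \<and>
     (\<forall>\<omega>\<in>space M. \<forall>K. bounded K \<longrightarrow> finite (Q \<omega> \<inter> (K \<times> UNIV))) \<and>
     (\<forall>(k::nat) (B :: nat \<Rightarrow> (pt3 \<times> bool) set).
        (\<forall>i<k. \<forall>b. {z. (z, b) \<in> B i} \<in> sets borel \<and> bounded {z. (z, b) \<in> B i}) \<and>
        disjoint_family_on B {..<k} \<longrightarrow>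
          prob_space.indep_vars M (\<lambda>_. count_space UNIV)
             (\<lambda>i \<omega>. card (Q \<omega> \<inter> B i)) {..<k} \<and>
          (\<forall>i<k. \<forall>n::nat. measure M {\<omega>\<in>space M. card (Q \<omega> \<inter> B i) = n}
               = mark_intensity p (B i) ^ n / fact n * exp (- mark_intensity p (B i))))"

definition voronoi_cell :: "(pt3 \<Rightarrow> pt3 \<Rightarrow> real) \<Rightarrow> pt3 set \<Rightarrow> pt3 \<Rightarrow> pt2 set" where
  "voronoi_cell d P z =
     {x. d (fst x, snd x, 0) z = (INF z'\<in>P. d (fst x, snd x, 0) z')}"

definition black_point :: "(pt3 \<Rightarrow> pt3 \<Rightarrow> real) \<Rightarrow> (pt3 \<times> bool) set \<Rightarrow> pt2 \<Rightarrow> bool" where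
  "black_point d Q x \<longleftrightarrow>
     (\<exists>z. (z, True) \<in> Q \<and> x \<in> voronoi_cell d (fst ` Q) z)"

definition black_crossing ::
  "(pt3 \<Rightarrow> pt3 \<Rightarrow> real) \<Rightarrow> (pt3 \<times> bool) set \<Rightarrow> real \<Rightarrow> real \<Rightarrow> bool" where
  "black_crossing d Q a b \<longleftrightarrow>
     (\<exists>vs :: pt2 list. vs \<noteq> [] \<and> fst (hd vs) = 0 \<and> fst (last vs) = a \<and>
        (\<forall>i < length vs - 1.
            closed_segment (vs ! i) (vs ! Suc i) \<subseteq> {0..a} \<times> {0..b} \<and>
            (\<forall>x \<in> closed_segment (vs ! i) (vs ! Suc i). black_point d Q x)) \<and>
        (\<forall>v\<in>set vs. v \<in> {0..a} \<times> {0..b} \<and> black_point d Q v))"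

end

theory Submission
  imports Defs "HOL-Library.Diagonal_Subsequence"
begin

text \<open>Cut \<open>\<real>\<^sup>2 \<times> [0, \<infinity>)\<close> into cubes of side \<open>1/K\<close> and record for each cube whether it contains a white and
  whether it contains a black point. In the resulting product space let \<open>\<theta>\<^sub>q(n)\<close> be the probability of a white
  connection from the unit box to distance \<open>n\<close> when white has density \<open>q\<close>; all estimates are uniform in \<open>K\<close>.

  At \<open>q = 1/2\<close> we have \<open>\<theta>(n) \<rightarrow> 0\<close> as \<open>K \<rightarrow> \<infinity>\<close> and then \<open>n \<rightarrow> \<infinity>\<close>: otherwise a large box is connected to all far
  scales with probability near one, hence, by the square root trick, to each of the eight halves of the sides
  of a larger box, bounded gaps between the halves being closed off at a bounded cost. Arms issuing from two shifted hubs are then forced to cross, which connects bottom to top of a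
  square with probability above \<open>1/2\<close>, contradicting colour symmetry.

  The inequality of O'Donnell, Saks, Schramm and Servedio turns this into
  \<open>\<theta>\<^sub>q(n) \<le> exp (- c (q' - q) n / \<Sum>\<^sub>j\<^sub>\<le>\<^sub>n \<theta>\<^sub>q\<^sub>'(j))\<close> for \<open>q < q' \<le> 1/2\<close>; iterating over a sequence of densities gives
  \<open>n \<theta>\<^sub>q(n) \<rightarrow> 0\<close> along a subsequence for every \<open>q < 1/2\<close>. Hence a white path crosses a long rectangle of height
  comparable to \<open>n\<close> vertically with small probability, and by the Hex theorem a black horizontal
  crossing exists with probability near one. Configurations with discrete crossings for infinitely many \<open>K\<close> have a
  continuous one by compactness.\<close>

section \<open>Finite products of Bernoulli variables\<close>

text \<open>No box-crossing estimate of Russo-Seymour-Welsh type enters: at density one half only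
  the symmetries of the square, Harris's inequality and colour symmetry are used. Hence smallness of
  \<open>n \<theta>(n)\<close> is reached only at some scales, which is enough because the theorem
  asks for one large height. The colour of a site depends on points at unbounded distance. Each
  decoupling therefore erases or adds the bits of a whole region; a change of colour then forces a
  large cube without points of one colour, whose probability decays exponentially in the radius,
  uniformly in \<open>K\<close>. The model has bits because the query inequality and Russo's formula
  live on finite products, and because for both bits of a cell the variance is at most the
  derivative in \<open>q\<close>, which has order \<open>K ^ (-3)\<close>; this is what makes the
  two fit together uniformly in \<open>K\<close>. Colours are asymmetric at ties: white is strict,
  so a site is never white for both colourings, while black is weak, so no site is left over in the
  Hex theorem. Only numbers pass to the limit in \<open>K\<close>, along one diagonal sequence, and
  the iteration over densities is run on these limits.\<close>

definition bexp :: "('i \<Rightarrow> real) \<Rightarrow> 'i set \<Rightarrow> ('i set \<Rightarrow> real) \<Rightarrow> real" where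
  "bexp \<pi> I f = (\<Sum>\<omega>\<in>Pow I. (\<Prod>i\<in>I. if i \<in> \<omega> then \<pi> i else 1 - \<pi> i) * f \<omega>)"

lemma bexp_empty [simp]: "bexp \<pi> {} f = f {}"
  by (simp add: bexp_def)

lemma bexp_insert:
  assumes "finite I" "i \<notin> I"
  shows "bexp \<pi> (insert i I) f
    = \<pi> i * bexp \<pi> I (\<lambda>\<omega>. f (insert i \<omega>)) + (1 - \<pi> i) * bexp \<pi> I f"
proof -
  let ?w = "\<lambda>I \<omega>. \<Prod>j\<in>I. if j \<in> \<omega> then \<pi> j else 1 - \<pi> j"
  have inj: "inj_on (insert i) (Pow I)"
    using assms(2) by (auto simp: inj_on_def)
  have disj: "Pow I \<inter> insert i ` Pow I = {}"
    using assms(2) by auto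
  have w1: "?w (insert i I) (insert i \<omega>) = \<pi> i * ?w I \<omega>" for \<omega>
  proof -
    have "(\<Prod>j\<in>I. if j \<in> insert i \<omega> then \<pi> j else 1 - \<pi> j) = ?w I \<omega>"
      using assms(2) by (intro prod.cong) auto
    then show ?thesis using assms by simp
  qed
  have w0: "?w (insert i I) \<omega> = (1 - \<pi> i) * ?w I \<omega>" if "\<omega> \<in> Pow I" for \<omega>
    using assms that by auto
  have "bexp \<pi> (insert i I) f = (\<Sum>\<omega>\<in>Pow I. ?w (insert i I) \<omega> * f \<omega>)
      + (\<Sum>\<omega>\<in>insert i ` Pow I. ?w (insert i I) \<omega> * f \<omega>)"
    unfolding bexp_def Pow_insert
    using assms disj by (intro sum.union_disjoint) auto
  also have "(\<Sum>\<omega>\<in>insert i ` Pow I. ?w (insert i I) \<omega> * f \<omega>)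
     = (\<Sum>\<omega>\<in>Pow I. \<pi> i * (?w I \<omega> * f (insert i \<omega>)))"
    by (subst sum.reindex[OF inj], simp only: o_def w1 mult.assoc)
  also have "(\<Sum>\<omega>\<in>Pow I. ?w (insert i I) \<omega> * f \<omega>)
     = (\<Sum>\<omega>\<in>Pow I. (1 - \<pi> i) * (?w I \<omega> * f \<omega>))"
    by (intro sum.cong refl) (simp only: w0 mult.assoc)
  finally show ?thesis by (simp add: bexp_def sum_distrib_left)
qed

lemma bexp_cong: "(\<And>\<omega>. \<omega> \<subseteq> I \<Longrightarrow> f \<omega> = g \<omega>) \<Longrightarrow> bexp \<pi> I f = bexp \<pi> I g"
  unfolding bexp_def by (intro sum.cong) auto

lemma bexp_add: "bexp \<pi> I (\<lambda>\<omega>. f \<omega> + g \<omega>) = bexp \<pi> I f + bexp \<pi> I g"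
  by (simp add: bexp_def distrib_left sum.distrib)

lemma bexp_diff: "bexp \<pi> I (\<lambda>\<omega>. f \<omega> - g \<omega>) = bexp \<pi> I f - bexp \<pi> I g"
  by (simp add: bexp_def right_diff_distrib sum_subtractf)

lemma bexp_cmult: "bexp \<pi> I (\<lambda>\<omega>. c * f \<omega>) = c * bexp \<pi> I f"
  by (simp add: bexp_def sum_distrib_left mult_ac)

lemma bexp_const [simp]: "finite I \<Longrightarrow> bexp \<pi> I (\<lambda>_. c) = c"
  by (induction I rule: finite_induct) (simp_all add: bexp_insert algebra_simps)

definition weights :: "('i \<Rightarrow> real) \<Rightarrow> bool" where
  "weights \<pi> \<longleftrightarrow> (\<forall>i. 0 \<le> \<pi> i \<and> \<pi> i \<le> 1)"

lemma bexp_mono: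
  assumes "weights \<pi>" "\<And>\<omega>. \<omega> \<subseteq> I \<Longrightarrow> f \<omega> \<le> g \<omega>"
  shows "bexp \<pi> I f \<le> bexp \<pi> I g"
  unfolding bexp_def using assms
  by (intro sum_mono mult_left_mono prod_nonneg) (auto simp: weights_def)

lemma bexp_nonneg:
  assumes "weights \<pi>" "\<And>\<omega>. \<omega> \<subseteq> I \<Longrightarrow> 0 \<le> f \<omega>"
  shows "0 \<le> bexp \<pi> I f"
  unfolding bexp_def using assms
  by (intro sum_nonneg mult_nonneg_nonneg prod_nonneg) (auto simp: weights_def)

lemma bexp_Un:
  assumes "finite A" "finite B" "A \<inter> B = {}"
  shows "bexp \<pi> (A \<union> B) f = bexp \<pi> A (\<lambda>\<alpha>. bexp \<pi> B (\<lambda>\<beta>. f (\<alpha> \<union> \<beta>)))"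
  using assms
proof (induction A arbitrary: f rule: finite_induct)
  case (insert a A)
  have "bexp \<pi> (insert a (A \<union> B)) f = \<pi> a * bexp \<pi> (A \<union> B) (\<lambda>\<omega>. f (insert a \<omega>))
      + (1 - \<pi> a) * bexp \<pi> (A \<union> B) f"
    using insert by (intro bexp_insert) auto
  then show ?case
    using insert by (simp add: bexp_insert)
qed simp

text \<open>The set \<open>I\<close> may be infinite: independence below concerns events supported
  on a set of coordinates and on its complement.\<close>

definition dep :: "'i set \<Rightarrow> ('i set \<Rightarrow> 'a) \<Rightarrow> bool" where
  "dep I f \<longleftrightarrow> (\<forall>\<omega>. f (\<omega> \<inter> I) = f \<omega>)"

lemma depD: "dep I f \<Longrightarrow> f (\<omega> \<inter> I) = f \<omega>"
  by (simp add: dep_def)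

lemma dep_eq: "dep I f \<Longrightarrow> \<omega> \<inter> I = \<omega>' \<inter> I \<Longrightarrow> f \<omega> = f \<omega>'"
  by (metis dep_def)

lemma dep_mono: "dep I f \<Longrightarrow> I \<subseteq> J \<Longrightarrow> dep J f"
  by (metis dep_def inf.absorb_iff2 inf_assoc)

lemma dep_comb2: "dep I f \<Longrightarrow> dep I g \<Longrightarrow> dep I (\<lambda>\<omega>. h (f \<omega>) (g \<omega>))"
  by (simp add: dep_def)

lemma dep_comb: "dep I f \<Longrightarrow> dep I (\<lambda>\<omega>. h (f \<omega>))"
  by (simp add: dep_def)

lemma bexp_dep:
  assumes "finite I'" "I \<subseteq> I'" "dep I f"
  shows "bexp \<pi> I' f = bexp \<pi> I f"
proof -
  have fin: "finite I" "finite (I' - I)" using assms finite_subset by auto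
  have "bexp \<pi> (I \<union> (I' - I)) f = bexp \<pi> I (\<lambda>\<alpha>. bexp \<pi> (I' - I) (\<lambda>\<beta>. f (\<alpha> \<union> \<beta>)))"
    using fin by (intro bexp_Un) auto
  also have "\<dots> = bexp \<pi> I (\<lambda>\<alpha>. bexp \<pi> (I' - I) (\<lambda>\<beta>. f \<alpha>))"
    by (intro bexp_cong dep_eq[OF assms(3)]) auto
  finally show ?thesis using fin assms(2) by (simp add: Un_absorb1)
qed

lemma mono_insert: "mono f \<Longrightarrow> mono (\<lambda>\<omega>. f (insert i \<omega>))"
  by (auto intro!: monoI elim!: monoD)

text \<open>Conditioning on one coordinate leaves the two-point case, where the covariance is
  \<open>\<pi> i * (1 - \<pi> i)\<close> times a product of two increments, both nonnegative by
  monotonicity.\<close>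

lemma bexp_Harris:
  assumes "finite I" "weights \<pi>" "mono f" "mono g"
  shows "bexp \<pi> I f * bexp \<pi> I g \<le> bexp \<pi> I (\<lambda>\<omega>. f \<omega> * g \<omega>)"
  using assms(1,3,4)
proof (induction I arbitrary: f g rule: finite_induct)
  case (insert i I)
  define f1 where "f1 = (\<lambda>\<omega>. f (insert i \<omega>))"
  define g1 where "g1 = (\<lambda>\<omega>. g (insert i \<omega>))"
  have m: "mono f1" "mono g1" using insert.prems
    by (simp_all add: f1_def g1_def mono_insert)
  let ?E = "bexp \<pi> I" and ?p = "\<pi> i"
  have p: "0 \<le> ?p" "?p \<le> 1" using assms(2) by (auto simp: weights_def)
  have ff: "?E f \<le> ?E f1" "?E g \<le> ?E g1"
    unfolding f1_def g1_def
    by (intro bexp_mono[OF assms(2)] monoD[OF insert.prems(1)] monoD[OF insert.prems(2)] subset_insertI)+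
  have i1: "?E f1 * ?E g1 \<le> ?E (\<lambda>\<omega>. f1 \<omega> * g1 \<omega>)" by (rule insert.IH[OF m])
  have i0: "?E f * ?E g \<le> ?E (\<lambda>\<omega>. f \<omega> * g \<omega>)" by (rule insert.IH[OF insert.prems])
  have "(?p * ?E f1 + (1 - ?p) * ?E f) * (?p * ?E g1 + (1 - ?p) * ?E g)
      = ?p * (?E f1 * ?E g1) + (1 - ?p) * (?E f * ?E g)
        - ?p * (1 - ?p) * ((?E f1 - ?E f) * (?E g1 - ?E g))"
    by (simp add: algebra_simps)
  also have "\<dots> \<le> ?p * (?E f1 * ?E g1) + (1 - ?p) * (?E f * ?E g)"
    using p ff by simp
  also have "\<dots> \<le> ?p * ?E (\<lambda>\<omega>. f1 \<omega> * g1 \<omega>) + (1 - ?p) * ?E (\<lambda>\<omega>. f \<omega> * g \<omega>)"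
    using p i1 i0 by (intro add_mono mult_left_mono) auto
  finally show ?case
    using insert.hyps by (simp add: bexp_insert f1_def g1_def)
qed simp

lemma bexp_mono_weight:
  assumes "finite I" "weights \<pi>" "weights \<pi>'" "\<And>i. \<pi> i \<le> \<pi>' i" "mono f"
  shows "bexp \<pi> I f \<le> bexp \<pi>' I f"
  using assms(1,5)
proof (induction I arbitrary: f rule: finite_induct)
  case (insert i I)
  define f1 where "f1 = (\<lambda>\<omega>. f (insert i \<omega>))"
  have m: "mono f1" using insert.prems by (simp add: f1_def mono_insert)
  have "bexp \<pi> I f1 \<le> bexp \<pi>' I f1" "bexp \<pi> I f \<le> bexp \<pi>' I f"
    using insert.IH[OF m] insert.IH[OF insert.prems] by auto
  moreover have "bexp \<pi>' I f \<le> bexp \<pi>' I f1"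
    unfolding f1_def by (intro bexp_mono[OF assms(3)] monoD[OF insert.prems] subset_insertI)
  moreover have p: "0 \<le> \<pi> i" "\<pi> i \<le> \<pi>' i" "\<pi>' i \<le> 1" "\<pi> i \<le> 1"
    using assms by (auto simp: weights_def)
  ultimately have "\<pi> i * bexp \<pi> I f1 + (1 - \<pi> i) * bexp \<pi> I f
     \<le> \<pi> i * bexp \<pi>' I f1 + (1 - \<pi> i) * bexp \<pi>' I f"
    by (intro add_mono mult_left_mono) auto
  also have "\<dots> \<le> \<pi>' i * bexp \<pi>' I f1 + (1 - \<pi>' i) * bexp \<pi>' I f"
  proof -
    have "0 \<le> (\<pi>' i - \<pi> i) * (bexp \<pi>' I f1 - bexp \<pi>' I f)"
      using p \<open>bexp \<pi>' I f \<le> bexp \<pi>' I f1\<close> by simp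
    then show ?thesis by (simp add: algebra_simps)
  qed
  finally show ?case using insert.hyps by (simp add: bexp_insert f1_def)
qed simp

lemma bexp_reindex:
  assumes "inj_on \<sigma> I" "finite I" "\<And>i. i \<in> I \<Longrightarrow> \<pi>' (\<sigma> i) = \<pi> i"
  shows "bexp \<pi> I (\<lambda>\<omega>. f (\<sigma> ` \<omega>)) = bexp \<pi>' (\<sigma> ` I) f"
  using assms(2,1,3)
proof (induction I arbitrary: f rule: finite_induct)
  case (insert i I)
  then have "\<sigma> i \<notin> \<sigma> ` I" by auto
  then show ?case
    using insert.hyps insert.prems insert.IH[of f] insert.IH[of "\<lambda>\<omega>. f (insert (\<sigma> i) \<omega>)"]
    by (simp add: bexp_insert)
qed simp

lemma bexp_flip:
  assumes "finite I"
  shows "bexp \<pi> I (\<lambda>\<omega>. f (I - \<omega>)) = bexp (\<lambda>i. 1 - \<pi> i) I f"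
  using assms
proof (induction I arbitrary: f rule: finite_induct)
  case (insert i I)
  have "bexp \<pi> I (\<lambda>\<omega>. f (insert i I - insert i \<omega>)) = bexp \<pi> I (\<lambda>\<omega>. f (I - \<omega>))"
    using insert by (intro bexp_cong arg_cong[where f=f]) auto
  moreover have "bexp \<pi> I (\<lambda>\<omega>. f (insert i I - \<omega>)) = bexp \<pi> I (\<lambda>\<omega>. f (insert i (I - \<omega>)))"
    using insert by (intro bexp_cong arg_cong[where f=f]) auto
  ultimately show ?case
    using insert.hyps insert.IH[of f] insert.IH[of "\<lambda>\<omega>. f (insert i \<omega>)"]
    by (simp add: bexp_insert)
qed simp

text \<open>Form of \<open>bexp_insert\<close> suited to resampling a coordinate: the expectations
  on the right run over the whole of \<open>I\<close> again.\<close>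

lemma bexp_split:
  assumes "finite I" "i \<in> I"
  shows "bexp \<pi> I h = \<pi> i * bexp \<pi> I (\<lambda>\<omega>. h (insert i \<omega>)) + (1 - \<pi> i) * bexp \<pi> I (\<lambda>\<omega>. h (\<omega> - {i}))"
proof -
  define J where "J = I - {i}"
  have I: "I = insert i J" "i \<notin> J" "finite J" using assms by (auto simp: J_def)
  have "bexp \<pi> J (\<lambda>\<omega>. h (\<omega> - {i})) = bexp \<pi> J h"
    using I by (intro bexp_cong arg_cong[where f=h]) auto
  moreover have "bexp \<pi> J (\<lambda>\<omega>. h (insert i \<omega> - {i})) = bexp \<pi> J h"
    using I by (intro bexp_cong arg_cong[where f=h]) auto
  ultimately show ?thesis unfolding I(1) using I by (simp add: bexp_insert algebra_simps)
qed

subsection \<open>Events with finite support in infinite products\<close>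

definition loc :: "('i set \<Rightarrow> bool) \<Rightarrow> bool" where
  "loc A \<longleftrightarrow> (\<exists>I. finite I \<and> dep I A)"

text \<open>By \<open>prb_eq\<close> every finite support gives the same value, so the choice is
  immaterial and no infinite product measure has to be built. The value has a meaning for
  \<open>loc\<close> events, whence the \<open>loc\<close> hypotheses throughout.\<close>

definition prb :: "('i \<Rightarrow> real) \<Rightarrow> ('i set \<Rightarrow> bool) \<Rightarrow> real" where
  "prb \<pi> A = bexp \<pi> (SOME I. finite I \<and> dep I A) (\<lambda>\<omega>. of_bool (A \<omega>))"

lemma prb_eq:
  assumes "finite I" "dep I A"
  shows "prb \<pi> A = bexp \<pi> I (\<lambda>\<omega>. of_bool (A \<omega>))"
proof -
  define J where "J = (SOME I. finite I \<and> dep I A)"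
  have J: "finite J" "dep J A"
    using someI[of "\<lambda>I. finite I \<and> dep I A" I] assms by (auto simp: J_def)
  have "dep J (\<lambda>\<omega>. of_bool (A \<omega>) :: real)" "dep I (\<lambda>\<omega>. of_bool (A \<omega>) :: real)"
    using J assms by (auto intro: dep_comb)
  then have "bexp \<pi> J (\<lambda>\<omega>. of_bool (A \<omega>)) = bexp \<pi> (I \<union> J) (\<lambda>\<omega>. of_bool (A \<omega>))"
    "bexp \<pi> I (\<lambda>\<omega>. of_bool (A \<omega>)) = bexp \<pi> (I \<union> J) (\<lambda>\<omega>. of_bool (A \<omega>))"
    using J assms by (auto intro!: bexp_dep[symmetric])
  then show ?thesis by (simp add: prb_def J_def)
qed

lemma loc_not: "loc A \<Longrightarrow> loc (\<lambda>\<omega>. \<not> A \<omega>)"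
  unfolding loc_def dep_def by simp

lemma loc_two:
  assumes "loc A" "loc B"
  obtains I where "finite I" "dep I A" "dep I B"
proof -
  obtain I J where "finite I" "dep I A" "finite J" "dep J B" using assms by (auto simp: loc_def)
  then show thesis using that[of "I \<union> J"] by (auto intro: dep_mono)
qed

lemma loc_conj: "loc A \<Longrightarrow> loc B \<Longrightarrow> loc (\<lambda>\<omega>. A \<omega> \<and> B \<omega>)"
  by (erule (1) loc_two, unfold loc_def dep_def) auto

lemma loc_disj: "loc A \<Longrightarrow> loc B \<Longrightarrow> loc (\<lambda>\<omega>. A \<omega> \<or> B \<omega>)"
  by (erule (1) loc_two, unfold loc_def dep_def) auto

lemma loc_const: "loc (\<lambda>_. c)"
  unfolding loc_def dep_def by blast

lemma loc_bex: "finite K \<Longrightarrow> (\<And>k. k \<in> K \<Longrightarrow> loc (A k)) \<Longrightarrow> loc (\<lambda>\<omega>. \<exists>k\<in>K. A k \<omega>)"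
  by (induction K rule: finite_induct) (auto simp: loc_const intro: loc_disj)

lemma loc_ball: "finite K \<Longrightarrow> (\<And>k. k \<in> K \<Longrightarrow> loc (A k)) \<Longrightarrow> loc (\<lambda>\<omega>. \<forall>k\<in>K. A k \<omega>)"
  by (induction K rule: finite_induct) (auto simp: loc_const intro: loc_conj)

lemma loc_member: "loc (\<lambda>\<omega>. i \<in> \<omega>)"
  unfolding loc_def dep_def by (intro exI[of _ "{i}"]) auto

lemma loc_Int: "loc A \<Longrightarrow> loc (\<lambda>\<omega>. A (\<omega> \<inter> J))"
  unfolding loc_def dep_def by (auto simp: inf.assoc inf.commute inf.left_commute)

lemma loc_Un:
  assumes "loc A"
  shows "loc (\<lambda>\<omega>. A (\<omega> \<union> J))"
proof -
  obtain I where I: "finite I" "dep I A" using assms by (auto simp: loc_def)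
  have "A ((\<omega> \<inter> I) \<union> J) = A (\<omega> \<union> J)" for \<omega>
    by (rule dep_eq[OF I(2)]) auto
  then show ?thesis unfolding loc_def dep_def using I(1) by blast
qed

definition inc :: "('i set \<Rightarrow> bool) \<Rightarrow> bool" where
  "inc A \<longleftrightarrow> (\<forall>\<omega> \<omega>'. \<omega> \<subseteq> \<omega>' \<longrightarrow> A \<omega> \<longrightarrow> A \<omega>')"

lemma incD: "inc A \<Longrightarrow> \<omega> \<subseteq> \<omega>' \<Longrightarrow> A \<omega> \<Longrightarrow> A \<omega>'"
  by (auto simp: inc_def)

lemma incI: "(\<And>\<omega> \<omega>'. \<omega> \<subseteq> \<omega>' \<Longrightarrow> A \<omega> \<Longrightarrow> A \<omega>') \<Longrightarrow> inc A"
  by (auto simp: inc_def)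

lemma inc_bex: "(\<And>k. k \<in> K \<Longrightarrow> inc (A k)) \<Longrightarrow> inc (\<lambda>\<omega>. \<exists>k\<in>K. A k \<omega>)"
  unfolding inc_def by blast

lemma inc_conj: "inc A \<Longrightarrow> inc B \<Longrightarrow> inc (\<lambda>\<omega>. A \<omega> \<and> B \<omega>)"
  unfolding inc_def by blast

lemma mono_of_bool: "inc A \<Longrightarrow> mono (\<lambda>\<omega>. of_bool (A \<omega>) :: real)"
  by (intro monoI) (auto dest: incD)

context
  fixes \<pi> :: "'i \<Rightarrow> real"
  assumes wt: "weights \<pi>"
begin

lemma prb_nonneg: "0 \<le> prb \<pi> A"
  unfolding prb_def by (rule bexp_nonneg[OF wt]) auto

lemma prb_mono:
  assumes "loc A" "loc B" "\<And>\<omega>. A \<omega> \<Longrightarrow> B \<omega>"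
  shows "prb \<pi> A \<le> prb \<pi> B"
proof -
  obtain I where I: "finite I" "dep I A" "dep I B" using loc_two assms by metis
  then show ?thesis using assms(3) by (auto simp: prb_eq intro!: bexp_mono[OF wt])
qed

lemma prb_const: "prb \<pi> (\<lambda>_. c) = of_bool c"
  by (subst prb_eq[of "{}"]) (auto simp: dep_def)

lemma prb_le_1: "loc A \<Longrightarrow> prb \<pi> A \<le> 1"
  using prb_mono[of A "\<lambda>_. True"] by (simp add: loc_const prb_const)

lemma prb_not: "loc A \<Longrightarrow> prb \<pi> (\<lambda>\<omega>. \<not> A \<omega>) = 1 - prb \<pi> A"
proof -
  assume "loc A"
  then obtain I where I: "finite I" "dep I A" by (auto simp: loc_def)
  then have d: "dep I (\<lambda>\<omega>. \<not> A \<omega>)" by (auto intro: dep_comb)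
  have "bexp \<pi> I (\<lambda>\<omega>. of_bool (\<not> A \<omega>)) = bexp \<pi> I (\<lambda>\<omega>. 1 - of_bool (A \<omega>))"
    by (intro bexp_cong) auto
  then show ?thesis using I d by (simp add: prb_eq bexp_diff)
qed

lemma prb_disj_le: "loc A \<Longrightarrow> loc B \<Longrightarrow> prb \<pi> (\<lambda>\<omega>. A \<omega> \<or> B \<omega>) \<le> prb \<pi> A + prb \<pi> B"
proof -
  assume "loc A" "loc B"
  then obtain I where I: "finite I" "dep I A" "dep I B" using loc_two by metis
  then have d: "dep I (\<lambda>\<omega>. A \<omega> \<or> B \<omega>)" by (auto intro: dep_comb2)
  have "bexp \<pi> I (\<lambda>\<omega>. of_bool (A \<omega> \<or> B \<omega>)) \<le> bexp \<pi> I (\<lambda>\<omega>. of_bool (A \<omega>) + of_bool (B \<omega>))"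
    by (intro bexp_mono[OF wt]) auto
  then show ?thesis using I d by (simp add: prb_eq bexp_add)
qed

lemma prb_bex_le:
  assumes "finite K" "\<And>k. k \<in> K \<Longrightarrow> loc (A k)"
  shows "prb \<pi> (\<lambda>\<omega>. \<exists>k\<in>K. A k \<omega>) \<le> (\<Sum>k\<in>K. prb \<pi> (A k))"
  using assms
proof (induction K rule: finite_induct)
  case (insert k K)
  have "prb \<pi> (\<lambda>\<omega>. A k \<omega> \<or> (\<exists>k\<in>K. A k \<omega>)) \<le> prb \<pi> (A k) + prb \<pi> (\<lambda>\<omega>. \<exists>k\<in>K. A k \<omega>)"
    using insert by (intro prb_disj_le loc_bex) auto
  then show ?case using insert by simp
qed (simp add: prb_const)

lemma prb_diff_le:
  assumes "loc A" "loc B"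
  shows "prb \<pi> A - prb \<pi> B \<le> prb \<pi> (\<lambda>\<omega>. A \<omega> \<and> \<not> B \<omega>)"
proof -
  have "prb \<pi> A \<le> prb \<pi> (\<lambda>\<omega>. (A \<omega> \<and> \<not> B \<omega>) \<or> B \<omega>)"
    using assms by (intro prb_mono loc_disj loc_conj loc_not) auto
  also have "\<dots> \<le> prb \<pi> (\<lambda>\<omega>. A \<omega> \<and> \<not> B \<omega>) + prb \<pi> B"
    using assms by (intro prb_disj_le loc_conj loc_not) auto
  finally show ?thesis by simp
qed

lemma prb_diff_eq:
  assumes "loc A" "loc B" "\<And>\<omega>. B \<omega> \<Longrightarrow> A \<omega>"
  shows "prb \<pi> (\<lambda>\<omega>. A \<omega> \<and> \<not> B \<omega>) = prb \<pi> A - prb \<pi> B"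
proof -
  obtain I where I: "finite I" "dep I A" "dep I B" using loc_two assms by metis
  have d: "dep I (\<lambda>\<omega>. A \<omega> \<and> \<not> B \<omega>)" using I by (auto simp: dep_def)
  have "bexp \<pi> I (\<lambda>\<omega>. of_bool (A \<omega> \<and> \<not> B \<omega>)) = bexp \<pi> I (\<lambda>\<omega>. of_bool (A \<omega>) - of_bool (B \<omega>))"
    using assms(3) by (intro bexp_cong) auto
  then show ?thesis using I d by (simp add: prb_eq bexp_diff)
qed

lemma prb_indep:
  assumes "loc A" "loc B" "dep S A" "dep (- S) B"
  shows "prb \<pi> (\<lambda>\<omega>. A \<omega> \<and> B \<omega>) = prb \<pi> A * prb \<pi> B"
proof -
  obtain I where I: "finite I" "dep I A" "dep I B" using loc_two assms by metis
  let ?U = "I \<inter> S" and ?V = "I - S"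
  have dA: "dep ?U A" using I assms unfolding dep_def by (metis inf_assoc)
  have dB: "dep ?V B" using I assms unfolding dep_def by (metis inf_assoc Diff_eq)
  have fin: "finite ?U" "finite ?V" using I by auto
  have dAB: "dep (?U \<union> ?V) (\<lambda>\<omega>. A \<omega> \<and> B \<omega>)"
    using I by (auto simp: Int_Diff_Un intro: dep_comb2)
  have "prb \<pi> (\<lambda>\<omega>. A \<omega> \<and> B \<omega>) = bexp \<pi> (?U \<union> ?V) (\<lambda>\<omega>. of_bool (A \<omega> \<and> B \<omega>))"
    using dAB fin by (intro prb_eq) auto
  also have "\<dots> = bexp \<pi> ?U (\<lambda>\<alpha>. bexp \<pi> ?V (\<lambda>\<beta>. of_bool (A (\<alpha> \<union> \<beta>) \<and> B (\<alpha> \<union> \<beta>))))"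
    using fin by (intro bexp_Un) auto
  also have "\<dots> = bexp \<pi> ?U (\<lambda>\<alpha>. bexp \<pi> ?V (\<lambda>\<beta>. of_bool (A \<alpha>) * of_bool (B \<beta>)))"
  proof (intro bexp_cong)
    fix \<alpha> \<beta> assume s: "\<alpha> \<subseteq> ?U" "\<beta> \<subseteq> ?V"
    have "A (\<alpha> \<union> \<beta>) = A \<alpha>" using s by (intro dep_eq[OF dA]) auto
    moreover have "B (\<alpha> \<union> \<beta>) = B \<beta>" using s by (intro dep_eq[OF dB]) auto
    ultimately show "of_bool (A (\<alpha> \<union> \<beta>) \<and> B (\<alpha> \<union> \<beta>)) = (of_bool (A \<alpha>) * of_bool (B \<beta>) :: real)"
      by simp
  qed
  also have "\<dots> = bexp \<pi> ?U (\<lambda>\<alpha>. bexp \<pi> ?V (\<lambda>\<beta>. of_bool (B \<beta>)) * of_bool (A \<alpha>))"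
    by (simp add: bexp_cmult mult.commute)
  also have "\<dots> = prb \<pi> A * prb \<pi> B"
    unfolding bexp_cmult prb_eq[OF fin(1) dA] prb_eq[OF fin(2) dB] by (rule mult.commute)
  finally show ?thesis .
qed

lemma prb_Harris:
  assumes "loc A" "loc B" "inc A" "inc B"
  shows "prb \<pi> A * prb \<pi> B \<le> prb \<pi> (\<lambda>\<omega>. A \<omega> \<and> B \<omega>)"
proof -
  obtain I where I: "finite I" "dep I A" "dep I B" using loc_two assms by metis
  then have d: "dep I (\<lambda>\<omega>. A \<omega> \<and> B \<omega>)" by (auto intro: dep_comb2)
  have "bexp \<pi> I (\<lambda>\<omega>. of_bool (A \<omega>)) * bexp \<pi> I (\<lambda>\<omega>. of_bool (B \<omega>))
      \<le> bexp \<pi> I (\<lambda>\<omega>. of_bool (A \<omega>) * of_bool (B \<omega>))"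
    using assms I by (intro bexp_Harris[OF _ wt] mono_of_bool) auto
  then show ?thesis using I d by (simp add: prb_eq of_bool_conj)
qed

text \<open>Increasing and decreasing events are negatively correlated; this is how an arm together
  with a hole is bounded by a product.\<close>

lemma prb_Harris_neg:
  assumes "loc A" "loc B" "inc A" "inc B"
  shows "prb \<pi> (\<lambda>\<omega>. A \<omega> \<and> \<not> B \<omega>) \<le> prb \<pi> A * (1 - prb \<pi> B)"
proof -
  have "prb \<pi> (\<lambda>\<omega>. A \<omega> \<and> \<not> (A \<omega> \<and> B \<omega>)) = prb \<pi> A - prb \<pi> (\<lambda>\<omega>. A \<omega> \<and> B \<omega>)"
    using assms by (intro prb_diff_eq loc_conj) auto
  moreover have "(\<lambda>\<omega>. A \<omega> \<and> \<not> (A \<omega> \<and> B \<omega>)) = (\<lambda>\<omega>. A \<omega> \<and> \<not> B \<omega>)" by auto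
  ultimately show ?thesis using prb_Harris[OF assms] by (simp add: algebra_simps)
qed

lemma prb_Harris_dec:
  assumes "loc A" "loc B" "inc A" "inc B"
  shows "(1 - prb \<pi> A) * (1 - prb \<pi> B) \<le> prb \<pi> (\<lambda>\<omega>. \<not> A \<omega> \<and> \<not> B \<omega>)"
proof -
  have "prb \<pi> (\<lambda>\<omega>. \<not> A \<omega> \<and> \<not> (B \<omega> \<and> \<not> A \<omega>)) \<ge> prb \<pi> (\<lambda>\<omega>. \<not> A \<omega>) - prb \<pi> (\<lambda>\<omega>. B \<omega> \<and> \<not> A \<omega>)"
    using assms by (intro prb_diff_le loc_conj loc_not) auto
  moreover have "(\<lambda>\<omega>. \<not> A \<omega> \<and> \<not> (B \<omega> \<and> \<not> A \<omega>)) = (\<lambda>\<omega>. \<not> A \<omega> \<and> \<not> B \<omega>)" by auto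
  ultimately show ?thesis using prb_Harris_neg[OF assms(2,1,4,3)] prb_not[OF assms(1)]
    by (simp add: algebra_simps)
qed

text \<open>With all \<open>A k\<close> of equal probability this is the square root trick: a likely
  union forces each single \<open>A k\<close> to be likely.\<close>

lemma prb_Harris_dec_ball:
  assumes "finite K" "\<And>k. k \<in> K \<Longrightarrow> loc (A k)" "\<And>k. k \<in> K \<Longrightarrow> inc (A k)"
    and "\<And>k. k \<in> K \<Longrightarrow> e \<le> 1 - prb \<pi> (A k)" "0 \<le> e"
  shows "e ^ card K \<le> prb \<pi> (\<lambda>\<omega>. \<forall>k\<in>K. \<not> A k \<omega>)"
  using assms(1-4)
proof (induction K rule: finite_induct)
  case (insert k K)
  let ?B = "\<lambda>\<omega>. \<exists>k\<in>K. A k \<omega>"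
  have lB: "loc ?B" using insert by (intro loc_bex) auto
  have mB: "inc ?B" using insert.prems(2) by (intro inc_bex) auto
  have eq: "prb \<pi> (\<lambda>\<omega>. \<forall>k\<in>K. \<not> A k \<omega>) = 1 - prb \<pi> ?B"
    using prb_not[OF lB] by simp
  have "e * e ^ card K \<le> (1 - prb \<pi> (A k)) * (1 - prb \<pi> ?B)"
  proof (rule mult_mono)
    show "e \<le> 1 - prb \<pi> (A k)" using insert.prems by simp
    show "e ^ card K \<le> 1 - prb \<pi> ?B" using insert eq by auto
    show "0 \<le> 1 - prb \<pi> (A k)" using insert.prems prb_le_1[of "A k"] by simp
  qed (use assms(5) in simp)
  also have "\<dots> \<le> prb \<pi> (\<lambda>\<omega>. \<not> A k \<omega> \<and> \<not> ?B \<omega>)"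
    using insert lB mB by (intro prb_Harris_dec) auto
  finally show ?case using insert by simp
qed (simp add: prb_const)

text \<open>Condition on the coordinates outside \<open>S\<close>. This fixes \<open>L\<close>, and
  in the coordinates of \<open>S\<close> the events \<open>\<not> A\<close> and
  \<open>\<not> B\<close> are both decreasing, so Harris applies in each fibre. Thus
  \<open>L\<close> may be increasing although the other two events are decreasing.\<close>

lemma prb_cond_Harris_dec:
  assumes "loc L" "loc A" "loc B" "inc A" "inc B" "dep (- S) L" "dep S B"
  shows "prb \<pi> (\<lambda>\<omega>. L \<omega> \<and> \<not> A \<omega>) * (1 - prb \<pi> B) \<le> prb \<pi> (\<lambda>\<omega>. L \<omega> \<and> \<not> A \<omega> \<and> \<not> B \<omega>)"
proof -
  obtain I1 I2 I3 where "finite I1" "dep I1 L" "finite I2" "dep I2 A" "finite I3" "dep I3 B"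
    using assms(1-3) by (auto simp: loc_def)
  then obtain I where I: "finite I" "dep I L" "dep I A" "dep I B"
    by (auto intro: dep_mono intro!: that[of "I1 \<union> I2 \<union> I3"])
  let ?U = "I - S" and ?V = "I \<inter> S"
  have dL: "dep ?U L" using I assms unfolding dep_def by (metis inf_assoc Diff_eq)
  have dB: "dep ?V B" using I assms unfolding dep_def by (metis inf_assoc)
  have fin: "finite ?U" "finite ?V" using I by auto
  have UV: "?U \<union> ?V = I" by auto
  let ?b = "of_bool :: bool \<Rightarrow> real"
  have B: "1 - prb \<pi> B = bexp \<pi> ?V (\<lambda>\<beta>. ?b (\<not> B \<beta>))"
    using prb_not[OF assms(3)] prb_eq[OF fin(2), of "\<lambda>\<omega>. \<not> B \<omega>" \<pi>] dB by (auto intro: dep_comb)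
  have L: "L (\<alpha> \<union> \<beta>) = L \<alpha>" if "\<alpha> \<subseteq> ?U" "\<beta> \<subseteq> ?V" for \<alpha> \<beta>
    using that by (intro dep_eq[OF dL]) auto
  have Bb: "B (\<alpha> \<union> \<beta>) = B \<beta>" if "\<alpha> \<subseteq> ?U" "\<beta> \<subseteq> ?V" for \<alpha> \<beta>
    using that by (intro dep_eq[OF dB]) auto
  have e1: "prb \<pi> (\<lambda>\<omega>. L \<omega> \<and> \<not> A \<omega>)
      = bexp \<pi> ?U (\<lambda>\<alpha>. ?b (L \<alpha>) * bexp \<pi> ?V (\<lambda>\<beta>. ?b (\<not> A (\<alpha> \<union> \<beta>))))"
  proof -
    have "prb \<pi> (\<lambda>\<omega>. L \<omega> \<and> \<not> A \<omega>) = bexp \<pi> (?U \<union> ?V) (\<lambda>\<omega>. ?b (L \<omega> \<and> \<not> A \<omega>))"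
      using I fin by (intro prb_eq) (auto simp: dep_def UV)
    also have "\<dots> = bexp \<pi> ?U (\<lambda>\<alpha>. bexp \<pi> ?V (\<lambda>\<beta>. ?b (L (\<alpha> \<union> \<beta>) \<and> \<not> A (\<alpha> \<union> \<beta>))))"
      using fin by (intro bexp_Un) auto
    also have "\<dots> = bexp \<pi> ?U (\<lambda>\<alpha>. bexp \<pi> ?V (\<lambda>\<beta>. ?b (L \<alpha>) * ?b (\<not> A (\<alpha> \<union> \<beta>))))"
      by (intro bexp_cong) (auto simp: L)
    finally show ?thesis by (simp add: bexp_cmult)
  qed
  have e2: "prb \<pi> (\<lambda>\<omega>. L \<omega> \<and> \<not> A \<omega> \<and> \<not> B \<omega>)
      = bexp \<pi> ?U (\<lambda>\<alpha>. ?b (L \<alpha>) * bexp \<pi> ?V (\<lambda>\<beta>. ?b (\<not> A (\<alpha> \<union> \<beta>)) * ?b (\<not> B \<beta>)))"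
  proof -
    have "prb \<pi> (\<lambda>\<omega>. L \<omega> \<and> \<not> A \<omega> \<and> \<not> B \<omega>) = bexp \<pi> (?U \<union> ?V) (\<lambda>\<omega>. ?b (L \<omega> \<and> \<not> A \<omega> \<and> \<not> B \<omega>))"
      using I fin by (intro prb_eq) (auto simp: dep_def UV)
    also have "\<dots> = bexp \<pi> ?U (\<lambda>\<alpha>. bexp \<pi> ?V (\<lambda>\<beta>. ?b (L (\<alpha> \<union> \<beta>) \<and> \<not> A (\<alpha> \<union> \<beta>) \<and> \<not> B (\<alpha> \<union> \<beta>))))"
      using fin by (intro bexp_Un) auto
    also have "\<dots> = bexp \<pi> ?U (\<lambda>\<alpha>. bexp \<pi> ?V (\<lambda>\<beta>. ?b (L \<alpha>) * (?b (\<not> A (\<alpha> \<union> \<beta>)) * ?b (\<not> B \<beta>))))"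
      by (intro bexp_cong) (auto simp: L Bb)
    finally show ?thesis by (simp add: bexp_cmult)
  qed
  have h: "bexp \<pi> ?V (\<lambda>\<beta>. ?b (\<not> A (\<alpha> \<union> \<beta>))) * bexp \<pi> ?V (\<lambda>\<beta>. ?b (\<not> B \<beta>))
      \<le> bexp \<pi> ?V (\<lambda>\<beta>. ?b (\<not> A (\<alpha> \<union> \<beta>)) * ?b (\<not> B \<beta>))" for \<alpha>
  proof -
    have mA: "mono (\<lambda>\<beta>. - ?b (\<not> A (\<alpha> \<union> \<beta>)))"
      using assms(4) by (intro monoI) (auto dest: incD[where A=A, OF _ Un_mono[OF order_refl]])
    have mB: "mono (\<lambda>\<beta>. - ?b (\<not> B \<beta>))"
      using assms(5) by (intro monoI) (auto dest: incD)
    have neg: "bexp \<pi> ?V (\<lambda>\<beta>. - g \<beta>) = - bexp \<pi> ?V g" for g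
      using bexp_cmult[of \<pi> ?V "-1" g] by simp
    show ?thesis using bexp_Harris[OF fin(2) wt mA mB] unfolding neg by simp
  qed
  have "prb \<pi> (\<lambda>\<omega>. L \<omega> \<and> \<not> A \<omega>) * (1 - prb \<pi> B)
      = bexp \<pi> ?U (\<lambda>\<alpha>. bexp \<pi> ?V (\<lambda>\<beta>. ?b (\<not> B \<beta>)) * (?b (L \<alpha>) * bexp \<pi> ?V (\<lambda>\<beta>. ?b (\<not> A (\<alpha> \<union> \<beta>)))))"
    unfolding e1 B bexp_cmult by simp
  also have "\<dots> \<le> prb \<pi> (\<lambda>\<omega>. L \<omega> \<and> \<not> A \<omega> \<and> \<not> B \<omega>)"
    unfolding e2
  proof (rule bexp_mono[OF wt])
    fix \<alpha>
    show "bexp \<pi> ?V (\<lambda>\<beta>. ?b (\<not> B \<beta>)) * (?b (L \<alpha>) * bexp \<pi> ?V (\<lambda>\<beta>. ?b (\<not> A (\<alpha> \<union> \<beta>))))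
      \<le> ?b (L \<alpha>) * bexp \<pi> ?V (\<lambda>\<beta>. ?b (\<not> A (\<alpha> \<union> \<beta>)) * ?b (\<not> B \<beta>))"
      using h[of \<alpha>] by (simp add: mult.commute)
  qed
  finally show ?thesis .
qed

end

lemma prb_all_in:
  assumes "finite S"
  shows "prb \<pi> (\<lambda>\<omega>. \<forall>i\<in>S. i \<in> \<omega>) = (\<Prod>i\<in>S. \<pi> i)"
proof -
  have "dep S (\<lambda>\<omega>. \<forall>i\<in>S. i \<in> \<omega>)" by (auto simp: dep_def)
  then have "prb \<pi> (\<lambda>\<omega>. \<forall>i\<in>S. i \<in> \<omega>) = bexp \<pi> S (\<lambda>\<omega>. of_bool (\<forall>i\<in>S. i \<in> \<omega>))"
    using assms by (rule prb_eq[rotated])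
  also have "\<dots> = (\<Prod>i\<in>S. \<pi> i)"
    using assms
  proof (induction S rule: finite_induct)
    case (insert j S)
    have "bexp \<pi> S (\<lambda>\<omega>. of_bool (\<forall>i\<in>insert j S. i \<in> insert j \<omega>)) = bexp \<pi> S (\<lambda>\<omega>. of_bool (\<forall>i\<in>S. i \<in> \<omega>))"
      using insert.hyps by (intro bexp_cong arg_cong[where f=of_bool]) auto
    moreover have "bexp \<pi> S (\<lambda>\<omega>. of_bool (\<forall>i\<in>insert j S. i \<in> \<omega>)) = bexp \<pi> S (\<lambda>\<omega>. 0)"
      using insert.hyps by (intro bexp_cong) auto
    ultimately show ?case using insert.hyps insert.IH by (simp add: bexp_insert del: insert_iff ball_simps)
  qed simp
  finally show ?thesis .
qed

lemma prb_none_in: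
  assumes "finite S"
  shows "prb \<pi> (\<lambda>\<omega>. \<forall>i\<in>S. i \<notin> \<omega>) = (\<Prod>i\<in>S. 1 - \<pi> i)"
proof -
  have "dep S (\<lambda>\<omega>. \<forall>i\<in>S. i \<notin> \<omega>)" by (auto simp: dep_def)
  then have "prb \<pi> (\<lambda>\<omega>. \<forall>i\<in>S. i \<notin> \<omega>) = bexp \<pi> S (\<lambda>\<omega>. of_bool (\<forall>i\<in>S. i \<notin> \<omega>))"
    using assms by (rule prb_eq[rotated])
  also have "\<dots> = (\<Prod>i\<in>S. 1 - \<pi> i)"
    using assms
  proof (induction S rule: finite_induct)
    case (insert j S)
    have "bexp \<pi> S (\<lambda>\<omega>. of_bool (\<forall>i\<in>insert j S. i \<notin> \<omega>)) = bexp \<pi> S (\<lambda>\<omega>. of_bool (\<forall>i\<in>S. i \<notin> \<omega>))"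
      using insert.hyps by (intro bexp_cong arg_cong[where f=of_bool]) auto
    moreover have "bexp \<pi> S (\<lambda>\<omega>. of_bool (\<forall>i\<in>insert j S. i \<notin> insert j \<omega>)) = bexp \<pi> S (\<lambda>\<omega>. 0)"
      using insert.hyps by (intro bexp_cong) auto
    ultimately show ?case using insert.hyps insert.IH by (simp add: bexp_insert del: insert_iff ball_simps)
  qed simp
  finally show ?thesis .
qed

lemma prb_mono_weight:
  assumes "weights \<pi>" "weights \<pi>'" "\<And>i. \<pi> i \<le> \<pi>' i" "loc A" "inc A"
  shows "prb \<pi> A \<le> prb \<pi>' A"
proof -
  obtain I where I: "finite I" "dep I A" using assms by (auto simp: loc_def)
  show ?thesis unfolding prb_eq[OF I]
    using assms(5) by (intro bexp_mono_weight[OF I(1) assms(1-3)] mono_of_bool) auto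
qed

lemma prb_reindex:
  assumes "bij \<sigma>" "\<And>i. \<pi> (\<sigma> i) = \<pi> i" "loc A"
  shows "prb \<pi> (\<lambda>\<omega>. A (\<sigma> ` \<omega>)) = prb \<pi> A" and "loc (\<lambda>\<omega>. A (\<sigma> ` \<omega>))"
proof -
  obtain J where J: "finite J" "dep J A" using assms by (auto simp: loc_def)
  define I where "I = \<sigma> -` J"
  have fI: "finite I" unfolding I_def using J assms(1) by (simp add: finite_vimageI bij_def)
  have dI: "dep I (\<lambda>\<omega>. A (\<sigma> ` \<omega>))"
    unfolding dep_def
  proof
    fix \<omega> show "A (\<sigma> ` (\<omega> \<inter> I)) = A (\<sigma> ` \<omega>)"
      by (rule dep_eq[OF J(2)]) (auto simp: I_def)
  qed
  then show "loc (\<lambda>\<omega>. A (\<sigma> ` \<omega>))" using fI by (auto simp: loc_def)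
  have "prb \<pi> (\<lambda>\<omega>. A (\<sigma> ` \<omega>)) = bexp \<pi> I (\<lambda>\<omega>. of_bool (A (\<sigma> ` \<omega>)))"
    by (rule prb_eq[OF fI dI])
  also have "\<dots> = bexp \<pi> (\<sigma> ` I) (\<lambda>\<omega>. of_bool (A \<omega>))"
    using assms fI by (intro bexp_reindex[where f="\<lambda>\<omega>. of_bool (A \<omega>)"]) (auto simp: bij_def intro: inj_on_subset)
  also have "\<sigma> ` I = J" using assms(1) by (simp add: I_def bij_def)
  finally show "prb \<pi> (\<lambda>\<omega>. A (\<sigma> ` \<omega>)) = prb \<pi> A" using prb_eq[OF J] by simp
qed

section \<open>The inequality of O'Donnell, Saks, Schramm and Servedio\<close>

text \<open>Expected change of \<open>g\<close> when coordinate \<open>i\<close> is resampled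
  independently.\<close>

definition infl :: "('i \<Rightarrow> real) \<Rightarrow> 'i set \<Rightarrow> ('i set \<Rightarrow> real) \<Rightarrow> 'i \<Rightarrow> real" where
  "infl \<pi> I g i = \<pi> i * bexp \<pi> I (\<lambda>Y. \<bar>g (insert i Y) - g Y\<bar>)
     + (1 - \<pi> i) * bexp \<pi> I (\<lambda>Y. \<bar>g (Y - {i}) - g Y\<bar>)"

text \<open>A query strategy \<open>query\<close> names the next coordinate to reveal, given the set \<open>J\<close> of revealed
  coordinates and the configuration on \<open>J\<close>. The first argument of \<open>reveal\<close> bounds the number of
  queries.\<close>
primrec reveal :: "('i set \<Rightarrow> 'i set \<Rightarrow> 'i option) \<Rightarrow> nat \<Rightarrow> 'i set \<Rightarrow> 'i set \<Rightarrow> 'i set" where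
  "reveal query 0 J \<omega> = J"
| "reveal query (Suc n) J \<omega> = (case query J (\<omega> \<inter> J) of None \<Rightarrow> J | Some i \<Rightarrow> reveal query n (insert i J) \<omega>)"

lemma reveal_mono: "J \<subseteq> reveal query n J \<omega>"
proof (induction n arbitrary: J)
  case (Suc n)
  then have "J \<subseteq> reveal query n (insert i J) \<omega>" for i by blast
  then show ?case by (auto split: option.split)
qed simp

definition mixc :: "'i set \<Rightarrow> 'i set \<Rightarrow> 'i set \<Rightarrow> 'i set" where
  "mixc R X Y = (X \<inter> R) \<union> (Y - R)"

text \<open>The revealed set is a stopping set: each query depends only on what has been seen, so
  two configurations agreeing on the set revealed for one of them follow the same branch.\<close>

lemma reveal_cong:
  "\<omega>' \<inter> reveal query n J \<omega> = \<omega> \<inter> reveal query n J \<omega> \<Longrightarrow> reveal query n J \<omega>' = reveal query n J \<omega>"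
proof (induction n arbitrary: J)
  case (Suc n)
  have "J \<subseteq> reveal query (Suc n) J \<omega>" by (rule reveal_mono)
  then have "\<omega>' \<inter> J = \<omega> \<inter> J" using Suc.prems by blast
  then show ?case using Suc by (auto split: option.splits)
qed simp

locale strategy =
  fixes I :: "'i set" and \<pi> :: "'i \<Rightarrow> real" and query :: "'i set \<Rightarrow> 'i set \<Rightarrow> 'i option"
  assumes fin: "finite I" and wt: "weights \<pi>"
    and query: "query J \<sigma> = Some i \<Longrightarrow> i \<in> I - J"
begin

lemma reveal_sub: "J \<subseteq> I \<Longrightarrow> reveal query n J \<omega> \<subseteq> I"
proof (induction n arbitrary: J)
  case (Suc n)
  then show ?case using query[of J "\<omega> \<inter> J"] by (auto split: option.splits)
qed simp

lemma reveal_done: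
  assumes "J \<subseteq> I" "card (I - J) \<le> n"
  shows "query (reveal query n J \<omega>) (\<omega> \<inter> reveal query n J \<omega>) = None"
  using assms
proof (induction n arbitrary: J)
  case 0
  then have "I - J = {}" using fin by simp
  then show ?case using query[of J "\<omega> \<inter> J"] by (cases "query J (\<omega> \<inter> J)") auto
next
  case (Suc n)
  show ?case
  proof (cases "query J (\<omega> \<inter> J)")
    case (Some i)
    then have i: "i \<in> I - J" by (rule query)
    then have "card (I - insert i J) < card (I - J)"
      using fin by (intro psubset_card_mono) auto
    then show ?thesis using Suc i Some by simp
  qed simp
qed

text \<open>Unfolding of the first query, by the value found at \<open>i\<close>. The hybrid of the
  whole tree is the hybrid of the subtree with coordinate \<open>i\<close> overwritten by that
  value.\<close>

lemma step_eqs: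
  assumes "query J \<sigma> = Some i" "\<sigma> \<subseteq> J" "J \<subseteq> I" "X \<subseteq> I - insert i J"
  shows "reveal query (Suc n) J (\<sigma> \<union> insert i X) = reveal query n (insert i J) (insert i \<sigma> \<union> X)"
    and "reveal query (Suc n) J (\<sigma> \<union> X) = reveal query n (insert i J) (\<sigma> \<union> X)"
    and "mixc (reveal query (Suc n) J (\<sigma> \<union> insert i X) - J) (\<sigma> \<union> insert i X) Y
       = insert i (mixc (reveal query n (insert i J) (insert i \<sigma> \<union> X) - insert i J) (insert i \<sigma> \<union> X) Y)"
    and "mixc (reveal query (Suc n) J (\<sigma> \<union> X) - J) (\<sigma> \<union> X) Y
       = mixc (reveal query n (insert i J) (\<sigma> \<union> X) - insert i J) (\<sigma> \<union> X) Y - {i}"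
proof -
  have i: "i \<in> I - J" by (rule query) fact
  have a: "(\<sigma> \<union> insert i X) \<inter> J = \<sigma>" "(\<sigma> \<union> X) \<inter> J = \<sigma>" using assms i by auto
  show 1: "reveal query (Suc n) J (\<sigma> \<union> insert i X) = reveal query n (insert i J) (insert i \<sigma> \<union> X)"
    by (simp only: reveal.simps a assms(1) option.case) simp
  show 2: "reveal query (Suc n) J (\<sigma> \<union> X) = reveal query n (insert i J) (\<sigma> \<union> X)"
    by (simp only: reveal.simps a assms(1) option.case)
  have m1: "insert i J \<subseteq> reveal query n (insert i J) (insert i \<sigma> \<union> X)" by (rule reveal_mono)
  have m2: "insert i J \<subseteq> reveal query n (insert i J) (\<sigma> \<union> X)" by (rule reveal_mono)
  show "mixc (reveal query (Suc n) J (\<sigma> \<union> insert i X) - J) (\<sigma> \<union> insert i X) Y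
       = insert i (mixc (reveal query n (insert i J) (insert i \<sigma> \<union> X) - insert i J) (insert i \<sigma> \<union> X) Y)"
    unfolding 1 mixc_def using m1 i by auto
  show "mixc (reveal query (Suc n) J (\<sigma> \<union> X) - J) (\<sigma> \<union> X) Y
       = mixc (reveal query n (insert i J) (\<sigma> \<union> X) - insert i J) (\<sigma> \<union> X) Y - {i}"
    unfolding 2 mixc_def using m2 i assms by auto
qed

text \<open>Overwriting an independent copy \<open>Y\<close> by \<open>X\<close> on an adaptively
  revealed set does not change its law: the decision to reveal a coordinate precedes its value. By
  \<open>step_eqs\<close> the first query amounts to resampling \<open>i\<close>, which is
  \<open>bexp_split\<close>; \<open>h\<close> is arbitrary so that overwriting can be absorbed into
  it.\<close>

lemma mix_law:
  assumes "\<sigma> \<subseteq> J" "J \<subseteq> I"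
  shows "bexp \<pi> (I - J) (\<lambda>X. bexp \<pi> I (\<lambda>Y. h (mixc (reveal query n J (\<sigma> \<union> X) - J) (\<sigma> \<union> X) Y))) = bexp \<pi> I h"
  using assms
proof (induction n arbitrary: J \<sigma> h)
  case 0
  then show ?case using fin by (simp add: mixc_def)
next
  case (Suc n)
  show ?case
  proof (cases "query J \<sigma>")
    case None
    have "reveal query (Suc n) J (\<sigma> \<union> X) = J" if "X \<subseteq> I - J" for X
    proof -
      have "(\<sigma> \<union> X) \<inter> J = \<sigma>" using that Suc.prems by auto
      then show ?thesis by (simp add: None)
    qed
    then have "bexp \<pi> (I - J) (\<lambda>X. bexp \<pi> I (\<lambda>Y. h (mixc (reveal query (Suc n) J (\<sigma> \<union> X) - J) (\<sigma> \<union> X) Y)))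
      = bexp \<pi> (I - J) (\<lambda>X. bexp \<pi> I h)"
      by (intro bexp_cong) (simp add: mixc_def del: reveal.simps)
    then show ?thesis using fin by simp
  next
    case (Some i)
    then have i: "i \<in> I - J" by (rule query)
    let ?J = "insert i J"
    have IJ: "I - J = insert i (I - ?J)" "i \<notin> I - ?J" "finite (I - ?J)" using i fin by auto
    note st = step_eqs[OF Some Suc.prems]
    have J: "?J \<subseteq> I" "insert i \<sigma> \<subseteq> ?J" "\<sigma> \<subseteq> ?J" using Suc.prems i by auto
    let ?h1 = "\<lambda>Z. h (insert i Z)" and ?h0 = "\<lambda>Z. h (Z - {i})"
    have "bexp \<pi> (I - J) (\<lambda>X. bexp \<pi> I (\<lambda>Y. h (mixc (reveal query (Suc n) J (\<sigma> \<union> X) - J) (\<sigma> \<union> X) Y)))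
      = \<pi> i * bexp \<pi> (I - ?J) (\<lambda>X. bexp \<pi> I (\<lambda>Y. ?h1 (mixc (reveal query n ?J (insert i \<sigma> \<union> X) - ?J) (insert i \<sigma> \<union> X) Y)))
      + (1 - \<pi> i) * bexp \<pi> (I - ?J) (\<lambda>X. bexp \<pi> I (\<lambda>Y. ?h0 (mixc (reveal query n ?J (\<sigma> \<union> X) - ?J) (\<sigma> \<union> X) Y)))"
      unfolding IJ(1) bexp_insert[OF IJ(3,2)]
      by (intro arg_cong2[where f="(+)"] arg_cong2[where f="(*)"] refl bexp_cong)
         (simp_all only: st(3,4))
    also have "\<dots> = \<pi> i * bexp \<pi> I ?h1 + (1 - \<pi> i) * bexp \<pi> I ?h0"
      using Suc.IH[OF J(2,1), of ?h1] Suc.IH[OF J(3,1), of ?h0] by (simp only:)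
    also have "\<dots> = bexp \<pi> I h" using i fin by (intro bexp_split[symmetric]) auto
    finally show ?thesis .
  qed
qed

text \<open>Telescoping along the decision tree, started from an arbitrary node. Passing from
  \<open>Y\<close> to the hybrid costs one resampling per revealed coordinate, and each resampling
  costs its influence.\<close>

lemma osss_step:
  assumes "\<sigma> \<subseteq> J" "J \<subseteq> I"
  shows "bexp \<pi> (I - J) (\<lambda>X. bexp \<pi> I (\<lambda>Y. \<bar>g (mixc (reveal query n J (\<sigma> \<union> X) - J) (\<sigma> \<union> X) Y) - g Y\<bar>))
    \<le> (\<Sum>i\<in>I. bexp \<pi> (I - J) (\<lambda>X. of_bool (i \<in> reveal query n J (\<sigma> \<union> X) - J)) * infl \<pi> I g i)"
  using assms
proof (induction n arbitrary: J \<sigma>)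
  case 0
  then show ?case using fin by (simp add: mixc_def)
next
  case (Suc n)
  let ?b = "of_bool :: bool \<Rightarrow> real"
  have infl_nn: "0 \<le> infl \<pi> I g i" for i
    unfolding infl_def using wt
    by (intro add_nonneg_nonneg mult_nonneg_nonneg bexp_nonneg) (auto simp: weights_def)
  show ?case
  proof (cases "query J \<sigma>")
    case None
    have "reveal query (Suc n) J (\<sigma> \<union> X) = J" if "X \<subseteq> I - J" for X
    proof -
      have "(\<sigma> \<union> X) \<inter> J = \<sigma>" using that Suc.prems by auto
      then show ?thesis by (simp add: None)
    qed
    then have "bexp \<pi> (I - J) (\<lambda>X. bexp \<pi> I (\<lambda>Y. \<bar>g (mixc (reveal query (Suc n) J (\<sigma> \<union> X) - J) (\<sigma> \<union> X) Y) - g Y\<bar>))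
      = bexp \<pi> (I - J) (\<lambda>X. bexp \<pi> I (\<lambda>Y. 0))"
      by (intro bexp_cong) (simp add: mixc_def del: reveal.simps)
    also have "\<dots> = 0" using fin by simp
    also have "0 \<le> (\<Sum>i\<in>I. bexp \<pi> (I - J) (\<lambda>X. ?b (i \<in> reveal query (Suc n) J (\<sigma> \<union> X) - J)) * infl \<pi> I g i)"
      by (intro sum_nonneg mult_nonneg_nonneg infl_nn bexp_nonneg[OF wt]) auto
    finally show ?thesis .
  next
    case (Some i)
    then have i: "i \<in> I - J" by (rule query)
    let ?J = "insert i J"
    have IJ: "I - J = insert i (I - ?J)" "i \<notin> I - ?J" "finite (I - ?J)" using i fin by auto
    note st = step_eqs[OF Some Suc.prems]
    have J: "?J \<subseteq> I" "insert i \<sigma> \<subseteq> ?J" "\<sigma> \<subseteq> ?J" using Suc.prems i by auto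
    have p: "0 \<le> \<pi> i" "0 \<le> 1 - \<pi> i" using wt by (auto simp: weights_def)
    let ?Z = "\<lambda>s X Y. mixc (reveal query n ?J (s \<union> X) - ?J) (s \<union> X) Y"
    let ?E = "\<lambda>F. bexp \<pi> (I - ?J) (\<lambda>X. bexp \<pi> I (\<lambda>Y. F X Y))"
    let ?r = "\<lambda>s k. bexp \<pi> (I - ?J) (\<lambda>X. ?b (k \<in> reveal query n ?J (s \<union> X) - ?J))"
    \<comment> \<open>The map \<open>c\<close> writes the value of the queried coordinate. By
      \<open>mix_law\<close> the subtree hybrid \<open>?Z\<close> is distributed like
      \<open>Y\<close>, so the cost of \<open>c\<close> can be computed on \<open>Y\<close>; the
      remaining difference is the induction hypothesis.\<close>
    have b: "?E (\<lambda>X Y. \<bar>g (c (?Z s X Y)) - g Y\<bar>)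
        \<le> bexp \<pi> I (\<lambda>Y. \<bar>g (c Y) - g Y\<bar>) + (\<Sum>k\<in>I. ?r s k * infl \<pi> I g k)"
      if "s \<subseteq> ?J" for c s
    proof -
      have "?E (\<lambda>X Y. \<bar>g (c (?Z s X Y)) - g Y\<bar>)
         \<le> ?E (\<lambda>X Y. \<bar>g (c (?Z s X Y)) - g (?Z s X Y)\<bar> + \<bar>g (?Z s X Y) - g Y\<bar>)"
        by (intro bexp_mono[OF wt]) linarith
      also have "\<dots> = ?E (\<lambda>X Y. \<bar>g (c (?Z s X Y)) - g (?Z s X Y)\<bar>) + ?E (\<lambda>X Y. \<bar>g (?Z s X Y) - g Y\<bar>)"
        by (simp only: bexp_add)
      also have "?E (\<lambda>X Y. \<bar>g (c (?Z s X Y)) - g (?Z s X Y)\<bar>) = bexp \<pi> I (\<lambda>Y. \<bar>g (c Y) - g Y\<bar>)"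
        using mix_law[OF that J(1), of "\<lambda>Z. \<bar>g (c Z) - g Z\<bar>" n] by simp
      also have "?E (\<lambda>X Y. \<bar>g (?Z s X Y) - g Y\<bar>) \<le> (\<Sum>k\<in>I. ?r s k * infl \<pi> I g k)"
        by (rule Suc.IH[OF that J(1)])
      finally show ?thesis by simp
    qed
    have "bexp \<pi> (I - J) (\<lambda>X. bexp \<pi> I (\<lambda>Y. \<bar>g (mixc (reveal query (Suc n) J (\<sigma> \<union> X) - J) (\<sigma> \<union> X) Y) - g Y\<bar>))
      = \<pi> i * ?E (\<lambda>X Y. \<bar>g (insert i (?Z (insert i \<sigma>) X Y)) - g Y\<bar>)
      + (1 - \<pi> i) * ?E (\<lambda>X Y. \<bar>g (?Z \<sigma> X Y - {i}) - g Y\<bar>)"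
      unfolding IJ(1) bexp_insert[OF IJ(3,2)]
      by (intro arg_cong2[where f="(+)"] arg_cong2[where f="(*)"] refl bexp_cong)
         (simp_all only: st(3,4))
    also have "\<dots> \<le> \<pi> i * (bexp \<pi> I (\<lambda>Y. \<bar>g (insert i Y) - g Y\<bar>) + (\<Sum>k\<in>I. ?r (insert i \<sigma>) k * infl \<pi> I g k))
      + (1 - \<pi> i) * (bexp \<pi> I (\<lambda>Y. \<bar>g (Y - {i}) - g Y\<bar>) + (\<Sum>k\<in>I. ?r \<sigma> k * infl \<pi> I g k))"
      using p b[OF J(2), of "insert i"] b[OF J(3), of "\<lambda>Z. Z - {i}"]
      by (intro add_mono mult_left_mono) auto
    also have "\<dots> = infl \<pi> I g i + (\<Sum>k\<in>I. (\<pi> i * ?r (insert i \<sigma>) k + (1 - \<pi> i) * ?r \<sigma> k) * infl \<pi> I g k)"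
      by (simp add: infl_def algebra_simps sum_distrib_left sum.distrib sum_subtractf)
    also have "infl \<pi> I g i = (\<Sum>k\<in>I. ?b (k = i) * infl \<pi> I g k)"
    proof -
      have "(\<Sum>k\<in>I. ?b (k = i) * infl \<pi> I g k) = (\<Sum>k\<in>I. if k = i then infl \<pi> I g k else 0)"
        by (intro sum.cong) auto
      then show ?thesis using i fin by (simp add: sum.delta)
    qed
    also have "\<dots> + (\<Sum>k\<in>I. (\<pi> i * ?r (insert i \<sigma>) k + (1 - \<pi> i) * ?r \<sigma> k) * infl \<pi> I g k)
      = (\<Sum>k\<in>I. (?b (k = i) + \<pi> i * ?r (insert i \<sigma>) k + (1 - \<pi> i) * ?r \<sigma> k) * infl \<pi> I g k)"
      unfolding sum.distrib[symmetric] by (intro sum.cong refl) (simp only: distrib_right add.assoc)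
    also have "\<dots> = (\<Sum>k\<in>I. bexp \<pi> (I - J) (\<lambda>X. ?b (k \<in> reveal query (Suc n) J (\<sigma> \<union> X) - J)) * infl \<pi> I g k)"
    proof (intro sum.cong refl arg_cong2[where f="(*)"])
      fix k
      have e: "?b (k \<in> reveal query n ?J \<omega> - J) = ?b (k = i) + ?b (k \<in> reveal query n ?J \<omega> - ?J)" for \<omega>
        using i reveal_mono[of ?J query n \<omega>] by auto
      have "bexp \<pi> (I - J) (\<lambda>X. ?b (k \<in> reveal query (Suc n) J (\<sigma> \<union> X) - J))
        = \<pi> i * bexp \<pi> (I - ?J) (\<lambda>X. ?b (k = i) + ?b (k \<in> reveal query n ?J (insert i \<sigma> \<union> X) - ?J))
        + (1 - \<pi> i) * bexp \<pi> (I - ?J) (\<lambda>X. ?b (k = i) + ?b (k \<in> reveal query n ?J (\<sigma> \<union> X) - ?J))"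
        unfolding IJ(1) bexp_insert[OF IJ(3,2)]
        by (intro arg_cong2[where f="(+)"] arg_cong2[where f="(*)"] refl bexp_cong)
           (simp_all only: st(1,2) e)
      also have "\<dots> = \<pi> i * (?b (k = i) + ?r (insert i \<sigma>) k) + (1 - \<pi> i) * (?b (k = i) + ?r \<sigma> k)"
        unfolding bexp_add bexp_const[OF IJ(3)] by (rule refl)
      also have "\<dots> = ?b (k = i) + \<pi> i * ?r (insert i \<sigma>) k + (1 - \<pi> i) * ?r \<sigma> k"
        by (simp add: algebra_simps)
      finally show "?b (k = i) + \<pi> i * ?r (insert i \<sigma>) k + (1 - \<pi> i) * ?r \<sigma> k
        = bexp \<pi> (I - J) (\<lambda>X. ?b (k \<in> reveal query (Suc n) J (\<sigma> \<union> X) - J))" by simp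
    qed
    finally show ?thesis .
  qed
qed

text \<open>The revealed coordinates decide \<open>A\<close>, so the hybrid has the same value as
  \<open>X\<close>, and the left side of \<open>osss_step\<close> becomes the probability that two
  independent copies disagree, namely \<open>2 * E * (1 - E)\<close>. For an increasing event the
  influence is \<open>2 * \<pi> i * (1 - \<pi> i)\<close> times the probability of being pivotal,
  and the factors 2 cancel.\<close>

lemma osss:
  fixes A :: "'i set \<Rightarrow> bool"
  assumes det: "\<And>\<omega>. \<omega> \<subseteq> I \<Longrightarrow> A (\<omega> \<inter> reveal query n {} \<omega>) = A \<omega>" and mono: "inc A"
  defines "E \<equiv> bexp \<pi> I (\<lambda>\<omega>. of_bool (A \<omega>))"
  shows "E * (1 - E) \<le> (\<Sum>i\<in>I. bexp \<pi> I (\<lambda>\<omega>. of_bool (i \<in> reveal query n {} \<omega>))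
     * (\<pi> i * (1 - \<pi> i) * bexp \<pi> I (\<lambda>\<omega>. of_bool (A (insert i \<omega>)) - of_bool (A (\<omega> - {i})))))"
proof -
  let ?b = "of_bool :: bool \<Rightarrow> real"
  let ?g = "\<lambda>\<omega>. ?b (A \<omega>)"
  let ?R = "\<lambda>\<omega>. reveal query n {} \<omega>"
  have mx: "?g (mixc (?R X) X Y) = ?g X" if "X \<subseteq> I" "Y \<subseteq> I" for X Y
  proof -
    let ?Z = "mixc (?R X) X Y"
    have Z: "?Z \<inter> ?R X = X \<inter> ?R X" "?Z \<subseteq> I" using that by (auto simp: mixc_def)
    have RZ: "?R ?Z = ?R X" by (rule reveal_cong[OF Z(1)])
    have "A ?Z = A (?Z \<inter> ?R X)" using det[OF Z(2)] RZ by simp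
    also have "\<dots> = A X" using det[OF that(1)] Z(1) by simp
    finally show ?thesis by simp
  qed
  have "bexp \<pi> I (\<lambda>X. bexp \<pi> I (\<lambda>Y. \<bar>?g X - ?g Y\<bar>)) = bexp \<pi> I (\<lambda>X. bexp \<pi> I (\<lambda>Y. \<bar>?g (mixc (?R X) X Y) - ?g Y\<bar>))"
    by (intro bexp_cong) (simp add: mx)
  also have "\<dots> \<le> (\<Sum>i\<in>I. bexp \<pi> I (\<lambda>X. ?b (i \<in> ?R X)) * infl \<pi> I ?g i)"
    using osss_step[of "{}" "{}" ?g n] by simp
  also have "infl \<pi> I ?g i = 2 * (\<pi> i * (1 - \<pi> i) * bexp \<pi> I (\<lambda>\<omega>. ?g (insert i \<omega>) - ?g (\<omega> - {i})))"
    if "i \<in> I" for i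
  proof -
    have le: "?g (\<omega> - {i}) \<le> ?g (insert i \<omega>)" for \<omega>
      using incD[OF mono, of "\<omega> - {i}" "insert i \<omega>"] by auto
    have "bexp \<pi> I (\<lambda>Y. \<bar>?g (insert i Y) - ?g Y\<bar>)
      = (1 - \<pi> i) * bexp \<pi> I (\<lambda>\<omega>. ?g (insert i \<omega>) - ?g (\<omega> - {i}))"
      using bexp_split[OF fin that, of \<pi> "\<lambda>Y. \<bar>?g (insert i Y) - ?g Y\<bar>"] le fin
      by (simp add: insert_absorb)
    moreover have "bexp \<pi> I (\<lambda>Y. \<bar>?g (Y - {i}) - ?g Y\<bar>)
      = \<pi> i * bexp \<pi> I (\<lambda>\<omega>. ?g (insert i \<omega>) - ?g (\<omega> - {i}))"
      using bexp_split[OF fin that, of \<pi> "\<lambda>Y. \<bar>?g (Y - {i}) - ?g Y\<bar>"] le fin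
      by (simp add: abs_minus_commute[of "?g (_ - _)"])
    ultimately show ?thesis unfolding infl_def by (simp only:) (simp add: algebra_simps)
  qed
  then have "(\<Sum>i\<in>I. bexp \<pi> I (\<lambda>X. ?b (i \<in> ?R X)) * infl \<pi> I ?g i)
     = 2 * (\<Sum>i\<in>I. bexp \<pi> I (\<lambda>\<omega>. ?b (i \<in> ?R \<omega>)) * (\<pi> i * (1 - \<pi> i) * bexp \<pi> I (\<lambda>\<omega>. ?g (insert i \<omega>) - ?g (\<omega> - {i}))))"
    by (simp add: sum_distrib_left mult_ac)
  also have "bexp \<pi> I (\<lambda>X. bexp \<pi> I (\<lambda>Y. \<bar>?g X - ?g Y\<bar>)) = 2 * (E * (1 - E))"
  proof -
    \<comment> \<open>For values 0 and 1, \<open>\<bar>x - y\<bar> = x + (1 - 2 * x) * y\<close>,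
      which is affine in \<open>y\<close>.\<close>
    have "bexp \<pi> I (\<lambda>X. bexp \<pi> I (\<lambda>Y. \<bar>?g X - ?g Y\<bar>))
        = bexp \<pi> I (\<lambda>X. bexp \<pi> I (\<lambda>Y. (?g X + (1 - 2 * ?g X) * ?g Y)))"
      by (intro bexp_cong) auto
    also have "\<dots> = bexp \<pi> I (\<lambda>X. ?g X + (1 - 2 * ?g X) * E)"
      unfolding bexp_add bexp_cmult E_def using fin by simp
    also have "\<dots> = bexp \<pi> I (\<lambda>X. (1 - 2 * E) * ?g X + E)"
      by (simp add: algebra_simps)
    also have "\<dots> = 2 * (E * (1 - E))"
      unfolding bexp_add bexp_cmult E_def[symmetric] using fin by (simp add: algebra_simps)
    finally show ?thesis .
  qed
  finally show ?thesis by simp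
qed

end

text \<open>The Margulis-Russo formula with a separate weight function per coordinate; the
  expectation is affine in each weight, so induction on the coordinates is the product rule.\<close>

lemma russo:
  fixes \<pi> \<pi>' :: "'i \<Rightarrow> real \<Rightarrow> real"
  assumes "finite I" "\<And>i. i \<in> I \<Longrightarrow> ((\<pi> i) has_real_derivative \<pi>' i t) (at t)"
  shows "((\<lambda>t. bexp (\<lambda>i. \<pi> i t) I f) has_real_derivative
     (\<Sum>i\<in>I. \<pi>' i t * bexp (\<lambda>i. \<pi> i t) I (\<lambda>\<omega>. f (insert i \<omega>) - f (\<omega> - {i})))) (at t)"
  using assms
proof (induction I arbitrary: f rule: finite_induct)
  case (insert j I)
  let ?E = "\<lambda>f. bexp (\<lambda>i. \<pi> i t) I f"
  let ?S = "\<lambda>f. \<Sum>i\<in>I. \<pi>' i t * ?E (\<lambda>\<omega>. f (insert i \<omega>) - f (\<omega> - {i}))"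
  let ?f1 = "\<lambda>\<omega>. f (insert j \<omega>)"
  have d: "((\<lambda>t. \<pi> j t * bexp (\<lambda>i. \<pi> i t) I ?f1 + (1 - \<pi> j t) * bexp (\<lambda>i. \<pi> i t) I f) has_real_derivative
     (\<pi> j t * ?S ?f1 + \<pi>' j t * ?E ?f1) + ((1 - \<pi> j t) * ?S f + (0 - \<pi>' j t) * ?E f)) (at t)"
    using insert by (intro DERIV_add DERIV_mult' DERIV_diff DERIV_const) auto
  have jj: "bexp (\<lambda>i. \<pi> i t) (insert j I) (\<lambda>\<omega>. f (insert j \<omega>) - f (\<omega> - {j})) = ?E ?f1 - ?E f"
  proof -
    have "?E (\<lambda>\<omega>. f (insert j \<omega> - {j})) = ?E f" "?E (\<lambda>\<omega>. f (\<omega> - {j})) = ?E f"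
      using insert.hyps by (auto intro!: bexp_cong arg_cong[where f=f])
    then show ?thesis using insert.hyps by (simp add: bexp_insert bexp_diff algebra_simps)
  qed
  have ii: "bexp (\<lambda>i. \<pi> i t) (insert j I) (\<lambda>\<omega>. f (insert i \<omega>) - f (\<omega> - {i}))
     = \<pi> j t * ?E (\<lambda>\<omega>. ?f1 (insert i \<omega>) - ?f1 (\<omega> - {i})) + (1 - \<pi> j t) * ?E (\<lambda>\<omega>. f (insert i \<omega>) - f (\<omega> - {i}))"
    if "i \<in> I" for i
  proof -
    have "i \<noteq> j" using that insert.hyps by auto
    then have "insert j \<omega> - {i} = insert j (\<omega> - {i})" for \<omega> by auto
    then show ?thesis using insert.hyps by (simp add: bexp_insert insert_commute)
  qed
  have eq: "(\<pi> j t * ?S ?f1 + \<pi>' j t * ?E ?f1) + ((1 - \<pi> j t) * ?S f + (0 - \<pi>' j t) * ?E f)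
     = (\<Sum>i\<in>insert j I. \<pi>' i t * bexp (\<lambda>i. \<pi> i t) (insert j I) (\<lambda>\<omega>. f (insert i \<omega>) - f (\<omega> - {i})))"
  proof -
    have "(\<Sum>i\<in>I. \<pi>' i t * bexp (\<lambda>i. \<pi> i t) (insert j I) (\<lambda>\<omega>. f (insert i \<omega>) - f (\<omega> - {i})))
      = \<pi> j t * ?S ?f1 + (1 - \<pi> j t) * ?S f"
      unfolding sum_distrib_left sum.distrib[symmetric]
      by (intro sum.cong refl) (simp add: ii algebra_simps)
    then show ?thesis using insert.hyps by (simp add: jj algebra_simps)
  qed
  show ?case using d insert.hyps unfolding eq by (simp add: bexp_insert)
qed simp

section \<open>Lattice paths in the plane\<close>

type_synonym site = "int \<times> int"

definition adj4 :: "site \<Rightarrow> site \<Rightarrow> bool" where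
  "adj4 x y \<longleftrightarrow> \<bar>fst x - fst y\<bar> + \<bar>snd x - snd y\<bar> = 1"

definition adj8 :: "site \<Rightarrow> site \<Rightarrow> bool" where
  "adj8 x y \<longleftrightarrow> \<bar>fst x - fst y\<bar> \<le> 1 \<and> \<bar>snd x - snd y\<bar> \<le> 1"

text \<open>The conjunct \<open>x \<in> S\<close> removes the trivial path at a point outside
  \<open>S\<close>, which the reflexive closure alone would admit.\<close>

definition reach :: "(site \<Rightarrow> site \<Rightarrow> bool) \<Rightarrow> site set \<Rightarrow> site \<Rightarrow> site \<Rightarrow> bool" where
  "reach R S x y \<longleftrightarrow> x \<in> S \<and> (x, y) \<in> {(u, v). u \<in> S \<and> v \<in> S \<and> R u v}\<^sup>*"

lemma adj4_sym: "adj4 x y = adj4 y x"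
  by (simp add: adj4_def abs_minus_commute)

lemma reach_refl: "x \<in> S \<Longrightarrow> reach R S x x"
  by (simp add: reach_def)

lemma reach_in:
  assumes "reach R S x y"
  shows "x \<in> S" "y \<in> S"
proof -
  show "x \<in> S" using assms by (simp add: reach_def)
  have "(x, y) \<in> {(u, v). u \<in> S \<and> v \<in> S \<and> R u v}\<^sup>*" using assms by (simp add: reach_def)
  then show "y \<in> S" using \<open>x \<in> S\<close> by (induction rule: rtrancl_induct) auto
qed

lemma reach_step: "reach R S x y \<Longrightarrow> R y z \<Longrightarrow> z \<in> S \<Longrightarrow> reach R S x z"
  using reach_in[of R S x y] unfolding reach_def
  by (auto intro: rtrancl_into_rtrancl)

lemma reach_trans: "reach R S x y \<Longrightarrow> reach R S y z \<Longrightarrow> reach R S x z"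
  by (auto simp: reach_def)

lemma reach_induct [consumes 1, case_names refl step]:
  assumes "reach R S x y" "P x"
    and "\<And>y z. reach R S x y \<Longrightarrow> R y z \<Longrightarrow> z \<in> S \<Longrightarrow> P y \<Longrightarrow> P z"
  shows "P y"
proof -
  have "x \<in> S" "(x, y) \<in> {(u, v). u \<in> S \<and> v \<in> S \<and> R u v}\<^sup>*" using assms by (auto simp: reach_def)
  from this(2) show ?thesis
  proof (induction rule: rtrancl_induct)
    case (step y z)
    then show ?case using assms(3)[of y z] \<open>x \<in> S\<close> by (auto simp: reach_def)
  qed (rule assms(2))
qed

lemma reach_mono:
  assumes "reach R S x y" "S \<subseteq> T"
  shows "reach R T x y"
  using assms(1)
proof (induction rule: reach_induct)
  case refl
  show ?case using reach_in(1)[OF assms(1)] assms(2) by (auto intro: reach_refl)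
qed (use assms(2) in \<open>auto intro: reach_step\<close>)

lemma reach_sym:
  assumes "\<And>u v. R u v \<Longrightarrow> R v u" "reach R S x y"
  shows "reach R S y x"
  using assms(2)
proof (induction rule: reach_induct)
  case refl
  then show ?case using assms(2) by (auto intro: reach_refl dest: reach_in)
next
  case (step y z)
  then have "reach R S z y" by (auto intro!: reach_step[OF reach_refl] assms(1) dest: reach_in)
  then show ?case using step by (auto intro: reach_trans)
qed

lemma reach4_sym: "reach adj4 S x y \<Longrightarrow> reach adj4 S y x"
  by (rule reach_sym) (auto simp: adj4_sym)

lemma reach_image:
  assumes "\<And>u v. R u v \<Longrightarrow> R (g u) (g v)" "reach R S x y"
  shows "reach R (g ` S) (g x) (g y)"
  using assms(2)
proof (induction rule: reach_induct)
  case refl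
  show ?case using reach_in(1)[OF assms(2)] by (auto intro: reach_refl)
qed (auto intro: reach_step assms(1))

lemma reach_exit:
  assumes "reach R S x y" "x \<in> U" "y \<notin> U"
  obtains v w where "reach R (S \<inter> U) x v" "w \<in> S - U" "R v w" "reach R S x w"
proof -
  have "reach R (S \<inter> U) x y \<or> (\<exists>v w. reach R (S \<inter> U) x v \<and> w \<in> S - U \<and> R v w \<and> reach R S x w)"
    using assms(1)
  proof (induction rule: reach_induct)
    case refl
    then show ?case using assms by (auto intro: reach_refl dest: reach_in)
  next
    case (step y z)
    show ?case
    proof (cases "z \<in> U")
      case True
      then show ?thesis using step by (auto intro: reach_step)
    next
      case False
      then show ?thesis using step by (blast intro: reach_step)
    qed
  qed
  then show ?thesis using that assms(3) reach_in by blast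
qed

definition crs :: "site set \<Rightarrow> site set \<Rightarrow> site set \<Rightarrow> bool" where
  "crs S X Y \<longleftrightarrow> (\<exists>x\<in>X. \<exists>y\<in>Y. reach adj4 S x y)"

lemma crs_mono: "crs S X Y \<Longrightarrow> S \<subseteq> S' \<Longrightarrow> X \<subseteq> X' \<Longrightarrow> Y \<subseteq> Y' \<Longrightarrow> crs S' X' Y'"
  unfolding crs_def by (blast intro: reach_mono)

subsection \<open>Crossing paths meet\<close>

definition emb :: "site \<Rightarrow> real^2" where
  "emb x = vector [of_int (fst x), of_int (snd x)]"

lemma emb_nth [simp]: "emb x $ 1 = of_int (fst x)" "emb x $ 2 = of_int (snd x)"
  by (simp_all add: emb_def)

text \<open>Rounding down turns an intersection of polygonal lines in the plane into a common
  lattice site: the same rounded point is an endpoint of the edge on either line.\<close>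

lemma floor_on_edge:
  assumes "adj4 u v \<or> u = v" "z \<in> closed_segment (emb u) (emb v)"
  shows "(\<lfloor>z $ 1\<rfloor>, \<lfloor>z $ 2\<rfloor>) \<in> {u, v}"
proof -
  obtain s where s: "0 \<le> s" "s \<le> 1" and z: "z = (1 - s) *\<^sub>R emb u + s *\<^sub>R emb v"
    using assms(2) by (auto simp: closed_segment_def)
  obtain u1 u2 where u: "u = (u1, u2)" by (cases u)
  obtain v1 v2 where v: "v = (v1, v2)" by (cases v)
  have z1: "z $ 1 = of_int u1 + s * of_int (v1 - u1)" and z2: "z $ 2 = of_int u2 + s * of_int (v2 - u2)"
    by (simp_all add: z u v algebra_simps)
  consider "u = v" | "v1 - u1 = 1 \<and> v2 = u2" | "v1 - u1 = -1 \<and> v2 = u2"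
    | "v2 - u2 = 1 \<and> v1 = u1" | "v2 - u2 = -1 \<and> v1 = u1"
    using assms(1) unfolding adj4_def u v by auto (smt (verit))+
  then show ?thesis
  proof cases
    case 1
    then show ?thesis using z1 z2 u v by simp
  next
    case 2
    show ?thesis
    proof (cases "s = 1")
      case True
      then show ?thesis using 2 z1 z2 u v by simp
    next
      case False
      then have "\<lfloor>z $ 1\<rfloor> = u1" unfolding z1 using 2 s by (simp add: floor_eq_iff)
      then show ?thesis using 2 z2 u by simp
    qed
  next
    case 3
    show ?thesis
    proof (cases "s = 0")
      case True
      then show ?thesis using 3 z1 z2 u v by simp
    next
      case False
      then have "\<lfloor>z $ 1\<rfloor> = u1 - 1" unfolding z1 using 3 s by (simp add: floor_eq_iff)
      then show ?thesis using 3 z2 u v by simp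
    qed
  next
    case 4
    show ?thesis
    proof (cases "s = 1")
      case True
      then show ?thesis using 4 z1 z2 u v by simp
    next
      case False
      then have "\<lfloor>z $ 2\<rfloor> = u2" unfolding z2 using 4 s by (simp add: floor_eq_iff)
      then show ?thesis using 4 z1 u by simp
    qed
  next
    case 5
    show ?thesis
    proof (cases "s = 0")
      case True
      then show ?thesis using 5 z1 z2 u v by simp
    next
      case False
      then have "\<lfloor>z $ 2\<rfloor> = u2 - 1" unfolding z2 using 5 s by (simp add: floor_eq_iff)
      then show ?thesis using 5 z1 u v by simp
    qed
  qed
qed

text \<open>Degenerate edges \<open>u = v\<close> are included so that the constant path of
  \<open>reach_path\<close> has its image here.\<close>

definition edges :: "site set \<Rightarrow> (real^2) set" where
  "edges S = (\<Union>u\<in>S. \<Union>v\<in>{v\<in>S. adj4 u v \<or> u = v}. closed_segment (emb u) (emb v))"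

lemma reach_path:
  assumes "reach adj4 S x y"
  shows "\<exists>g. path g \<and> path_image g \<subseteq> edges S \<and> pathstart g = emb x \<and> pathfinish g = emb y"
  using assms
proof (induction rule: reach_induct)
  case refl
  have "x \<in> S" using assms reach_in by auto
  then have "emb x \<in> edges S" unfolding edges_def by (intro UN_I[of x]) auto
  then show ?case
    by (intro exI[of _ "\<lambda>_. emb x"])
       (auto simp: path_def path_image_def pathstart_def pathfinish_def)
next
  case (step y z)
  then obtain g where g: "path g" "path_image g \<subseteq> edges S" "pathstart g = emb x" "pathfinish g = emb y" by auto
  have "y \<in> S" using step reach_in by auto
  then have e: "closed_segment (emb y) (emb z) \<subseteq> edges S" using step by (auto simp: edges_def)
  show ?case
    using g e by (intro exI[of _ "g +++ linepath (emb y) (emb z)"]) (auto simp: path_image_join)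
qed

text \<open>The planar fact behind it is \<open>fashoda\<close>; \<open>floor_on_edge\<close> brings
  the common point back to the lattice, which works for 4-paths because their edges are
  axis-parallel of length one.\<close>

lemma crossing_paths_meet:
  assumes "S \<subseteq> {l..r} \<times> {b..t}" "T \<subseteq> {l..r} \<times> {b..t}"
    and "reach adj4 S x x'" "fst x = l" "fst x' = r"
    and "reach adj4 T y y'" "snd y = b" "snd y' = t"
  shows "S \<inter> T \<noteq> {}"
proof -
  obtain f where f: "path f" "path_image f \<subseteq> edges S" "pathstart f = emb x" "pathfinish f = emb x'"
    using reach_path[OF assms(3)] by auto
  obtain g where g: "path g" "path_image g \<subseteq> edges T" "pathstart g = emb y" "pathfinish g = emb y'"
    using reach_path[OF assms(6)] by auto
  have box: "edges U \<subseteq> cbox (emb (l, b)) (emb (r, t))" if "U \<subseteq> {l..r} \<times> {b..t}" for U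
  proof -
    have "emb u \<in> cbox (emb (l, b)) (emb (r, t))" if "u \<in> U" for u
      using that \<open>U \<subseteq> _\<close> by (auto simp: mem_box_cart forall_2)
    then show ?thesis unfolding edges_def
      using closed_segment_subset[OF _ _ convex_box(1)] by blast
  qed
  obtain z where z: "z \<in> path_image f" "z \<in> path_image g"
    by (rule fashoda[of f g "emb (l, b)" "emb (r, t)"])
       (use f g box[OF assms(1)] box[OF assms(2)] assms in auto)
  have "(\<lfloor>z $ 1\<rfloor>, \<lfloor>z $ 2\<rfloor>) \<in> U" if "z \<in> edges U" for U
    using that floor_on_edge unfolding edges_def by fastforce
  then show ?thesis using z f g by blast
qed

subsection \<open>Hex: a black 8-crossing or a white 4-crossing\<close>

definition usq :: "site \<Rightarrow> (real \<times> real) set" where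
  "usq x = cbox (of_int (fst x) - 1/2, of_int (snd x) - 1/2) (of_int (fst x) + 1/2, of_int (snd x) + 1/2)"

lemma usq_iff: "z \<in> usq x \<longleftrightarrow> \<bar>fst z - of_int (fst x)\<bar> \<le> 1/2 \<and> \<bar>snd z - of_int (snd x)\<bar> \<le> 1/2"
  unfolding usq_def abs_le_iff by (cases z) (auto simp: cbox_Pair_eq)

definition clampr :: "real \<Rightarrow> real \<Rightarrow> real \<Rightarrow> real" where
  "clampr a b s = max a (min b s)"

text \<open>Hex from Brouwer. Let \<open>A\<close> be the black sites joined to the left side and
  \<open>C\<close> the white sites joined to the bottom. The map pushes right near \<open>A\<close>,
  left near the other black sites, up near \<open>C\<close>, down near the other white sites, and is
  clamped to the rectangle. At a fixed point a nonzero push must be stopped by a side; each of the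
  four cases produces a forbidden crossing or puts a site of the side into the class it was supposed
  to avoid.\<close>

lemma hex:
  fixes l r b t :: int
  assumes lr: "l \<le> r" "b \<le> t" and Bk: "Bk \<subseteq> {l..r} \<times> {b..t}"
    and nocross: "\<not> (\<exists>x x'. fst x = l \<and> fst x' = r \<and> reach adj8 Bk x x')"
  shows "\<exists>x x'. snd x = b \<and> snd x' = t \<and> reach adj4 ({l..r} \<times> {b..t} - Bk) x x'"
proof (rule ccontr)
  assume nw: "\<not> ?thesis"
  define W where "W = {l..r} \<times> {b..t} - Bk"
  define A where "A = {x. \<exists>y. fst y = l \<and> reach adj8 Bk y x}"
  define C where "C = {x. \<exists>y. snd y = b \<and> reach adj4 W y x}"
  have AB: "A \<subseteq> Bk" "C \<subseteq> W" by (auto simp: A_def C_def dest: reach_in)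
  have finR: "finite ({l..r} \<times> {b..t})" by simp
  have fin: "finite A" "finite (Bk - A)" "finite C" "finite (W - C)"
    using Bk AB by (auto intro: finite_subset[OF _ finR] simp: W_def)
  \<comment> \<open>A dummy point outside the rectangle: it keeps the sets nonempty, since
    \<open>infdist\<close> to the empty set is 0 by convention, and never matters for membership of
    the fixed point.\<close>
  let ?p = "(real_of_int l - 10, 0) :: real \<times> real"
  define hat where "hat X = insert ?p (\<Union>x\<in>X. usq x)" for X
  have clo: "closed (hat X)" if "finite X" for X
    unfolding hat_def using that by (intro closed_insert closed_UN) (auto simp: usq_def)
  have ne: "hat X \<noteq> {}" for X by (simp add: hat_def)
  let ?R = "cbox (real_of_int l - 1/2, real_of_int b - 1/2) (real_of_int r + 1/2, real_of_int t + 1/2)"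
  have Riff: "z \<in> ?R \<longleftrightarrow> l - 1/2 \<le> fst z \<and> fst z \<le> r + 1/2 \<and> b - 1/2 \<le> snd z \<and> snd z \<le> t + 1/2" for z
    by (cases z) (auto simp: cbox_Pair_eq)
  have pR: "z \<noteq> ?p" if "z \<in> ?R" for z using that unfolding Riff by auto
  define u where "u z = infdist z (hat (Bk - A)) - infdist z (hat A)" for z
  define v where "v z = infdist z (hat (W - C)) - infdist z (hat C)" for z
  define g where "g z = (clampr (l - 1/2) (r + 1/2) (fst z + u z), clampr (b - 1/2) (t + 1/2) (snd z + v z))" for z
  have "continuous_on ?R g"
    unfolding g_def u_def v_def clampr_def
    by (intro continuous_intros continuous_on_infdist)
  moreover have "g \<in> ?R \<rightarrow> ?R"
    using lr by (auto simp: g_def Riff clampr_def simp del: mem_box)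
  moreover have "?R \<noteq> {}"
  proof -
    have "(real_of_int l, real_of_int b) \<in> ?R" unfolding Riff using lr by simp
    then show ?thesis by blast
  qed
  ultimately obtain z where z: "z \<in> ?R" "g z = z"
    using brouwer[of ?R g] by auto
  have fz: "clampr (l - 1/2) (r + 1/2) (fst z + u z) = fst z"
    and sz: "clampr (b - 1/2) (t + 1/2) (snd z + v z) = snd z"
    using z(2) unfolding g_def by (metis fst_conv, metis snd_conv)
  have upos: "u z > 0 \<Longrightarrow> fst z = r + 1/2" "u z < 0 \<Longrightarrow> fst z = l - 1/2"
    using fz z(1) lr unfolding clampr_def Riff by (auto simp: max_def min_def split: if_splits)
  have vpos: "v z > 0 \<Longrightarrow> snd z = t + 1/2" "v z < 0 \<Longrightarrow> snd z = b - 1/2"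
    using sz z(1) lr unfolding clampr_def Riff by (auto simp: max_def min_def split: if_splits)
  have mem: "z \<in> hat X \<longleftrightarrow> (\<exists>x\<in>X. z \<in> usq x)" for X
    using pR[OF z(1)] by (auto simp: hat_def)
  have idist: "infdist z (hat X) = 0 \<longleftrightarrow> z \<in> hat X" if "finite X" for X
    using in_closed_iff_infdist_zero[OF clo[OF that] ne] by simp
  have idnn: "infdist z (hat X) \<ge> 0" for X by (rule infdist_nonneg)
  have near: "\<bar>fst x - fst y\<bar> \<le> 1 \<and> \<bar>snd x - snd y\<bar> \<le> 1" if "z \<in> usq x" "z \<in> usq y" for x y
  proof -
    have "\<bar>real_of_int (fst x) - real_of_int (fst y)\<bar> \<le> 1" "\<bar>real_of_int (snd x) - real_of_int (snd y)\<bar> \<le> 1"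
      using that unfolding usq_iff by linarith+
    then show ?thesis by linarith
  qed
  show False
  proof (cases "\<exists>x\<in>Bk. z \<in> usq x")
    case True
    then obtain x where x: "x \<in> Bk" "z \<in> usq x" by auto
    show False
    proof (cases "x \<in> A")
      case xA: True
      have "z \<notin> hat (Bk - A)"
      proof
        assume "z \<in> hat (Bk - A)"
        then obtain y where y: "y \<in> Bk - A" "z \<in> usq y" using mem by auto
        then have "adj8 x y" using near x by (auto simp: adj8_def)
        then have "y \<in> A" using xA y unfolding A_def by (auto intro: reach_step)
        then show False using y by auto
      qed
      moreover have "z \<in> hat A" using mem x xA by auto
      ultimately have "u z > 0"
        unfolding u_def using idist[OF fin(1)] idist[OF fin(2)] idnn[of "Bk - A"] by force
      then have "fst z = r + 1/2" by (rule upos)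
      then have "fst x = r" using x Bk unfolding usq_iff by force
      then show False using xA nocross unfolding A_def by blast
    next
      case xA: False
      have "z \<notin> hat A"
      proof
        assume "z \<in> hat A"
        then obtain y where y: "y \<in> A" "z \<in> usq y" using mem by auto
        then have "adj8 y x" using near x by (auto simp: adj8_def)
        then have "x \<in> A" using y x unfolding A_def by (auto intro: reach_step)
        then show False using xA by auto
      qed
      moreover have "z \<in> hat (Bk - A)" using mem x xA by auto
      ultimately have "u z < 0"
        unfolding u_def using idist[OF fin(1)] idist[OF fin(2)] idnn[of A] by force
      then have "fst z = l - 1/2" by (rule upos)
      then have "fst x = l" using x Bk unfolding usq_iff by force
      then have "x \<in> A" using reach_refl[OF x(1), of adj8] unfolding A_def by blast
      then show False using xA by auto
    qed
  next
    case nb: False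
    \<comment> \<open>The minimum is needed on the right and upper sides, where the half-integer
      coordinate would round to a site outside the rectangle.\<close>
    define x where "x = (min r \<lfloor>fst z + 1/2\<rfloor>, min t \<lfloor>snd z + 1/2\<rfloor>)"
    have fl: "l \<le> \<lfloor>fst z + 1/2\<rfloor>" "b \<le> \<lfloor>snd z + 1/2\<rfloor>"
      using z(1) unfolding Riff by (auto simp: le_floor_iff)
    have rnd: "\<bar>s - real_of_int (min m \<lfloor>s + 1/2\<rfloor>)\<bar> \<le> 1/2" if "s \<le> m + 1/2" for s and m :: int
    proof (cases "m \<le> \<lfloor>s + 1/2\<rfloor>")
      case True
      then have "real_of_int m \<le> s + 1/2" by (simp add: le_floor_iff)
      then show ?thesis using True that unfolding abs_le_iff by (simp add: min_def)
    next
      case False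
      then show ?thesis
        using floor_correct[of "s + 1/2"] unfolding abs_le_iff by (simp add: min_def) linarith
    qed
    have "\<bar>fst z - real_of_int (min r \<lfloor>fst z + 1/2\<rfloor>)\<bar> \<le> 1/2"
      "\<bar>snd z - real_of_int (min t \<lfloor>snd z + 1/2\<rfloor>)\<bar> \<le> 1/2"
      using z(1) unfolding Riff by (intro rnd; simp)+
    then have zx: "z \<in> usq x" by (simp add: usq_iff x_def)
    have xR: "x \<in> {l..r} \<times> {b..t}" using fl lr by (auto simp: x_def)
    then have xW: "x \<in> W" using nb zx by (auto simp: W_def)
    have CC: False if c: "c \<in> C" "z \<in> usq c" "d \<in> W - C" "z \<in> usq d" for c d
    proof -
      have nd: "\<not> adj4 c d" using c unfolding C_def by (auto intro: reach_step)
      have ncd: "c \<noteq> d" using c by auto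
      have n: "\<bar>fst c - fst d\<bar> \<le> 1" "\<bar>snd c - snd d\<bar> \<le> 1" using near c by auto
      \<comment> \<open>If the two white squares meet only diagonally at \<open>z\<close>, the
        square of the corner site \<open>w\<close> contains \<open>z\<close> too; it is white
        because no black square contains \<open>z\<close>, and it links \<open>c\<close> to
        \<open>d\<close> by 4-steps.\<close>
      define w where "w = (fst c, snd d)"
      have a1: "adj4 c w" "adj4 w d"
        using nd ncd n unfolding adj4_def w_def by (auto simp: prod_eq_iff) 
      have "z \<in> usq w" using c by (auto simp: usq_iff w_def)
      moreover have "w \<in> {l..r} \<times> {b..t}" using c AB unfolding w_def W_def by force
      ultimately have "w \<in> W" using nb by (auto simp: W_def)
      moreover obtain y where "snd y = b" "reach adj4 W y c" using c(1) by (auto simp: C_def)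
      ultimately have "reach adj4 W y d" using a1 c(3) by (meson DiffD1 reach_step)
      then have "d \<in> C" using \<open>snd y = b\<close> unfolding C_def by blast
      then show False using c by auto
    qed
    show False
    proof (cases "x \<in> C")
      case xC: True
      have "z \<notin> hat (W - C)" using mem CC xC zx by blast
      moreover have "z \<in> hat C" using mem zx xC by auto
      ultimately have "v z > 0"
        unfolding v_def using idist[OF fin(3)] idist[OF fin(4)] idnn[of "W - C"] by force
      then have "snd z = t + 1/2" by (rule vpos)
      then have "snd x = t" using zx xR unfolding usq_iff by force
      then show False using xC nw unfolding C_def W_def by blast
    next
      case xC: False
      have "z \<notin> hat C" using mem CC xC zx xW by blast
      moreover have "z \<in> hat (W - C)" using mem zx xC xW by auto
      ultimately have "v z < 0"
        unfolding v_def using idist[OF fin(3)] idist[OF fin(4)] idnn[of C] by force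
      then have "snd z = b - 1/2" by (rule vpos)
      then have "snd x = b" using zx xR unfolding usq_iff by force
      then have "x \<in> C" using reach_refl[OF xW, of adj4] unfolding C_def by blast
      then show False using xC by auto
    qed
  qed
qed

section \<open>The discretised model\<close>

text \<open>A bit \<open>(z, True)\<close> says that the cell \<open>z\<close> contains a white point, a bit \<open>(z, False)\<close> that it contains
  no black point; with this orientation all events concerning white connections are increasing.\<close>
type_synonym coord = "(site \<times> nat) \<times> bool"

text \<open>\<open>D u v t\<close> is the distance, in cell widths, between a site at level zero and
  a cell with offset \<open>(u, v)\<close> and height \<open>t\<close>. The symmetries of the square
  and the comparison with the sup and the sum norm are common to both metrics.\<close>

locale planar_metric =
  fixes D :: "int \<Rightarrow> int \<Rightarrow> nat \<Rightarrow> real"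
  assumes D_neg1: "D (- u) v t = D u v t" and D_neg2: "D u (- v) t = D u v t"
    and D_swap: "D v u t = D u v t"
    and D_lb1: "\<bar>real_of_int u\<bar> \<le> D u v t" and D_lb3: "real t \<le> D u v t"
    and D_ub: "D u v t \<le> \<bar>real_of_int u\<bar> + \<bar>real_of_int v\<bar> + real t"
begin

lemma D_lb2: "\<bar>real_of_int v\<bar> \<le> D u v t"
  using D_lb1[of v u t] D_swap by simp

definition dd :: "site \<Rightarrow> site \<times> nat \<Rightarrow> real" where
  "dd x z = D (fst x - fst (fst z)) (snd x - snd (fst z)) (snd z)"

lemma dd_ub: "dd x z \<le> real_of_int \<bar>fst x - fst (fst z)\<bar> + real_of_int \<bar>snd x - snd (fst z)\<bar> + real (snd z)"
  using D_ub unfolding dd_def by (metis of_int_abs)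

lemma dd_lb: "real_of_int \<bar>fst x - fst (fst z)\<bar> \<le> dd x z" "real_of_int \<bar>snd x - snd (fst z)\<bar> \<le> dd x z"
  "real (snd z) \<le> dd x z"
  using D_lb1[of "fst x - fst (fst z)"] D_lb2[of "snd x - snd (fst z)"] D_lb3 unfolding dd_def
  by (metis of_int_abs)+

lemma finite_ball: "finite {z. dd x z \<le> R}"
proof -
  have "{z. dd x z \<le> R} \<subseteq> ({fst x - \<lceil>R\<rceil>..fst x + \<lceil>R\<rceil>} \<times> {snd x - \<lceil>R\<rceil>..snd x + \<lceil>R\<rceil>}) \<times> {..nat \<lceil>R\<rceil>}"
  proof
    fix z assume "z \<in> {z. dd x z \<le> R}"
    then have "real_of_int \<bar>fst x - fst (fst z)\<bar> \<le> R" "real_of_int \<bar>snd x - snd (fst z)\<bar> \<le> R" "real (snd z) \<le> R"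
      using dd_lb[where x=x and z=z] by auto
    then have "\<bar>fst x - fst (fst z)\<bar> \<le> \<lceil>R\<rceil>" "\<bar>snd x - snd (fst z)\<bar> \<le> \<lceil>R\<rceil>" "int (snd z) \<le> \<lceil>R\<rceil>"
      by linarith+
    then show "z \<in> ({fst x - \<lceil>R\<rceil>..fst x + \<lceil>R\<rceil>} \<times> {snd x - \<lceil>R\<rceil>..snd x + \<lceil>R\<rceil>}) \<times> {..nat \<lceil>R\<rceil>}"
      by (cases z; cases "fst z") auto
  qed
  then show ?thesis by (rule finite_subset) simp
qed

text \<open>Strict inequality makes a tie non-white. The cut-off \<open>K * K\<close> in cell widths
  is distance \<open>K\<close> in true units: it makes the event depend on finitely many bits and
  recedes as \<open>K\<close> grows.\<close>

definition wh :: "nat \<Rightarrow> coord set \<Rightarrow> site \<Rightarrow> bool" where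
  "wh K \<omega> x \<longleftrightarrow> (\<exists>w. (w, True) \<in> \<omega> \<and> dd x w \<le> real (K * K) \<and> (\<forall>b. (b, False) \<notin> \<omega> \<longrightarrow> dd x w < dd x b))"

lemma wh_mono: "wh K \<omega> x \<Longrightarrow> \<omega> \<subseteq> \<omega>' \<Longrightarrow> wh K \<omega>' x"
  unfolding wh_def by blast

definition supp :: "nat \<Rightarrow> site set \<Rightarrow> coord set" where
  "supp K X = (\<Union>x\<in>X. {z. dd x z \<le> real (K * K)} \<times> UNIV)"

lemma finite_supp: "finite X \<Longrightarrow> finite (supp K X)"
  unfolding supp_def by (intro finite_UN_I finite_cartesian_product finite_ball) auto

lemma wh_supp:
  assumes "x \<in> X"
  shows "wh K (\<omega> \<inter> supp K X) x = wh K \<omega> x"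
proof -
  have m: "(z, c) \<in> supp K X" if "dd x z \<le> real (K * K)" for z c
    using that assms by (auto simp: supp_def)
  show ?thesis
  proof
    assume "wh K (\<omega> \<inter> supp K X) x"
    then obtain w where w: "(w, True) \<in> \<omega>" "dd x w \<le> real (K * K)"
      "\<And>b. (b, False) \<notin> \<omega> \<inter> supp K X \<Longrightarrow> dd x w < dd x b" by (auto simp: wh_def)
    then show "wh K \<omega> x" unfolding wh_def by blast
  next
    assume "wh K \<omega> x"
    then obtain w where w: "(w, True) \<in> \<omega>" "dd x w \<le> real (K * K)"
      "\<And>b. (b, False) \<notin> \<omega> \<Longrightarrow> dd x w < dd x b" by (auto simp: wh_def)
    have "dd x w < dd x b" if "(b, False) \<notin> \<omega> \<inter> supp K X" for b
      using w that m[of b False] by (cases "dd x b \<le> real (K * K)") auto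
    then show "wh K (\<omega> \<inter> supp K X) x" unfolding wh_def using w m by blast
  qed
qed

definition cn :: "nat \<Rightarrow> coord set \<Rightarrow> site set \<Rightarrow> site set \<Rightarrow> site set \<Rightarrow> bool" where
  "cn K \<omega> B X Y \<longleftrightarrow> crs {x\<in>B. wh K \<omega> x} X Y"

lemma cn_supp: "cn K (\<omega> \<inter> supp K B) B X Y = cn K \<omega> B X Y"
proof -
  have "{x\<in>B. wh K (\<omega> \<inter> supp K B) x} = {x\<in>B. wh K \<omega> x}" using wh_supp by blast
  then show ?thesis by (simp add: cn_def)
qed

lemma loc_cn: "finite B \<Longrightarrow> loc (\<lambda>\<omega>. cn K \<omega> B X Y)"
  unfolding loc_def dep_def by (intro exI[of _ "supp K B"]) (simp add: cn_supp finite_supp)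

lemma inc_cn: "inc (\<lambda>\<omega>. cn K \<omega> B X Y)"
  unfolding cn_def by (rule incI, erule crs_mono) (auto intro: wh_mono)

subsection \<open>The law of the bits\<close>

text \<open>A cell has volume \<open>1 / K ^ 3\<close>; these are the occupation and void
  probabilities of Poisson processes of intensity \<open>q\<close> (white) and \<open>1 - q\<close>
  (black).\<close>

definition pw :: "real \<Rightarrow> nat \<Rightarrow> coord \<Rightarrow> real" where
  "pw q K i = (if snd i then 1 - exp (- q / real K ^ 3) else exp (- (1 - q) / real K ^ 3))"

lemma weights_pw: "0 \<le> q \<Longrightarrow> q \<le> 1 \<Longrightarrow> weights (pw q K)"
  by (auto simp: weights_def pw_def divide_nonpos_nonneg)

lemma pw_mono: "q \<le> q' \<Longrightarrow> pw q K i \<le> pw q' K i"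
  by (auto simp: pw_def divide_right_mono)

abbreviation "PP q K \<equiv> prb (pw q K)"

text \<open>\<open>K\<close> cells make a unit of length. For radius 0 the set is empty, so
  \<open>noW\<close> and \<open>noB\<close> hold trivially; radii given by truncated subtraction
  rely on this.\<close>

definition cube :: "nat \<Rightarrow> site \<Rightarrow> nat \<Rightarrow> (site \<times> nat) set" where
  "cube K u \<rho> = ({K * fst u - \<rho> * K<..<K * fst u + \<rho> * K} \<times> {K * snd u - \<rho> * K<..<K * snd u + \<rho> * K}) \<times> {..<\<rho> * K}"

lemma cube_iff: "z \<in> cube K u \<rho> \<longleftrightarrow> \<bar>fst (fst z) - K * fst u\<bar> < \<rho> * K \<and> \<bar>snd (fst z) - K * snd u\<bar> < \<rho> * K \<and> snd z < \<rho> * K"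
  unfolding cube_def by (cases z; cases "fst z") auto

lemma finite_cube [simp]: "finite (cube K u \<rho>)"
  by (simp add: cube_def)

text \<open>The factor \<open>K ^ 3\<close> cancels against the intensity per cell, so the resulting
  void probabilities are bounded uniformly in \<open>K\<close>. A lower bound linear in
  \<open>\<rho>\<close> already yields exponential decay.\<close>

lemma card_cube:
  assumes "K \<ge> 1" "\<rho> \<ge> 1"
  shows "real \<rho> * real K ^ 3 \<le> real (card (cube K u \<rho>))"
    and "real (card (cube K u \<rho>)) \<le> 4 * real \<rho> ^ 3 * real K ^ 3"
proof -
  define N where "N = \<rho> * K"
  have N: "N \<ge> 1" unfolding N_def using assms by simp
  have "card {c - int N<..<c + int N} = 2 * N - 1" for c using N by simp
  then have c: "card (cube K u \<rho>) = (2 * N - 1) * (2 * N - 1) * N"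
    unfolding cube_def card_cartesian_product by (simp add: N_def)
  have "\<rho> * K ^ 3 \<le> \<rho> ^ 3 * K ^ 3" using assms by (simp add: self_le_power)
  also have "\<dots> = N * N * N" by (simp add: N_def power3_eq_cube mult_ac)
  also have "\<dots> \<le> (2 * N - 1) * (2 * N - 1) * N" using N by (intro mult_mono) auto
  finally have "\<rho> * K ^ 3 \<le> card (cube K u \<rho>)" using c by simp
  then show "real \<rho> * real K ^ 3 \<le> real (card (cube K u \<rho>))"
    by (metis of_nat_le_iff of_nat_mult of_nat_power)
  have "(2 * N - 1) * (2 * N - 1) * N \<le> (2 * N) * (2 * N) * N" by (intro mult_mono) auto
  also have "\<dots> = 4 * \<rho> ^ 3 * K ^ 3" by (simp add: N_def power3_eq_cube mult_ac)
  finally have "card (cube K u \<rho>) \<le> 4 * \<rho> ^ 3 * K ^ 3" using c by simp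
  then have "real (card (cube K u \<rho>)) \<le> real (4 * \<rho> ^ 3 * K ^ 3)" by (simp only: of_nat_le_iff)
  then show "real (card (cube K u \<rho>)) \<le> 4 * real \<rho> ^ 3 * real K ^ 3" by simp
qed

definition noW :: "coord set \<Rightarrow> (site \<times> nat) set \<Rightarrow> bool" where
  "noW \<omega> S \<longleftrightarrow> (\<forall>z\<in>S. (z, True) \<notin> \<omega>)"

definition noB :: "coord set \<Rightarrow> (site \<times> nat) set \<Rightarrow> bool" where
  "noB \<omega> S \<longleftrightarrow> (\<forall>z\<in>S. (z, False) \<in> \<omega>)"

lemma loc_noW: "finite S \<Longrightarrow> loc (\<lambda>\<omega>. noW \<omega> S)"
  unfolding noW_def by (intro loc_ball loc_not loc_member)

lemma loc_noB: "finite S \<Longrightarrow> loc (\<lambda>\<omega>. noB \<omega> S)"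
  unfolding noB_def by (intro loc_ball loc_member)

lemma dep_noW: "S \<times> {True} \<subseteq> J \<Longrightarrow> dep J (\<lambda>\<omega>. noW \<omega> S)"
  unfolding noW_def dep_def by blast

lemma dep_noB: "S \<times> {False} \<subseteq> J \<Longrightarrow> dep J (\<lambda>\<omega>. noB \<omega> S)"
  unfolding noB_def dep_def by blast

lemma inc_noW: "inc (\<lambda>\<omega>. \<not> noW \<omega> S)"
  unfolding noW_def inc_def by blast

lemma inc_noB: "inc (\<lambda>\<omega>. noB \<omega> S)"
  unfolding noB_def inc_def by blast

lemma PP_noW:
  assumes "finite S"
  shows "PP q K (\<lambda>\<omega>. noW \<omega> S) = exp (- q * real (card S) / real K ^ 3)"
proof -
  have "(\<lambda>\<omega>. noW \<omega> S) = (\<lambda>\<omega>. \<forall>i\<in>S \<times> {True}. i \<notin> \<omega>)" by (auto simp: noW_def)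
  then have "PP q K (\<lambda>\<omega>. noW \<omega> S) = (\<Prod>i\<in>S \<times> {True}. 1 - pw q K i)"
    by (simp only:) (rule prb_none_in, use assms in simp)
  also have "\<dots> = (\<Prod>i\<in>S \<times> {True}. exp (- q / real K ^ 3))"
    by (intro prod.cong) (auto simp: pw_def)
  also have "\<dots> = exp (- q / real K ^ 3) ^ card S" by (simp add: card_cartesian_product)
  also have "\<dots> = exp (- q * real (card S) / real K ^ 3)" by (simp add: exp_of_nat_mult[symmetric] mult.commute)
  finally show ?thesis .
qed

lemma PP_noB:
  assumes "finite S"
  shows "PP q K (\<lambda>\<omega>. noB \<omega> S) = exp (- (1 - q) * real (card S) / real K ^ 3)"
proof -
  have "(\<lambda>\<omega>. noB \<omega> S) = (\<lambda>\<omega>. \<forall>i\<in>S \<times> {False}. i \<in> \<omega>)" by (auto simp: noB_def)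
  then have "PP q K (\<lambda>\<omega>. noB \<omega> S) = (\<Prod>i\<in>S \<times> {False}. pw q K i)"
    by (simp only:) (rule prb_all_in, use assms in simp)
  also have "\<dots> = (\<Prod>i\<in>S \<times> {False}. exp (- (1 - q) / real K ^ 3))"
    by (intro prod.cong) (auto simp: pw_def)
  also have "\<dots> = exp (- (1 - q) / real K ^ 3) ^ card S" by (simp add: card_cartesian_product)
  also have "\<dots> = exp (- (1 - q) * real (card S) / real K ^ 3)"
    by (simp only: exp_of_nat_mult[symmetric]) (simp add: mult_ac)
  finally show ?thesis .
qed

lemma exp_card_cube:
  assumes "K \<ge> 1" "0 \<le> a"
  shows "exp (- a * real (card (cube K u \<rho>)) / real K ^ 3) \<le> exp (- a * real \<rho>)"
proof (cases "\<rho> = 0")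
  case False
  then have "real \<rho> * real K ^ 3 \<le> real (card (cube K u \<rho>))" using assms card_cube(1) by simp
  then have "real \<rho> \<le> real (card (cube K u \<rho>)) / real K ^ 3" using assms by (simp add: field_simps)
  then have "a * real \<rho> \<le> a * (real (card (cube K u \<rho>)) / real K ^ 3)" using assms by (intro mult_left_mono)
  then show ?thesis by simp
qed (use assms in simp)

lemma PP_noW_cube: "K \<ge> 1 \<Longrightarrow> 0 \<le> q \<Longrightarrow> PP q K (\<lambda>\<omega>. noW \<omega> (cube K u \<rho>)) \<le> exp (- q * real \<rho>)"
  using exp_card_cube[of K q] by (simp add: PP_noW)

lemma PP_noB_cube: "K \<ge> 1 \<Longrightarrow> q \<le> 1 \<Longrightarrow> PP q K (\<lambda>\<omega>. noB \<omega> (cube K u \<rho>)) \<le> exp (- (1 - q) * real \<rho>)"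
  using exp_card_cube[of K "1 - q"] by (simp add: PP_noB)

lemma PP_noB_cube_ge:
  assumes "K \<ge> 1" "0 \<le> q" "q \<le> 1" "\<rho> \<ge> 1"
  shows "exp (- 4 * real \<rho> ^ 3) \<le> PP q K (\<lambda>\<omega>. noB \<omega> (cube K u \<rho>))"
    and "exp (- 4 * real \<rho> ^ 3) \<le> PP q K (\<lambda>\<omega>. noW \<omega> (cube K u \<rho>))"
proof -
  have "real (card (cube K u \<rho>)) / real K ^ 3 \<le> 4 * real \<rho> ^ 3"
    using card_cube(2)[OF assms(1,4), of u] assms by (simp add: field_simps)
  then have e: "a * (real (card (cube K u \<rho>)) / real K ^ 3) \<le> 1 * (4 * real \<rho> ^ 3)" if "0 \<le> a" "a \<le> 1" for a
    using that by (intro mult_mono) auto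
  show "exp (- 4 * real \<rho> ^ 3) \<le> PP q K (\<lambda>\<omega>. noB \<omega> (cube K u \<rho>))"
    using e[of "1 - q"] assms unfolding PP_noB[OF finite_cube] exp_le_cancel_iff
    by (simp only: minus_mult_left[symmetric] minus_divide_left[symmetric] times_divide_eq_right[symmetric]) simp
  show "exp (- 4 * real \<rho> ^ 3) \<le> PP q K (\<lambda>\<omega>. noW \<omega> (cube K u \<rho>))"
    using e[of q] assms unfolding PP_noW[OF finite_cube] exp_le_cancel_iff
    by (simp only: minus_mult_left[symmetric] minus_divide_left[symmetric] times_divide_eq_right[symmetric]) simp
qed

subsection \<open>Macroscopic cells and holes\<close>

text \<open>Nearest macroscopic lattice point; adding \<open>K\<close> before dividing rounds to
  nearest, so the error is at most half a unit.\<close>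

definition mcell :: "nat \<Rightarrow> site \<Rightarrow> site" where
  "mcell K x = ((2 * fst x + K) div (2 * K), (2 * snd x + K) div (2 * K))"

lemma round_div:
  fixes a K :: int
  assumes "K > 0"
  shows "2 * \<bar>a - K * ((2 * a + K) div (2 * K))\<bar> \<le> K"
proof -
  define m where "m = (2 * a + K) div (2 * K)"
  have "2 * K * m + (2 * a + K) mod (2 * K) = 2 * a + K" unfolding m_def by simp
  moreover have "0 \<le> (2 * a + K) mod (2 * K)" "(2 * a + K) mod (2 * K) < 2 * K" using assms by auto
  ultimately have "2 * K * m \<le> 2 * a + K" "2 * a + K < 2 * K * m + 2 * K" by linarith+
  then have "2 * (a - K * m) \<le> K" "- (2 * (a - K * m)) \<le> K" by (simp_all add: algebra_simps)
  then show ?thesis unfolding m_def[symmetric] by linarith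
qed

lemma mcell: "K \<ge> 1 \<Longrightarrow> 2 * \<bar>fst x - K * fst (mcell K x)\<bar> \<le> K"
  "K \<ge> 1 \<Longrightarrow> 2 * \<bar>snd x - K * snd (mcell K x)\<bar> \<le> K"
  using round_div[of "int K" "fst x"] round_div[of "int K" "snd x"] by (auto simp: mcell_def)

lemma twice_dist_less: "2 * \<bar>x - c\<bar> \<le> k \<Longrightarrow> \<bar>z - c\<bar> < P \<Longrightarrow> 2 * \<bar>x - z\<bar> < k + 2 * P" for x c z k P :: int
  by arith

lemma twice_sum_less: "2 * A < k + 2 * P \<Longrightarrow> 2 * B < k + 2 * P \<Longrightarrow> z < P \<Longrightarrow> A + B + z < 3 * P + k" for A B z k P :: int
  by arith

text \<open>In the sum norm: at most \<open>\<rho> + 1/2\<close> units in each planar coordinate,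
  the half from rounding, and \<open>\<rho>\<close> in height.\<close>

lemma cube_in_ball:
  assumes "K \<ge> 1" "z \<in> cube K (mcell K x) \<rho>"
  shows "dd x z < real ((3 * \<rho> + 1) * K)"
proof -
  have a: "2 * \<bar>fst x - K * fst (mcell K x)\<bar> \<le> K" "2 * \<bar>snd x - K * snd (mcell K x)\<bar> \<le> K"
    using mcell assms by auto
  have b: "\<bar>fst (fst z) - K * fst (mcell K x)\<bar> < \<rho> * K" "\<bar>snd (fst z) - K * snd (mcell K x)\<bar> < \<rho> * K" "snd z < \<rho> * K"
    using assms(2) unfolding cube_iff by auto
  have "\<bar>fst x - fst (fst z)\<bar> + \<bar>snd x - snd (fst z)\<bar> + int (snd z) < int ((3 * \<rho> + 1) * K)"
  proof -
    define P where "P = int \<rho> * int K"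
    have "int (snd z) < P" using b(3) by (simp add: P_def flip: of_nat_mult)
    moreover have e: "int ((3 * \<rho> + 1) * K) = 3 * P + int K" by (simp add: P_def algebra_simps)
    moreover have "2 * \<bar>fst x - fst (fst z)\<bar> < int K + 2 * P"
      using a(1) b(1) unfolding of_nat_mult P_def by (rule twice_dist_less)
    moreover have "2 * \<bar>snd x - snd (fst z)\<bar> < int K + 2 * P"
      using a(2) b(2) unfolding of_nat_mult P_def by (rule twice_dist_less)
    ultimately show ?thesis unfolding e using twice_sum_less by blast
  qed
  then have "real_of_int (\<bar>fst x - fst (fst z)\<bar> + \<bar>snd x - snd (fst z)\<bar> + int (snd z)) < real_of_int (int ((3 * \<rho> + 1) * K))"
    by (simp only: of_int_less_iff)
  then show ?thesis using dd_ub[of x z] by simp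
qed

lemma PP_bex_noW:
  assumes "finite U" "K \<ge> 1" "0 \<le> q" "q \<le> 1"
  shows "PP q K (\<lambda>\<omega>. \<exists>u\<in>U. noW \<omega> (cube K u (\<rho> u))) \<le> (\<Sum>u\<in>U. exp (- q * real (\<rho> u)))"
proof -
  have "PP q K (\<lambda>\<omega>. \<exists>u\<in>U. noW \<omega> (cube K u (\<rho> u))) \<le> (\<Sum>u\<in>U. PP q K (\<lambda>\<omega>. noW \<omega> (cube K u (\<rho> u))))"
    using assms by (intro prb_bex_le weights_pw loc_noW) auto
  also have "\<dots> \<le> (\<Sum>u\<in>U. exp (- q * real (\<rho> u)))" using assms by (intro sum_mono PP_noW_cube) auto
  finally show ?thesis .
qed

lemma PP_bex_noB:
  assumes "finite U" "K \<ge> 1" "0 \<le> q" "q \<le> 1"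
  shows "PP q K (\<lambda>\<omega>. \<exists>u\<in>U. noB \<omega> (cube K u (\<rho> u))) \<le> (\<Sum>u\<in>U. exp (- (1 - q) * real (\<rho> u)))"
proof -
  have "PP q K (\<lambda>\<omega>. \<exists>u\<in>U. noB \<omega> (cube K u (\<rho> u))) \<le> (\<Sum>u\<in>U. PP q K (\<lambda>\<omega>. noB \<omega> (cube K u (\<rho> u))))"
    using assms by (intro prb_bex_le weights_pw loc_noB) auto
  also have "\<dots> \<le> (\<Sum>u\<in>U. exp (- (1 - q) * real (\<rho> u)))" using assms by (intro sum_mono PP_noB_cube) auto
  finally show ?thesis .
qed

text \<open>Erasing the bits outside \<open>J\<close> removes white points and inserts black ones
  there. If a white cell lay within \<open>R\<close> of \<open>x\<close>, a white cell at least as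
  near as both it and the witness of whiteness would still beat every black cell, old or inserted;
  so losing whiteness needs a white hole.\<close>

lemma wh_Int_hole:
  assumes "wh K \<omega> x" "\<not> wh K (\<omega> \<inter> J) x" "\<And>z c. dd x z < R \<Longrightarrow> (z, c) \<in> J" "dd x z < R"
  shows "(z, True) \<notin> \<omega>"
proof
  assume z: "(z, True) \<in> \<omega>"
  obtain w where w: "(w, True) \<in> \<omega>" "dd x w \<le> real (K * K)" "\<And>b. (b, False) \<notin> \<omega> \<Longrightarrow> dd x w < dd x b"
    using assms(1) by (auto simp: wh_def)
  obtain w' where w': "(w', True) \<in> \<omega>" "dd x w' \<le> dd x w" "dd x w' \<le> dd x z"
    by (cases "dd x w \<le> dd x z") (use w z in auto)
  have "dd x w' < dd x b" if "(b, False) \<notin> \<omega> \<inter> J" for b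
  proof (cases "dd x b < R")
    case True
    then have "(b, False) \<notin> \<omega>" using assms(3)[of b False] that by blast
    then have "dd x w < dd x b" by (rule w(3))
    then show ?thesis using w' by linarith
  next
    case False
    then show ?thesis using w' assms(4) by linarith
  qed
  moreover have "(w', True) \<in> J" by (rule assms(3)) (use w'(3) assms(4) in linarith)
  moreover have "dd x w' \<le> real (K * K)" using w'(2) w(2) by linarith
  ultimately have "wh K (\<omega> \<inter> J) x" unfolding wh_def using w'(1) by blast
  then show False using assms(2) by simp
qed

text \<open>Dual statement: bits set outside \<open>J\<close> insert white points and remove black
  ones. A black cell within \<open>R\<close> would force the new white witness to be nearer still,
  hence inside \<open>J\<close>, where nothing changed.\<close>

lemma wh_Un_hole:
  assumes "wh K (\<omega> \<union> - J) x" "\<not> wh K \<omega> x" "\<And>z c. dd x z < R \<Longrightarrow> (z, c) \<in> J" "dd x z < R"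
  shows "(z, False) \<in> \<omega>"
proof (rule ccontr)
  assume z: "(z, False) \<notin> \<omega>"
  obtain w where w: "(w, True) \<in> \<omega> \<union> - J" "dd x w \<le> real (K * K)" "\<And>b. (b, False) \<notin> \<omega> \<union> - J \<Longrightarrow> dd x w < dd x b"
    using assms(1) by (auto simp: wh_def)
  have "(z, False) \<notin> \<omega> \<union> - J" using z assms(3)[OF assms(4), of False] by blast
  then have zw: "dd x w < dd x z" by (rule w(3))
  have "dd x w < dd x b" if "(b, False) \<notin> \<omega>" for b
  proof (cases "dd x b < R")
    case True
    then show ?thesis using assms(3)[of b False] that w(3)[of b] by blast
  next
    case False
    then show ?thesis using zw assms(4) by linarith
  qed
  moreover have "dd x w < R" using zw assms(4) by linarith
  then have "(w, True) \<in> \<omega>" using w(1) assms(3)[of w True] by blast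
  ultimately have "wh K \<omega> x" unfolding wh_def using w by blast
  then show False using assms(2) by simp
qed

subsection \<open>Symmetries\<close>

definition isom :: "(site \<Rightarrow> site) \<Rightarrow> bool" where
  "isom g \<longleftrightarrow> bij g \<and> (\<forall>u v. adj4 (g u) (g v) = adj4 u v) \<and> (\<forall>x y t. dd (g x) (g y, t) = dd x (y, t))"

definition cact :: "(site \<Rightarrow> site) \<Rightarrow> coord \<Rightarrow> coord" where
  "cact g i = ((g (fst (fst i)), snd (fst i)), snd i)"

lemma isom_trans: "isom (\<lambda>x. (fst x + a, snd x + b))"
  unfolding isom_def
proof (intro conjI allI)
  show "bij (\<lambda>x. (fst x + a, snd x + b))"
    by (rule o_bij[where g="\<lambda>x. (fst x - a, snd x - b)"]) (auto simp: fun_eq_iff)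
qed (auto simp: adj4_def dd_def)

lemma isom_swap: "isom (\<lambda>x. (snd x, fst x))"
  unfolding isom_def
proof (intro conjI allI)
  show "bij (\<lambda>x::site. (snd x, fst x))"
    by (rule o_bij[where g="\<lambda>x::site. (snd x, fst x)"]) (auto simp: fun_eq_iff)
  show "dd (snd x, fst x) ((snd y, fst y), t) = dd x (y, t)" for x y t
    by (simp add: dd_def D_swap)
qed (auto simp: adj4_def)

lemma isom_neg1: "isom (\<lambda>x. (- fst x, snd x))"
  unfolding isom_def
proof (intro conjI allI)
  show "bij (\<lambda>x::site. (- fst x, snd x))"
    by (rule o_bij[where g="\<lambda>x::site. (- fst x, snd x)"]) (auto simp: fun_eq_iff)
  show "dd (- fst x, snd x) ((- fst y, snd y), t) = dd x (y, t)" for x y t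
    using D_neg1[of "fst x - fst y"] by (simp add: dd_def)
  show "adj4 (- fst u, snd u) (- fst v, snd v) = adj4 u v" for u v by (auto simp: adj4_def)
qed

lemma isom_neg2: "isom (\<lambda>x. (fst x, - snd x))"
  unfolding isom_def
proof (intro conjI allI)
  show "bij (\<lambda>x::site. (fst x, - snd x))"
    by (rule o_bij[where g="\<lambda>x::site. (fst x, - snd x)"]) (auto simp: fun_eq_iff)
  show "dd (fst x, - snd x) ((fst y, - snd y), t) = dd x (y, t)" for x y t
    using D_neg2[of _ "snd x - snd y"] by (simp add: dd_def)
  show "adj4 (fst u, - snd u) (fst v, - snd v) = adj4 u v" for u v by (auto simp: adj4_def)
qed

lemma bij_cact: "bij g \<Longrightarrow> bij (cact g)"
  by (rule o_bij[where g="cact (inv g)"])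
     (auto simp: fun_eq_iff cact_def bij_is_inj bij_is_surj surj_f_inv_f)

lemma wh_cact:
  assumes "isom g"
  shows "wh K (cact g ` \<omega>) (g x) = wh K \<omega> x"
proof -
  have b: "bij g" and d: "\<And>x y t. dd (g x) (g y, t) = dd x (y, t)" using assms by (auto simp: isom_def)
  have m: "((g y, t), c) \<in> cact g ` \<omega> \<longleftrightarrow> ((y, t), c) \<in> \<omega>" for y t c
    using bij_is_inj[OF bij_cact[OF b]] inj_image_mem_iff[of "cact g" "((y, t), c)" \<omega>] by (simp add: cact_def)
  have sur: "\<exists>y t. w = (g y, t)" for w :: "site \<times> nat"
    using bij_is_surj[OF b] by (metis surjD prod.collapse)
  show ?thesis
  proof
    assume "wh K (cact g ` \<omega>) (g x)"
    then obtain w where w: "(w, True) \<in> cact g ` \<omega>" "dd (g x) w \<le> real (K * K)"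
      "\<And>b. (b, False) \<notin> cact g ` \<omega> \<Longrightarrow> dd (g x) w < dd (g x) b" unfolding wh_def by blast
    obtain y t where y: "w = (g y, t)" using sur by blast
    have "dd x (y, t) < dd x b" if "(b, False) \<notin> \<omega>" for b
      using w(3)[of "(g (fst b), snd b)"] that unfolding y m d by simp
    then show "wh K \<omega> x" unfolding wh_def using w(1,2) unfolding y m d by blast
  next
    assume "wh K \<omega> x"
    then obtain w where w: "(w, True) \<in> \<omega>" "dd x w \<le> real (K * K)"
      "\<And>b. (b, False) \<notin> \<omega> \<Longrightarrow> dd x w < dd x b" unfolding wh_def by blast
    obtain y t where y: "w = (y, t)" by (cases w)
    have "dd (g x) (g y, t) < dd (g x) b" if b: "(b, False) \<notin> cact g ` \<omega>" for b
    proof -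
      obtain y' t' where "b = (g y', t')" using sur by blast
      then show ?thesis using w(3)[of "(y', t')"] b unfolding y by (simp add: m d)
    qed
    then show "wh K (cact g ` \<omega>) (g x)"
      unfolding wh_def using w(1,2) unfolding y by (intro exI[of _ "(g y, t)"]) (auto simp: m d)
  qed
qed

lemma crs_image:
  assumes "isom g"
  shows "crs (g ` S) (g ` X) (g ` Y) = crs S X Y"
proof -
  have b: "bij g" and a: "\<And>u v. adj4 (g u) (g v) = adj4 u v" using assms by (auto simp: isom_def)
  have fwd: "crs (h ` S) (h ` X) (h ` Y)" if "crs S X Y" "\<And>u v. adj4 u v \<Longrightarrow> adj4 (h u) (h v)" for h S X Y
    using that unfolding crs_def by (blast intro: reach_image)
  show ?thesis
  proof
    assume "crs (g ` S) (g ` X) (g ` Y)"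
    moreover have "adj4 (inv g u) (inv g v)" if "adj4 u v" for u v
      using that a[of "inv g u" "inv g v"] b by (simp add: bij_is_surj surj_f_inv_f)
    ultimately have "crs (inv g ` g ` S) (inv g ` g ` X) (inv g ` g ` Y)" by (rule fwd)
    then show "crs S X Y" using b by (simp add: bij_is_inj)
  qed (rule fwd, auto simp: a)
qed

lemma PP_isom:
  assumes "isom g" "finite B"
  shows "PP q K (\<lambda>\<omega>. cn K \<omega> (g ` B) (g ` X) (g ` Y)) = PP q K (\<lambda>\<omega>. cn K \<omega> B X Y)"
proof -
  have b: "bij g" using assms by (auto simp: isom_def)
  have "PP q K (\<lambda>\<omega>. cn K \<omega> (g ` B) (g ` X) (g ` Y)) = PP q K (\<lambda>\<omega>. cn K (cact g ` \<omega>) (g ` B) (g ` X) (g ` Y))"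
    using assms b by (intro prb_reindex(1)[symmetric] loc_cn bij_cact) (auto simp: pw_def cact_def)
  also have "(\<lambda>\<omega>. cn K (cact g ` \<omega>) (g ` B) (g ` X) (g ` Y)) = (\<lambda>\<omega>. cn K \<omega> B X Y)"
  proof
    fix \<omega>
    have "{x \<in> g ` B. wh K (cact g ` \<omega>) x} = g ` {x \<in> B. wh K \<omega> x}"
      using wh_cact[OF assms(1)] by auto
    then show "cn K (cact g ` \<omega>) (g ` B) (g ` X) (g ` Y) = cn K \<omega> B X Y"
      by (simp add: cn_def crs_image[OF assms(1)])
  qed
  finally show ?thesis .
qed

text \<open>Exchange of colours: the two bits of a cell are swapped and negated, because they are
  oriented oppositely.\<close>

definition flipc :: "coord set \<Rightarrow> coord set" where
  "flipc \<omega> = {i. (fst i, \<not> snd i) \<notin> \<omega>}"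

text \<open>At one half the weight of the white bit is one minus the weight of the black bit of the
  same cell, so swapping and negating preserves the law.\<close>

lemma PP_flip:
  assumes "loc A"
  shows "PP (1/2) K (\<lambda>\<omega>. A (flipc \<omega>)) = PP (1/2) K A" and "loc (\<lambda>\<omega>. A (flipc \<omega>))"
proof -
  define \<sigma> :: "coord \<Rightarrow> coord" where "\<sigma> i = (fst i, \<not> snd i)" for i
  obtain I0 where I0: "finite I0" "dep I0 A" using assms by (auto simp: loc_def)
  \<comment> \<open>The support is enlarged to be invariant under swapping the bits of a
    cell.\<close>
  define I where "I = I0 \<union> \<sigma> ` I0"
  have ss: "\<sigma> (\<sigma> i) = i" for i by (simp add: \<sigma>_def)
  have im: "i \<in> \<sigma> ` \<omega> \<longleftrightarrow> \<sigma> i \<in> \<omega>" for i \<omega> by (metis ss image_iff)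
  have fl: "i \<in> flipc \<omega> \<longleftrightarrow> \<sigma> i \<notin> \<omega>" for i \<omega> by (simp add: flipc_def \<sigma>_def)
  have I: "finite I" "dep I A" using I0 dep_mono[of I0 A I] unfolding I_def by auto
  have sI: "\<sigma> i \<in> I \<longleftrightarrow> i \<in> I" for i unfolding I_def Un_iff im ss by blast
  have I3: "\<sigma> ` I = I" by (rule set_eqI) (simp only: im sI)
  have inj: "inj_on \<sigma> I" by (rule inj_onI) (metis ss)
  have eq: "A (flipc \<omega>) = A (I - \<sigma> ` \<omega>)" for \<omega>
  proof (rule dep_eq[OF I(2)])
    show "flipc \<omega> \<inter> I = (I - \<sigma> ` \<omega>) \<inter> I" by (rule set_eqI) (simp add: im fl conj_commute)
  qed
  have d: "dep I (\<lambda>\<omega>. A (flipc \<omega>))"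
    unfolding dep_def
  proof
    fix \<omega> show "A (flipc (\<omega> \<inter> I)) = A (flipc \<omega>)"
    proof (rule dep_eq[OF I(2)])
      show "flipc (\<omega> \<inter> I) \<inter> I = flipc \<omega> \<inter> I" by (rule set_eqI) (auto simp: fl sI)
    qed
  qed
  then show "loc (\<lambda>\<omega>. A (flipc \<omega>))" using I by (auto simp: loc_def)
  let ?\<pi> = "pw (1/2) K"
  have "PP (1/2) K (\<lambda>\<omega>. A (flipc \<omega>)) = bexp ?\<pi> I (\<lambda>\<omega>. of_bool (A (I - \<sigma> ` \<omega>)))"
    unfolding prb_eq[OF I(1) d] by (simp add: eq)
  also have "\<dots> = bexp (\<lambda>i. 1 - ?\<pi> i) (\<sigma> ` I) (\<lambda>\<omega>. of_bool (A (I - \<omega>)))"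
    by (rule bexp_reindex[OF inj I(1)]) (auto simp: pw_def \<sigma>_def)
  also have "\<dots> = bexp ?\<pi> I (\<lambda>\<omega>. of_bool (A \<omega>))"
    unfolding I3 using bexp_flip[OF I(1), of "\<lambda>i. 1 - ?\<pi> i" "\<lambda>\<omega>. of_bool (A \<omega>)"] by simp
  finally show "PP (1/2) K (\<lambda>\<omega>. A (flipc \<omega>)) = PP (1/2) K A" unfolding prb_eq[OF I] .
qed

lemma wh_flip_excl: "wh K (flipc \<omega>) x \<Longrightarrow> \<not> wh K \<omega> x"
  unfolding wh_def flipc_def by fastforce

subsection \<open>Boxes and arms\<close>

text \<open>The centre \<open>u\<close> and the radius \<open>n\<close> are macroscopic, the sites
  of the box are counted in cell widths.\<close>

definition lbox :: "nat \<Rightarrow> site \<Rightarrow> nat \<Rightarrow> site set" where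
  "lbox K u n = {x. \<bar>fst x - K * fst u\<bar> \<le> n * K \<and> \<bar>snd x - K * snd u\<bar> \<le> n * K}"

definition bd :: "nat \<Rightarrow> site \<Rightarrow> nat \<Rightarrow> site set" where
  "bd K u n = {x\<in>lbox K u n. \<bar>fst x - K * fst u\<bar> = n * K \<or> \<bar>snd x - K * snd u\<bar> = n * K}"

lemma lbox_eq: "lbox K u n = {K * fst u - n * K..K * fst u + n * K} \<times> {K * snd u - n * K..K * snd u + n * K}"
  unfolding lbox_def by (auto simp: abs_le_iff)

lemma finite_lbox [simp]: "finite (lbox K u n)"
  unfolding lbox_eq by simp

lemma lbox_mono: "m \<le> n \<Longrightarrow> lbox K u m \<subseteq> lbox K u n"
proof -
  assume "m \<le> n"
  then have "int m * int K \<le> int n * int K" by (intro mult_right_mono) auto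
  then show ?thesis unfolding lbox_def by auto
qed

lemma last_before_exit: "\<bar>v - c\<bar> \<le> P \<Longrightarrow> \<not> \<bar>w - c\<bar> \<le> P \<Longrightarrow> \<bar>v - w\<bar> \<le> 1 \<Longrightarrow> \<bar>v - c\<bar> = P" for v w c P :: int
  by arith

lemma reach_to_bd:
  assumes "reach adj4 S x y" "x \<in> lbox K u n" "y \<notin> lbox K u n \<or> y \<in> bd K u n"
  obtains v where "v \<in> bd K u n" "reach adj4 (S \<inter> lbox K u n) x v" "reach adj4 S x v"
proof (cases "y \<in> lbox K u n \<and> reach adj4 (S \<inter> lbox K u n) x y")
  case True
  then show ?thesis using that[of y] assms by auto
next
  case False
  have "\<exists>y'. reach adj4 S x y' \<and> y' \<notin> lbox K u n"
  proof (rule ccontr)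
    assume a: "\<nexists>y'. reach adj4 S x y' \<and> y' \<notin> lbox K u n"
    have "reach adj4 (S \<inter> lbox K u n) x y" using assms(1)
    proof (induction rule: reach_induct)
      case refl
      show ?case using reach_in(1)[OF assms(1)] assms(2) by (auto intro!: reach_refl)
    next
      case (step y z)
      then have "z \<in> lbox K u n" using a reach_step[OF step(1,2,3)] by blast
      then show ?case using step by (auto intro: reach_step)
    qed
    moreover have "y \<in> lbox K u n" using a assms(1) by blast
    ultimately show False using False by blast
  qed
  then obtain y' where y': "reach adj4 S x y'" "y' \<notin> lbox K u n" by auto
  obtain v w where v: "reach adj4 (S \<inter> lbox K u n) x v" "w \<in> S - lbox K u n" "adj4 v w"
    using reach_exit[OF y'(1) assms(2) y'(2)] by metis
  have vb: "v \<in> lbox K u n" using reach_in(2)[OF v(1)] by auto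
  have "w \<notin> lbox K u n" using v by auto
  then have "\<not> \<bar>fst w - K * fst u\<bar> \<le> n * K \<or> \<not> \<bar>snd w - K * snd u\<bar> \<le> n * K"
    by (simp add: lbox_def)
  moreover have "\<bar>fst v - fst w\<bar> \<le> 1" "\<bar>snd v - snd w\<bar> \<le> 1" using v(3) unfolding adj4_def by linarith+
  moreover have "\<bar>fst v - K * fst u\<bar> \<le> n * K" "\<bar>snd v - K * snd u\<bar> \<le> n * K"
    using vb by (auto simp: lbox_def)
  ultimately have "\<bar>fst v - K * fst u\<bar> = n * K \<or> \<bar>snd v - K * snd u\<bar> = n * K"
    using last_before_exit by blast
  then have "v \<in> bd K u n" using vb by (simp add: bd_def)
  then show ?thesis using that v(1) reach_mono[OF v(1)] by blast
qed

definition arm :: "nat \<Rightarrow> coord set \<Rightarrow> site \<Rightarrow> nat \<Rightarrow> nat \<Rightarrow> bool" where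
  "arm K \<omega> u m n \<longleftrightarrow> cn K \<omega> (lbox K u n) (lbox K u m) (bd K u n)"

lemma loc_arm: "loc (\<lambda>\<omega>. arm K \<omega> u m n)"
  unfolding arm_def by (rule loc_cn) simp

lemma inc_arm: "inc (\<lambda>\<omega>. arm K \<omega> u m n)"
  unfolding arm_def by (rule inc_cn)

lemma arm_of_reach:
  assumes "reach adj4 S x y" "S \<subseteq> {x. wh K \<omega> x}" "x \<in> lbox K u m" "m \<le> n" "y \<notin> lbox K u n \<or> y \<in> bd K u n"
  shows "arm K \<omega> u m n"
proof -
  have "x \<in> lbox K u n" using assms lbox_mono by blast
  then obtain v where v: "v \<in> bd K u n" "reach adj4 (S \<inter> lbox K u n) x v"
    using reach_to_bd[OF assms(1) _ assms(5)] by metis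
  have "reach adj4 {x \<in> lbox K u n. wh K \<omega> x} x v"
    by (rule reach_mono[OF v(2)]) (use assms(2) in auto)
  then show ?thesis unfolding arm_def cn_def crs_def using v assms by blast
qed

lemma arm_antimono:
  assumes "arm K \<omega> u m n'" "m \<le> n" "n \<le> n'"
  shows "arm K \<omega> u m n"
proof -
  obtain x y where xy: "x \<in> lbox K u m" "y \<in> bd K u n'" "reach adj4 {x \<in> lbox K u n'. wh K \<omega> x} x y"
    using assms(1) unfolding arm_def cn_def crs_def by auto
  have nn: "int n * int K \<le> int n' * int K" using assms(3) by (intro mult_right_mono) auto
  have "y \<in> bd K u n" if "y \<in> lbox K u n"
  proof -
    have l: "\<bar>fst y - K * fst u\<bar> \<le> int n * int K" "\<bar>snd y - K * snd u\<bar> \<le> int n * int K"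
      using that by (auto simp: lbox_def)
    have "\<bar>fst y - K * fst u\<bar> = int n' * int K \<or> \<bar>snd y - K * snd u\<bar> = int n' * int K"
      using xy(2) by (auto simp: bd_def)
    then have "\<bar>fst y - K * fst u\<bar> = int n * int K \<or> \<bar>snd y - K * snd u\<bar> = int n * int K"
      using l nn by (elim disjE) (simp_all only:, linarith+)
    then show ?thesis using that by (simp add: bd_def)
  qed
  then have yy: "y \<notin> lbox K u n \<or> y \<in> bd K u n" by blast
  show ?thesis by (rule arm_of_reach[OF xy(3) _ xy(1) assms(2) yy]) auto
qed

lemma arm_mono_inner: "arm K \<omega> u m n \<Longrightarrow> m \<le> m' \<Longrightarrow> arm K \<omega> u m' n"
  unfolding arm_def cn_def by (erule crs_mono) (use lbox_mono in auto)

lemma PP_arm_trans: "PP q K (\<lambda>\<omega>. arm K \<omega> u m n) = PP q K (\<lambda>\<omega>. arm K \<omega> (0, 0) m n)"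
proof -
  define g :: "site \<Rightarrow> site" where "g x = (fst x + K * fst u, snd x + K * snd u)" for x
  have im: "g ` {x. P (fst x) (snd x)} = {x. P (fst x - K * fst u) (snd x - K * snd u)}" for P
  proof (intro equalityI subsetI)
    fix x assume "x \<in> {x. P (fst x - K * fst u) (snd x - K * snd u)}"
    then show "x \<in> g ` {x. P (fst x) (snd x)}"
      by (intro image_eqI[of _ _ "(fst x - K * fst u, snd x - K * snd u)"]) (auto simp: g_def)
  qed (auto simp: g_def)
  have b: "g ` lbox K (0, 0) n = lbox K u n" for n
    unfolding lbox_def using im[of "\<lambda>a b. \<bar>a\<bar> \<le> n * K \<and> \<bar>b\<bar> \<le> n * K"] by simp
  have bb: "g ` bd K (0, 0) n = bd K u n"
    unfolding bd_def lbox_def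
    using im[of "\<lambda>a b. (\<bar>a\<bar> \<le> n * K \<and> \<bar>b\<bar> \<le> n * K) \<and> (\<bar>a\<bar> = n * K \<or> \<bar>b\<bar> = n * K)"] by simp
  have iso: "isom g" unfolding g_def by (rule isom_trans)
  show ?thesis
    using PP_isom[OF iso, of "lbox K (0,0) n" q K "lbox K (0,0) m" "bd K (0,0) n"] b bb
    by (simp add: arm_def)
qed

end

section \<open>Sharpness\<close>

definition sd :: "site \<Rightarrow> site \<Rightarrow> nat" where
  "sd u v = nat (max (abs (fst u - fst v)) (abs (snd u - snd v)))"

lemma sum_power_int:
  fixes x :: real and c :: int
  assumes "0 \<le> x" "x < 1" "finite A"
  shows "(\<Sum>a\<in>A. x ^ nat \<bar>a - c\<bar>) \<le> 2 / (1 - x)"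
proof -
  have geo: "(\<Sum>n\<in>N. x ^ n) \<le> 1 / (1 - x)" if "finite N" for N :: "nat set"
  proof -
    have "(\<Sum>n\<in>N. x ^ n) \<le> (\<Sum>n. x ^ n)"
      using assms that by (intro sum_le_suminf summable_geometric) auto
    then show ?thesis using assms by (simp add: suminf_geometric)
  qed
  let ?P = "{a\<in>A. c \<le> a}" and ?N = "{a\<in>A. a < c}"
  have p: "(\<Sum>a\<in>?P. x ^ nat \<bar>a - c\<bar>) = (\<Sum>n\<in>(\<lambda>a. nat (a - c)) ` ?P. x ^ n)"
    by (subst sum.reindex) (auto simp: inj_on_def intro!: sum.cong)
  have n: "(\<Sum>a\<in>?N. x ^ nat \<bar>a - c\<bar>) = (\<Sum>n\<in>(\<lambda>a. nat (c - a)) ` ?N. x ^ n)"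
    by (subst sum.reindex) (auto simp: inj_on_def intro!: sum.cong)
  have "(\<Sum>a\<in>A. x ^ nat \<bar>a - c\<bar>) = (\<Sum>a\<in>?P \<union> ?N. x ^ nat \<bar>a - c\<bar>)"
    by (intro sum.cong) auto
  also have "\<dots> = (\<Sum>a\<in>?P. x ^ nat \<bar>a - c\<bar>) + (\<Sum>a\<in>?N. x ^ nat \<bar>a - c\<bar>)"
    using assms by (intro sum.union_disjoint) auto
  also have "\<dots> \<le> 1 / (1 - x) + 1 / (1 - x)"
    unfolding p n using assms by (intro add_mono geo) auto
  finally show ?thesis by simp
qed

text \<open>A hole at \<open>u\<close> reaching towards \<open>v\<close> has radius about a third of
  their distance, and 1/4 is the least density in use, so the rate is 1/12 per unit. Of this, 1/24
  is kept as decay in the distance \<open>k\<close> and 1/48 per coordinate makes the sum over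
  \<open>u\<close> geometric; \<open>1/6\<close> is the rounding loss of the division by 3.\<close>

lemma hole_sum:
  "\<exists>C>0. \<forall>s v U k. finite U \<longrightarrow> (\<forall>u\<in>U. k \<le> sd u v) \<longrightarrow>
     (\<Sum>u\<in>U. exp (- (1/4) * real ((sd u v - s) div 3))) \<le> C * exp (real s / 12 - real k / 24)"
proof -
  define x where "x = exp (- 1 / 48 :: real)"
  have x: "0 \<le> x" "x < 1" by (auto simp: x_def)
  define G where "G = 2 / (1 - x)"
  have G: "G > 0" using x by (simp add: G_def)
  define C where "C = exp (1/6) * (G * G)"
  have "(\<Sum>u\<in>U. exp (- (1/4) * real ((sd u v - s) div 3))) \<le> C * exp (real s / 12 - real k / 24)"
    if U: "finite U" "\<forall>u\<in>U. k \<le> sd u v" for s v U k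
  proof -
    let ?e = "exp (1/6 + real s / 12 - real k / 24)"
    have pt: "exp (- (1/4) * real ((sd u v - s) div 3)) \<le> ?e * (x ^ nat \<bar>fst u - fst v\<bar> * x ^ nat \<bar>snd u - snd v\<bar>)"
      if "u \<in> U" for u
    proof -
      define a where "a = nat \<bar>fst u - fst v\<bar>"
      define b where "b = nat \<bar>snd u - snd v\<bar>"
      have ab: "a \<le> sd u v" "b \<le> sd u v" by (auto simp: a_def b_def sd_def)
      have "sd u v \<le> 3 * ((sd u v - s) div 3) + 2 + s" by linarith
      then have "real (sd u v) \<le> real (3 * ((sd u v - s) div 3) + 2 + s)" by (simp only: of_nat_le_iff)
      then have "real (sd u v) \<le> 3 * real ((sd u v - s) div 3) + 2 + real s" by simp
      moreover have "real k \<le> real (sd u v)" using U that by simp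
      moreover have "real a \<le> real (sd u v)" "real b \<le> real (sd u v)" using ab by auto
      ultimately have "- (1/4) * real ((sd u v - s) div 3) \<le> 1/6 + real s / 12 - real k / 24 + (real a * (- 1/48) + real b * (- 1/48))"
        by (simp add: field_simps)
      then have "exp (- (1/4) * real ((sd u v - s) div 3))
        \<le> exp (1/6 + real s / 12 - real k / 24 + (real a * (- 1/48) + real b * (- 1/48)))"
        by (simp only: exp_le_cancel_iff)
      also have "\<dots> = ?e * (x ^ a * x ^ b)"
        unfolding x_def exp_of_nat_mult[symmetric] exp_add[symmetric] by simp
      finally show ?thesis by (simp add: a_def b_def)
    qed
    have "(\<Sum>u\<in>U. exp (- (1/4) * real ((sd u v - s) div 3)))
      \<le> (\<Sum>u\<in>U. ?e * (x ^ nat \<bar>fst u - fst v\<bar> * x ^ nat \<bar>snd u - snd v\<bar>))"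
      by (intro sum_mono pt)
    also have "\<dots> \<le> (\<Sum>u\<in>fst ` U \<times> snd ` U. ?e * (x ^ nat \<bar>fst u - fst v\<bar> * x ^ nat \<bar>snd u - snd v\<bar>))"
      using U x by (intro sum_mono2 subset_fst_snd) auto
    also have "\<dots> = ?e * ((\<Sum>a\<in>fst ` U. x ^ nat \<bar>a - fst v\<bar>) * (\<Sum>b\<in>snd ` U. x ^ nat \<bar>b - snd v\<bar>))"
    proof -
      have "(\<Sum>a\<in>fst ` U. x ^ nat \<bar>a - fst v\<bar>) * (\<Sum>b\<in>snd ` U. x ^ nat \<bar>b - snd v\<bar>)
        = (\<Sum>u\<in>fst ` U \<times> snd ` U. x ^ nat \<bar>fst u - fst v\<bar> * x ^ nat \<bar>snd u - snd v\<bar>)"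
        unfolding sum_product sum.cartesian_product case_prod_unfold by (rule refl)
      then show ?thesis by (simp only: sum_distrib_left)
    qed
    also have "\<dots> \<le> ?e * (G * G)"
      unfolding G_def using U x
      by (intro mult_left_mono mult_mono sum_power_int sum_nonneg) auto
    also have "\<dots> = C * exp (real s / 12 - real k / 24)"
      by (simp add: C_def exp_add[symmetric] algebra_simps)
    finally show ?thesis .
  qed
  moreover have "C > 0" using G by (simp add: C_def)
  ultimately show ?thesis by blast
qed

context planar_metric
begin

abbreviation (input) org :: site where "org \<equiv> (0, 0)"

text \<open>The value 1 at scale 0 stands for an arm that need not leave its unit box, and it makes
  \<open>sumth\<close> at least 1.\<close>

definition th :: "real \<Rightarrow> nat \<Rightarrow> nat \<Rightarrow> real" where
  "th q K n = (if n = 0 then 1 else PP q K (\<lambda>\<omega>. arm K \<omega> org 1 n))"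

definition sumth :: "real \<Rightarrow> nat \<Rightarrow> nat \<Rightarrow> real" where
  "sumth q K n = (\<Sum>j\<le>n. th q K j)"

lemma th_nonneg: "0 \<le> q \<Longrightarrow> q \<le> 1 \<Longrightarrow> 0 \<le> th q K n"
  by (simp add: th_def prb_nonneg weights_pw)

lemma th_le_1: "0 \<le> q \<Longrightarrow> q \<le> 1 \<Longrightarrow> th q K n \<le> 1"
  by (simp add: th_def prb_le_1 weights_pw loc_arm)

lemma th_mono: "0 \<le> q \<Longrightarrow> q \<le> q' \<Longrightarrow> q' \<le> 1 \<Longrightarrow> th q K n \<le> th q' K n"
  by (auto simp: th_def intro!: prb_mono_weight weights_pw pw_mono loc_arm inc_arm)

lemma sumth_ge_1: "0 \<le> q \<Longrightarrow> q \<le> 1 \<Longrightarrow> 1 \<le> sumth q K n"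
proof -
  assume q: "0 \<le> q" "q \<le> 1"
  have "th q K 0 \<le> sumth q K n" unfolding sumth_def
    using q by (intro member_le_sum th_nonneg) auto
  then show ?thesis by (simp add: th_def)
qed

section \<open>Exploration of the white clusters of a sphere\<close>

definition WS :: "nat \<Rightarrow> nat \<Rightarrow> coord set \<Rightarrow> site set" where
  "WS K n \<omega> = {x\<in>lbox K org n. wh K \<omega> x}"

text \<open>The sites whose colour the exploration must decide: those of the sphere of radius
  \<open>k\<close>, and the neighbours of white sites already joined to it.\<close>

definition Rch :: "nat \<Rightarrow> nat \<Rightarrow> nat \<Rightarrow> coord set \<Rightarrow> site set" where
  "Rch K n k \<omega> = {x\<in>lbox K org n. x \<in> bd K org k \<or> (\<exists>s\<in>bd K org k. \<exists>y. reach adj4 (WS K n \<omega>) s y \<and> adj4 y x)}"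

lemma WS_mono: "\<omega> \<subseteq> \<omega>' \<Longrightarrow> WS K n \<omega> \<subseteq> WS K n \<omega>'"
  unfolding WS_def by (auto intro: wh_mono)

lemma Rch_mono: "\<omega> \<subseteq> \<omega>' \<Longrightarrow> Rch K n k \<omega> \<subseteq> Rch K n k \<omega>'"
  unfolding Rch_def using reach_mono[OF _ WS_mono] by blast

text \<open>Around a site to be decided, bits are read in order of distance up to and including the
  distance of the nearest white cell. Stopping is governed by white cells alone, so that a bit being
  read forces a white hole, a decreasing event that Harris separates from an arm.\<close>

definition needed :: "nat \<Rightarrow> nat \<Rightarrow> nat \<Rightarrow> coord set \<Rightarrow> coord set \<Rightarrow> coord \<Rightarrow> bool" where
  "needed K n k J \<sigma> i \<longleftrightarrow> (\<exists>x\<in>Rch K n k \<sigma>. dd x (fst i) \<le> real (K * K) \<and>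
     (\<forall>z. dd x z < dd x (fst i) \<longrightarrow> (z, True) \<in> J \<and> (z, False) \<in> J \<and> (z, True) \<notin> \<sigma>))"

definition expl :: "nat \<Rightarrow> nat \<Rightarrow> nat \<Rightarrow> coord set \<Rightarrow> coord set \<Rightarrow> coord option" where
  "expl K n k J \<sigma> = (if \<exists>i\<in>supp K (lbox K org n) - J. needed K n k J \<sigma> i
     then Some (SOME i. i \<in> supp K (lbox K org n) - J \<and> needed K n k J \<sigma> i) else None)"

lemma expl_Some:
  assumes "expl K n k J \<sigma> = Some i"
  shows "i \<in> supp K (lbox K org n) - J" "needed K n k J \<sigma> i"
proof -
  have ex: "\<exists>i. i \<in> supp K (lbox K org n) - J \<and> needed K n k J \<sigma> i"
    using assms unfolding expl_def by (auto split: if_splits)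
  have "i = (SOME i. i \<in> supp K (lbox K org n) - J \<and> needed K n k J \<sigma> i)"
    using assms unfolding expl_def by (auto split: if_splits)
  then show "i \<in> supp K (lbox K org n) - J" "needed K n k J \<sigma> i" using someI_ex[OF ex] by auto
qed

lemma reveal_needed:
  "i \<in> reveal (expl K n k) m J \<omega> \<Longrightarrow> i \<in> J \<or> (\<exists>J'. needed K n k J' (\<omega> \<inter> J') i)"
proof (induction m arbitrary: J)
  case (Suc m)
  show ?case
  proof (cases "expl K n k J (\<omega> \<inter> J)")
    case None
    then show ?thesis using Suc.prems by simp
  next
    case (Some j)
    then have "i \<in> reveal (expl K n k) m (insert j J) \<omega>" using Suc.prems by simp
    then have "i \<in> insert j J \<or> (\<exists>J'. needed K n k J' (\<omega> \<inter> J') i)" by (rule Suc.IH)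
    then show ?thesis using expl_Some(2)[OF Some] by blast
  qed
qed simp

lemma revealed:
  assumes "i \<in> reveal (expl K n k) m {} \<omega>"
  obtains x where "x \<in> Rch K n k \<omega>" "\<And>z. dd x z < dd x (fst i) \<Longrightarrow> (z, True) \<notin> \<omega>"
proof -
  obtain J where J: "needed K n k J (\<omega> \<inter> J) i" using reveal_needed[OF assms] by auto
  then obtain x where x: "x \<in> Rch K n k (\<omega> \<inter> J)"
    "\<And>z. dd x z < dd x (fst i) \<Longrightarrow> (z, True) \<in> J \<and> (z, False) \<in> J \<and> (z, True) \<notin> \<omega> \<inter> J"
    unfolding needed_def by blast
  have "x \<in> Rch K n k \<omega>" using x(1) Rch_mono[of "\<omega> \<inter> J" \<omega>] by blast
  then show ?thesis using that x(2) by blast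
qed

text \<open>Once no query is left, all bits up to the distance of the nearest white cell
  \<open>v\<close> of \<open>x\<close> have been read, and these decide that \<open>x\<close> is
  white.\<close>

lemma explored_wh:
  assumes none: "expl K n k J (\<omega> \<inter> J) = None" and x: "x \<in> Rch K n k (\<omega> \<inter> J)" and w: "wh K \<omega> x"
  shows "wh K (\<omega> \<inter> J) x"
proof -
  obtain w0 where w0: "(w0, True) \<in> \<omega>" "dd x w0 \<le> real (K * K)" "\<And>b. (b, False) \<notin> \<omega> \<Longrightarrow> dd x w0 < dd x b"
    using w unfolding wh_def by blast
  define Wn where "Wn = {z. (z, True) \<in> \<omega> \<and> dd x z \<le> dd x w0}"
  have finW: "finite Wn" unfolding Wn_def by (rule finite_subset[OF _ finite_ball[of x "dd x w0"]]) auto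
  have "w0 \<in> Wn" using w0(1) by (simp add: Wn_def)
  then have neW: "Wn \<noteq> {}" by blast
  obtain v where v: "v \<in> Wn" "\<And>z. z \<in> Wn \<Longrightarrow> dd x v \<le> dd x z"
    using finW neW by (metis arg_min_if_finite(1) arg_min_least)
  have vW: "(v, True) \<in> \<omega>" "dd x v \<le> dd x w0" using v(1) by (auto simp: Wn_def)
  have nov: "(z, True) \<notin> \<omega>" if "dd x z < dd x v" for z
  proof
    assume "(z, True) \<in> \<omega>"
    then have "z \<in> Wn" using that vW by (auto simp: Wn_def)
    then show False using v(2)[of z] that by linarith
  qed
  have xb: "x \<in> lbox K org n" using x by (auto simp: Rch_def)
  have inJ: "(z, c) \<in> J" if "dd x z \<le> dd x v" for z c
  proof (rule ccontr)
    assume a: "(z, c) \<notin> J"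
    \<comment> \<open>A nearest cell with an unread bit would be requested next: everything strictly
      nearer has been read and contains no white point.\<close>
    define N where "N = {z. dd x z \<le> dd x v \<and> (\<exists>c. (z, c) \<notin> J)}"
    have finN: "finite N" unfolding N_def by (rule finite_subset[OF _ finite_ball[of x "dd x v"]]) auto
    have neN: "N \<noteq> {}" unfolding N_def using a that by blast
    obtain y where y: "y \<in> N" "\<And>z. z \<in> N \<Longrightarrow> dd x y \<le> dd x z"
      using finN neN by (metis arg_min_if_finite(1) arg_min_least)
    obtain e where e: "dd x y \<le> dd x v" "(y, e) \<notin> J" using y(1) by (auto simp: N_def)
    have near: "(z', c') \<in> J" if "dd x z' < dd x y" for z' c'
    proof (rule ccontr)
      assume "(z', c') \<notin> J"
      then have "z' \<in> N" using that e by (auto simp: N_def)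
      then show False using y(2)[of z'] that by linarith
    qed
    have rng: "dd x y \<le> real (K * K)" using e vW w0 by linarith
    have "needed K n k J (\<omega> \<inter> J) (y, e)"
      unfolding needed_def
    proof (intro bexI[OF _ x] conjI allI impI)
      show "dd x (fst (y, e)) \<le> real (K * K)" using rng by simp
      fix z' assume z': "dd x z' < dd x (fst (y, e))"
      then show "(z', True) \<in> J" "(z', False) \<in> J" using near by auto
      have "dd x z' < dd x v" using z' e by simp
      then show "(z', True) \<notin> \<omega> \<inter> J" using nov by blast
    qed
    moreover have "(y, e) \<in> supp K (lbox K org n) - J" using e rng xb by (auto simp: supp_def)
    ultimately show False using none unfolding expl_def by (auto split: if_splits)
  qed
  have "dd x v < dd x b" if "(b, False) \<notin> \<omega> \<inter> J" for b
  proof (rule ccontr)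
    assume "\<not> dd x v < dd x b"
    then have le: "dd x b \<le> dd x v" by simp
    then have "(b, False) \<notin> \<omega>" using inJ that by blast
    then have "dd x w0 < dd x b" by (rule w0(3))
    then show False using le vW by linarith
  qed
  moreover have "(v, True) \<in> \<omega> \<inter> J" using vW inJ[of v True] by simp
  moreover have "dd x v \<le> real (K * K)" using vW w0 by linarith
  ultimately show ?thesis unfolding wh_def by blast
qed

text \<open>A path from the unit box to distance \<open>n\<close> meets the sphere of radius
  \<open>k\<close>, so it lies in a white cluster of that sphere. The exploration follows such
  clusters completely, hence decides the arm event for every starting radius
  \<open>k\<close>.\<close>

lemma explored_det:
  assumes none: "expl K n k J (\<omega> \<inter> J) = None" and k: "1 \<le> k" "k \<le> n"
  shows "arm K (\<omega> \<inter> J) org 1 n = arm K \<omega> org 1 n"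
proof
  show "arm K (\<omega> \<inter> J) org 1 n \<Longrightarrow> arm K \<omega> org 1 n"
    using incD[OF inc_arm, of "\<omega> \<inter> J" \<omega>] by simp
  assume "arm K \<omega> org 1 n"
  then obtain x y where xy: "x \<in> lbox K org 1" "y \<in> bd K org n" "reach adj4 (WS K n \<omega>) x y"
    unfolding arm_def cn_def crs_def WS_def by blast
  have xk: "x \<in> lbox K org k" using xy(1) lbox_mono k by blast
  have yk: "y \<notin> lbox K org k \<or> y \<in> bd K org k"
  proof -
    have "int k * int K \<le> int n * int K" using k by (intro mult_right_mono) auto
    then show ?thesis using xy(2) unfolding bd_def lbox_def by fastforce
  qed
  obtain s where s: "s \<in> bd K org k" "reach adj4 (WS K n \<omega>) x s"
    using reach_to_bd[OF xy(3) xk yk] by metis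
  have key: "reach adj4 (WS K n (\<omega> \<inter> J)) s z" if "reach adj4 (WS K n \<omega>) s z" for z
    using that
  proof (induction rule: reach_induct)
    case refl
    have sW: "s \<in> WS K n \<omega>" using s(2) reach_in by blast
    then have "s \<in> Rch K n k (\<omega> \<inter> J)" using s(1) by (auto simp: Rch_def WS_def)
    then have "wh K (\<omega> \<inter> J) s" using explored_wh[OF none] sW by (auto simp: WS_def)
    then show ?case using sW by (auto simp: WS_def intro: reach_refl)
  next
    case (step y z)
    have "z \<in> Rch K n k (\<omega> \<inter> J)" using step s(1) unfolding Rch_def WS_def by blast
    then have "wh K (\<omega> \<inter> J) z" using explored_wh[OF none] step by (auto simp: WS_def)
    then have "z \<in> WS K n (\<omega> \<inter> J)" using step by (auto simp: WS_def)
    then show ?case using step by (auto intro: reach_step)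
  qed
  have "reach adj4 (WS K n (\<omega> \<inter> J)) s x" by (rule key[OF reach4_sym[OF s(2)]])
  moreover have "reach adj4 (WS K n (\<omega> \<inter> J)) s y"
    by (rule key[OF reach_trans[OF reach4_sym[OF s(2)] xy(3)]])
  ultimately have "reach adj4 (WS K n (\<omega> \<inter> J)) x y" by (meson reach4_sym reach_trans)
  then show "arm K (\<omega> \<inter> J) org 1 n" unfolding arm_def cn_def crs_def WS_def using xy by blast
qed

section \<open>Sup norm, rounding and the probability of being revealed\<close>

definition msup :: "site \<Rightarrow> int" where "msup u = max (abs (fst u)) (abs (snd u))"

lemma lbox_org: "x \<in> lbox K org n \<longleftrightarrow> msup x \<le> n * K"
  by (auto simp: lbox_def msup_def)

lemma bd_org: "x \<in> bd K org n \<longleftrightarrow> msup x = n * K"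
  by (auto simp: bd_def lbox_def msup_def)

lemma max_lipschitz: "max x y \<le> max z w + max (abs (x - z)) (abs (y - w))" for x y z w :: int
proof (rule max.boundedI)
  have "x = z + (x - z)" by simp
  also have "\<dots> \<le> max z w + max (abs (x - z)) (abs (y - w))"
    by (intro add_mono max.cobounded1 order_trans[OF abs_ge_self max.cobounded1])
  finally show "x \<le> max z w + max (abs (x - z)) (abs (y - w))" .
  have "y = w + (y - w)" by simp
  also have "\<dots> \<le> max z w + max (abs (x - z)) (abs (y - w))"
    by (intro add_mono max.cobounded2 order_trans[OF abs_ge_self max.cobounded2])
  finally show "y \<le> max z w + max (abs (x - z)) (abs (y - w))" .
qed

lemma max_abs_lipschitz: "abs (max (abs a) (abs b) - max (abs c) (abs d)) \<le> max (abs (a - c)) (abs (b - d))"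
  for a b c d :: int
proof -
  define e where "e = max (abs (abs a - abs c)) (abs (abs b - abs d))"
  have "max (abs a) (abs b) \<le> max (abs c) (abs d) + e" unfolding e_def by (rule max_lipschitz)
  moreover have "max (abs c) (abs d) \<le> max (abs a) (abs b) + e"
    unfolding e_def using max_lipschitz[of "abs c" "abs d" "abs a" "abs b"] by (simp only: abs_minus_commute)
  ultimately have "abs (max (abs a) (abs b) - max (abs c) (abs d)) \<le> e"
    by (intro abs_leI) (simp_all only: minus_diff_eq diff_le_eq add.commute)
  also have "e \<le> max (abs (a - c)) (abs (b - d))"
    unfolding e_def by (intro max.mono abs_triangle_ineq3)
  finally show ?thesis .
qed

lemma max_abs_close:
  fixes a b c d k :: int
  assumes "2 * abs (a - c) \<le> k" "2 * abs (b - d) \<le> k"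
  shows "2 * abs (max (abs a) (abs b) - max (abs c) (abs d)) \<le> k"
proof -
  have "2 * max (abs (a - c)) (abs (b - d)) \<le> k" using assms by (simp only: max_def split: if_split) simp
  moreover have "2 * abs (max (abs a) (abs b) - max (abs c) (abs d)) \<le> 2 * max (abs (a - c)) (abs (b - d))"
    by (intro mult_left_mono max_abs_lipschitz) simp
  ultimately show ?thesis by (rule order_trans[rotated])
qed

lemma msup_mcell: "K \<ge> 1 \<Longrightarrow> 2 * \<bar>msup x - K * msup (mcell K x)\<bar> \<le> K"
proof -
  assume K: "K \<ge> 1"
  have m: "int K * max (abs (a)) (abs (b)) = max (abs (int K * a)) (abs (int K * b))" for a b
    by (simp add: max_mult_distrib_left abs_mult)
  have ar: "2 * abs (max (abs a) (abs b) - max (abs c) (abs d)) \<le> k" if "2 * \<bar>a - c\<bar> \<le> k" "2 * \<bar>b - d\<bar> \<le> k" for a b c d k :: int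
    using that by (rule max_abs_close)
  show ?thesis unfolding msup_def m using mcell[OF K, of x] by (intro ar)
qed

lemma mult_abs_diff: "int K * \<bar>int k - a\<bar> = \<bar>int (k * K) - int K * a\<bar>"
proof -
  have "int (k * K) - int K * a = int K * (int k - a)" by (simp add: algebra_simps)
  then show ?thesis by (simp only: abs_mult abs_of_nat)
qed

lemma twice_mult_le: "2 * (k * a) \<le> k \<Longrightarrow> 0 < k \<Longrightarrow> a < 1" for k a :: int
proof (rule ccontr)
  assume a: "2 * (k * a) \<le> k" "0 < k" "\<not> a < 1"
  then have "k * 1 \<le> k * a" by (intro mult_left_mono) auto
  then show False using a by linarith
qed

text \<open>A reached site lies next to a white site joined to the sphere of radius
  \<open>k\<close>; seen from its macroscopic cell \<open>u\<close>, this is an arm over the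
  distance of \<open>u\<close> to the sphere. With \<open>K \<ge> 2\<close> the half unit of
  rounding and one lattice step together stay within the unit box.\<close>

lemma touch:
  assumes K: "K \<ge> 2" and x: "x \<in> Rch K n k \<omega>"
  defines "u \<equiv> mcell K x"
  defines "d \<equiv> nat \<bar>int k - msup u\<bar>"
  shows "d = 0 \<or> arm K \<omega> u 1 d" and "msup u \<le> n"
proof -
  have K1: "K \<ge> 1" using K by simp
  have mx: "2 * \<bar>msup x - K * msup u\<bar> \<le> K" unfolding u_def by (rule msup_mcell[OF K1])
  have xn: "msup x \<le> n * K" using x unfolding Rch_def lbox_org by auto
  show "msup u \<le> n"
  proof (rule ccontr)
    assume "\<not> msup u \<le> n"
    then have "int K * (int n + 1) \<le> int K * msup u" by (intro mult_left_mono) auto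
    then show False using mx xn K by (simp add: algebra_simps)
  qed
  show "d = 0 \<or> arm K \<omega> u 1 d"
  proof (cases "x \<in> bd K org k")
    case True
    then have "msup x = k * K" by (simp add: bd_org)
    then have "2 * (int K * \<bar>int k - msup u\<bar>) \<le> int K" using mx mult_abs_diff[of K k "msup u"] by simp
    then have "\<bar>int k - msup u\<bar> < 1" by (rule twice_mult_le) (use K1 in simp)
    then show ?thesis by (simp add: d_def)
  next
    case False
    then obtain s y where sy: "s \<in> bd K org k" "reach adj4 (WS K n \<omega>) s y" "adj4 y x"
      using x unfolding Rch_def by blast
    show ?thesis
    proof (cases "d = 0")
      case d: False
      have yx: "\<bar>fst y - fst x\<bar> \<le> 1" "\<bar>snd y - snd x\<bar> \<le> 1" using sy(3) unfolding adj4_def by linarith+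
      have mc: "2 * \<bar>fst x - K * fst u\<bar> \<le> K" "2 * \<bar>snd x - K * snd u\<bar> \<le> K"
        unfolding u_def using mcell[OF K1] by auto
      have ar: "\<bar>b - c\<bar> \<le> k" if "\<bar>b - a\<bar> \<le> 1" "2 * \<bar>a - c\<bar> \<le> k" "2 \<le> k" for a b c k :: int
        using that by arith
      have yb: "y \<in> lbox K u 1"
        unfolding lbox_def using ar[OF yx(1) mc(1)] ar[OF yx(2) mc(2)] K by simp
      have sk: "msup s = k * K" using sy(1) by (simp add: bd_org)
      have "int d * int K = \<bar>msup s - K * msup u\<bar>"
        unfolding d_def sk using mult_abs_diff[of K k "msup u"] by (simp add: mult.commute)
      also have "\<dots> \<le> max (abs (fst s - K * fst u)) (abs (snd s - K * snd u))"
      proof -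
        have m: "int K * max (abs (a)) (abs (b)) = max (abs (int K * a)) (abs (int K * b))" for a b
          by (simp add: max_mult_distrib_left abs_mult)
        have ar: "abs (max (abs a) (abs b) - max (abs c) (abs d)) \<le> max (abs (a - c)) (abs (b - d))" for a b c d :: int
          by (rule max_abs_lipschitz)
        show ?thesis unfolding msup_def m by (rule ar)
      qed
      finally have "s \<notin> lbox K u d \<or> s \<in> bd K u d"
        unfolding lbox_def bd_def by auto
      then show ?thesis
        using arm_of_reach[OF reach4_sym[OF sy(2)] _ yb, of \<omega> d] d by (auto simp: WS_def)
    qed simp
  qed
qed

text \<open>Each value of \<open>\<bar>int k - a\<bar>\<close> is taken by at most two radii
  \<open>k\<close>.\<close>

lemma sum_abs_diff_le:
  fixes f :: "nat \<Rightarrow> real" and a :: int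
  assumes f: "\<And>j. 0 \<le> f j" and a: "0 \<le> a" "a \<le> n"
  shows "(\<Sum>k=1..n. f (nat \<bar>int k - a\<bar>)) \<le> 2 * (\<Sum>j\<le>n. f j)"
proof -
  define b where "b = nat a"
  have ab: "a = int b" "b \<le> n" using a by (auto simp: b_def)
  let ?P = "{k\<in>{1..n}. b \<le> k}" and ?N = "{k\<in>{1..n}. k < b}"
  have "(\<Sum>k=1..n. f (nat \<bar>int k - a\<bar>)) = (\<Sum>k\<in>?P \<union> ?N. f (nat \<bar>int k - a\<bar>))"
    by (intro sum.cong) auto
  also have "\<dots> = (\<Sum>k\<in>?P. f (nat \<bar>int k - a\<bar>)) + (\<Sum>k\<in>?N. f (nat \<bar>int k - a\<bar>))"
    by (intro sum.union_disjoint) auto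
  also have "(\<Sum>k\<in>?P. f (nat \<bar>int k - a\<bar>)) = (\<Sum>j\<in>(\<lambda>k. k - b) ` ?P. f j)"
    unfolding ab by (subst sum.reindex) (auto simp: inj_on_def nat_diff_distrib intro!: sum.cong arg_cong[where f=f])
  also have "\<dots> \<le> (\<Sum>j\<le>n. f j)" using f by (intro sum_mono2) auto
  also have "(\<Sum>k\<in>?N. f (nat \<bar>int k - a\<bar>)) = (\<Sum>j\<in>(\<lambda>k. b - k) ` ?N. f j)"
    unfolding ab by (subst sum.reindex) (auto simp: inj_on_def nat_diff_distrib intro!: sum.cong arg_cong[where f=f])
  also have "\<dots> \<le> (\<Sum>j\<le>n. f j)" using f ab by (intro sum_mono2) auto
  finally show ?thesis by simp
qed

lemma dist_rounding:
  fixes x y A B k :: int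
  assumes "2 * \<bar>x - A\<bar> \<le> k" "2 * \<bar>y - B\<bar> \<le> k"
  shows "\<bar>A - B\<bar> - k \<le> \<bar>x - y\<bar>"
proof -
  have lin: "D \<le> p + e + r \<Longrightarrow> 2 * p \<le> k \<Longrightarrow> 2 * r \<le> k \<Longrightarrow> D - k \<le> e" for D p e r :: int by linarith
  have "A - B = - (x - A) + (x - y) + (y - B)" by simp
  then have "\<bar>A - B\<bar> \<le> \<bar>- (x - A)\<bar> + \<bar>x - y\<bar> + \<bar>y - B\<bar>"
    by (metis abs_triangle_ineq add_mono_thms_linordered_semiring(3) order_trans)
  then have "\<bar>A - B\<bar> \<le> \<bar>x - A\<bar> + \<bar>x - y\<bar> + \<bar>y - B\<bar>" by (simp only: abs_minus_cancel)
  then show ?thesis using assms by (rule lin)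
qed

text \<open>To read a bit over \<open>v\<close>, some cell \<open>u\<close> must have an arm to the
  sphere and a white hole reaching as far as \<open>v\<close>. Harris bounds this by a product.
  Summing the arm over the starting radii \<open>k\<close> gives \<open>2 * sumth\<close>, for every
  \<open>u\<close>; summing the hole over \<open>u\<close> gives a constant.\<close>

lemma revealment:
  fixes n m K :: nat
  assumes K: "K \<ge> 2" and q: "1/4 \<le> q" "q \<le> 1"
    and C: "\<And>s v U k. finite U \<Longrightarrow> (\<forall>u\<in>U. k \<le> sd u v) \<Longrightarrow>
     (\<Sum>u\<in>U. exp (- (1/4) * real ((sd u v - s) div 3))) \<le> C * exp (real s / 12 - real k / 24)"
  defines "I \<equiv> supp K (lbox K org n)"
  assumes i: "i \<in> I"
  shows "(\<Sum>k=1..n. bexp (pw q K) I (\<lambda>\<omega>. of_bool (i \<in> reveal (expl K n k) m {} \<omega>))) \<le> 2 * C * exp (1/6) * sumth q K n"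
proof -
  have wt: "weights (pw q K)" using q by (intro weights_pw) auto
  define U where "U = {u :: site. msup u \<le> n}"
  have finU: "finite U"
    by (rule finite_subset[of _ "{- int n..int n} \<times> {- int n..int n}"]) (auto simp: U_def msup_def)
  define v where "v = mcell K (fst (fst i))"
  \<comment> \<open>The ball containing the cube has radius \<open>3 * \<rho> + 1\<close>, and
    rounding both ends costs one further unit; hence the offset 2.\<close>
  define \<rho> where "\<rho> u = (sd u v - 2) div 3" for u
  define dk where "dk k u = nat \<bar>int k - msup u\<bar>" for k u
  define T where "T k u \<omega> \<longleftrightarrow> dk k u = 0 \<or> arm K \<omega> u 1 (dk k u)" for k u \<omega>
  have locT: "loc (T k u)" for k u unfolding T_def by (intro loc_disj loc_const loc_arm)
  have incT: "inc (T k u)" for k u unfolding T_def inc_def using incD[OF inc_arm] by blast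
  have PT: "PP q K (T k u) = th q K (dk k u)" for k u
    using prb_const[OF wt, of True] PP_arm_trans[of q K u 1 "dk k u"] unfolding T_def th_def by (cases "dk k u = 0") auto
  have K1: "K \<ge> 1" using K by simp
  have bnd: "bexp (pw q K) I (\<lambda>\<omega>. of_bool (i \<in> reveal (expl K n k) m {} \<omega>))
      \<le> (\<Sum>u\<in>U. th q K (dk k u) * exp (- (1/4) * real (\<rho> u)))" for k
  proof -
    let ?E = "\<lambda>\<omega>. \<exists>u\<in>U. T k u \<omega> \<and> noW \<omega> (cube K u (\<rho> u))"
    have sub: "?E \<omega>" if r: "i \<in> reveal (expl K n k) m {} \<omega>" for \<omega>
    proof -
      obtain x where x: "x \<in> Rch K n k \<omega>" "\<And>z. dd x z < dd x (fst i) \<Longrightarrow> (z, True) \<notin> \<omega>"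
        using revealed[OF r] by metis
      let ?u = "mcell K x"
      have t: "T k ?u \<omega>" "?u \<in> U" using touch[OF K x(1)] by (auto simp: T_def dk_def U_def)
      have "noW \<omega> (cube K ?u (\<rho> ?u))"
      proof (cases "\<rho> ?u = 0")
        case True
        then show ?thesis by (simp add: noW_def cube_def)
      next
        case False
        then have s: "3 * \<rho> ?u + 2 \<le> sd ?u v" unfolding \<rho>_def by linarith
        let ?y = "fst (fst i)"
        have ar: "k * \<bar>a - b\<bar> - k \<le> \<bar>x - y\<bar>" if "2 * \<bar>x - k * a\<bar> \<le> k" "2 * \<bar>y - k * b\<bar> \<le> k" "0 \<le> k" for a b x y k :: int
        proof -
          have "k * \<bar>a - b\<bar> = \<bar>k * a - k * b\<bar>" using that(3) by (simp add: abs_mult right_diff_distrib[symmetric])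
          then show ?thesis using dist_rounding[OF that(1,2)] by simp
        qed
        have "int K * \<bar>fst ?u - fst v\<bar> - K \<le> \<bar>fst x - fst ?y\<bar>" "int K * \<bar>snd ?u - snd v\<bar> - K \<le> \<bar>snd x - snd ?y\<bar>"
          unfolding v_def using mcell[OF K1, of x] mcell[OF K1, of ?y] by (auto intro!: ar)
        then have "real_of_int (int K * \<bar>fst ?u - fst v\<bar> - K) \<le> dd x (fst i)" "real_of_int (int K * \<bar>snd ?u - snd v\<bar> - K) \<le> dd x (fst i)"
          using dd_lb[where x=x and z="fst i"] by (meson of_int_le_iff order_trans)+
        then have "real_of_int (int K * int (sd ?u v) - K) \<le> dd x (fst i)"
          unfolding sd_def by (auto simp: max_def)
        moreover have "int ((3 * \<rho> ?u + 1) * K) \<le> int K * int (sd ?u v) - K"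
        proof -
          have "int K * int (3 * \<rho> ?u + 2) \<le> int K * int (sd ?u v)" using s by (intro mult_left_mono) auto
          then show ?thesis by (simp add: algebra_simps)
        qed
        then have "real_of_int (int ((3 * \<rho> ?u + 1) * K)) \<le> real_of_int (int K * int (sd ?u v) - K)"
          by (simp only: of_int_le_iff)
        ultimately have "real ((3 * \<rho> ?u + 1) * K) \<le> dd x (fst i)" by simp
        then show ?thesis unfolding noW_def using cube_in_ball[OF K1] x(2) by fastforce
      qed
      then show ?thesis using t by blast
    qed
    have locE: "loc ?E" using finU by (intro loc_bex loc_conj locT loc_noW) auto
    obtain J where J: "finite J" "dep J ?E" using locE by (auto simp: loc_def)
    have finI: "finite I" unfolding I_def by (simp add: finite_supp)
    have depR: "dep I (\<lambda>\<omega>. i \<in> reveal (expl K n k) m {} \<omega>)"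
      unfolding dep_def
    proof
      interpret strategy I "pw q K" "expl K n k"
        by unfold_locales (use finI wt expl_Some in \<open>auto simp: I_def\<close>)
      fix \<omega>
      have "reveal (expl K n k) m {} \<omega> \<subseteq> I" by (rule reveal_sub) simp
      then have "(\<omega> \<inter> I) \<inter> reveal (expl K n k) m {} \<omega> = \<omega> \<inter> reveal (expl K n k) m {} \<omega>" by blast
      then have "reveal (expl K n k) m {} (\<omega> \<inter> I) = reveal (expl K n k) m {} \<omega>" by (rule reveal_cong)
      then show "(i \<in> reveal (expl K n k) m {} (\<omega> \<inter> I)) = (i \<in> reveal (expl K n k) m {} \<omega>)" by simp
    qed
    have "bexp (pw q K) I (\<lambda>\<omega>. of_bool (i \<in> reveal (expl K n k) m {} \<omega>)) = PP q K (\<lambda>\<omega>. i \<in> reveal (expl K n k) m {} \<omega>)"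
      by (rule prb_eq[OF finI depR, symmetric])
    also have "\<dots> \<le> PP q K ?E"
      using depR finI by (intro prb_mono[OF wt _ locE]) (auto simp: loc_def sub)
    also have "\<dots> \<le> (\<Sum>u\<in>U. PP q K (\<lambda>\<omega>. T k u \<omega> \<and> noW \<omega> (cube K u (\<rho> u))))"
      by (intro prb_bex_le[OF wt finU] loc_conj locT loc_noW) auto
    also have "\<dots> \<le> (\<Sum>u\<in>U. th q K (dk k u) * exp (- (1/4) * real (\<rho> u)))"
    proof (intro sum_mono)
      fix u
      have lW: "loc (\<lambda>\<omega>. noW \<omega> (cube K u (\<rho> u)))" by (rule loc_noW) simp
      have "PP q K (\<lambda>\<omega>. T k u \<omega> \<and> noW \<omega> (cube K u (\<rho> u))) \<le> PP q K (T k u) * (1 - PP q K (\<lambda>\<omega>. \<not> noW \<omega> (cube K u (\<rho> u))))"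
        using prb_Harris_neg[OF wt locT loc_not[OF lW] incT inc_noW] by simp
      also have "\<dots> = th q K (dk k u) * PP q K (\<lambda>\<omega>. noW \<omega> (cube K u (\<rho> u)))"
        using prb_not[OF wt lW] by (simp add: PT)
      also have "\<dots> \<le> th q K (dk k u) * exp (- (1/4) * real (\<rho> u))"
      proof (intro mult_left_mono th_nonneg)
        have "PP q K (\<lambda>\<omega>. noW \<omega> (cube K u (\<rho> u))) \<le> exp (- q * real (\<rho> u))" using K1 q by (intro PP_noW_cube) auto
        also have "\<dots> \<le> exp (- (1/4) * real (\<rho> u))"
          using q mult_right_mono[of "1/4" q "real (\<rho> u)"] by simp
        finally show "PP q K (\<lambda>\<omega>. noW \<omega> (cube K u (\<rho> u))) \<le> exp (- (1/4) * real (\<rho> u))" .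
      qed (use q in auto)
      finally show "PP q K (\<lambda>\<omega>. T k u \<omega> \<and> noW \<omega> (cube K u (\<rho> u))) \<le> th q K (dk k u) * exp (- (1/4) * real (\<rho> u))" .
    qed
    finally show ?thesis .
  qed
  have "(\<Sum>k=1..n. bexp (pw q K) I (\<lambda>\<omega>. of_bool (i \<in> reveal (expl K n k) m {} \<omega>)))
     \<le> (\<Sum>k=1..n. \<Sum>u\<in>U. th q K (dk k u) * exp (- (1/4) * real (\<rho> u)))"
    by (intro sum_mono bnd)
  also have "\<dots> = (\<Sum>u\<in>U. (\<Sum>k=1..n. th q K (dk k u)) * exp (- (1/4) * real (\<rho> u)))"
    unfolding sum_distrib_right by (rule sum.swap)
  also have "\<dots> \<le> (\<Sum>u\<in>U. (2 * sumth q K n) * exp (- (1/4) * real (\<rho> u)))"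
    unfolding dk_def sumth_def
    using q by (intro sum_mono mult_right_mono sum_abs_diff_le th_nonneg) (auto simp: U_def msup_def)
  also have "\<dots> = (2 * sumth q K n) * (\<Sum>u\<in>U. exp (- (1/4) * real ((sd u v - 2) div 3)))"
    by (simp add: sum_distrib_left \<rho>_def)
  also have "\<dots> \<le> (2 * sumth q K n) * (C * exp (real 2 / 12 - real 0 / 24))"
    using q sumth_ge_1[of q K n] by (intro mult_left_mono C finU) auto
  finally show ?thesis by (simp add: mult_ac)
qed

section \<open>Differential inequality in the density\<close>

definition pw' :: "real \<Rightarrow> nat \<Rightarrow> coord \<Rightarrow> real" where
  "pw' q K i = (if snd i then exp (- q / real K ^ 3) / real K ^ 3 else exp (- (1 - q) / real K ^ 3) / real K ^ 3)"

lemma pw_alt: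
  "pw q K i = (if snd i then 1 - exp (- (q * (1 / real K ^ 3))) else exp (- ((1 - q) * (1 / real K ^ 3))))"
  "pw' q K i = (if snd i then exp (- (q * (1 / real K ^ 3))) * (1 / real K ^ 3)
     else exp (- ((1 - q) * (1 / real K ^ 3))) * (1 / real K ^ 3))"
proof -
  have e: "- a / c = - (a * (1 / c))" "a / c = a * (1 / c)" for a c :: real by simp_all
  show "pw q K i = (if snd i then 1 - exp (- (q * (1 / real K ^ 3))) else exp (- ((1 - q) * (1 / real K ^ 3))))"
    unfolding pw_def e(1) by (rule refl)
  show "pw' q K i = (if snd i then exp (- (q * (1 / real K ^ 3))) * (1 / real K ^ 3)
     else exp (- ((1 - q) * (1 / real K ^ 3))) * (1 / real K ^ 3))"
    unfolding pw'_def e(1) by (simp only: e(2)[of "exp _"])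
qed

lemma pw_deriv: "((\<lambda>q. pw q K i) has_real_derivative pw' q K i) (at q)"
proof -
  define l where "l = 1 / real K ^ 3"
  show ?thesis unfolding pw_alt l_def[symmetric] by (cases "snd i") (auto intro!: derivative_eq_intros)
qed

text \<open>Connects the query inequality, which carries variances, with Russo's formula, which
  carries derivatives, without loss in \<open>K\<close>: one factor of the variance is the
  exponential in the derivative, the other is at most \<open>1 / K ^ 3\<close>.\<close>

lemma pw_var_le:
  assumes "0 \<le> q" "q \<le> 1"
  shows "pw q K i * (1 - pw q K i) \<le> pw' q K i"
proof -
  define l where "l = 1 / real K ^ 3"
  have l: "0 \<le> l" by (simp add: l_def)
  have key: "exp (- (a * l)) * (1 - exp (- (a * l))) \<le> exp (- (a * l)) * l" if "0 \<le> a" "a \<le> 1" for a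
  proof (rule mult_left_mono)
    have "1 - exp (- (a * l)) \<le> a * l" using exp_ge_add_one_self[of "- (a * l)"] by simp
    also have "\<dots> \<le> 1 * l" using that l by (intro mult_right_mono) auto
    finally show "1 - exp (- (a * l)) \<le> l" by simp
  qed simp
  show ?thesis
    using key[of q] key[of "1 - q"] assms unfolding pw_alt l_def[symmetric]
    by (auto simp: mult.commute)
qed

text \<open>Averaging the query inequality over the \<open>n\<close> starting radii replaces the
  revealment by \<open>sumth / n\<close>. With Russo's formula this becomes
  \<open>n * E * (1 - E) \<le> C1 * sumth * E'\<close>, a lower bound for the logarithmic
  derivative, which is integrated from \<open>q\<close> to \<open>q'\<close>.\<close>

lemma sharpness:
  "\<exists>C>0. \<forall>K\<ge>2. \<forall>n\<ge>1. \<forall>q q'. 1/4 \<le> q \<longrightarrow> q \<le> q' \<longrightarrow> q' \<le> 1/2 \<longrightarrow> th q' K n \<le> 1/2 \<longrightarrow>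
     th q K n \<le> th q' K n * exp (- (C * (q' - q) * real n / sumth q' K n))"
proof -
  obtain C0 where C0: "C0 > 0" "\<And>s v U k. finite U \<Longrightarrow> (\<forall>u\<in>U. k \<le> sd u v) \<Longrightarrow>
     (\<Sum>u\<in>U. exp (- (1/4) * real ((sd u v - s) div 3))) \<le> C0 * exp (real s / 12 - real k / 24)"
    using hole_sum by blast
  define C1 where "C1 = 2 * C0 * exp (1/6)"
  have C1: "C1 > 0" using C0 by (simp add: C1_def)
  have "th q K n \<le> th q' K n * exp (- ((1 / (2 * C1)) * (q' - q) * real n / sumth q' K n))"
    if K: "K \<ge> 2" and n: "n \<ge> 1" and q: "1/4 \<le> q" "q \<le> q'" "q' \<le> 1/2" and half: "th q' K n \<le> 1/2" for K n q q'
  proof -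
    define I where "I = supp K (lbox K org n)"
    have finI: "finite I" unfolding I_def by (simp add: finite_supp)
    define A where "A \<omega> = arm K \<omega> org 1 n" for \<omega>
    have dA: "dep I A" unfolding dep_def A_def I_def arm_def using cn_supp by blast
    define E where "E t = bexp (pw t K) I (\<lambda>\<omega>. of_bool (A \<omega>))" for t
    have thE: "th t K n = E t" for t
      using n prb_eq[OF finI dA, of "pw t K"] unfolding th_def A_def E_def by simp
    define piv where "piv t i = bexp (pw t K) I (\<lambda>\<omega>. of_bool (A (insert i \<omega>)) - of_bool (A (\<omega> - {i})))" for t i
    define E' where "E' t = (\<Sum>i\<in>I. pw' t K i * piv t i)" for t
    have der: "(E has_real_derivative E' t) (at t)" for t
      unfolding E_def E'_def piv_def by (rule russo[OF finI]) (rule pw_deriv)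
    have incA: "inc A" unfolding A_def by (rule inc_arm)
    have main: "real n * (E t * (1 - E t)) \<le> C1 * sumth t K n * E' t" if t: "1/4 \<le> t" "t \<le> 1/2" for t
    proof -
      have wt: "weights (pw t K)" using t by (intro weights_pw) auto
      have pvn: "0 \<le> piv t i" for i
        unfolding piv_def
      proof (rule bexp_nonneg[OF wt])
        fix \<omega> show "0 \<le> (of_bool (A (insert i \<omega>)) - of_bool (A (\<omega> - {i})) :: real)"
          using incD[OF incA, of "\<omega> - {i}" "insert i \<omega>"] by auto
      qed
      let ?r = "\<lambda>k i. bexp (pw t K) I (\<lambda>\<omega>. of_bool (i \<in> reveal (expl K n k) (card I) {} \<omega>))"
      have one: "E t * (1 - E t) \<le> (\<Sum>i\<in>I. ?r k i * (pw t K i * (1 - pw t K i) * piv t i))" if k: "k \<in> {1..n}" for k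
      proof -
        interpret strategy I "pw t K" "expl K n k"
          by unfold_locales (use finI wt expl_Some in \<open>auto simp: I_def\<close>)
        show ?thesis unfolding E_def piv_def
        proof (rule osss[OF _ incA])
          fix \<omega> assume "\<omega> \<subseteq> I"
          have "expl K n k (reveal (expl K n k) (card I) {} \<omega>) (\<omega> \<inter> reveal (expl K n k) (card I) {} \<omega>) = None"
            by (rule reveal_done) auto
          then show "A (\<omega> \<inter> reveal (expl K n k) (card I) {} \<omega>) = A \<omega>"
            unfolding A_def using k by (intro explored_det) auto
        qed
      qed
      have "real n * (E t * (1 - E t)) = (\<Sum>k=1..n. E t * (1 - E t))" by simp
      also have "\<dots> \<le> (\<Sum>k=1..n. \<Sum>i\<in>I. ?r k i * (pw t K i * (1 - pw t K i) * piv t i))"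
        by (intro sum_mono one)
      also have "\<dots> = (\<Sum>i\<in>I. (\<Sum>k=1..n. ?r k i) * (pw t K i * (1 - pw t K i) * piv t i))"
        unfolding sum_distrib_right by (rule sum.swap)
      also have "\<dots> \<le> (\<Sum>i\<in>I. (C1 * sumth t K n) * (pw' t K i * piv t i))"
      proof (intro sum_mono mult_mono)
        fix i assume i: "i \<in> I"
        show "(\<Sum>k=1..n. ?r k i) \<le> C1 * sumth t K n"
          unfolding C1_def I_def using t i by (intro revealment[OF K _ _ C0(2)]) (auto simp: I_def)
        show "pw t K i * (1 - pw t K i) \<le> pw' t K i" using t by (intro pw_var_le) auto
        show "0 \<le> C1 * sumth t K n" using C1 sumth_ge_1[of t K n] t by simp
        show "0 \<le> pw t K i * (1 - pw t K i) * piv t i"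
        proof -
          have "0 \<le> pw t K i" "pw t K i \<le> 1" using wt unfolding weights_def by blast+
          then show ?thesis using pvn[of i] by (intro mult_nonneg_nonneg) auto
        qed
      qed (use pvn in \<open>auto simp: pw'_def\<close>)
      finally show ?thesis by (simp add: E'_def sum_distrib_left)
    qed
    define S where "S = sumth q' K n"
    have S: "S \<ge> 1" unfolding S_def using q by (intro sumth_ge_1) auto
    \<comment> \<open>The 2 comes from \<open>1 - E t \<ge> 1/2\<close>; using \<open>sumth\<close>
      at the upper density makes the rate constant on the interval.\<close>
    define a where "a = real n / (2 * C1 * S)"
    have Eder: "a * E t \<le> E' t" if t: "q \<le> t" "t \<le> q'" for t
    proof -
      have t': "1/4 \<le> t" "t \<le> 1/2" using t q by auto
      have Et: "0 \<le> E t" "E t \<le> 1/2" using th_nonneg[of t K n] th_mono[of t q' K n] half t t' q unfolding thE by auto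
      have st: "sumth t K n \<le> S" unfolding S_def sumth_def using t t' q by (intro sum_mono th_mono) auto
      have st1: "sumth t K n \<ge> 1" using t' by (intro sumth_ge_1) auto
      have "real n * (E t * (1/2)) \<le> real n * (E t * (1 - E t))"
        using Et by (intro mult_left_mono) auto
      also have "\<dots> \<le> C1 * sumth t K n * E' t" by (rule main[OF t'])
      finally have m: "real n * (E t * (1/2)) \<le> C1 * sumth t K n * E' t" .
      have "0 \<le> C1 * sumth t K n * E' t" using m Et by (smt (verit) mult_nonneg_nonneg of_nat_0_le_iff)
      moreover have "0 < C1 * sumth t K n" using C1 st1 by simp
      ultimately have "0 \<le> E' t" by (meson linorder_not_less mult_pos_neg)
      then have "C1 * sumth t K n * E' t \<le> C1 * S * E' t"
        using C1 st by (intro mult_right_mono mult_left_mono) auto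
      then have "real n * (E t * (1/2)) \<le> C1 * S * E' t" using m by linarith
      then show ?thesis unfolding a_def using C1 S by (simp add: field_simps)
    qed
    define g where "g t = E t * exp (- (a * t))" for t
    have "g q \<le> g q'"
    proof (rule DERIV_nonneg_imp_nondecreasing[OF q(2)])
      fix t assume t: "q \<le> t" "t \<le> q'"
      have "(g has_real_derivative (E' t * exp (- (a * t)) + E t * (exp (- (a * t)) * - a))) (at t)"
        unfolding g_def using der[of t] by (auto intro!: derivative_eq_intros)
      moreover have "E' t * exp (- (a * t)) + E t * (exp (- (a * t)) * - a) = (E' t - a * E t) * exp (- (a * t))"
        by (simp add: algebra_simps)
      moreover have "0 \<le> (E' t - a * E t) * exp (- (a * t))" using Eder[OF t] by simp
      ultimately show "\<exists>y. (g has_real_derivative y) (at t) \<and> 0 \<le> y" by metis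
    qed
    then have "E q * exp (- (a * q)) * exp (a * q) \<le> E q' * exp (- (a * q')) * exp (a * q)"
      unfolding g_def by (intro mult_right_mono) auto
    then have "E q \<le> E q' * exp (- (a * (q' - q)))"
      by (simp add: mult.assoc exp_add[symmetric] algebra_simps)
    then show ?thesis unfolding thE a_def S_def by (simp add: field_simps)
  qed
  moreover have "1 / (2 * C1) > 0" using C1 by simp
  ultimately show ?thesis by blast
qed

end

section \<open>No percolation at density one half\<close>

lemma limit_le_of_eventually:
  fixes f g :: "nat \<Rightarrow> real"
  assumes "f \<longlonglongrightarrow> a" "g \<longlonglongrightarrow> b" "\<And>n. n \<ge> N \<Longrightarrow> f n \<le> g n"
  shows "a \<le> b"
  using assms by (intro LIMSEQ_le[OF assms(1,2)]) auto

context planar_metric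
begin

abbreviation "PH \<equiv> PP (1/2)"

lemma wtH: "weights (pw (1/2) K)"
  by (rule weights_pw) auto

lemma loc_arm_Int: "loc (\<lambda>\<omega>. arm K (\<omega> \<inter> J) u m n)"
  using loc_Int[OF loc_arm[of K u m n], of J] .

lemma loc_arm_Un: "loc (\<lambda>\<omega>. arm K (\<omega> \<union> J) u m n)"
  using loc_Un[OF loc_arm[of K u m n], of J] .

lemma sd_org: "int (sd u org) = msup u"
  by (simp add: sd_def msup_def)

lemma finite_msup: "finite {u. msup u \<le> n}"
  by (rule finite_subset[of _ "{- n..n} \<times> {- n..n}"]) (auto simp: msup_def)

lemma card_msup: "card {u. msup u \<le> int n} \<le> (2 * n + 1) * (2 * n + 1)"
proof -
  have "card {u. msup u \<le> int n} \<le> card ({- int n..int n} \<times> {- int n..int n})"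
    by (intro card_mono) (auto simp: msup_def)
  also have "card {- int n..int n} = 2 * n + 1" unfolding card_atLeastAtMost_int by arith
  then have "card ({- int n..int n} \<times> {- int n..int n}) = (2 * n + 1) * (2 * n + 1)"
    by (simp only: card_cartesian_product)
  finally show ?thesis .
qed

lemma msup_triangle: "msup y \<le> msup x + max (abs (fst x - fst y)) (abs (snd x - snd y))"
  using abs_le_D2[OF max_abs_lipschitz[of "fst x" "snd x" "fst y" "snd y"]]
  unfolding msup_def by (simp only: minus_diff_eq diff_le_eq add.commute)

lemma dd_ge_max: "real_of_int (max (abs (fst x - fst (fst z))) (abs (snd x - snd (fst z)))) \<le> dd x z"
  using dd_lb[where x=x and z=z] by (simp add: max_def)

lemma mcell_msup_le:
  assumes "K \<ge> 1" "x \<in> lbox K org n"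
  shows "msup (mcell K x) \<le> n"
proof (rule ccontr)
  assume "\<not> msup (mcell K x) \<le> n"
  then have "int K * (int n + 1) \<le> int K * msup (mcell K x)" by (intro mult_left_mono) auto
  moreover have "msup x \<le> n * K" using assms(2) by (simp add: lbox_org)
  moreover have "2 * \<bar>msup x - K * msup (mcell K x)\<bar> \<le> K" by (rule msup_mcell[OF assms(1)])
  ultimately show False using assms(1) by (simp add: algebra_simps)
qed

subsection \<open>Zero-one law\<close>

text \<open>Radius \<open>M + 3 * \<rho> + 1\<close> contains the ball of radius
  \<open>3 * \<rho> + 1\<close> about each site of the box. By \<open>wh_Int_hole\<close> a
  difference forces a white hole of radius \<open>\<rho>\<close> at one of
  \<open>(2 * M + 1) ^ 2\<close> cells.\<close>

lemma arm_inner_local: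
  fixes K M m \<rho> :: nat
  assumes K: "K \<ge> 1"
  defines "J \<equiv> {i :: coord. fst (fst i) \<in> lbox K org (M + 3 * \<rho> + 1)}"
  shows "PH K (\<lambda>\<omega>. arm K \<omega> org m M) - real ((2 * M + 1) * (2 * M + 1)) * exp (- (1/2) * real \<rho>)
    \<le> PH K (\<lambda>\<omega>. arm K (\<omega> \<inter> J) org m M)"
proof -
  let ?U = "{u. msup u \<le> int M}"
  let ?H = "\<lambda>\<omega>. \<exists>u\<in>?U. noW \<omega> (cube K u \<rho>)"
  have sub: "?H \<omega>" if a: "arm K \<omega> org m M" "\<not> arm K (\<omega> \<inter> J) org m M" for \<omega>
  proof -
    have "{x \<in> lbox K org M. wh K \<omega> x} \<noteq> {x \<in> lbox K org M. wh K (\<omega> \<inter> J) x}"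
      using a unfolding arm_def cn_def by metis
    moreover have "{x \<in> lbox K org M. wh K (\<omega> \<inter> J) x} \<subseteq> {x \<in> lbox K org M. wh K \<omega> x}"
      using wh_mono[of K "\<omega> \<inter> J" _ \<omega>] by blast
    ultimately obtain x where x: "x \<in> lbox K org M" "wh K \<omega> x" "\<not> wh K (\<omega> \<inter> J) x" by blast
    have inJ: "(z, c) \<in> J" if "dd x z < real ((3 * \<rho> + 1) * K)" for z c
    proof -
      have "real_of_int (max (abs (fst x - fst (fst z))) (abs (snd x - snd (fst z)))) < real_of_int (int ((3 * \<rho> + 1) * K))"
        using dd_ge_max[of x z] that by simp
      then have "max (abs (fst x - fst (fst z))) (abs (snd x - snd (fst z))) < int ((3 * \<rho> + 1) * K)"
        by (simp only: of_int_less_iff)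
      moreover have "msup x \<le> int (M * K)" using x(1) by (simp add: lbox_org)
      ultimately have "msup (fst z) \<le> int (M * K) + int ((3 * \<rho> + 1) * K)"
        using msup_triangle[of "fst z" x] by linarith
      also have "\<dots> = int ((M + 3 * \<rho> + 1) * K)" by (simp add: algebra_simps)
      finally show ?thesis unfolding J_def by (simp add: lbox_org)
    qed
    have "noW \<omega> (cube K (mcell K x) \<rho>)"
      unfolding noW_def using wh_Int_hole[OF x(2,3) inJ] cube_in_ball[OF K] by blast
    moreover have "mcell K x \<in> ?U" using mcell_msup_le[OF K x(1)] by simp
    ultimately show ?thesis by blast
  qed
  have locH: "loc ?H" by (intro loc_bex loc_noW finite_msup) auto
  have "PH K (\<lambda>\<omega>. arm K \<omega> org m M) - PH K (\<lambda>\<omega>. arm K (\<omega> \<inter> J) org m M)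
     \<le> PH K (\<lambda>\<omega>. arm K \<omega> org m M \<and> \<not> arm K (\<omega> \<inter> J) org m M)"
    by (intro prb_diff_le wtH loc_arm loc_arm_Int)
  also have "\<dots> \<le> PH K ?H"
    by (intro prb_mono[OF wtH _ locH] loc_conj loc_not loc_arm loc_arm_Int) (use sub in blast)
  also have "\<dots> \<le> (\<Sum>u\<in>?U. exp (- (1/2) * real \<rho>))"
    using K finite_msup by (intro PP_bex_noW[of _ K "1/2" "\<lambda>_. \<rho>"]) auto
  also have "\<dots> = real (card ?U) * exp (- (1/2) * real \<rho>)" by simp
  also have "\<dots> \<le> real ((2 * M + 1) * (2 * M + 1)) * exp (- (1/2) * real \<rho>)"
    using card_msup[of M] by (intro mult_right_mono) (simp_all only: of_nat_le_iff exp_ge_zero)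
  finally show ?thesis by simp
qed

text \<open>Making the inner box as favourable to white as possible helps an arm outside radius
  \<open>M\<close> only through a black hole reaching from the site back to radius \<open>N\<close>,
  whose probability is summable.\<close>

lemma arm_outer_local:
  assumes K: "K \<ge> 1" and M: "N < M" "M < n"
    and C: "\<And>s v U k. finite U \<Longrightarrow> (\<forall>u\<in>U. k \<le> sd u v) \<Longrightarrow>
     (\<Sum>u\<in>U. exp (- (1/4) * real ((sd u v - s) div 3))) \<le> C * exp (real s / 12 - real k / 24)"
  defines "J \<equiv> {i :: coord. fst (fst i) \<in> lbox K org N}"
  shows "PH K (\<lambda>\<omega>. arm K (\<omega> \<union> J) org M n)
    \<le> PH K (\<lambda>\<omega>. arm K \<omega> org (M + 1) n) + C * exp (real (N + 2) / 12 - real M / 24)"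
proof -
  let ?U = "{u. msup u \<le> int n \<and> int M \<le> msup u}"
  define \<rho> where "\<rho> u = (sd u org - (N + 2)) div 3" for u
  let ?H = "\<lambda>\<omega>. \<exists>u\<in>?U. noB \<omega> (cube K u (\<rho> u))"
  have finU: "finite ?U" by (rule finite_subset[OF _ finite_msup[of "int n"]]) auto
  have sub: "?H \<omega>" if a: "arm K (\<omega> \<union> J) org M n" "\<not> arm K \<omega> org (M + 1) n" for \<omega>
  proof -
    define S where "S = {x \<in> lbox K org n. wh K (\<omega> \<union> J) x}"
    obtain x0 y where xy: "x0 \<in> lbox K org M" "y \<in> bd K org n" "reach adj4 S x0 y"
      using a(1) unfolding arm_def cn_def crs_def S_def by blast
    have MK: "int M * int K < int n * int K" using M K by (intro mult_strict_right_mono) auto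
    have yM: "y \<in> - lbox K org M" using xy(2) MK unfolding Compl_iff lbox_org bd_org by simp
    have x0M: "x0 \<notin> - lbox K org M" using xy(1) by simp
    \<comment> \<open>Follow the path inwards from its outer end and stop before it enters the box
      of radius \<open>M\<close>; the part outside may have been white all along, and it starts
      within one lattice step of the box, hence radius \<open>M + 1\<close> in the
      conclusion.\<close>
    obtain v w where vw: "reach adj4 (S \<inter> - lbox K org M) y v" "w \<in> S - - lbox K org M" "adj4 v w"
      using reach_exit[OF reach4_sym[OF xy(3)] yM x0M] by metis
    have "msup w \<le> int M * int K" using vw(2) by (simp add: lbox_org)
    moreover have "max (abs (fst w - fst v)) (abs (snd w - snd v)) \<le> 1"
      using vw(3) unfolding adj4_def by arith
    ultimately have "msup v \<le> int M * int K + 1" using msup_triangle[of v w] by linarith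
    then have vM: "v \<in> lbox K org (M + 1)" unfolding lbox_org using K by (simp add: algebra_simps)
    have "\<exists>x\<in>S \<inter> - lbox K org M. \<not> wh K \<omega> x"
    proof (rule ccontr)
      assume "\<not> ?thesis"
      then have "S \<inter> - lbox K org M \<subseteq> {x \<in> lbox K org n. wh K \<omega> x}" unfolding S_def by blast
      then have "reach adj4 {x \<in> lbox K org n. wh K \<omega> x} v y" using reach_mono[OF reach4_sym[OF vw(1)]] by blast
      then have "arm K \<omega> org (M + 1) n" unfolding arm_def cn_def crs_def using vM xy(2) by blast
      then show False using a(2) by simp
    qed
    then obtain x where x: "x \<in> S" "x \<notin> lbox K org M" "\<not> wh K \<omega> x" by blast
    have xw: "wh K (\<omega> \<union> J) x" and xn: "x \<in> lbox K org n" using x(1) by (auto simp: S_def)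
    let ?u = "mcell K x"
    have mu: "2 * \<bar>msup x - K * msup ?u\<bar> \<le> K" by (rule msup_mcell[OF K])
    have un: "msup ?u \<le> int n" by (rule mcell_msup_le[OF K xn])
    have uM: "int M \<le> msup ?u"
    proof (rule ccontr)
      assume "\<not> int M \<le> msup ?u"
      then have "int K * (msup ?u + 1) \<le> int K * int M" by (intro mult_left_mono) auto
      moreover have "int K * int M < msup x" using x(2) by (simp add: lbox_org mult.commute)
      ultimately show False using mu K by (simp add: algebra_simps)
    qed
    have "noB \<omega> (cube K ?u (\<rho> ?u))"
    proof (cases "\<rho> ?u = 0")
      case True
      then show ?thesis by (simp add: noB_def cube_def)
    next
      case False
      then have s: "3 * \<rho> ?u + 2 + N \<le> sd ?u org" unfolding \<rho>_def by linarith
      have outJ: "(z, c) \<in> - J" if z: "dd x z < real ((3 * \<rho> ?u + 1) * K)" for z c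
      proof
        assume "(z, c) \<in> J"
        then have zN: "msup (fst z) \<le> int N * int K" by (simp add: J_def lbox_org)
        have "real_of_int (max (abs (fst x - fst (fst z))) (abs (snd x - snd (fst z)))) < real_of_int (int ((3 * \<rho> ?u + 1) * K))"
          using dd_ge_max[of x z] z by simp
        then have "max (abs (fst x - fst (fst z))) (abs (snd x - snd (fst z))) < int ((3 * \<rho> ?u + 1) * K)"
          by (simp only: of_int_less_iff)
        then have "msup x < int N * int K + int ((3 * \<rho> ?u + 1) * K)"
          using msup_triangle[of x "fst z"] zN
          unfolding abs_minus_commute[of "fst (fst z)"] abs_minus_commute[of "snd (fst z)"] by linarith
        moreover have "int K * int (3 * \<rho> ?u + 2 + N) \<le> int K * msup ?u"
          using s sd_org[of ?u] by (intro mult_left_mono) auto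
        ultimately show False using mu K by (simp add: algebra_simps)
      qed
      have w': "wh K (\<omega> \<union> - (- J)) x" using xw by simp
      show ?thesis
        unfolding noB_def using wh_Un_hole[OF w' x(3) outJ] cube_in_ball[OF K] by blast
    qed
    then show ?thesis using un uM by blast
  qed
  have locH: "loc ?H" by (intro loc_bex loc_noB finU) auto
  have "PH K (\<lambda>\<omega>. arm K (\<omega> \<union> J) org M n) - PH K (\<lambda>\<omega>. arm K \<omega> org (M + 1) n)
     \<le> PH K (\<lambda>\<omega>. arm K (\<omega> \<union> J) org M n \<and> \<not> arm K \<omega> org (M + 1) n)"
    by (intro prb_diff_le wtH loc_arm loc_arm_Un)
  also have "\<dots> \<le> PH K ?H"
    by (intro prb_mono[OF wtH _ locH] loc_conj loc_not loc_arm loc_arm_Un) (use sub in blast)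
  also have "\<dots> \<le> (\<Sum>u\<in>?U. exp (- (1 - 1/2) * real (\<rho> u)))"
    using K finU by (intro PP_bex_noB) auto
  also have "\<dots> \<le> (\<Sum>u\<in>?U. exp (- (1/4) * real ((sd u org - (N + 2)) div 3)))"
    unfolding \<rho>_def by (intro sum_mono) simp
  also have "\<dots> \<le> C * exp (real (N + 2) / 12 - real M / 24)"
    using finU sd_org by (intro C) (auto simp flip: of_nat_le_iff[where 'a=int])
  finally show ?thesis by simp
qed

text \<open>The localised arm to \<open>M\<close> and the absence of a localised arm from
  \<open>4 * N\<close> use disjoint bits, and together they stop the cluster between
  \<open>M\<close> and \<open>n\<close>. If arms do not decay, the right side is small for suitable
  \<open>M\<close>, so large boxes reach far with probability near one. The factor 4 turns the hole
  error into \<open>exp (1/6 - real N / 12)\<close>.\<close>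

lemma arm_zero_one:
  assumes K: "K \<ge> 1" and n: "4 * (M + 3 * \<rho> + 1) < n"
    and C: "\<And>s v U k. finite U \<Longrightarrow> (\<forall>u\<in>U. k \<le> sd u v) \<Longrightarrow>
     (\<Sum>u\<in>U. exp (- (1/4) * real ((sd u v - s) div 3))) \<le> C * exp (real s / 12 - real k / 24)"
    and M: "1 \<le> M"
  defines "N \<equiv> M + 3 * \<rho> + 1"
  defines "e1 \<equiv> real ((2 * M + 1) * (2 * M + 1)) * exp (- (1/2) * real \<rho>)"
  assumes pos: "e1 \<le> PH K (\<lambda>\<omega>. arm K \<omega> org 1 M)"
  shows "(PH K (\<lambda>\<omega>. arm K \<omega> org 1 M) - e1)
     * (1 - PH K (\<lambda>\<omega>. arm K \<omega> org (4 * N + 1) n) - C * exp (1/6 - real N / 12))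
    \<le> PH K (\<lambda>\<omega>. arm K \<omega> org 1 M) - PH K (\<lambda>\<omega>. arm K \<omega> org 1 n)"
proof -
  define J where "J = {i :: coord. fst (fst i) \<in> lbox K org N}"
  let ?C = "\<lambda>\<omega>. arm K (\<omega> \<inter> J) org 1 M" and ?T = "\<lambda>\<omega>. arm K (\<omega> \<union> J) org (4 * N) n"
  have c: "PH K (\<lambda>\<omega>. arm K \<omega> org 1 M) - e1 \<le> PH K ?C"
    unfolding e1_def J_def N_def by (rule arm_inner_local[OF K])
  have t: "PH K ?T \<le> PH K (\<lambda>\<omega>. arm K \<omega> org (4 * N + 1) n) + C * exp (1/6 - real N / 12)"
  proof -
    have "PH K ?T \<le> PH K (\<lambda>\<omega>. arm K \<omega> org (4 * N + 1) n) + C * exp (real (N + 2) / 12 - real (4 * N) / 24)"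
      unfolding J_def by (rule arm_outer_local[OF K _ _ C]) (use n in \<open>auto simp: N_def\<close>)
    moreover have "real (N + 2) / 12 - real (4 * N) / 24 = 1/6 - real N / 12" by (simp add: field_simps)
    ultimately show ?thesis by simp
  qed
  have dC: "dep J ?C" by (simp add: dep_def Int_assoc)
  have dT: "dep (- J) (\<lambda>\<omega>. \<not> ?T \<omega>)"
  proof -
    have "\<omega> \<inter> - J \<union> J = \<omega> \<union> J" for \<omega> by blast
    then show ?thesis by (simp add: dep_def)
  qed
  have "PH K ?C * (1 - PH K ?T) = PH K (\<lambda>\<omega>. ?C \<omega> \<and> \<not> ?T \<omega>)"
    using prb_indep[OF wtH loc_arm_Int loc_not[OF loc_arm_Un] dC dT] prb_not[OF wtH loc_arm_Un] by simp
  also have "\<dots> \<le> PH K (\<lambda>\<omega>. arm K \<omega> org 1 M \<and> \<not> arm K \<omega> org 1 n)"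
  proof (intro prb_mono[OF wtH] loc_conj loc_not loc_arm loc_arm_Int loc_arm_Un)
    fix \<omega> assume a: "?C \<omega> \<and> \<not> ?T \<omega>"
    have "arm K \<omega> org 1 M" using a incD[OF inc_arm, of "\<omega> \<inter> J" \<omega>] by auto
    moreover have "\<not> arm K \<omega> org 1 n"
    proof
      assume "arm K \<omega> org 1 n"
      then have "arm K \<omega> org (4 * N) n" by (rule arm_mono_inner) (simp add: N_def)
      then have "?T \<omega>" by (rule incD[OF inc_arm, rotated]) simp
      then show False using a by simp
    qed
    ultimately show "arm K \<omega> org 1 M \<and> \<not> arm K \<omega> org 1 n" by simp
  qed
  also have "\<dots> = PH K (\<lambda>\<omega>. arm K \<omega> org 1 M) - PH K (\<lambda>\<omega>. arm K \<omega> org 1 n)"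
    using n M by (intro prb_diff_eq[OF wtH] loc_arm) (auto intro: arm_antimono)
  finally have main: "PH K ?C * (1 - PH K ?T) \<le> PH K (\<lambda>\<omega>. arm K \<omega> org 1 M) - PH K (\<lambda>\<omega>. arm K \<omega> org 1 n)" .
  have T1: "PH K ?T \<le> 1" by (rule prb_le_1[OF wtH loc_arm_Un])
  have "(PH K (\<lambda>\<omega>. arm K \<omega> org 1 M) - e1)
     * (1 - PH K (\<lambda>\<omega>. arm K \<omega> org (4 * N + 1) n) - C * exp (1/6 - real N / 12))
    \<le> (PH K (\<lambda>\<omega>. arm K \<omega> org 1 M) - e1) * (1 - PH K ?T)"
    using pos t by (intro mult_left_mono) auto
  also have "\<dots> \<le> PH K ?C * (1 - PH K ?T)" using c T1 by (intro mult_right_mono) auto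
  finally show ?thesis using main by linarith
qed

subsection \<open>The eight boundary segments\<close>

text \<open>The eight symmetries of the square, coded by two reflections applied after an optional
  exchange of the axes.\<close>

definition g8 :: "bool \<times> bool \<times> bool \<Rightarrow> site \<Rightarrow> site" where
  "g8 i x = (let p = if snd (snd i) then snd x else fst x; q = if snd (snd i) then fst x else snd x
     in (if fst i then - p else p, if fst (snd i) then - q else q))"

lemma isom_comp:
  assumes "isom f" "isom g"
  shows "isom (\<lambda>x. f (g x))"
proof -
  have f: "\<And>u v. adj4 (f u) (f v) = adj4 u v" "\<And>x y t. dd (f x) (f y, t) = dd x (y, t)" "bij f"
    using assms(1) unfolding isom_def by blast+
  have g: "\<And>u v. adj4 (g u) (g v) = adj4 u v" "\<And>x y t. dd (g x) (g y, t) = dd x (y, t)" "bij g"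
    using assms(2) unfolding isom_def by blast+
  have "bij (\<lambda>x. f (g x))" using bij_comp[OF g(3) f(3)] by (simp add: comp_def)
  then show ?thesis unfolding isom_def f(1,2) g(1,2) by blast
qed

lemma isom_id: "isom (\<lambda>x. x)"
  using bij_id[unfolded id_def] by (simp add: isom_def)

lemma isom_g8: "isom (g8 i)"
proof -
  let ?s = "\<lambda>x :: site. if snd (snd i) then (snd x, fst x) else x"
  let ?a = "\<lambda>x :: site. if fst i then (- fst x, snd x) else x"
  let ?b = "\<lambda>x :: site. if fst (snd i) then (fst x, - snd x) else x"
  have s: "isom ?s" using isom_swap isom_id by (cases "snd (snd i)") auto
  have a: "isom ?a" using isom_neg1 isom_id by (cases "fst i") auto
  have b: "isom ?b" using isom_neg2 isom_id by (cases "fst (snd i)") auto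
  have "g8 i = (\<lambda>x. ?a (?b (?s x)))" by (auto simp: g8_def fun_eq_iff Let_def)
  moreover have "isom (\<lambda>x. ?a (?b (?s x)))" by (rule isom_comp[OF a isom_comp[OF b s]])
  ultimately show ?thesis by simp
qed

lemma msup_g8: "msup (g8 i x) = msup x"
  by (simp add: msup_def g8_def Let_def max.commute)

definition gs :: "nat \<Rightarrow> site \<Rightarrow> bool \<times> bool \<times> bool \<Rightarrow> site \<Rightarrow> site" where
  "gs K u i x = (fst (g8 i x) + K * fst u, snd (g8 i x) + K * snd u)"

lemma isom_gs: "isom (gs K u i)"
  unfolding gs_def by (rule isom_comp[OF isom_trans isom_g8])

lemma lbox_shift: "x \<in> lbox K u n \<longleftrightarrow> msup (fst x - K * fst u, snd x - K * snd u) \<le> n * K"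
  by (auto simp: lbox_def msup_def)

lemma gs_lbox: "gs K u i ` lbox K org n = lbox K u n"
proof (intro equalityI subsetI)
  fix y assume y: "y \<in> lbox K u n"
  obtain x where x: "gs K u i x = y"
    using isom_gs[of K u i] unfolding isom_def by (metis bij_is_surj surjD)
  have "msup x = msup (g8 i x)" by (simp add: msup_g8)
  also have "g8 i x = (fst y - K * fst u, snd y - K * snd u)" using x by (auto simp: gs_def)
  finally have "x \<in> lbox K org n" using y unfolding lbox_org lbox_shift by simp
  then show "y \<in> gs K u i ` lbox K org n" using x by blast
next
  fix y assume "y \<in> gs K u i ` lbox K org n"
  then obtain x where "x \<in> lbox K org n" "y = gs K u i x" by blast
  then show "y \<in> lbox K u n" unfolding lbox_org lbox_shift by (simp add: gs_def msup_g8)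
qed

text \<open>The right side above height \<open>\<alpha>\<close>. Its images under \<open>g8\<close>
  cover the boundary of the box except for a window of radius \<open>\<alpha>\<close> around the
  middle of each side; the corner is cut off by the box itself.\<close>

definition RU :: "nat \<Rightarrow> nat \<Rightarrow> nat \<Rightarrow> site set" where
  "RU K n \<alpha> = {x. fst x = int n * int K \<and> int \<alpha> * int K \<le> snd x}"

definition sarm :: "nat \<Rightarrow> coord set \<Rightarrow> site \<Rightarrow> bool \<times> bool \<times> bool \<Rightarrow> nat \<Rightarrow> nat \<Rightarrow> nat \<Rightarrow> bool" where
  "sarm K \<omega> u i m \<alpha> n \<longleftrightarrow> cn K \<omega> (lbox K u n) (lbox K u m) (gs K u i ` RU K n \<alpha>)"

lemma loc_sarm: "loc (\<lambda>\<omega>. sarm K \<omega> u i m \<alpha> n)"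
  unfolding sarm_def by (rule loc_cn) simp

lemma inc_sarm: "inc (\<lambda>\<omega>. sarm K \<omega> u i m \<alpha> n)"
  unfolding sarm_def by (rule inc_cn)

definition UU :: "nat \<Rightarrow> nat \<Rightarrow> nat \<Rightarrow> nat \<Rightarrow> real" where
  "UU K m \<alpha> n = PH K (\<lambda>\<omega>. cn K \<omega> (lbox K org n) (lbox K org m) (RU K n \<alpha>))"

lemma PH_sarm: "PH K (\<lambda>\<omega>. sarm K \<omega> u i m \<alpha> n) = UU K m \<alpha> n"
  using PP_isom[OF isom_gs[of K u i], of "lbox K org n" "1/2" K "lbox K org m" "RU K n \<alpha>"]
  unfolding sarm_def UU_def gs_lbox by simp

subsection \<open>Filling and killing\<close>

lemma fill_upper:
  assumes "x \<in> lbox K u m" "b \<in> cube K u 1"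
  shows "dd x b < real ((2 * m + 3) * K)"
proof -
  define A where "A = int m * int K"
  have x: "\<bar>fst x - K * fst u\<bar> \<le> A" "\<bar>snd x - K * snd u\<bar> \<le> A" using assms(1) by (auto simp: lbox_def A_def)
  have b: "\<bar>fst (fst b) - K * fst u\<bar> < int K" "\<bar>snd (fst b) - K * snd u\<bar> < int K" "snd b < K"
    using assms(2) unfolding cube_iff by auto
  have ar: "\<bar>p - c\<bar> \<le> A \<Longrightarrow> \<bar>q - c\<bar> < k \<Longrightarrow> \<bar>p - q\<bar> < A + k" for p q c k :: int by arith
  have "\<bar>fst x - fst (fst b)\<bar> < A + K" "\<bar>snd x - snd (fst b)\<bar> < A + K"
    using ar[OF x(1) b(1)] ar[OF x(2) b(2)] by auto
  moreover have b3: "int (snd b) < int K" using b(3) by simp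
  moreover have lin: "p < A + k \<Longrightarrow> q < A + k \<Longrightarrow> t < k \<Longrightarrow> p + q + t < 2 * A + 3 * k" for p q t k :: int by linarith
  ultimately have s: "\<bar>fst x - fst (fst b)\<bar> + \<bar>snd x - snd (fst b)\<bar> + int (snd b) < 2 * A + 3 * int K"
    by (intro lin)
  have e: "2 * A + 3 * int K = int ((2 * m + 3) * K)" by (simp add: A_def algebra_simps)
  have "real_of_int (\<bar>fst x - fst (fst b)\<bar> + \<bar>snd x - snd (fst b)\<bar> + int (snd b)) < real_of_int (int ((2 * m + 3) * K))"
    using s unfolding e by (simp only: of_int_less_iff)
  then show ?thesis using dd_ub[of x b] by simp
qed

text \<open>From a site of the box the cells of the unit cube are nearer than
  \<open>(m + 1) + (m + 1) + 1 = 2 * m + 3\<close> in the sum norm. A cell outside radius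
  \<open>3 * m + 3\<close> is at least \<open>2 * m + 3\<close> away in the sup norm. So one point
  in the middle decides the colour of the whole box if the other colour is absent from the large
  cube.\<close>

lemma fill:
  assumes "x \<in> lbox K u m" "b \<in> cube K u 1" "w \<notin> cube K u (3 * m + 3)"
  shows "dd x b < dd x w"
proof -
  define A where "A = int m * int K"
  have x: "\<bar>fst x - K * fst u\<bar> \<le> A" "\<bar>snd x - K * snd u\<bar> \<le> A" using assms(1) by (auto simp: lbox_def A_def)
  define k where "k = int ((2 * m + 3) * K)"
  have "int ((3 * m + 3) * K) \<le> \<bar>fst (fst w) - K * fst u\<bar> \<or> int ((3 * m + 3) * K) \<le> \<bar>snd (fst w) - K * snd u\<bar> \<or> int ((3 * m + 3) * K) \<le> int (snd w)"
    using assms(3) unfolding cube_iff de_Morgan_conj not_less of_nat_le_iff .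
  moreover have e3: "int ((3 * m + 3) * K) = A + k" by (simp add: A_def k_def algebra_simps)
  ultimately have d: "A + k \<le> \<bar>fst (fst w) - K * fst u\<bar> \<or> A + k \<le> \<bar>snd (fst w) - K * snd u\<bar> \<or> A + k \<le> int (snd w)"
    by (simp only:)
  have ar2: "\<bar>p - c\<bar> \<le> A \<Longrightarrow> A + k \<le> \<bar>q - c\<bar> \<Longrightarrow> k \<le> \<bar>p - q\<bar>" for p q c :: int by arith
  have "0 \<le> A" by (simp add: A_def)
  then have "k \<le> \<bar>fst x - fst (fst w)\<bar> \<or> k \<le> \<bar>snd x - snd (fst w)\<bar> \<or> k \<le> int (snd w)"
    using d ar2[OF x(1)] ar2[OF x(2)] by (elim disjE) auto
  then have "int ((2 * m + 3) * K) \<le> \<bar>fst x - fst (fst w)\<bar> \<or> int ((2 * m + 3) * K) \<le> \<bar>snd x - snd (fst w)\<bar> \<or> int ((2 * m + 3) * K) \<le> int (snd w)"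
    by (simp only: k_def)
  then have "real_of_int (int ((2 * m + 3) * K)) \<le> dd x w"
  proof (elim disjE)
    assume "int ((2 * m + 3) * K) \<le> \<bar>fst x - fst (fst w)\<bar>"
    then have "real_of_int (int ((2 * m + 3) * K)) \<le> real_of_int \<bar>fst x - fst (fst w)\<bar>" by (simp only: of_int_le_iff)
    then show ?thesis using dd_lb(1)[where x=x and z=w] by linarith
  next
    assume "int ((2 * m + 3) * K) \<le> \<bar>snd x - snd (fst w)\<bar>"
    then have "real_of_int (int ((2 * m + 3) * K)) \<le> real_of_int \<bar>snd x - snd (fst w)\<bar>" by (simp only: of_int_le_iff)
    then show ?thesis using dd_lb(2)[where x=x and z=w] by linarith
  next
    assume "int ((2 * m + 3) * K) \<le> int (snd w)"
    then have "real_of_int (int ((2 * m + 3) * K)) \<le> real_of_int (int (snd w))" by (simp only: of_int_le_iff)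
    then show ?thesis using dd_lb(3)[where x=x and z=w] by simp
  qed
  then show ?thesis using fill_upper[OF assms(1,2)] by simp
qed

text \<open>Local event that paints the box of radius \<open>m\<close> white, see
  \<open>fillW_wh\<close>; its probability is bounded below uniformly in \<open>K\<close>.\<close>

definition fillW :: "nat \<Rightarrow> nat \<Rightarrow> site \<Rightarrow> coord set \<Rightarrow> bool" where
  "fillW K m u \<omega> \<longleftrightarrow> \<not> noW \<omega> (cube K u 1) \<and> noB \<omega> (cube K u (3 * m + 3))"

lemma fillW_wh:
  assumes "fillW K m u \<omega>" "x \<in> lbox K u m" "2 * m + 3 \<le> K"
  shows "wh K \<omega> x"
proof -
  obtain w where w: "w \<in> cube K u 1" "(w, True) \<in> \<omega>" using assms(1) by (auto simp: fillW_def noW_def)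
  have "dd x w < dd x b" if "(b, False) \<notin> \<omega>" for b
  proof -
    have "b \<notin> cube K u (3 * m + 3)" using assms(1) that by (auto simp: fillW_def noB_def)
    then show ?thesis by (rule fill[OF assms(2) w(1)])
  qed
  moreover have "dd x w \<le> real (K * K)"
  proof -
    have "(2 * m + 3) * K \<le> K * K" using assms(3) by (rule mult_le_mono1)
    then have "real ((2 * m + 3) * K) \<le> real (K * K)" by (simp only: of_nat_le_iff)
    then show ?thesis using fill_upper[OF assms(2) w(1)] by linarith
  qed
  ultimately show ?thesis unfolding wh_def using w(2) by blast
qed

lemma kill_not_wh:
  assumes "noW \<omega> (cube K u (3 * m + 3))" "\<not> noB \<omega> (cube K u 1)" "x \<in> lbox K u m"
  shows "\<not> wh K \<omega> x"
proof
  assume "wh K \<omega> x"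
  then obtain w where w: "(w, True) \<in> \<omega>" "\<And>b. (b, False) \<notin> \<omega> \<Longrightarrow> dd x w < dd x b" unfolding wh_def by blast
  obtain b where b: "b \<in> cube K u 1" "(b, False) \<notin> \<omega>" using assms(2) by (auto simp: noB_def)
  have "w \<notin> cube K u (3 * m + 3)" using assms(1) w(1) by (auto simp: noW_def)
  then have "dd x b < dd x w" by (rule fill[OF assms(3) b(1)])
  then show False using w(2)[OF b(2)] by linarith
qed

end

section \<open>Closing the windows between the boundary segments\<close>

context planar_metric
begin

definition win :: "nat \<Rightarrow> site set" where
  "win n = {(int n, 0), (- int n, 0), (0, int n), (0, - int n)}"

lemma finite_win: "finite (win n)"
  by (simp add: win_def)

lemma msup_win: "v \<in> win n \<Longrightarrow> msup v = int n"
  by (auto simp: win_def msup_def)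

lemma gs_org: "gs K org i = g8 i"
  by (simp add: gs_def fun_eq_iff)

lemma bd_segments:
  assumes "y \<in> bd K org n"
  shows "(\<exists>i. y \<in> gs K org i ` RU K n \<alpha>) \<or> (\<exists>v\<in>win n. y \<in> lbox K v \<alpha>)"
proof -
  have y: "msup y = int n * int K" using assms by (simp add: bd_org)
  then consider "\<bar>fst y\<bar> = int n * int K" | "\<bar>snd y\<bar> = int n * int K" by (auto simp: msup_def max_def split: if_splits)
  then show ?thesis
  proof cases
    case 1
    show ?thesis
    proof (cases "int \<alpha> * int K \<le> \<bar>snd y\<bar>")
      case True
      have "y = g8 (fst y < 0, snd y < 0, False) (\<bar>fst y\<bar>, \<bar>snd y\<bar>)"
        by (simp add: g8_def prod_eq_iff abs_if)
      then show ?thesis using 1 True unfolding gs_org RU_def by (intro disjI1 exI) (rule image_eqI, assumption, simp)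
    next
      case False
      have "y \<in> lbox K (if fst y < 0 then - int n else int n, 0) \<alpha>"
        unfolding lbox_def using 1 False by (auto simp: abs_if mult.commute split: if_splits)
      then show ?thesis unfolding win_def by (cases "fst y < 0") auto
    qed
  next
    case 2
    show ?thesis
    proof (cases "int \<alpha> * int K \<le> \<bar>fst y\<bar>")
      case True
      have "y = g8 (fst y < 0, snd y < 0, True) (\<bar>snd y\<bar>, \<bar>fst y\<bar>)"
        by (simp add: g8_def prod_eq_iff abs_if)
      then show ?thesis using 2 True unfolding gs_org RU_def by (intro disjI1 exI) (rule image_eqI, assumption, simp)
    next
      case False
      have "y \<in> lbox K (0, if snd y < 0 then - int n else int n) \<alpha>"
        unfolding lbox_def using 2 False by (auto simp: abs_if mult.commute split: if_splits)
      then show ?thesis unfolding win_def by (cases "snd y < 0") auto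
    qed
  qed
qed

lemma cube_mono: "\<rho> \<le> \<rho>' \<Longrightarrow> cube K u \<rho> \<subseteq> cube K u \<rho>'"
proof
  fix z assume r: "\<rho> \<le> \<rho>'" and z: "z \<in> cube K u \<rho>"
  have "\<rho> * K \<le> \<rho>' * K" using r by (rule mult_le_mono1)
  then have "int (\<rho> * K) \<le> int (\<rho>' * K)" by (simp only: of_nat_le_iff)
  then show "z \<in> cube K u \<rho>'" using z \<open>\<rho> * K \<le> \<rho>' * K\<close> unfolding cube_iff by linarith
qed

text \<open>Lower bound, uniform in \<open>K\<close> and valid for either colour at density one
  half, for each half of a fill or kill: a large cube without one colour, and a unit cube with a
  point of the other.\<close>

definition kap :: "nat \<Rightarrow> real" where
  "kap \<alpha> = min (exp (- 4 * real (3 * \<alpha> + 3) ^ 3)) (1 - exp (- (1/2)))"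

lemma kap_bounds: "0 < kap \<alpha>" "kap \<alpha> \<le> 1"
  by (auto simp: kap_def min_def)

lemma abs_chain:
  fixes U V p q k A B :: int
  assumes "2 * \<bar>p - U\<bar> \<le> k" "\<bar>p - q\<bar> < A" "\<bar>q - V\<bar> < B"
  shows "\<bar>U - V\<bar> < k + A + B"
proof -
  have lin: "d \<le> x + e + r \<Longrightarrow> 2 * x \<le> k \<Longrightarrow> e < A \<Longrightarrow> r < B \<Longrightarrow> 0 \<le> x \<Longrightarrow> d < k + A + B" for d x e r :: int
    by linarith
  have "U - V = - (p - U) + (p - q) + (q - V)" by simp
  then have "\<bar>U - V\<bar> \<le> \<bar>- (p - U)\<bar> + \<bar>p - q\<bar> + \<bar>q - V\<bar>"
    by (metis abs_triangle_ineq add_mono_thms_linordered_semiring(3) order_trans)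
  then have "\<bar>U - V\<bar> \<le> \<bar>p - U\<bar> + \<bar>p - q\<bar> + \<bar>q - V\<bar>" by (simp only: abs_minus_cancel)
  then show ?thesis using assms abs_ge_zero by (rule lin)
qed

text \<open>If the cluster of the box comes within \<open>c\<close> of the boundary but hits none of
  the eight segments, it can arrive only through the four windows, and these can be blackened at
  cost \<open>kap \<alpha> ^ 8\<close> (two conditions each). So as long as \<open>UU\<close> stays
  away from 1, the arm probability drops by a fixed amount over \<open>c\<close> further
  units.\<close>

lemma kill_inequality:
  assumes K: "K \<ge> 1" and c: "c \<le> n" "m \<le> n - c"
    and C: "\<And>s v U k. finite U \<Longrightarrow> (\<forall>u\<in>U. k \<le> sd u v) \<Longrightarrow>
     (\<Sum>u\<in>U. exp (- (1/4) * real ((sd u v - s) div 3))) \<le> C * exp (real s / 12 - real k / 24)"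
  shows "((1 - UU K m \<alpha> n) ^ 8 - (1 - PH K (\<lambda>\<omega>. arm K \<omega> org m (n - c)))
      - 4 * (C * exp (real (3 * \<alpha> + 3 + 2) / 12 - real c / 24))) * kap \<alpha> ^ 8
    \<le> PH K (\<lambda>\<omega>. arm K \<omega> org m (n - c)) - PH K (\<lambda>\<omega>. arm K \<omega> org m n)"
proof -
  define r where "r = 3 * \<alpha> + 3"
  define Sc :: "coord set" where "Sc = (\<Union>v\<in>win n. cube K v r) \<times> UNIV"
  \<comment> \<open>Failures of the blackening, which are increasing: a white point in the large
    cube, or no black point in the unit cube.\<close>
  define Bk where "Bk = (\<lambda>(v, f) \<omega>. if f then \<not> noW \<omega> (cube K v r) else noB \<omega> (cube K v 1))"
  define Bev where "Bev \<omega> \<longleftrightarrow> (\<exists>k\<in>win n \<times> UNIV. Bk k \<omega>)" for \<omega>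
  define Aev where "Aev \<omega> \<longleftrightarrow> (\<exists>i\<in>UNIV. sarm K \<omega> org i m \<alpha> n)" for \<omega>
  \<comment> \<open>The arm is recomputed without the bits of the windows, so that it depends on
    bits disjoint from those of the blackening, as \<open>prb_cond_Harris_dec\<close>
    requires.\<close>
  define L where "L \<omega> \<longleftrightarrow> arm K (\<omega> \<inter> - Sc) org m (n - c)" for \<omega>
  have finW: "finite (win n \<times> (UNIV :: bool set))" using finite_win by simp
  have locBk: "loc (Bk k)" for k
  proof (cases k)
    case (Pair v f)
    show ?thesis unfolding Bk_def Pair by (cases f) (simp_all add: loc_noB loc_not loc_noW)
  qed
  have incBk: "inc (Bk k)" for k
  proof (cases k)
    case (Pair v f)
    show ?thesis unfolding Bk_def Pair by (cases f) (simp_all add: inc_noB inc_noW)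
  qed
  have locB: "loc Bev" unfolding Bev_def by (intro loc_bex finW locBk)
  have incB: "inc Bev" unfolding Bev_def by (intro inc_bex incBk)
  have locA: "loc Aev" unfolding Aev_def by (intro loc_bex loc_sarm) auto
  have incA: "inc Aev" unfolding Aev_def by (intro inc_bex inc_sarm)
  have locL: "loc L" unfolding L_def by (rule loc_arm_Int)
  have depL: "dep (- Sc) L" unfolding L_def by (simp add: dep_def Int_assoc)
  have depB: "dep Sc Bev"
  proof -
    have "Bk k (\<omega> \<inter> Sc) = Bk k \<omega>" if "k \<in> win n \<times> UNIV" for k \<omega>
    proof -
      obtain v f where k0: "k = (v, f)" by (cases k)
      then have k: "k = (v, f)" "v \<in> win n" using that by simp_all
      have "cube K v 1 \<subseteq> cube K v r" by (rule cube_mono) (simp add: r_def)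
      then have "cube K v 1 \<times> {False} \<subseteq> Sc" "cube K v r \<times> {True} \<subseteq> Sc" using k(2) unfolding Sc_def by auto
      then show ?thesis using depD[OF dep_noW] depD[OF dep_noB] unfolding Bk_def k(1) by (cases f) simp_all
    qed
    then show ?thesis unfolding dep_def Bev_def by blast
  qed
  have PB: "kap \<alpha> ^ 8 \<le> 1 - PH K Bev"
  proof -
    have "kap \<alpha> ^ card (win n \<times> (UNIV :: bool set)) \<le> PH K (\<lambda>\<omega>. \<forall>k\<in>win n \<times> UNIV. \<not> Bk k \<omega>)"
    proof (intro prb_Harris_dec_ball wtH finW locBk incBk)
      fix k :: "site \<times> bool" assume "k \<in> win n \<times> UNIV"
      obtain v f where k: "k = (v, f)" by (cases k)
      show "kap \<alpha> \<le> 1 - PH K (Bk k)"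
      proof (cases f)
        case True
        have "PH K (Bk k) = 1 - PH K (\<lambda>\<omega>. noW \<omega> (cube K v r))"
          using prb_not[OF wtH[of K] loc_noW[OF finite_cube]] by (simp add: Bk_def k True)
        moreover have "exp (- 4 * real r ^ 3) \<le> PH K (\<lambda>\<omega>. noW \<omega> (cube K v r))"
          using K by (intro PP_noB_cube_ge(2)) (auto simp: r_def)
        ultimately show ?thesis unfolding kap_def r_def[symmetric] by simp
      next
        case False
        have "PH K (\<lambda>\<omega>. noB \<omega> (cube K v 1)) \<le> exp (- (1 - 1/2) * real 1)"
          using K by (intro PP_noB_cube) auto
        then show ?thesis unfolding kap_def by (simp add: Bk_def k False)
      qed
    qed (use kap_bounds[of \<alpha>] in simp)
    also have "(\<lambda>\<omega>. \<forall>k\<in>win n \<times> UNIV. \<not> Bk k \<omega>) = (\<lambda>\<omega>. \<not> Bev \<omega>)" by (auto simp: Bev_def)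
    also have "PH K (\<lambda>\<omega>. \<not> Bev \<omega>) = 1 - PH K Bev" by (rule prb_not[OF wtH[of K] locB])
    finally have 1: "kap \<alpha> ^ card (win n \<times> (UNIV :: bool set)) \<le> 1 - PH K Bev" .
    have "card (win n) \<le> 4" unfolding win_def by (intro card_insert_le_m1 | simp)+
    then have "card (win n \<times> (UNIV :: bool set)) \<le> 8" by (simp add: card_cartesian_product card_UNIV_bool)
    then have "kap \<alpha> ^ 8 \<le> kap \<alpha> ^ card (win n \<times> (UNIV :: bool set))"
      using kap_bounds[of \<alpha>] by (intro power_decreasing) auto
    then show ?thesis using 1 by linarith
  qed
  have PA: "(1 - UU K m \<alpha> n) ^ 8 \<le> 1 - PH K Aev"
  proof -
    have "(1 - UU K m \<alpha> n) ^ card (UNIV :: (bool \<times> bool \<times> bool) set) \<le> PH K (\<lambda>\<omega>. \<forall>i\<in>UNIV. \<not> sarm K \<omega> org i m \<alpha> n)"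
    proof (intro prb_Harris_dec_ball wtH loc_sarm inc_sarm)
      show "0 \<le> 1 - UU K m \<alpha> n" using prb_le_1[OF wtH loc_sarm, of K K org _ m \<alpha> n] unfolding PH_sarm by simp
    qed (auto simp: PH_sarm)
    also have "(\<lambda>\<omega>. \<forall>i\<in>UNIV. \<not> sarm K \<omega> org i m \<alpha> n) = (\<lambda>\<omega>. \<not> Aev \<omega>)" by (auto simp: Aev_def)
    also have "PH K (\<lambda>\<omega>. \<not> Aev \<omega>) = 1 - PH K Aev" by (rule prb_not[OF wtH[of K] locA])
    also have "card (UNIV :: (bool \<times> bool \<times> bool) set) = 8"
      by (simp add: card_UNIV_bool UNIV_Times_UNIV[symmetric] card_cartesian_product del: UNIV_Times_UNIV)
    finally show ?thesis .
  qed
  have dead: "\<not> arm K \<omega> org m n" if ab: "\<not> Aev \<omega>" "\<not> Bev \<omega>" for \<omega>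
  proof
    assume "arm K \<omega> org m n"
    then obtain x y where xy: "x \<in> lbox K org m" "y \<in> bd K org n" "reach adj4 {x \<in> lbox K org n. wh K \<omega> x} x y"
      unfolding arm_def cn_def crs_def by blast
    have wy: "wh K \<omega> y" using reach_in(2)[OF xy(3)] by simp
    from bd_segments[OF xy(2), of \<alpha>] show False
    proof
      assume "\<exists>i. y \<in> gs K org i ` RU K n \<alpha>"
      then obtain i where "y \<in> gs K org i ` RU K n \<alpha>" by blast
      then have "sarm K \<omega> org i m \<alpha> n" unfolding sarm_def cn_def crs_def using xy by blast
      then show False using ab(1) unfolding Aev_def by blast
    next
      assume "\<exists>v\<in>win n. y \<in> lbox K v \<alpha>"
      then obtain v where v: "v \<in> win n" "y \<in> lbox K v \<alpha>" by blast
      have "\<not> Bk (v, True) \<omega>" "\<not> Bk (v, False) \<omega>" using ab(2) v(1) unfolding Bev_def by blast+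
      then have "noW \<omega> (cube K v (3 * \<alpha> + 3))" "\<not> noB \<omega> (cube K v 1)" unfolding Bk_def r_def by simp_all
      then have "\<not> wh K \<omega> y" by (rule kill_not_wh[OF _ _ v(2)])
      then show False using wy by simp
    qed
  qed
  have PL: "PH K (\<lambda>\<omega>. arm K \<omega> org m (n - c)) - 4 * (C * exp (real (r + 2) / 12 - real c / 24)) \<le> PH K L"
  proof -
    let ?U = "{u. msup u \<le> int (n - c)}"
    define \<rho> where "\<rho> v u = (sd u v - (r + 2)) div 3" for v u
    let ?H = "\<lambda>\<omega>. \<exists>v\<in>win n. \<exists>u\<in>?U. noW \<omega> (cube K u (\<rho> v u))"
    have sub: "?H \<omega>" if a: "arm K \<omega> org m (n - c)" "\<not> L \<omega>" for \<omega>
    proof -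
      have "{x \<in> lbox K org (n - c). wh K \<omega> x} \<noteq> {x \<in> lbox K org (n - c). wh K (\<omega> \<inter> - Sc) x}"
        using a unfolding L_def arm_def cn_def by metis
      moreover have "{x \<in> lbox K org (n - c). wh K (\<omega> \<inter> - Sc) x} \<subseteq> {x \<in> lbox K org (n - c). wh K \<omega> x}"
        using wh_mono[of K "\<omega> \<inter> - Sc" _ \<omega>] by blast
      ultimately obtain x where x: "x \<in> lbox K org (n - c)" "wh K \<omega> x" "\<not> wh K (\<omega> \<inter> - Sc) x" by blast
      let ?u = "mcell K x"
      have uU: "?u \<in> ?U" using mcell_msup_le[OF K x(1)] by simp
      \<comment> \<open>The nearest window governs the size of the hole: a ball short of it misses
        all windows.\<close>
      obtain v where v: "v \<in> win n" "\<And>v'. v' \<in> win n \<Longrightarrow> sd ?u v \<le> sd ?u v'"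
      proof -
        have "win n \<noteq> {}" by (simp add: win_def)
        then show ?thesis using that finite_win arg_min_if_finite(1) arg_min_least by metis
      qed
      have "noW \<omega> (cube K ?u (\<rho> v ?u))"
      proof (cases "\<rho> v ?u = 0")
        case True
        then show ?thesis by (simp add: noW_def cube_def)
      next
        case False
        then have s: "3 * \<rho> v ?u + 2 + r \<le> sd ?u v" unfolding \<rho>_def by linarith
        have outS: "(z, b) \<in> - Sc" if z: "dd x z < real ((3 * \<rho> v ?u + 1) * K)" for z b
        proof
          assume "(z, b) \<in> Sc"
          then obtain v' where v': "v' \<in> win n" "z \<in> cube K v' r" by (auto simp: Sc_def)
          have sv: "3 * \<rho> v ?u + 2 + r \<le> sd ?u v'" using s v(2)[OF v'(1)] by linarith
          define k where "k = 3 * \<rho> v ?u + 2 + r"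
          have "int k \<le> \<bar>fst ?u - fst v'\<bar> \<or> int k \<le> \<bar>snd ?u - snd v'\<bar>"
            using sv unfolding sd_def k_def[symmetric] by (auto simp: max_def nat_le_iff le_nat_iff split: if_splits)
          then have kk: "int K * int k \<le> \<bar>int K * fst ?u - int K * fst v'\<bar> \<or> int K * int k \<le> \<bar>int K * snd ?u - int K * snd v'\<bar>"
            by (simp add: right_diff_distrib[symmetric] abs_mult mult_left_mono) (metis mult_left_mono of_nat_0_le_iff)
          have zz: "max (abs (fst x - fst (fst z))) (abs (snd x - snd (fst z))) < int ((3 * \<rho> v ?u + 1) * K)"
          proof -
            have "real_of_int (max (abs (fst x - fst (fst z))) (abs (snd x - snd (fst z)))) < real_of_int (int ((3 * \<rho> v ?u + 1) * K))"
              using dd_ge_max[of x z] z by simp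
            then show ?thesis by (simp only: of_int_less_iff)
          qed
          have cz: "\<bar>fst (fst z) - K * fst v'\<bar> < int (r * K)" "\<bar>snd (fst z) - K * snd v'\<bar> < int (r * K)"
            using v'(2) unfolding cube_iff by auto
          have mc: "2 * \<bar>fst x - K * fst ?u\<bar> \<le> K" "2 * \<bar>snd x - K * snd ?u\<bar> \<le> K" using mcell[OF K] by auto
          have ar: "\<bar>U - V\<bar> < k + A + B" if "2 * \<bar>p - U\<bar> \<le> k" "\<bar>p - q\<bar> < A" "\<bar>q - V\<bar> < B" for U V p q k A B :: int
            using that by (rule abs_chain)
          have zf: "\<bar>fst x - fst (fst z)\<bar> < int ((3 * \<rho> v ?u + 1) * K)" "\<bar>snd x - snd (fst z)\<bar> < int ((3 * \<rho> v ?u + 1) * K)"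
            using zz unfolding max_less_iff_conj by auto
          have "\<bar>int K * fst ?u - int K * fst v'\<bar> < int K + int ((3 * \<rho> v ?u + 1) * K) + int (r * K)"
            "\<bar>int K * snd ?u - int K * snd v'\<bar> < int K + int ((3 * \<rho> v ?u + 1) * K) + int (r * K)"
            by (rule ar[OF mc(1) zf(1) cz(1)]) (rule ar[OF mc(2) zf(2) cz(2)])
          moreover have "int K + int ((3 * \<rho> v ?u + 1) * K) + int (r * K) = int K * int k"
            by (simp add: k_def algebra_simps)
          ultimately show False using kk by linarith
        qed
        show ?thesis
          unfolding noW_def using wh_Int_hole[OF x(2,3) outS] cube_in_ball[OF K] by blast
      qed
      then show ?thesis using v(1) uU by blast
    qed
    have locH: "loc ?H" by (intro loc_bex loc_noW finite_win finite_msup) auto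
    have "PH K (\<lambda>\<omega>. arm K \<omega> org m (n - c)) - PH K L \<le> PH K (\<lambda>\<omega>. arm K \<omega> org m (n - c) \<and> \<not> L \<omega>)"
      by (intro prb_diff_le wtH loc_arm locL)
    also have "\<dots> \<le> PH K ?H"
      by (intro prb_mono[OF wtH _ locH] loc_conj loc_not loc_arm locL) (use sub in blast)
    also have "\<dots> \<le> (\<Sum>v\<in>win n. PH K (\<lambda>\<omega>. \<exists>u\<in>?U. noW \<omega> (cube K u (\<rho> v u))))"
      by (intro prb_bex_le wtH finite_win loc_bex loc_noW finite_msup) auto
    also have "\<dots> \<le> (\<Sum>v\<in>win n. C * exp (real (r + 2) / 12 - real c / 24))"
    proof (intro sum_mono)
      fix v assume v: "v \<in> win n"
      have "PH K (\<lambda>\<omega>. \<exists>u\<in>?U. noW \<omega> (cube K u (\<rho> v u))) \<le> (\<Sum>u\<in>?U. exp (- (1/2) * real (\<rho> v u)))"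
        using K finite_msup by (intro PP_bex_noW) auto
      also have "\<dots> \<le> (\<Sum>u\<in>?U. exp (- (1/4) * real ((sd u v - (r + 2)) div 3)))"
        unfolding \<rho>_def by (intro sum_mono) simp
      also have "\<dots> \<le> C * exp (real (r + 2) / 12 - real c / 24)"
      proof (intro C finite_msup ballI)
        fix u assume "u \<in> ?U"
        then have "msup u \<le> int (n - c)" by simp
        moreover have "msup v \<le> msup u + int (sd u v)"
          using msup_triangle[of v u] by (simp add: sd_def)
        ultimately show "c \<le> sd u v" using msup_win[OF v] c(1) by linarith
      qed
      finally show "PH K (\<lambda>\<omega>. \<exists>u\<in>?U. noW \<omega> (cube K u (\<rho> v u))) \<le> C * exp (real (r + 2) / 12 - real c / 24)" .
    qed
    also have "\<dots> = real (card (win n)) * (C * exp (real (r + 2) / 12 - real c / 24))" by simp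
    also have "\<dots> \<le> 4 * (C * exp (real (r + 2) / 12 - real c / 24))"
    proof (rule mult_right_mono)
      have "card (win n) \<le> 4" unfolding win_def by (intro card_insert_le_m1 | simp)+
      then show "real (card (win n)) \<le> 4" by simp
      have "0 \<le> C * exp (real 0 / 12 - real 0 / 24)" using C[of "{}" 0 org 0] by simp
      then show "0 \<le> C * exp (real (r + 2) / 12 - real c / 24)" by (simp add: zero_le_mult_iff)
    qed
    finally show ?thesis by simp
  qed
  have "PH K (\<lambda>\<omega>. \<not> Aev \<omega>) - PH K (\<lambda>\<omega>. \<not> L \<omega>) \<le> PH K (\<lambda>\<omega>. \<not> Aev \<omega> \<and> \<not> \<not> L \<omega>)"
    by (intro prb_diff_le wtH loc_not locA locL)
  also have "(\<lambda>\<omega>. \<not> Aev \<omega> \<and> \<not> \<not> L \<omega>) = (\<lambda>\<omega>. L \<omega> \<and> \<not> Aev \<omega>)" by auto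
  finally have LA: "(1 - UU K m \<alpha> n) ^ 8 - (1 - PH K (\<lambda>\<omega>. arm K \<omega> org m (n - c)))
      - 4 * (C * exp (real (r + 2) / 12 - real c / 24)) \<le> PH K (\<lambda>\<omega>. L \<omega> \<and> \<not> Aev \<omega>)"
    using PA PL prb_not[OF wtH[of K] locA] prb_not[OF wtH[of K] locL] by linarith
  have nn: "0 \<le> PH K (\<lambda>\<omega>. L \<omega> \<and> \<not> Aev \<omega>)" by (rule prb_nonneg[OF wtH])
  have "((1 - UU K m \<alpha> n) ^ 8 - (1 - PH K (\<lambda>\<omega>. arm K \<omega> org m (n - c)))
      - 4 * (C * exp (real (r + 2) / 12 - real c / 24))) * kap \<alpha> ^ 8 \<le> PH K (\<lambda>\<omega>. L \<omega> \<and> \<not> Aev \<omega>) * kap \<alpha> ^ 8"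
    using LA kap_bounds[of \<alpha>] by (intro mult_right_mono) auto
  also have "\<dots> \<le> PH K (\<lambda>\<omega>. L \<omega> \<and> \<not> Aev \<omega>) * (1 - PH K Bev)" using PB nn by (intro mult_left_mono)
  also have "\<dots> \<le> PH K (\<lambda>\<omega>. L \<omega> \<and> \<not> Aev \<omega> \<and> \<not> Bev \<omega>)"
    by (rule prb_cond_Harris_dec[OF wtH locL locA locB incA incB depL depB])
  also have "\<dots> \<le> PH K (\<lambda>\<omega>. arm K \<omega> org m (n - c) \<and> \<not> arm K \<omega> org m n)"
  proof (intro prb_mono[OF wtH] loc_conj loc_not locL locA locB loc_arm)
    fix \<omega> assume a: "L \<omega> \<and> \<not> Aev \<omega> \<and> \<not> Bev \<omega>"
    have "arm K \<omega> org m (n - c)" using a incD[OF inc_arm, of "\<omega> \<inter> - Sc" \<omega>] unfolding L_def by auto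
    then show "arm K \<omega> org m (n - c) \<and> \<not> arm K \<omega> org m n" using dead a by blast
  qed
  also have "\<dots> = PH K (\<lambda>\<omega>. arm K \<omega> org m (n - c)) - PH K (\<lambda>\<omega>. arm K \<omega> org m n)"
    using c by (intro prb_diff_eq[OF wtH] loc_arm) (auto intro: arm_antimono)
  finally show ?thesis unfolding r_def .
qed

subsection \<open>Crossings of squares\<close>

text \<open>A white vertical crossing excludes a horizontal crossing for the exchanged colours, and
  both have the same probability, by reflection in the diagonal and by colour symmetry. Ties only
  decrease the probability.\<close>

lemma square_crossing_le_half:
  "PH K (\<lambda>\<omega>. cn K \<omega> (lbox K u n) {x. snd x = K * snd u - n * K} {x. snd x = K * snd u + n * K}) \<le> 1/2"
proof -
  define a where "a = int K * fst u"
  define b where "b = int K * snd u"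
  define N where "N = int n * int K"
  define h :: "site \<Rightarrow> site" where "h x = (snd x - b + a, fst x - a + b)" for x
  have B: "lbox K u n = {a - N..a + N} \<times> {b - N..b + N}" by (simp add: lbox_eq a_def b_def N_def)
  let ?V = "\<lambda>\<omega>. cn K \<omega> (lbox K u n) {x. snd x = b - N} {x. snd x = b + N}"
  let ?H = "\<lambda>\<omega>. cn K \<omega> (lbox K u n) {x. fst x = a - N} {x. fst x = a + N}"
  have iso: "isom h"
  proof -
    have "isom (\<lambda>x. (\<lambda>x. (fst x + (a - b), snd x + (b - a))) ((\<lambda>x. (snd x, fst x)) x))"
      by (rule isom_comp[OF isom_trans isom_swap])
    moreover have "h = (\<lambda>x. (\<lambda>x. (fst x + (a - b), snd x + (b - a))) ((\<lambda>x. (snd x, fst x)) x))"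
      by (auto simp: h_def fun_eq_iff)
    ultimately show ?thesis by simp
  qed
  have hh: "h (h x) = x" for x by (simp add: h_def)
  have im: "h ` {x. P x} = {x. P (h x)}" for P
    by (rule set_eqI) (metis (mono_tags) hh image_iff mem_Collect_eq)
  have hB: "h ` lbox K u n = lbox K u n"
  proof -
    have "lbox K u n = {x. x \<in> lbox K u n}" by simp
    then have "h ` lbox K u n = {x. h x \<in> lbox K u n}" using im[of "\<lambda>x. x \<in> lbox K u n"] by simp
    also have "\<dots> = lbox K u n" unfolding B by (auto simp: h_def)
    finally show ?thesis .
  qed
  have h1: "h ` {x. snd x = b - N} = {x. fst x = a - N}" unfolding im by (auto simp: h_def)
  have h2: "h ` {x. snd x = b + N} = {x. fst x = a + N}" unfolding im by (auto simp: h_def)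
  have VH: "PH K ?V = PH K ?H"
    using PP_isom[OF iso, of "lbox K u n" "1/2" K "{x. snd x = b - N}" "{x. snd x = b + N}"]
    unfolding hB h1 h2 by simp
  have lV: "loc ?V" and lH: "loc ?H" by (intro loc_cn finite_lbox)+
  have excl: "\<not> (?V \<omega> \<and> ?H (flipc \<omega>))" for \<omega>
  proof
    assume "?V \<omega> \<and> ?H (flipc \<omega>)"
    then obtain y y' x x' where p: "snd y = b - N" "snd y' = b + N" "reach adj4 {x \<in> lbox K u n. wh K \<omega> x} y y'"
      "fst x = a - N" "fst x' = a + N" "reach adj4 {x \<in> lbox K u n. wh K (flipc \<omega>) x} x x'"
      unfolding cn_def crs_def by blast
    have "{x \<in> lbox K u n. wh K (flipc \<omega>) x} \<inter> {x \<in> lbox K u n. wh K \<omega> x} \<noteq> {}"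
      by (rule crossing_paths_meet[OF _ _ p(6,4,5) p(3,1,2)]) (auto simp: B)
    then show False using wh_flip_excl by blast
  qed
  have "PH K ?V \<le> PH K (\<lambda>\<omega>. \<not> ?H (flipc \<omega>))"
    by (intro prb_mono[OF wtH] lV loc_not PP_flip(2) lH) (use excl in blast)
  also have "\<dots> = 1 - PH K ?H" using prb_not[OF wtH[of K] PP_flip(2)[OF lH]] PP_flip(1)[OF lH] by simp
  finally have "PH K ?V \<le> 1/2" using VH by simp
  then show ?thesis unfolding a_def b_def N_def by simp
qed

lemma card_cube_eq: "K \<ge> 1 \<Longrightarrow> card (cube K u \<rho>) = card (cube K v \<rho>)"
  unfolding cube_def card_cartesian_product by simp

end

lemma adjacent: "adj4 (i, j) (i + 1, j)" "adj4 (i, j) (i, j + 1)"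
  by (simp_all add: adj4_def)

lemma reach_hline:
  assumes "a \<le> b" "{a..b} \<times> {y} \<subseteq> S"
  shows "reach adj4 S (a, y) (b, y)"
  using assms
proof (induction b rule: int_ge_induct)
  case base
  then show ?case by (auto intro: reach_refl)
next
  case (step i)
  then have "reach adj4 S (a, y) (i, y)" by force
  moreover have "(i + 1, y) \<in> S" using step by auto
  ultimately show ?case by (rule reach_step[where R=adj4, OF _ adjacent(1)])
qed

lemma reach_vline:
  assumes "a \<le> b" "{x} \<times> {a..b} \<subseteq> S"
  shows "reach adj4 S (x, a) (x, b)"
  using assms
proof (induction b rule: int_ge_induct)
  case base
  then show ?case by (auto intro: reach_refl)
next
  case (step i)
  then have "reach adj4 S (x, a) (x, i)" by force
  moreover have "(x, i + 1) \<in> S" using step by auto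
  ultimately show ?case by (rule reach_step[where R=adj4, OF _ adjacent(2)])
qed

lemma reach_rect:
  assumes "x \<in> {a..b} \<times> {c..d}" "y \<in> {a..b} \<times> {c..d}"
  shows "reach adj4 ({a..b} \<times> {c..d}) x y"
proof -
  let ?R = "{a..b} \<times> {c..d}"
  obtain x1 x2 y1 y2 where xy: "x = (x1, x2)" "y = (y1, y2)" by (cases x, cases y)
  have "reach adj4 ?R (x1, x2) (y1, x2)"
  proof (cases "x1 \<le> y1")
    case True
    then show ?thesis using assms xy by (intro reach_hline) auto
  next
    case False
    then show ?thesis using assms xy by (intro reach4_sym[OF reach_hline]) auto
  qed
  moreover have "reach adj4 ?R (y1, x2) (y1, y2)"
  proof (cases "x2 \<le> y2")
    case True
    then show ?thesis using assms xy by (intro reach_vline) auto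
  next
    case False
    then show ?thesis using assms xy by (intro reach4_sym[OF reach_vline]) auto
  qed
  ultimately show ?thesis unfolding xy by (rule reach_trans)
qed

lemma reach_component:
  assumes "reach R S x y"
  shows "reach R {z. reach R S x z} x y"
  using assms
proof (induction rule: reach_induct)
  case refl
  have "x \<in> {z. reach R S x z}" using reach_refl[OF reach_in(1)[OF assms]] by simp
  then show ?case by (rule reach_refl)
next
  case (step y z)
  have "z \<in> {z. reach R S x z}" using reach_step[OF step(1,2,3)] by simp
  then show ?case by (rule reach_step[OF step(4,2)])
qed

text \<open>Stop on first reaching level \<open>t\<close>, then go back until level \<open>b\<close>
  is met.\<close>

lemma reach_vclip:
  assumes "reach adj4 S p q" "snd p \<le> b" "t \<le> snd q" "b < t"
  shows "\<exists>p' q'. snd p' = b \<and> snd q' = t \<and> reach adj4 (S \<inter> {x. b \<le> snd x \<and> snd x \<le> t}) p' q'"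
proof -
  let ?U = "{x :: site. snd x < t}"
  obtain v w where v: "reach adj4 (S \<inter> ?U) p v" "w \<in> S - ?U" "adj4 v w"
  proof -
    have "p \<in> ?U" "q \<notin> ?U" using assms by auto
    then show ?thesis using reach_exit[OF assms(1)] that by metis
  qed
  have vU: "snd v < t" using reach_in(2)[OF v(1)] by simp
  have w: "snd w = t" "w \<in> S" using v(2,3) vU unfolding adj4_def by auto
  let ?S = "S \<inter> {x. snd x \<le> t}"
  have "reach adj4 ?S p v" by (rule reach_mono[OF v(1)]) auto
  then have pw: "reach adj4 ?S p w" by (rule reach_step[where R=adj4, OF _ v(3)]) (use w in auto)
  let ?V = "{x :: site. b < snd x}"
  obtain v' w' where v': "reach adj4 (?S \<inter> ?V) w v'" "w' \<in> ?S - ?V" "adj4 v' w'"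
  proof -
    have "w \<in> ?V" "p \<notin> ?V" using assms w by auto
    then show ?thesis using reach_exit[OF reach4_sym[OF pw]] that by metis
  qed
  have "snd v' > b" using reach_in(2)[OF v'(1)] by simp
  then have w': "snd w' = b" "w' \<in> ?S" using v'(2,3) unfolding adj4_def by auto
  let ?T = "S \<inter> {x. b \<le> snd x \<and> snd x \<le> t}"
  have "reach adj4 ?T w v'" by (rule reach_mono[OF v'(1)]) auto
  then have "reach adj4 ?T w w'" by (rule reach_step[where R=adj4, OF _ v'(3)]) (use w' assms in auto)
  then show ?thesis using reach4_sym w w' by blast
qed

text \<open>Two left-right connections whose ends are in opposite order on the two sides must meet,
  so they lie in one cluster.\<close>

lemma reach_order_flip:
  assumes S: "S \<subseteq> {- N..N} \<times> {b..t}"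
    and r: "reach adj4 S l0 r0" "reach adj4 S l1 r1"
    and e: "fst l0 = - N" "fst r0 = N" "fst l1 = - N" "fst r1 = N" "snd l0 < snd l1" "snd r1 < snd r0"
  shows "reach adj4 S l0 l1"
proof (rule ccontr)
  assume n: "\<not> reach adj4 S l0 l1"
  define S0 where "S0 = {z. reach adj4 S l0 z}"
  define S1 where "S1 = {z. reach adj4 S l1 z}"
  have dis: "S0 \<inter> S1 = {}"
    unfolding S0_def S1_def using n reach_trans reach4_sym by blast
  have sub: "S0 \<subseteq> S" "S1 \<subseteq> S" unfolding S0_def S1_def using reach_in(2) by blast+
  \<comment> \<open>In a rectangle with one extra column on each side, the first cluster is
    prolonged down the left column and up the right one into a vertical crossing; the second,
    prolonged by one site at each end, is a horizontal one. The strict order of the ends keeps them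
    apart in the new columns, so they meet inside.\<close>
  define T where "T = S0 \<union> {- N - 1} \<times> {b..snd l0} \<union> {N + 1} \<times> {snd r0..t}"
  define H where "H = S1 \<union> {(- N - 1, snd l1), (N + 1, snd r1)}"
  have l0: "l0 \<in> S0" "r0 \<in> S0" "l1 \<in> S1" "r1 \<in> S1"
    using r reach_refl[OF reach_in(1)[OF r(1)]] reach_refl[OF reach_in(1)[OF r(2)]]
    unfolding S0_def S1_def by simp_all
  have Sf: "- N \<le> fst z \<and> fst z \<le> N \<and> b \<le> snd z \<and> snd z \<le> t" if "z \<in> S" for z
    using subsetD[OF S that] by (cases z) auto
  have bt: "b \<le> snd l0" "snd l0 \<le> t" "b \<le> snd r0" "snd r0 \<le> t" "b \<le> snd l1" "snd l1 \<le> t" "b \<le> snd r1" "snd r1 \<le> t"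
    using Sf l0 sub by blast+
  have N0: "- N \<le> N" using Sf l0(1) sub(1) e(1) by fastforce
  have T1: "reach adj4 T (- N - 1, b) (- N - 1, snd l0)"
    using bt by (intro reach_vline) (auto simp: T_def)
  have T2: "reach adj4 T (- N - 1, b) l0"
    by (rule reach_step[OF T1]) (use e l0 in \<open>auto simp: adj4_def T_def\<close>)
  have "reach adj4 S0 l0 r0" unfolding S0_def by (rule reach_component[OF r(1)])
  then have "reach adj4 T l0 r0" by (rule reach_mono) (auto simp: T_def)
  then have T3: "reach adj4 T (- N - 1, b) r0" by (rule reach_trans[OF T2])
  have T4: "reach adj4 T (- N - 1, b) (N + 1, snd r0)"
    by (rule reach_step[OF T3]) (use e bt in \<open>auto simp: adj4_def T_def\<close>)
  have T5: "reach adj4 T (N + 1, snd r0) (N + 1, t)"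
    using bt by (intro reach_vline) (auto simp: T_def)
  have TT: "reach adj4 T (- N - 1, b) (N + 1, t)" by (rule reach_trans[OF T4 T5])
  have H1: "reach adj4 H (- N - 1, snd l1) l1"
    by (rule reach_step[OF reach_refl]) (use e l0 in \<open>auto simp: adj4_def H_def\<close>)
  have "reach adj4 S1 l1 r1" unfolding S1_def by (rule reach_component[OF r(2)])
  then have "reach adj4 H l1 r1" by (rule reach_mono) (auto simp: H_def)
  then have H2: "reach adj4 H (- N - 1, snd l1) r1" by (rule reach_trans[OF H1])
  have HH: "reach adj4 H (- N - 1, snd l1) (N + 1, snd r1)"
    by (rule reach_step[OF H2]) (use e in \<open>auto simp: adj4_def H_def\<close>)
  have "H \<inter> T \<noteq> {}"
  proof (rule crossing_paths_meet[OF _ _ HH _ _ TT])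
    show "H \<subseteq> {- N - 1..N + 1} \<times> {b..t}"
      using sub(2) Sf bt N0 unfolding H_def by (fastforce simp: mem_Times_iff)
    show "T \<subseteq> {- N - 1..N + 1} \<times> {b..t}"
      using sub(1) Sf bt N0 unfolding T_def by (fastforce simp: mem_Times_iff)
  qed simp_all
  then obtain z where z: "z \<in> H" "z \<in> T" by blast
  show False
  proof (cases "z \<in> S1")
    case True
    then have "z \<notin> S0" "- N \<le> fst z" "fst z \<le> N" using dis sub Sf by blast+
    then show False using z(2) unfolding T_def by auto
  next
    case False
    then have "z = (- N - 1, snd l1) \<or> z = (N + 1, snd r1)" using z(1) unfolding H_def by blast
    moreover have "z \<notin> S0" using calculation sub(1) Sf N0 by fastforce
    ultimately show False using z(2) e N0 unfolding T_def by auto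
  qed
qed

section \<open>Independent hubs on a vertical line\<close>

context planar_metric
begin

lemma loc_fillW: "loc (fillW K m u)"
  unfolding fillW_def by (intro loc_conj loc_not loc_noW loc_noB finite_cube)

lemma inc_fillW: "inc (fillW K m u)"
  unfolding fillW_def by (intro inc_conj inc_noW inc_noB)

lemma dep_fillW: "dep (cube K u (3 * m + 3) \<times> UNIV) (fillW K m u)"
proof -
  have "cube K u 1 \<subseteq> cube K u (3 * m + 3)" by (rule cube_mono) simp
  then have "cube K u 1 \<times> {True} \<subseteq> cube K u (3 * m + 3) \<times> UNIV" "cube K u (3 * m + 3) \<times> {False} \<subseteq> cube K u (3 * m + 3) \<times> UNIV"
    by auto
  then show ?thesis using dep_noW dep_noB unfolding fillW_def dep_def by blast
qed

lemma PH_fillW: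
  assumes "K \<ge> 1"
  shows "PH K (fillW K m u) = PH K (fillW K m org)" and "kap m * kap m \<le> PH K (fillW K m org)"
proof -
  have f: "PH K (fillW K m u) = PH K (\<lambda>\<omega>. \<not> noW \<omega> (cube K u 1)) * PH K (\<lambda>\<omega>. noB \<omega> (cube K u (3 * m + 3)))" for u
    unfolding fillW_def
  proof (rule prb_indep[OF wtH loc_not[OF loc_noW] loc_noB])
    show "dep (UNIV \<times> {True}) (\<lambda>\<omega>. \<not> noW \<omega> (cube K u 1))" by (rule dep_comb[OF dep_noW]) auto
    show "dep (- (UNIV \<times> {True})) (\<lambda>\<omega>. noB \<omega> (cube K u (3 * m + 3)))" by (rule dep_noB) auto
  qed auto
  have w: "PH K (\<lambda>\<omega>. \<not> noW \<omega> (cube K u 1)) = 1 - exp (- (1/2) * real (card (cube K u 1)) / real K ^ 3)" for u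
    using prb_not[OF wtH[of K] loc_noW[OF finite_cube]] PP_noW[OF finite_cube] by simp
  have b: "PH K (\<lambda>\<omega>. noB \<omega> (cube K u (3 * m + 3))) = exp (- (1 - 1/2) * real (card (cube K u (3 * m + 3))) / real K ^ 3)" for u
    by (rule PP_noB[OF finite_cube])
  show "PH K (fillW K m u) = PH K (fillW K m org)"
    unfolding f w b card_cube_eq[OF assms, of u 1 org] card_cube_eq[OF assms, of u "3 * m + 3" org] by (rule refl)
  show "kap m * kap m \<le> PH K (fillW K m org)"
    unfolding f
  proof (rule mult_mono)
    have "PH K (\<lambda>\<omega>. noW \<omega> (cube K org 1)) \<le> exp (- (1/2) * real 1)" using assms by (intro PP_noW_cube) auto
    then show "kap m \<le> PH K (\<lambda>\<omega>. \<not> noW \<omega> (cube K org 1))"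
      using prb_not[OF wtH[of K] loc_noW[OF finite_cube]] by (simp add: kap_def)
    have "exp (- 4 * real (3 * m + 3) ^ 3) \<le> PH K (\<lambda>\<omega>. noB \<omega> (cube K org (3 * m + 3)))"
      using assms by (intro PP_noB_cube_ge(1)) auto
    then show "kap m \<le> PH K (\<lambda>\<omega>. noB \<omega> (cube K org (3 * m + 3)))" by (simp add: kap_def)
  qed (use kap_bounds[of m] prb_nonneg[OF wtH] in auto)
qed

text \<open>The spacing \<open>6 * m + 6\<close> is twice the radius of the cubes used by
  \<open>fillW\<close>, so different positions use disjoint bits. The offset \<open>s\<close>
  separates the two families of hubs.\<close>

definition tpos :: "nat \<Rightarrow> nat \<Rightarrow> nat \<Rightarrow> site" where
  "tpos m s j = (0, int (s + j * (6 * m + 6)))"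

lemma cubes_disjoint:
  assumes "j < j'" "K \<ge> 1"
  shows "cube K (tpos m s j) (3 * m + 3) \<inter> cube K (tpos m s j') (3 * m + 3) = {}"
proof (rule ccontr)
  assume "\<not> ?thesis"
  then obtain z where z: "z \<in> cube K (tpos m s j) (3 * m + 3)" "z \<in> cube K (tpos m s j') (3 * m + 3)" by blast
  define p where "p = int K * int (s + j * (6 * m + 6))"
  define p' where "p' = int K * int (s + j' * (6 * m + 6))"
  define h where "h = int ((3 * m + 3) * K)"
  have "\<bar>snd (fst z) - p\<bar> < h" "\<bar>snd (fst z) - p'\<bar> < h"
    using z unfolding cube_iff tpos_def p_def p'_def h_def by auto
  moreover have "p + 2 * h \<le> p'"
  proof -
    have "int K * int (s + (j + 1) * (6 * m + 6)) \<le> p'"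
    proof -
      have "(j + 1) * (6 * m + 6) \<le> j' * (6 * m + 6)" using assms(1) by (intro mult_le_mono1) simp
      then have "int (s + (j + 1) * (6 * m + 6)) \<le> int (s + j' * (6 * m + 6))"
        by (simp only: of_nat_le_iff add_le_cancel_left)
      then show ?thesis unfolding p'_def by (intro mult_left_mono) simp_all
    qed
    then show ?thesis by (simp add: p_def h_def algebra_simps)
  qed
  ultimately show False by arith
qed

lemma PH_no_fill:
  assumes "K \<ge> 1"
  shows "PH K (\<lambda>\<omega>. \<forall>j\<in>{1..J}. \<not> fillW K m (tpos m s j) \<omega>) = (1 - PH K (fillW K m org)) ^ J"
proof (induction J)
  case 0
  then show ?case using prb_const[OF wtH[of K], of True] by simp
next
  case (Suc J)
  let ?A = "\<lambda>\<omega>. \<forall>j\<in>{1..J}. \<not> fillW K m (tpos m s j) \<omega>" and ?u = "tpos m s (Suc J)"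
  define S :: "coord set" where "S = cube K ?u (3 * m + 3) \<times> UNIV"
  have dA: "dep (- S) ?A"
    unfolding dep_def
  proof
    fix \<omega>
    have "fillW K m (tpos m s j) (\<omega> \<inter> - S) = fillW K m (tpos m s j) \<omega>" if j: "j \<in> {1..J}" for j
    proof (rule dep_eq[OF dep_fillW])
      have "cube K (tpos m s j) (3 * m + 3) \<inter> cube K ?u (3 * m + 3) = {}" using j assms by (intro cubes_disjoint) auto
      then show "\<omega> \<inter> - S \<inter> cube K (tpos m s j) (3 * m + 3) \<times> UNIV = \<omega> \<inter> cube K (tpos m s j) (3 * m + 3) \<times> UNIV"
        unfolding S_def by blast
    qed
    then show "?A (\<omega> \<inter> - S) = ?A \<omega>" by blast
  qed
  have dB: "dep S (\<lambda>\<omega>. \<not> fillW K m ?u \<omega>)" unfolding S_def by (rule dep_comb[OF dep_fillW])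
  have lA: "loc ?A" by (intro loc_ball loc_not loc_fillW) auto
  have "(\<lambda>\<omega>. \<forall>j\<in>{1..Suc J}. \<not> fillW K m (tpos m s j) \<omega>) = (\<lambda>\<omega>. \<not> fillW K m ?u \<omega> \<and> ?A \<omega>)"
  proof -
    have "{1..Suc J} = insert (Suc J) {1..J}" by auto
    then show ?thesis by (simp only: fun_eq_iff Ball_def insert_iff) blast
  qed
  then have "PH K (\<lambda>\<omega>. \<forall>j\<in>{1..Suc J}. \<not> fillW K m (tpos m s j) \<omega>) = PH K (\<lambda>\<omega>. \<not> fillW K m ?u \<omega>) * PH K ?A"
    using prb_indep[OF wtH loc_not[OF loc_fillW] lA dB dA] by simp
  also have "PH K (\<lambda>\<omega>. \<not> fillW K m ?u \<omega>) = 1 - PH K (fillW K m org)"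
    using prb_not[OF wtH[of K] loc_fillW] PH_fillW(1)[OF assms] by simp
  finally show ?case using Suc by simp
qed

definition trial :: "nat \<Rightarrow> nat \<Rightarrow> nat \<Rightarrow> nat \<Rightarrow> nat \<Rightarrow> nat \<Rightarrow> (bool \<times> bool \<times> bool) set \<Rightarrow> coord set \<Rightarrow> bool" where
  "trial K m \<alpha> n J s G \<omega> \<longleftrightarrow> (\<exists>j\<in>{1..J}. fillW K m (tpos m s j) \<omega> \<and> (\<forall>i\<in>G. sarm K \<omega> (tpos m s j) i m \<alpha> n))"

text \<open>About \<open>3 / k\<close> positions are tried, where \<open>k\<close> is the
  probability of a fill. No fill at all has probability at most \<open>exp (- 3) \<le> 1/8\<close>.
  By Harris a fill lacking one of its at most three arms has probability at most
  \<open>k * 3/200\<close>, in total at most \<open>12/200\<close> since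
  \<open>J * k \<le> 4\<close>. The level \<open>3/4\<close> is chosen so that two such events
  overlap with probability above one half.\<close>

lemma trial_prob:
  assumes K: "K \<ge> 1" and U: "1 - 1/200 \<le> UU K m \<alpha> n" and G: "card G \<le> 3"
  defines "J \<equiv> nat \<lceil>3 / PH K (fillW K m org)\<rceil>"
  shows "3/4 < PH K (trial K m \<alpha> n J s G)" and "loc (trial K m \<alpha> n J s G)"
proof -
  define k where "k = PH K (fillW K m org)"
  have k0: "0 < k"
    using PH_fillW(2)[OF K, of m] kap_bounds[of m] unfolding k_def by (meson less_le_trans mult_pos_pos)
  have k1: "k \<le> 1" unfolding k_def by (rule prb_le_1[OF wtH loc_fillW])
  have Jk: "3 \<le> real J * k" "real J * k \<le> 4"
  proof -
    have "0 \<le> \<lceil>3 / k\<rceil>" using k0 by (simp add: zero_le_ceiling) (smt (verit) divide_pos_pos)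
    then have J: "real J = real_of_int \<lceil>3 / k\<rceil>" unfolding J_def k_def[symmetric] by simp
    have "3 / k \<le> real J" unfolding J by (rule le_of_int_ceiling)
    then show "3 \<le> real J * k" using k0 by (simp add: field_simps)
    have "real J \<le> 3 / k + 1" unfolding J by linarith
    then have "real J * k \<le> (3 / k + 1) * k" using k0 by (intro mult_right_mono) auto
    also have "\<dots> = 3 + k" using k0 by (simp add: field_simps)
    finally show "real J * k \<le> 4" using k1 by simp
  qed
  let ?F = "\<lambda>\<omega>. \<exists>j\<in>{1..J}. fillW K m (tpos m s j) \<omega>"
  let ?B = "\<lambda>\<omega>. \<exists>j\<in>{1..J}. \<exists>i\<in>G. fillW K m (tpos m s j) \<omega> \<and> \<not> sarm K \<omega> (tpos m s j) i m \<alpha> n"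
  have finG: "finite G" by (rule finite_subset[OF subset_UNIV]) simp
  have lF: "loc ?F" by (intro loc_bex loc_fillW) auto
  have lB: "loc ?B" by (intro loc_bex loc_conj loc_not loc_fillW loc_sarm finG) auto
  show lT: "loc (trial K m \<alpha> n J s G)"
    unfolding trial_def by (intro loc_bex loc_conj loc_ball loc_fillW loc_sarm finG) auto
  have F: "7/8 \<le> PH K ?F"
  proof -
    have "PH K (\<lambda>\<omega>. \<not> ?F \<omega>) = (1 - k) ^ J" using PH_no_fill[OF K, of J m s] by (simp add: k_def)
    also have "\<dots> \<le> exp (- k) ^ J" using k1 exp_ge_add_one_self[of "- k"] by (intro power_mono) auto
    also have "\<dots> = exp (- (real J * k))" by (simp add: exp_of_nat_mult[symmetric])
    also have "\<dots> \<le> exp (- 3)" using Jk by simp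
    also have "\<dots> \<le> 1/8"
    proof -
      have "(2::real) ^ 3 \<le> exp 1 ^ 3" using exp_ge_add_one_self[of 1] by (intro power_mono) auto
      also have "\<dots> = exp 3" by (simp add: exp_of_nat_mult[symmetric])
      finally have "8 \<le> exp (3::real)" by simp
      then have "inverse (exp (3::real)) \<le> inverse 8" by (intro le_imp_inverse_le) auto
      then show ?thesis by (simp add: exp_minus)
    qed
    finally show ?thesis using prb_not[OF wtH[of K] lF] by linarith
  qed
  have B: "PH K ?B \<le> 12 / 200"
  proof -
    have "PH K ?B \<le> (\<Sum>j\<in>{1..J}. PH K (\<lambda>\<omega>. \<exists>i\<in>G. fillW K m (tpos m s j) \<omega> \<and> \<not> sarm K \<omega> (tpos m s j) i m \<alpha> n))"
      by (intro prb_bex_le wtH loc_bex loc_conj loc_not loc_fillW loc_sarm finG) auto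
    also have "\<dots> \<le> (\<Sum>j\<in>{1..J}. \<Sum>i\<in>G. PH K (\<lambda>\<omega>. fillW K m (tpos m s j) \<omega> \<and> \<not> sarm K \<omega> (tpos m s j) i m \<alpha> n))"
      by (intro sum_mono prb_bex_le wtH loc_conj loc_not loc_fillW loc_sarm finG)
    also have "\<dots> \<le> (\<Sum>j\<in>{1..J}. \<Sum>i\<in>G. k * (1/200))"
    proof (intro sum_mono)
      fix j i
      have "PH K (\<lambda>\<omega>. fillW K m (tpos m s j) \<omega> \<and> \<not> sarm K \<omega> (tpos m s j) i m \<alpha> n)
        \<le> PH K (fillW K m (tpos m s j)) * (1 - PH K (\<lambda>\<omega>. sarm K \<omega> (tpos m s j) i m \<alpha> n))"
        by (rule prb_Harris_neg[OF wtH loc_fillW loc_sarm inc_fillW inc_sarm])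
      also have "\<dots> \<le> k * (1/200)"
        unfolding PH_sarm PH_fillW(1)[OF K, of m "tpos m s j"] k_def[symmetric]
        using U k0 by (intro mult_left_mono) auto
      finally show "PH K (\<lambda>\<omega>. fillW K m (tpos m s j) \<omega> \<and> \<not> sarm K \<omega> (tpos m s j) i m \<alpha> n) \<le> k * (1/200)" .
    qed
    also have "\<dots> = (real J * k) * (real (card G) / 200)" by simp
    also have "\<dots> \<le> 4 * (3 / 200)" using Jk k0 G by (intro mult_mono divide_right_mono) auto
    finally show ?thesis by simp
  qed
  have "PH K ?F - PH K ?B \<le> PH K (\<lambda>\<omega>. ?F \<omega> \<and> \<not> ?B \<omega>)" by (intro prb_diff_le wtH lF lB)
  also have "\<dots> \<le> PH K (trial K m \<alpha> n J s G)"
    by (intro prb_mono[OF wtH] loc_conj loc_not lF lB lT) (auto simp: trial_def)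
  finally show "3/4 < PH K (trial K m \<alpha> n J s G)" using F B by linarith
qed

text \<open>The filled box joins the separate arms into one cluster containing its centre;
  \<open>2 * m + 3 \<le> K\<close> keeps the filling point within the cut-off of
  \<open>wh\<close>.\<close>

lemma trial_hub:
  assumes K: "2 * m + 3 \<le> K" and m: "m \<le> n" and t: "trial K m \<alpha> n J s G \<omega>"
  obtains j where "j \<in> {1..J}"
    "\<And>i. i \<in> G \<Longrightarrow> \<exists>x\<in>gs K (tpos m s j) i ` RU K n \<alpha>.
        reach adj4 {x \<in> lbox K (tpos m s j) n. wh K \<omega> x} (0, K * snd (tpos m s j)) x"
proof -
  obtain j where j: "j \<in> {1..J}" "fillW K m (tpos m s j) \<omega>" "\<And>i. i \<in> G \<Longrightarrow> sarm K \<omega> (tpos m s j) i m \<alpha> n"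
    using t unfolding trial_def by blast
  let ?u = "tpos m s j"
  let ?W = "{x \<in> lbox K ?u n. wh K \<omega> x}"
  have sub: "lbox K ?u m \<subseteq> ?W" using fillW_wh[OF j(2) _ K] lbox_mono[OF m] by blast
  have hub: "(0, K * snd ?u) \<in> lbox K ?u m" by (simp add: lbox_def tpos_def)
  have "\<exists>x\<in>gs K ?u i ` RU K n \<alpha>. reach adj4 ?W (0, K * snd ?u) x" if i: "i \<in> G" for i
  proof -
    obtain p x where px: "p \<in> lbox K ?u m" "x \<in> gs K ?u i ` RU K n \<alpha>" "reach adj4 ?W p x"
      using j(3)[OF i] unfolding sarm_def cn_def crs_def by blast
    have "reach adj4 (lbox K ?u m) (0, K * snd ?u) p"
      using hub px(1) unfolding lbox_eq by (rule reach_rect)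
    then have "reach adj4 ?W (0, K * snd ?u) p" using reach_mono sub by blast
    then show ?thesis using px reach_trans by blast
  qed
  then show ?thesis using that j(1) by blast
qed

text \<open>The cluster of the lower hub joins the lower left to the upper right, that of the upper hub the upper left
  to the lower right; they meet, and the union joins bottom to top.\<close>
lemma merge_contradiction:
  assumes K: "2 * m + 3 \<le> K" and m: "m \<le> n" "1 \<le> n" and U: "1 - 1/200 \<le> UU K m (10 * a) n" and a: "1 \<le> a"
    and aJ: "nat \<lceil>3 / PH K (fillW K m org)\<rceil> * (6 * m + 6) \<le> a"
  shows False
proof -
  define J where "J = nat \<lceil>3 / PH K (fillW K m org)\<rceil>"
  have K1: "K \<ge> 1" using K by simp
  \<comment> \<open>In the coding of \<open>g8\<close>: lower left, upper right and bottom for the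
    first hub; on the next line upper left, lower right and top for the second.\<close>
  let ?G0 = "{(True, True, False), (False, False, False), (False, True, True)}"
  let ?G1 = "{(True, False, False), (False, True, False), (False, False, True)}"
  \<comment> \<open>With segments beginning \<open>10 * a\<close> from the axis of each hub and hub
    displacements at most \<open>a\<close>, the shift \<open>18 * a\<close> keeps the left ends in
    order but reverses the right ones: \<open>18 + 1 - 10 < 10\<close>.\<close>
  let ?T0 = "trial K m (10 * a) n J 0 ?G0" and ?T1 = "trial K m (10 * a) n J (18 * a) ?G1"
  \<comment> \<open>The centre is at height \<open>a\<close> because the lower hub sits at height at
    most \<open>a\<close>: its arm then still ends at or below the bottom of this square.\<close>
  define V where "V \<omega> = cn K \<omega> (lbox K (0, int a) n) {x. snd x = K * snd (0 :: int, int a) - n * K} {x. snd x = K * snd (0 :: int, int a) + n * K}" for \<omega>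
  have p0: "3/4 < PH K ?T0" "loc ?T0" unfolding J_def by (intro trial_prob[OF K1 U]; simp add: card_insert_if)+
  have p1: "3/4 < PH K ?T1" "loc ?T1" unfolding J_def by (intro trial_prob[OF K1 U]; simp add: card_insert_if)+
  have lV: "loc V" unfolding V_def by (rule loc_cn) simp
  have imp: "V \<omega>" if T: "?T0 \<omega>" "?T1 \<omega>" for \<omega>
  proof -
    obtain j where j: "j \<in> {1..J}" "\<And>i. i \<in> ?G0 \<Longrightarrow> \<exists>x\<in>gs K (tpos m 0 j) i ` RU K n (10 * a).
        reach adj4 {x \<in> lbox K (tpos m 0 j) n. wh K \<omega> x} (0, K * snd (tpos m 0 j)) x"
      using trial_hub[OF K m(1) T(1)] by blast
    obtain j' where j': "j' \<in> {1..J}" "\<And>i. i \<in> ?G1 \<Longrightarrow> \<exists>x\<in>gs K (tpos m (18 * a) j') i ` RU K n (10 * a).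
        reach adj4 {x \<in> lbox K (tpos m (18 * a) j') n. wh K \<omega> x} (0, K * snd (tpos m (18 * a) j')) x"
      using trial_hub[OF K m(1) T(2)] by blast
    define N where "N = int n * int K"
    define A where "A = int a * int K"
    define y where "y = int K * int (j * (6 * m + 6))"
    define y' where "y' = int K * int (j' * (6 * m + 6))"
    have A1: "1 \<le> A" unfolding A_def using a K1 by (simp add: mult_le_cancel_right1 flip: of_nat_mult)
    have N1: "1 \<le> N" unfolding N_def using m K1 by (simp flip: of_nat_mult)
    have yb: "0 \<le> y" "y \<le> A" "0 \<le> y'" "y' \<le> A"
    proof -
      have b: "k * (6 * m + 6) \<le> a" if "k \<in> {1..J}" for k
        using that aJ unfolding J_def[symmetric] by (meson atLeastAtMost_iff mult_le_mono1 order_trans)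
      have "int (k * (6 * m + 6)) * int K \<le> int a * int K" if "k \<in> {1..J}" for k
        using b[OF that] by (intro mult_right_mono) (simp_all only: of_nat_le_iff of_nat_0_le_iff)
      then show "y \<le> A" "y' \<le> A" using j(1) j'(1) unfolding y_def y'_def A_def by (auto simp: mult.commute)
    qed (auto simp: y_def y'_def)
    let ?D = "{- N..N} \<times> {- N..N + 19 * A}"
    define S where "S = {x \<in> ?D. wh K \<omega> x}"
    have e0: "int K * int (0 + j * (6 * m + 6)) = y" by (simp add: y_def)
    have L0: "lbox K (tpos m 0 j) n = {- N..N} \<times> {y - N..y + N}"
      unfolding lbox_eq tpos_def fst_conv snd_conv e0 by (simp add: N_def)
    have s0: "{x \<in> lbox K (tpos m 0 j) n. wh K \<omega> x} \<subseteq> S"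
      using yb A1 unfolding L0 S_def by auto
    have e18: "int K * int (18 * a + j' * (6 * m + 6)) = 18 * A + y'" by (simp add: A_def y'_def algebra_simps)
    have L1: "lbox K (tpos m (18 * a) j') n = {- N..N} \<times> {18 * A + y' - N..18 * A + y' + N}"
      unfolding lbox_eq tpos_def fst_conv snd_conv e18 by (simp add: N_def)
    have s1: "{x \<in> lbox K (tpos m (18 * a) j') n. wh K \<omega> x} \<subseteq> S"
      using yb A1 unfolding L1 S_def by auto
    let ?h = "(0, y)" and ?h' = "(0, 18 * A + y')"
    have hub: "(0, K * snd (tpos m 0 j)) = ?h" "(0, K * snd (tpos m (18 * a) j')) = ?h'"
      unfolding tpos_def snd_conv e0 e18 by (rule refl)+
    have g0: "\<exists>x\<in>gs K (tpos m 0 j) i ` RU K n (10 * a). reach adj4 S ?h x" if "i \<in> ?G0" for i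
      using j(2)[OF that] reach_mono[OF _ s0] unfolding hub by blast
    have g1: "\<exists>x\<in>gs K (tpos m (18 * a) j') i ` RU K n (10 * a). reach adj4 S ?h' x" if "i \<in> ?G1" for i
      using j'(2)[OF that] reach_mono[OF _ s1] unfolding hub by blast
    have gs0: "fst (gs K (tpos m 0 j) i x) = fst (g8 i x)" "snd (gs K (tpos m 0 j) i x) = snd (g8 i x) + y" for i x
      unfolding gs_def tpos_def fst_conv snd_conv e0 by simp_all
    have gs1: "fst (gs K (tpos m (18 * a) j') i x) = fst (g8 i x)"
      "snd (gs K (tpos m (18 * a) j') i x) = snd (g8 i x) + (18 * A + y')" for i x
      unfolding gs_def tpos_def fst_conv snd_conv e18 by simp_all
    have RUi: "x \<in> RU K n (10 * a) \<longleftrightarrow> fst x = N \<and> 10 * A \<le> snd x" for x by (simp add: RU_def N_def A_def mult.assoc)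
    have get0: "\<exists>x. reach adj4 S ?h (gs K (tpos m 0 j) i x) \<and> fst x = N \<and> 10 * A \<le> snd x" if "i \<in> ?G0" for i
      using g0[OF that] RUi by blast
    have get1: "\<exists>x. reach adj4 S ?h' (gs K (tpos m (18 * a) j') i x) \<and> fst x = N \<and> 10 * A \<le> snd x" if "i \<in> ?G1" for i
      using g1[OF that] RUi by blast
    obtain l0 where l0: "reach adj4 S ?h l0" "fst l0 = - N" "snd l0 \<le> y - 10 * A"
    proof -
      obtain x where x: "reach adj4 S ?h (gs K (tpos m 0 j) (True, True, False) x)" "fst x = N" "10 * A \<le> snd x"
        using get0[of "(True, True, False)"] by blast
      show thesis
        by (rule that[OF x(1)]) (simp_all only: gs0 g8_def Let_def fst_conv snd_conv if_True if_False, insert x(2,3), linarith+)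
    qed
    obtain r0 where r0: "reach adj4 S ?h r0" "fst r0 = N" "10 * A + y \<le> snd r0"
    proof -
      obtain x where x: "reach adj4 S ?h (gs K (tpos m 0 j) (False, False, False) x)" "fst x = N" "10 * A \<le> snd x"
        using get0[of "(False, False, False)"] by blast
      show thesis
        by (rule that[OF x(1)]) (simp_all only: gs0 g8_def Let_def fst_conv snd_conv if_True if_False, insert x(2,3), linarith+)
    qed
    obtain b0 where b0: "reach adj4 S ?h b0" "snd b0 = y - N"
    proof -
      obtain x where x: "reach adj4 S ?h (gs K (tpos m 0 j) (False, True, True) x)" "fst x = N" "10 * A \<le> snd x"
        using get0[of "(False, True, True)"] by blast
      show thesis
        by (rule that[OF x(1)]) (simp_all only: gs0 g8_def Let_def fst_conv snd_conv if_True if_False, insert x(2,3), linarith+)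
    qed
    obtain l1 where l1: "reach adj4 S ?h' l1" "fst l1 = - N" "28 * A + y' \<le> snd l1"
    proof -
      obtain x where x: "reach adj4 S ?h' (gs K (tpos m (18 * a) j') (True, False, False) x)" "fst x = N" "10 * A \<le> snd x"
        using get1[of "(True, False, False)"] by blast
      show thesis
        by (rule that[OF x(1)]) (simp_all only: gs1 g8_def Let_def fst_conv snd_conv if_True if_False, insert x(2,3), linarith+)
    qed
    obtain r1 where r1: "reach adj4 S ?h' r1" "fst r1 = N" "snd r1 \<le> 8 * A + y'"
    proof -
      obtain x where x: "reach adj4 S ?h' (gs K (tpos m (18 * a) j') (False, True, False) x)" "fst x = N" "10 * A \<le> snd x"
        using get1[of "(False, True, False)"] by blast
      show thesis
        by (rule that[OF x(1)]) (simp_all only: gs1 g8_def Let_def fst_conv snd_conv if_True if_False, insert x(2,3), linarith+)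
    qed
    obtain t1 where t1: "reach adj4 S ?h' t1" "snd t1 = N + 18 * A + y'"
    proof -
      obtain x where x: "reach adj4 S ?h' (gs K (tpos m (18 * a) j') (False, False, True) x)" "fst x = N" "10 * A \<le> snd x"
        using get1[of "(False, False, True)"] by blast
      show thesis
        by (rule that[OF x(1)]) (simp_all only: gs1 g8_def Let_def fst_conv snd_conv if_True if_False, insert x(2,3), linarith+)
    qed
    have "reach adj4 S l0 l1"
    proof (rule reach_order_flip)
      show "S \<subseteq> ?D" by (auto simp: S_def)
      show "reach adj4 S l0 r0" "reach adj4 S l1 r1"
        using l0 r0 l1 r1 reach_trans reach4_sym by blast+
      show "snd l0 < snd l1" using l0 l1 yb A1 by linarith
      show "snd r1 < snd r0" using r0 r1 yb A1 by linarith
    qed (use l0 r0 l1 r1 in auto)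
    then have "reach adj4 S b0 t1" using b0(1) l0(1) l1(1) t1(1) reach_trans reach4_sym by meson
    then obtain p q where pq: "snd p = A - N" "snd q = A + N" "reach adj4 (S \<inter> {x. A - N \<le> snd x \<and> snd x \<le> A + N}) p q"
      using reach_vclip[of S b0 t1 "A - N" "A + N"] b0(2) t1(2) yb A1 N1 by auto
    have "reach adj4 {x \<in> lbox K (0, int a) n. wh K \<omega> x} p q"
      by (rule reach_mono[OF pq(3)]) (auto simp: S_def lbox_eq N_def A_def algebra_simps)
    moreover have "snd p = K * snd (0 :: int, int a) - n * K" "snd q = K * snd (0 :: int, int a) + n * K"
      using pq(1,2) by (simp_all add: A_def N_def mult.commute)
    ultimately show ?thesis unfolding V_def cn_def crs_def by blast
  qed
  have "PH K ?T0 - PH K (\<lambda>\<omega>. \<not> ?T1 \<omega>) \<le> PH K (\<lambda>\<omega>. ?T0 \<omega> \<and> \<not> \<not> ?T1 \<omega>)"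
    by (intro prb_diff_le wtH p0(2) loc_not p1(2))
  also have "\<dots> \<le> PH K V"
    by (intro prb_mono[OF wtH] loc_conj loc_not p0(2) p1(2) lV) (use imp in blast)
  also have "\<dots> \<le> 1/2" using square_crossing_le_half[of K "(0, int a)" n] unfolding V_def by simp
  finally show False using p0(1) p1(1) prb_not[OF wtH[of K] p1(2)] by linarith
qed

end

section \<open>Decay below one half\<close>

lemma ln2: "ln (2::real) \<le> 3/4"
  using ln2_le_25_over_36 by simp

lemma convergent_subsequence:
  fixes f :: "nat \<Rightarrow> 'a::countable \<Rightarrow> real"
  assumes "\<And>n x. \<bar>f n x\<bar> \<le> 1"
  obtains r where "strict_mono (r::nat \<Rightarrow> nat)" "\<And>x. convergent (\<lambda>n. f (r n) x)"
proof -
  let ?P = "\<lambda>i s. i \<in> range (to_nat :: 'a \<Rightarrow> nat) \<longrightarrow> convergent (\<lambda>n. f (s n) (from_nat i))"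
  interpret subseqs ?P
  proof
    fix i and s :: "nat \<Rightarrow> nat" assume "strict_mono s"
    have "bounded (range (\<lambda>n. f (s n) (from_nat i)))"
      using assms by (auto simp: bounded_iff intro!: exI[of _ 1])
    then obtain l r where "strict_mono r" "((\<lambda>n. f (s n) (from_nat i)) \<circ> r) \<longlonglongrightarrow> l"
      using bounded_imp_convergent_subsequence by blast
    then show "\<exists>r'. strict_mono r' \<and> ?P i (s \<circ> r')"
      by (intro exI[of _ r]) (auto simp: convergent_def o_def)
  qed
  have "convergent (\<lambda>n. f (diagseq n) x)" for x
  proof -
    have "?P (to_nat x) (diagseq \<circ> ((+) (Suc (to_nat x))))"
    proof (rule diagseq_holds)
      fix r s :: "nat \<Rightarrow> nat" and i assume r: "strict_mono r" and P: "?P i s"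
      show "?P i (s \<circ> r)"
      proof
        assume "i \<in> range (to_nat :: 'a \<Rightarrow> nat)"
        then have "convergent (\<lambda>n. f (s n) (from_nat i))" using P by simp
        then have "convergent ((\<lambda>n. f (s n) (from_nat i)) \<circ> r)" by (rule convergent_subseq_convergent[OF _ r])
        then show "convergent (\<lambda>n. f ((s \<circ> r) n) (from_nat i))" by (simp add: o_def)
      qed
    qed
    then have "convergent (\<lambda>n. f (diagseq (n + Suc (to_nat x))) x)" by (simp add: o_def add.commute)
    then show ?thesis
      using convergent_ignore_initial_segment[of "\<lambda>n. f (diagseq n) x" "Suc (to_nat x)"] by (simp only:)
  qed
  then show ?thesis using that subseq_diagseq by blast
qed

text \<open>Applied to the sequence \<open>x (Suc k) = B * exp (x k) / 2 ^ (k + 2)\<close>, it shows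
  that the terms at least double. A quarter of the exponent beats the linear factor, and the
  remaining three quarters beat \<open>2 ^ k\<close> because \<open>ln 2 \<le> 3/4\<close>.\<close>

lemma exp_beats_linear:
  fixes B :: real
  assumes "B > 0"
  shows "\<exists>X\<ge>1. \<forall>x\<ge>X. \<forall>k. real k \<le> x \<longrightarrow> 2 * x \<le> B * exp x / 2 ^ (k + 2)"
proof -
  define X0 where "X0 = 256 / B"
  have "2 * x \<le> B * exp x / 2 ^ (k + 2)" if x: "x \<ge> max 1 X0" "real k \<le> x" for x k
  proof -
    have "256 \<le> B * x" using x assms by (simp add: X0_def field_simps)
    then have "256 * x \<le> B * x * x" using x by (intro mult_right_mono) auto
    moreover have "B * (((1/4) * x)\<^sup>2 / 2) \<le> B * exp ((1/4) * x)"
    proof (intro mult_left_mono)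
      show "((1/4) * x)\<^sup>2 / 2 \<le> exp ((1/4) * x)"
        using exp_lower_Taylor_quadratic[of "(1/4) * x"] x by linarith
    qed (use assms in simp)
    ultimately have a: "8 * x \<le> B * exp ((1/4) * x)" by (simp add: power2_eq_square)
    have "(2::real) ^ k = exp (real k * ln 2)" by (simp add: exp_of_nat_mult)
    also have "\<dots> \<le> exp ((3/4) * x)"
    proof -
      have "ln (2::real) \<le> 3/4" using ln2 by simp
      then have "real k * ln 2 \<le> x * (3/4)" using x by (intro mult_mono) auto
      then show ?thesis by simp
    qed
    finally have k: "(2::real) ^ k \<le> exp ((3/4) * x)" .
    have "8 * x * 2 ^ k \<le> B * exp ((1/4) * x) * exp ((3/4) * x)"
      using x assms by (intro mult_mono[OF a k]) auto
    also have "\<dots> = B * exp x" by (simp add: mult.assoc exp_add[symmetric])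
    finally have "8 * x * 2 ^ k \<le> B * exp x" .
    then show ?thesis by (simp add: field_simps)
  qed
  then show ?thesis by (intro exI[of _ "max 1 X0"]) auto
qed

text \<open>Feeding the bound on the partial sums of \<open>T k\<close> into \<open>step\<close> makes \<open>S k n / n\<close> decrease like an iterated
  exponential in \<open>k\<close>, while the scale from which this holds grows much more slowly.\<close>
lemma tower_contradiction:
  fixes T :: "nat \<Rightarrow> nat \<Rightarrow> real" and B c :: real
  defines "S \<equiv> \<lambda>k n. \<Sum>j\<le>n. T k j"
  assumes T: "\<And>k n. 0 \<le> T k n" "\<And>k n. T k n \<le> 1" "\<And>k n. T (Suc k) n \<le> T k n" "\<And>k. T k 0 = 1"
    and T0: "(\<lambda>n. T 0 n) \<longlonglongrightarrow> 0"
    and B: "B > 0" and c: "c > 0"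
    and step: "\<And>k n. n \<ge> 1 \<Longrightarrow> T k n < 1/2 \<Longrightarrow> T (Suc k) n \<le> exp (- (B / 2 ^ k * real n / S k n))"
    and low: "\<And>k n. n \<ge> N0 \<Longrightarrow> n \<ge> 1 \<Longrightarrow> T k n < 1/2 \<Longrightarrow> c / real n \<le> exp (- (B * real n / S k n))"
  shows False
proof -
  have S1: "1 \<le> S k n" for k n
  proof -
    have "T k 0 \<le> S k n" unfolding S_def using T by (intro member_le_sum) auto
    then show ?thesis using T(4) by simp
  qed
  obtain X where X: "X \<ge> 1" "\<And>x k. x \<ge> X \<Longrightarrow> real k \<le> x \<Longrightarrow> 2 * x \<le> B * exp x / 2 ^ (k + 2)"
    using exp_beats_linear[OF B] by blast
  \<comment> \<open>Chosen so that \<open>x 0 = X\<close> below, the point from which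
    \<open>X(2)\<close> applies.\<close>
  define e0 where "e0 = B / X"
  have e0: "e0 > 0" using B X by (simp add: e0_def)
  obtain n1 where n1: "\<And>n. n \<ge> n1 \<Longrightarrow> T 0 n < min (1/2) (e0 / 2)"
  proof -
    have "eventually (\<lambda>n. T 0 n < min (1/2) (e0 / 2)) sequentially"
      using T0 e0 by (intro order_tendstoD(2)[OF T0]) auto
    then show ?thesis using that by (auto simp: eventually_sequentially)
  qed
  \<comment> \<open>Beyond \<open>n0\<close> the first \<open>n1 + 1\<close> terms contribute at
    most half of the bound \<open>e0 * n\<close>.\<close>
  define n0 where "n0 = max (max 1 N0) (max n1 (nat \<lceil>2 * real (n1 + 1) / e0\<rceil>))"
  have n0: "n0 \<ge> 1" "n0 \<ge> N0" "n0 \<ge> n1" "real n0 * e0 \<ge> 2 * real (n1 + 1)"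
  proof -
    have "2 * real (n1 + 1) / e0 \<le> real (nat \<lceil>2 * real (n1 + 1) / e0\<rceil>)" by (rule real_nat_ceiling_ge)
    also have "\<dots> \<le> real n0"
      unfolding n0_def by (intro of_nat_mono max.coboundedI2 order_refl)
    finally show "real n0 * e0 \<ge> 2 * real (n1 + 1)" using e0 by (simp add: field_simps)
  qed (auto simp: n0_def)
  have split: "S k n \<le> real a + real n * d" if d: "\<And>j. j \<ge> a \<Longrightarrow> T k j \<le> d" "0 \<le> d" "1 \<le> a" for k n a d
  proof -
    have "S k n \<le> (\<Sum>j\<le>n. of_bool (j < a) + (if 1 \<le> j then d else 0))"
      unfolding S_def
    proof (rule sum_mono)
      fix j
      show "T k j \<le> of_bool (j < a) + (if 1 \<le> j then d else 0)"
      proof (cases "j < a")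
        case True
        then show ?thesis using T(2)[of k j] d(2) by (auto intro: order_trans)
      next
        case False
        then show ?thesis using d(1)[of j] d(3) by auto
      qed
    qed
    also have "\<dots> = (\<Sum>j\<le>n. of_bool (j < a)) + (\<Sum>j\<le>n. if 1 \<le> j then d else 0)" by (rule sum.distrib)
    also have "(\<Sum>j\<le>n. if 1 \<le> j then d else 0) = real n * d"
    proof -
      have "(\<Sum>j\<le>n. if 1 \<le> j then d else 0) = (\<Sum>j\<in>{1..n}. d)"
        by (rule sum.mono_neutral_cong_right) auto
      then show ?thesis by simp
    qed
    also have "(\<Sum>j\<le>n. of_bool (j < a)) \<le> real a"
    proof -
      have "(\<Sum>j\<le>n. of_bool (j < a) :: real) = (\<Sum>j\<in>{j. j \<le> n \<and> j < a}. 1)"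
        by (rule sum.mono_neutral_cong_right) auto
      also have "\<dots> = real (card {j. j \<le> n \<and> j < a})" by simp
      also have "\<dots> \<le> real (card {..<a})" by (simp only: of_nat_le_iff) (intro card_mono, auto)
      finally show ?thesis by simp
    qed
    finally show ?thesis by simp
  qed
  \<comment> \<open>\<open>e k\<close> bounds \<open>S k n / n\<close> for
    \<open>n \<ge> N k\<close>. Inserted into \<open>step\<close> it gives
    \<open>T (Suc k) n \<le> exp (- x k)\<close> with \<open>x k = B / (2 ^ k * e k)\<close>; the
    factor 2 pays for the terms before \<open>N k\<close>.\<close>
  define e where "e = rec_nat e0 (\<lambda>k ek. 2 * exp (- (B / (2 ^ k * ek))))"
  have eS: "e (Suc k) = 2 * exp (- (B / (2 ^ k * e k)))" and ez: "e 0 = e0" for k by (simp_all add: e_def)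
  have epos: "e k > 0" for k by (cases k) (simp_all add: ez e0 eS)
  \<comment> \<open>Beyond \<open>N k * (2 / e (Suc k))\<close> the initial \<open>N k\<close>
    terms, each at most 1, are at most half of \<open>e (Suc k) * n\<close>.\<close>
  define N where "N = rec_nat n0 (\<lambda>k nk. nk * nat \<lceil>2 / e (Suc k)\<rceil>)"
  have NS: "N (Suc k) = N k * nat \<lceil>2 / e (Suc k)\<rceil>" and Nz: "N 0 = n0" for k by (simp_all add: N_def)
  define x where "x k = B / (2 ^ k * e k)" for k
  have xpos: "x k > 0" for k using B epos by (simp add: x_def)
  have eSx: "e (Suc k) = 2 * exp (- x k)" for k by (simp add: eS x_def)
  have xS: "x (Suc k) = B * exp (x k) / 2 ^ (k + 2)" for k
    unfolding x_def[of "Suc k"] eSx by (simp add: exp_minus field_simps)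
  have ceil1: "1 \<le> nat \<lceil>2 / e (Suc k)\<rceil>" for k
  proof -
    have "0 < 2 / e (Suc k)" using epos by simp
    then have "0 < \<lceil>2 / e (Suc k)\<rceil>" by (simp only: zero_less_ceiling)
    then show ?thesis by linarith
  qed
  have Nmono: "N k \<le> N (Suc k)" for k using ceil1[of k] unfolding NS by simp
  have Nn0: "n0 \<le> N k" for k
  proof (induction k)
    case (Suc k) then show ?case using Nmono[of k] by linarith
  qed (simp add: Nz)
  have N1: "1 \<le> N k" for k using Nn0[of k] n0(1) by linarith
  have Thalf: "T k n < 1/2" if "n \<ge> n0" for k n
  proof -
    have "T k n \<le> T 0 n" 
    proof (induction k)
      case (Suc k) then show ?case using T(3)[of k n] by linarith
    qed simp
    then show ?thesis using n1[of n] that n0(3) by simp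
  qed
  have inv: "S k n \<le> e k * real n" if "n \<ge> N k" for k n
    using that
  proof (induction k arbitrary: n)
    case 0
    have "S 0 n \<le> real (n1 + 1) + real n * (e0 / 2)"
    proof (rule split)
      show "T 0 j \<le> e0 / 2" if "j \<ge> n1 + 1" for j using n1[of j] that by simp
    qed (use e0 in auto)
    moreover have "real (n1 + 1) \<le> real n * (e0 / 2)"
    proof -
      have "real n0 * e0 \<le> real n * e0" using 0 Nz e0 by (intro mult_right_mono) auto
      then show ?thesis using n0(4) by simp
    qed
    ultimately show ?case by (simp add: ez algebra_simps)
  next
    case (Suc k)
    have t: "T (Suc k) j \<le> e (Suc k) / 2" if j: "j \<ge> N k" for j
    proof -
      have j1: "j \<ge> 1" using j N1[of k] by linarith
      have "T (Suc k) j \<le> exp (- (B / 2 ^ k * real j / S k j))"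
        using step[OF j1 Thalf] j Nn0[of k] by auto
      also have "\<dots> \<le> exp (- x k)"
      proof -
        have "S k j \<le> e k * real j" by (rule Suc.IH[OF j])
        then have "1 / e k \<le> real j / S k j" using epos[of k] S1[of k j] by (simp add: field_simps)
        then have "B / 2 ^ k * (1 / e k) \<le> B / 2 ^ k * (real j / S k j)" using B by (intro mult_left_mono) auto
        then show ?thesis by (simp add: x_def)
      qed
      finally show ?thesis by (simp add: eSx)
    qed
    have "S (Suc k) n \<le> real (N k) + real n * (e (Suc k) / 2)"
      using t epos[of "Suc k"] N1[of k] by (intro split) auto
    moreover have "real (N k) \<le> real n * (e (Suc k) / 2)"
    proof -
      have "real (N k) * (2 / e (Suc k)) \<le> real (N k) * real (nat \<lceil>2 / e (Suc k)\<rceil>)"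
        by (intro mult_left_mono real_nat_ceiling_ge) auto
      also have "\<dots> \<le> real n" using Suc.prems unfolding NS by (simp only: of_nat_mult[symmetric] of_nat_le_iff)
      finally show ?thesis using epos[of "Suc k"] by (simp add: field_simps)
    qed
    ultimately show ?case by (simp add: algebra_simps)
  qed
  have lnN: "ln (real (N (Suc k))) \<le> ln (real (N k)) + (1 + x k)" for k
  proof -
    have e2: "e (Suc k) \<le> 2" using xpos[of k] by (simp add: eSx)
    have "0 < 2 / e (Suc k)" using epos[of "Suc k"] by simp
    then have "real (nat \<lceil>2 / e (Suc k)\<rceil>) \<le> 2 / e (Suc k) + 1" by linarith
    also have "\<dots> \<le> 4 / e (Suc k)" using e2 epos[of "Suc k"] by (simp add: field_simps)
    finally have "ln (real (nat \<lceil>2 / e (Suc k)\<rceil>)) \<le> ln (4 / e (Suc k))"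
      using ceil1[of k] epos[of "Suc k"] by (subst ln_le_cancel_iff) auto
    also have "4 / e (Suc k) = 2 * exp (x k)" by (simp add: eSx exp_minus field_simps)
    also have "ln (2 * exp (x k)) = ln 2 + x k" by (simp add: ln_mult)
    also have "\<dots> \<le> 1 + x k" using ln2 by simp
    finally show ?thesis
      unfolding NS of_nat_mult using N1[of k] ceil1[of k] by (subst ln_mult) auto
  qed
  have xgrow: "X + real k \<le> x k \<and> (k > 0 \<longrightarrow> 2 * x (k - 1) \<le> x k)" for k
  proof (induction k)
    case 0
    then show ?case using B X by (simp add: x_def ez e0_def)
  next
    case (Suc k)
    then have "2 * x k \<le> x (Suc k)" unfolding xS using X by (intro X(2)) auto
    then show ?case using Suc X by simp
  qed
  have xdouble: "2 * x k \<le> x (Suc k)" for k using xgrow[of "Suc k"] by simp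
  \<comment> \<open>Since the \<open>x k\<close> double, the sum of all of them is at most twice the
    last, so \<open>ln (N (Suc k))\<close> is only linear in \<open>x k\<close>.\<close>
  have lnb: "ln (real (N (Suc k))) \<le> ln (real n0) + real (k + 1) + 2 * x k" for k
  proof (induction k)
    case 0
    then show ?case using lnN[of 0] xpos[of 0] by (simp add: Nz)
  next
    case (Suc k)
    then show ?case using lnN[of "Suc k"] xdouble[of k] by simp
  qed
  \<comment> \<open>At \<open>n = N (Suc k)\<close> the assumption \<open>low\<close> forces
    \<open>B / e (Suc k)\<close>, exponential in \<open>x k\<close>, below
    \<open>ln n - ln c\<close>, linear in \<open>x k\<close>. As \<open>x k\<close> is unbounded,
    this fails for large \<open>k\<close>.\<close>
  have key: "B * exp (x k) / 2 \<le> ln (real n0) - ln c + 1 + 3 * x k" for k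
  proof -
    let ?n = "N (Suc k)"
    have n: "?n \<ge> n0" "?n \<ge> 1" "?n \<ge> N0" using Nn0[of "Suc k"] N1[of "Suc k"] n0(2) by auto
    have "c / real ?n \<le> exp (- (B * real ?n / S (Suc k) ?n))" by (rule low[OF n(3,2) Thalf[OF n(1)]])
    also have "\<dots> \<le> exp (- (B / e (Suc k)))"
    proof -
      have "S (Suc k) ?n \<le> e (Suc k) * real ?n" by (rule inv) simp
      then have "1 / e (Suc k) \<le> real ?n / S (Suc k) ?n" using epos[of "Suc k"] S1[of "Suc k" ?n] by (simp add: field_simps)
      then have "B * (1 / e (Suc k)) \<le> B * (real ?n / S (Suc k) ?n)" using B by (intro mult_left_mono) auto
      then show ?thesis by simp
    qed
    finally have "ln (c / real ?n) \<le> ln (exp (- (B / e (Suc k))))"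
      using c n by (subst ln_le_cancel_iff) auto
    then have "ln (c / real ?n) \<le> - (B / e (Suc k))" by (simp only: ln_exp)
    then have "B / e (Suc k) \<le> ln (real ?n) - ln c" using c n by (simp add: ln_div)
    moreover have "B / e (Suc k) = B * exp (x k) / 2" by (simp add: eSx exp_minus field_simps)
    moreover have "ln (real ?n) \<le> ln (real n0) + real (k + 1) + 2 * x k" by (rule lnb)
    moreover have "real k \<le> x k" using xgrow[of k] X(1) by simp
    ultimately show ?thesis by simp
  qed
  define Z where "Z = ln (real n0) - ln c + 1"
  define t0 where "t0 = max 1 (4 * (\<bar>Z\<bar> + 4) / B)"
  have t0: "Z + 1 \<le> B * exp t / 2 - 3 * t" if t: "t \<ge> t0" for t
  proof -
    have t1: "1 \<le> t" "4 * (\<bar>Z\<bar> + 4) \<le> B * t" using t B by (auto simp: t0_def field_simps)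
    have "B * (t\<^sup>2 / 2) \<le> B * exp t"
      using exp_lower_Taylor_quadratic[of t] t1 B by (intro mult_left_mono) auto
    then have h: "B * (t\<^sup>2 / 2) / 2 - 3 * t \<le> B * exp t / 2 - 3 * t" by (intro diff_right_mono divide_right_mono) auto
    have "Z \<le> \<bar>Z\<bar>" by (rule abs_ge_self)
    then have h3: "Z + 1 \<le> B * t / 4 - 3" using t1(2) by (simp add: field_simps)
    have h4: "3 \<le> B * t / 4" using t1(2) abs_ge_zero[of Z] by (simp add: field_simps)
    have "1 * (B * t / 4 - 3) \<le> t * (B * t / 4 - 3)" using t1(1) h4 by (intro mult_right_mono) auto
    also have "t * (B * t / 4 - 3) = B * (t\<^sup>2 / 2) / 2 - 3 * t" by (simp add: power2_eq_square field_simps)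
    also note h
    finally show ?thesis using h3 by (simp only: mult_1)
  qed
  obtain k :: nat where "t0 \<le> real k" using real_arch_simple by blast
  then have "t0 \<le> x k" using xgrow[of k] X(1) by simp
  then show False using t0[of "x k"] key[of k] unfolding Z_def by simp
qed


lemma scaled_exp_small:
  fixes a b c \<epsilon> :: real
  assumes "a > 0" "\<epsilon> > 0"
  shows "\<exists>n0. \<forall>n\<ge>n0. c * exp (b - a * real n) \<le> \<epsilon>"
proof -
  have "(\<lambda>n. (c * exp b) * exp (- a) ^ n) \<longlonglongrightarrow> (c * exp b) * 0"
    using assms by (intro tendsto_mult tendsto_const LIMSEQ_realpow_zero) auto
  then have "eventually (\<lambda>n. (c * exp b) * exp (- a) ^ n < \<epsilon>) sequentially"
    using assms by (intro order_tendstoD(2)) auto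
  moreover have "(c * exp b) * exp (- a) ^ n = c * exp (b - a * real n)" for n
  proof -
    have "exp (b - a * real n) = exp (b + real n * - a)" by (simp add: algebra_simps)
    then show ?thesis by (simp only: exp_add exp_of_nat_mult mult.assoc)
  qed
  ultimately show ?thesis by (auto simp: eventually_sequentially intro: less_imp_le)
qed

section \<open>Limits in \<open>K\<close>, vanishing at one half and decay below it\<close>

context planar_metric
begin

text \<open>The limits \<open>Ab\<close> and \<open>Ub\<close> inherit the inequalities that hold
  for each large \<open>K\<close>. Working with limits allows \<open>n\<close> to grow without bound
  at fixed \<open>m\<close>, \<open>c\<close> and \<open>\<alpha>\<close>; only the final
  contradiction returns to one large finite \<open>K\<close>.\<close>

lemma arm_limit_zero:
  assumes \<kappa>: "strict_mono (\<kappa> :: nat \<Rightarrow> nat)"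
    and Ab: "\<And>m n. (\<lambda>j. PH (\<kappa> j) (\<lambda>\<omega>. arm (\<kappa> j) \<omega> org m n)) \<longlonglongrightarrow> Ab m n"
    and Ub: "\<And>m \<alpha> n. (\<lambda>j. UU (\<kappa> j) m \<alpha> n) \<longlonglongrightarrow> Ub m \<alpha> n"
  shows "(\<lambda>n. Ab 1 n) \<longlonglongrightarrow> 0"
proof -
  have \<kappa>j: "j \<le> \<kappa> j" for j by (rule strict_mono_imp_increasing[OF \<kappa>])
  have A0: "0 \<le> Ab m n" and A1: "Ab m n \<le> 1" for m n
  proof -
    show "0 \<le> Ab m n"
      by (rule limit_le_of_eventually[OF tendsto_const Ab, of 0]) (simp add: prb_nonneg wtH)
    show "Ab m n \<le> 1"
      by (rule limit_le_of_eventually[OF Ab tendsto_const, of 0]) (simp add: prb_le_1 wtH loc_arm)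
  qed
  have Aanti: "Ab m n' \<le> Ab m n" if le: "m \<le> n" "n \<le> n'" for m n n'
    by (rule limit_le_of_eventually[OF Ab Ab, of 0])
      (use le in \<open>intro prb_mono wtH loc_arm; blast intro: arm_antimono\<close>)
  obtain C where C: "C > 0" "\<And>s v U k. finite U \<Longrightarrow> (\<forall>u\<in>U. k \<le> sd u v) \<Longrightarrow>
     (\<Sum>u\<in>U. exp (- (1/4) * real ((sd u v - s) div 3))) \<le> C * exp (real s / 12 - real k / 24)"
    using hole_sum by blast
  have dec: "decseq (\<lambda>n. Ab 1 (Suc n))" unfolding decseq_def by (auto intro: Aanti)
  obtain L where L: "(\<lambda>n. Ab 1 (Suc n)) \<longlonglongrightarrow> L" "\<And>n. L \<le> Ab 1 (Suc n)"
    using decseq_convergent[OF dec, of 0] A0 that by blast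
  have L0: "0 \<le> L" by (rule LIMSEQ_le_const[OF L(1)]) (use A0 in auto)
  have "\<not> 0 < L"
  proof
    assume Lpos: "0 < L"
    have zo: "\<exists>m\<ge>1. \<forall>n\<ge>m. 1 - \<eta> \<le> Ab m n" if \<eta>: "0 < \<eta>" for \<eta> :: real
    proof -
      \<comment> \<open>The margin \<open>\<eta> * L / 8\<close> is smaller than
        \<open>(L / 2) * (\<eta> / 2)\<close>, the drop that \<open>arm_zero_one\<close> would
        enforce if the box were not well connected.\<close>
      have "eventually (\<lambda>n. Ab 1 (Suc n) < L + \<eta> * L / 8) sequentially"
        using Lpos \<eta> by (intro order_tendstoD(2)[OF L(1)]) auto
      then obtain M0 where M0: "Ab 1 (Suc M0) < L + \<eta> * L / 8" by (auto simp: eventually_sequentially)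
      define M where "M = Suc M0"
      have M1: "1 \<le> M" by (simp add: M_def)
      obtain r1 where r1: "\<And>r. r \<ge> r1 \<Longrightarrow> real ((2 * M + 1) * (2 * M + 1)) * exp (0 - (1/2) * real r) \<le> L / 2"
        using scaled_exp_small[of "1/2" "L / 2" "real ((2 * M + 1) * (2 * M + 1))" 0] Lpos by auto
      obtain r2 where r2: "\<And>r. r \<ge> r2 \<Longrightarrow> C * exp (1/6 - (1/12) * real r) \<le> \<eta> / 2"
        using scaled_exp_small[of "1/12" "\<eta> / 2" C "1/6"] \<eta> by auto
      define r where "r = max r1 r2"
      define N where "N = M + 3 * r + 1"
      define e1 where "e1 = real ((2 * M + 1) * (2 * M + 1)) * exp (- (1/2) * real r)"
      have e1: "e1 \<le> L / 2" using r1[of r] by (simp add: e1_def r_def)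
      have h: "C * exp (1/6 - real N / 12) \<le> \<eta> / 2" using r2[of N] by (simp add: N_def r_def)
      have LM: "L \<le> Ab 1 M" using L(2)[of M0] by (simp add: M_def)
      have "1 - \<eta> \<le> Ab (4 * N + 1) n" if n: "n \<ge> 4 * N + 1" for n
      proof -
        have "eventually (\<lambda>j. e1 < PH (\<kappa> j) (\<lambda>\<omega>. arm (\<kappa> j) \<omega> org 1 M)) sequentially"
          using e1 LM Lpos by (intro order_tendstoD(1)[OF Ab]) auto
        then obtain J where J: "\<And>j. j \<ge> J \<Longrightarrow> e1 < PH (\<kappa> j) (\<lambda>\<omega>. arm (\<kappa> j) \<omega> org 1 M)"
          by (auto simp: eventually_sequentially)
        have ineq: "(Ab 1 M - e1) * (1 - Ab (4 * N + 1) n - C * exp (1/6 - real N / 12)) \<le> Ab 1 M - Ab 1 n"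
        proof (rule limit_le_of_eventually[of _ _ _ _ "max J 1"])
          show "(\<lambda>j. (PH (\<kappa> j) (\<lambda>\<omega>. arm (\<kappa> j) \<omega> org 1 M) - e1) *
              (1 - PH (\<kappa> j) (\<lambda>\<omega>. arm (\<kappa> j) \<omega> org (4 * N + 1) n) - C * exp (1/6 - real N / 12)))
            \<longlonglongrightarrow> (Ab 1 M - e1) * (1 - Ab (4 * N + 1) n - C * exp (1/6 - real N / 12))"
            by (intro tendsto_intros Ab)
          show "(\<lambda>j. PH (\<kappa> j) (\<lambda>\<omega>. arm (\<kappa> j) \<omega> org 1 M) - PH (\<kappa> j) (\<lambda>\<omega>. arm (\<kappa> j) \<omega> org 1 n))
            \<longlonglongrightarrow> Ab 1 M - Ab 1 n" by (intro tendsto_intros Ab)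
          fix j assume j: "j \<ge> max J 1"
          have K1: "\<kappa> j \<ge> 1" using j \<kappa>j[of j] by simp
          have nn: "4 * (M + 3 * r + 1) < n" using n by (simp add: N_def)
          have ee: "real ((2 * M + 1) * (2 * M + 1)) * exp (- (1/2) * real r) \<le> PH (\<kappa> j) (\<lambda>\<omega>. arm (\<kappa> j) \<omega> org 1 M)"
            using J[of j] j unfolding e1_def by simp
          show "(PH (\<kappa> j) (\<lambda>\<omega>. arm (\<kappa> j) \<omega> org 1 M) - e1) *
              (1 - PH (\<kappa> j) (\<lambda>\<omega>. arm (\<kappa> j) \<omega> org (4 * N + 1) n) - C * exp (1/6 - real N / 12))
             \<le> PH (\<kappa> j) (\<lambda>\<omega>. arm (\<kappa> j) \<omega> org 1 M) - PH (\<kappa> j) (\<lambda>\<omega>. arm (\<kappa> j) \<omega> org 1 n)"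
            unfolding e1_def N_def by (rule arm_zero_one[OF K1 nn C(2) M1 ee])
        qed
        have Ln: "L \<le> Ab 1 n" using L(2)[of "n - 1"] n by simp
        show ?thesis
        proof (rule ccontr)
          assume "\<not> ?thesis"
          then have "\<eta> / 2 \<le> 1 - Ab (4 * N + 1) n - C * exp (1/6 - real N / 12)" using h by linarith
          then have "(L / 2) * (\<eta> / 2) \<le> (Ab 1 M - e1) * (1 - Ab (4 * N + 1) n - C * exp (1/6 - real N / 12))"
            using e1 LM Lpos \<eta> by (intro mult_mono) auto
          then have "(L / 2) * (\<eta> / 2) \<le> Ab 1 M - L" using ineq Ln by linarith
          also have "\<dots> < \<eta> * L / 8" using M0 by (simp add: M_def)
          finally show False using mult_pos_pos[OF \<eta> Lpos] by (simp add: mult.commute)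
        qed
      qed
      then show ?thesis by (intro exI[of _ "4 * N + 1"]) auto
    qed
    \<comment> \<open>The tolerance required by \<open>merge_contradiction\<close>. Its eighth power
      bounds the avoidance of all eight segments from below; the two errors take a quarter of it
      each and leave half.\<close>
    define \<epsilon> where "\<epsilon> = (1/200 :: real)"
    have \<epsilon>: "0 < \<epsilon>" by (simp add: \<epsilon>_def)
    have e8: "0 < \<epsilon> ^ 8" using \<epsilon> by (rule zero_less_power)
    obtain m where m: "m \<ge> 1" "\<And>n. n \<ge> m \<Longrightarrow> 1 - \<epsilon> ^ 8 / 4 \<le> Ab m n" using zo[of "\<epsilon> ^ 8 / 4"] e8 by auto
    \<comment> \<open>Fixed before \<open>n\<close> and \<open>K\<close>:
      \<open>kap m * kap m\<close> bounds the fill probability for all \<open>K\<close>, so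
      \<open>a\<close> exceeds the height of every trial position.\<close>
    define a where "a = nat \<lceil>3 / (kap m * kap m)\<rceil> * (6 * m + 6) + 1"
    define \<alpha> where "\<alpha> = 10 * a"
    obtain c where c: "4 * C * exp (real (3 * \<alpha> + 3 + 2) / 12 - (1/24) * real c) \<le> \<epsilon> ^ 8 / 4"
      using scaled_exp_small[of "1/24" "\<epsilon> ^ 8 / 4" "4 * C" "real (3 * \<alpha> + 3 + 2) / 12"] e8 by auto
    have "\<exists>n\<ge>m. 1 - \<epsilon> < Ub m \<alpha> n"
    proof (rule ccontr)
      assume "\<not> ?thesis"
      then have no: "\<And>n. n \<ge> m \<Longrightarrow> Ub m \<alpha> n \<le> 1 - \<epsilon>" by (auto simp: not_less)
      define \<delta> where "\<delta> = \<epsilon> ^ 8 / 2 * kap \<alpha> ^ 8"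
      have \<delta>: "\<delta> > 0" using e8 kap_bounds[of \<alpha>] by (simp add: \<delta>_def)
      \<comment> \<open>Iterating this fixed drop would make a probability negative, so
        \<open>Ub m \<alpha> n\<close> must exceed \<open>1 - \<epsilon>\<close> for some
        \<open>n\<close>.\<close>
      have drop: "Ab m n \<le> Ab m (n - c) - \<delta>" if n: "n \<ge> m + c" for n
      proof -
        have "((1 - Ub m \<alpha> n) ^ 8 - (1 - Ab m (n - c)) - 4 * (C * exp (real (3 * \<alpha> + 3 + 2) / 12 - real c / 24))) * kap \<alpha> ^ 8
          \<le> Ab m (n - c) - Ab m n"
        proof (rule limit_le_of_eventually[of _ _ _ _ 1])
          show "(\<lambda>j. ((1 - UU (\<kappa> j) m \<alpha> n) ^ 8 - (1 - PH (\<kappa> j) (\<lambda>\<omega>. arm (\<kappa> j) \<omega> org m (n - c)))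
              - 4 * (C * exp (real (3 * \<alpha> + 3 + 2) / 12 - real c / 24))) * kap \<alpha> ^ 8)
            \<longlonglongrightarrow> ((1 - Ub m \<alpha> n) ^ 8 - (1 - Ab m (n - c)) - 4 * (C * exp (real (3 * \<alpha> + 3 + 2) / 12 - real c / 24))) * kap \<alpha> ^ 8"
            by (intro tendsto_intros Ab Ub)
          show "(\<lambda>j. PH (\<kappa> j) (\<lambda>\<omega>. arm (\<kappa> j) \<omega> org m (n - c)) - PH (\<kappa> j) (\<lambda>\<omega>. arm (\<kappa> j) \<omega> org m n))
            \<longlonglongrightarrow> Ab m (n - c) - Ab m n" by (intro tendsto_intros Ab)
          fix j :: nat assume "1 \<le> j"
          then have K1: "\<kappa> j \<ge> 1" using \<kappa>j[of j] by simp
          have n': "c \<le> n" "m \<le> n - c" using n by auto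
          show "((1 - UU (\<kappa> j) m \<alpha> n) ^ 8 - (1 - PH (\<kappa> j) (\<lambda>\<omega>. arm (\<kappa> j) \<omega> org m (n - c)))
              - 4 * (C * exp (real (3 * \<alpha> + 3 + 2) / 12 - real c / 24))) * kap \<alpha> ^ 8
            \<le> PH (\<kappa> j) (\<lambda>\<omega>. arm (\<kappa> j) \<omega> org m (n - c)) - PH (\<kappa> j) (\<lambda>\<omega>. arm (\<kappa> j) \<omega> org m n)"
            by (rule kill_inequality[OF K1 n' C(2)])
        qed
        moreover have "\<epsilon> ^ 8 / 2 * kap \<alpha> ^ 8 \<le> ((1 - Ub m \<alpha> n) ^ 8 - (1 - Ab m (n - c)) - 4 * (C * exp (real (3 * \<alpha> + 3 + 2) / 12 - real c / 24))) * kap \<alpha> ^ 8"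
        proof (rule mult_right_mono)
          have "\<epsilon> ^ 8 \<le> (1 - Ub m \<alpha> n) ^ 8" using no[of n] n \<epsilon> by (intro power_mono) auto
          moreover have "1 - \<epsilon> ^ 8 / 4 \<le> Ab m (n - c)" using m(2)[of "n - c"] n by simp
          moreover have "4 * (C * exp (real (3 * \<alpha> + 3 + 2) / 12 - real c / 24)) \<le> \<epsilon> ^ 8 / 4" using c by (simp add: mult.assoc)
          ultimately show "\<epsilon> ^ 8 / 2 \<le> (1 - Ub m \<alpha> n) ^ 8 - (1 - Ab m (n - c)) - 4 * (C * exp (real (3 * \<alpha> + 3 + 2) / 12 - real c / 24))"
            by linarith
        qed (use kap_bounds[of \<alpha>] in simp)
        ultimately show ?thesis unfolding \<delta>_def by linarith
      qed
      have it: "Ab m (m + k * c) \<le> 1 - real k * \<delta>" for k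
      proof (induction k)
        case 0 then show ?case using A1 by simp
      next
        case (Suc k)
        have "Ab m (m + Suc k * c) \<le> Ab m (m + Suc k * c - c) - \<delta>" by (rule drop) simp
        moreover have "m + Suc k * c - c = m + k * c" by simp
        ultimately show ?case using Suc by (simp add: algebra_simps)
      qed
      obtain k :: nat where "2 / \<delta> \<le> real k" using real_arch_simple by blast
      then have "2 \<le> real k * \<delta>" using \<delta> by (simp add: field_simps)
      then show False using it[of k] A0[of m "m + k * c"] by linarith
    qed
    then obtain n where n: "n \<ge> m" "1 - \<epsilon> < Ub m \<alpha> n" by blast
    have "eventually (\<lambda>j. 1 - \<epsilon> < UU (\<kappa> j) m \<alpha> n) sequentially"
      using n(2) by (intro order_tendstoD(1)[OF Ub])
    then obtain J where J: "\<And>j. j \<ge> J \<Longrightarrow> 1 - \<epsilon> < UU (\<kappa> j) m \<alpha> n" by (auto simp: eventually_sequentially)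
    define j where "j = J + 2 * m + 3"
    have Kj: "2 * m + 3 \<le> \<kappa> j" using \<kappa>j[of j] by (simp add: j_def)
    have K1: "\<kappa> j \<ge> 1" using Kj by simp
    have U: "1 - 1/200 \<le> UU (\<kappa> j) m (10 * a) n" using J[of j] by (simp add: j_def \<epsilon>_def \<alpha>_def)
    have f: "kap m * kap m \<le> PH (\<kappa> j) (fillW (\<kappa> j) m org)" by (rule PH_fillW(2)[OF K1])
    have kk: "0 < kap m * kap m" using kap_bounds[of m] by simp
    have "3 / PH (\<kappa> j) (fillW (\<kappa> j) m org) \<le> 3 / (kap m * kap m)" using f kk by (intro divide_left_mono) auto
    then have "nat \<lceil>3 / PH (\<kappa> j) (fillW (\<kappa> j) m org)\<rceil> \<le> nat \<lceil>3 / (kap m * kap m)\<rceil>"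
      by (intro nat_mono ceiling_mono)
    then have "nat \<lceil>3 / PH (\<kappa> j) (fillW (\<kappa> j) m org)\<rceil> * (6 * m + 6) \<le> nat \<lceil>3 / (kap m * kap m)\<rceil> * (6 * m + 6)"
      by (rule mult_le_mono1)
    then have aJ: "nat \<lceil>3 / PH (\<kappa> j) (fillW (\<kappa> j) m org)\<rceil> * (6 * m + 6) \<le> a" unfolding a_def by linarith
    have a1: "1 \<le> a" by (simp add: a_def)
    have n1: "1 \<le> n" using n(1) m(1) by simp
    show False by (rule merge_contradiction[OF Kj n(1) n1 U a1 aJ])
  qed
  then have "L = 0" using L0 by simp
  then show ?thesis using L(1) LIMSEQ_imp_Suc by blast
qed

text \<open>If it failed, then for every large \<open>g\<close> all but finitely many
  \<open>K\<close> of the chosen sequence would satisfy \<open>c < g * th q1 K (7 * g)\<close>. In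
  the limit this is the lower bound of order \<open>1 / n\<close> refuted by
  \<open>tower_contradiction\<close>.\<close>

lemma arm_decay:
  assumes q1: "1/4 \<le> q1" "q1 < 1/2" and c: "c > 0"
  shows "\<exists>g\<ge>g0. \<exists>\<kappa>. strict_mono (\<kappa> :: nat \<Rightarrow> nat) \<and> (\<forall>j. real g * th q1 (\<kappa> j) (7 * g) \<le> c)"
proof (rule ccontr)
  assume contra: "\<not> ?thesis"
  define \<Delta> where "\<Delta> = (1/2 - q1) / 2"
  have \<Delta>: "\<Delta> > 0" "q1 + 2 * \<Delta> = 1/2" using q1 unfolding \<Delta>_def by (simp_all add: diff_divide_distrib)
  \<comment> \<open>Densities decreasing from one half with summable gaps
    \<open>\<Delta> / 2 ^ (k + 1)\<close>; all stay at least \<open>\<Delta>\<close> above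
    \<open>q1\<close>, which leaves room for a last comparison at every \<open>k\<close>.\<close>
  define qs where "qs k = q1 + \<Delta> + \<Delta> / 2 ^ k" for k :: nat
  have pw2: "0 < \<Delta> / 2 ^ k" "\<Delta> / 2 ^ k \<le> \<Delta>" for k :: nat
    using \<Delta>(1) by (simp_all add: divide_le_eq mult_le_cancel_left1)
  have qs: "1/4 \<le> qs k" "qs k \<le> 1/2" "q1 \<le> qs k" "\<Delta> \<le> qs k - q1" "qs k - qs (Suc k) = \<Delta> / 2 / 2 ^ k" for k
  proof -
    show "1/4 \<le> qs k" "qs k \<le> 1/2" "q1 \<le> qs k" "\<Delta> \<le> qs k - q1"
      using pw2[of k] \<Delta> q1 unfolding qs_def by linarith+
    show "qs k - qs (Suc k) = \<Delta> / 2 / 2 ^ k" by (simp add: qs_def)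
  qed
  have qs0: "qs 0 = 1/2" using \<Delta> by (simp add: qs_def)
  have qsd: "qs (Suc k) \<le> qs k" for k
  proof -
    have "0 \<le> \<Delta> / 2 / 2 ^ k" using \<Delta>(1) by simp
    then show ?thesis using qs(5)[of k] by linarith
  qed
  have q01: "0 \<le> qs k" "qs k \<le> 1" "0 \<le> q1" "q1 \<le> 1" for k using qs(1,2)[of k] q1 by auto
  \<comment> \<open>Four families of probabilities coded over one countable index set, so that a
    single sequence of \<open>K\<close> makes all of them converge.\<close>
  define f :: "nat \<Rightarrow> nat \<times> nat \<times> nat \<times> nat \<Rightarrow> real" where
    "f K = (\<lambda>(i, m, a, n). if i = 0 then PH K (\<lambda>\<omega>. arm K \<omega> org m n) else if i = 1 then UU K m a n
       else if i = 2 then th (qs m) K n else th q1 K n)" for K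
  have f01: "\<bar>f K x\<bar> \<le> 1" for K x
  proof (cases x)
    case (fields i m a n)
    have "0 \<le> UU K m a n" "UU K m a n \<le> 1"
    proof -
      have "UU K m a n = PH K (\<lambda>\<omega>. sarm K \<omega> org undefined m a n)" by (simp only: PH_sarm)
      then show "0 \<le> UU K m a n" "UU K m a n \<le> 1" by (simp_all add: prb_nonneg prb_le_1 wtH loc_sarm del: PH_sarm)
    qed
    moreover have "0 \<le> PH K (\<lambda>\<omega>. arm K \<omega> org m n)" "PH K (\<lambda>\<omega>. arm K \<omega> org m n) \<le> 1"
      by (simp_all add: prb_nonneg prb_le_1 wtH loc_arm)
    moreover have "0 \<le> th (qs m) K n" "th (qs m) K n \<le> 1" "0 \<le> th q1 K n" "th q1 K n \<le> 1"
      using q01 by (simp_all add: th_nonneg th_le_1)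
    ultimately have b: "0 \<le> f K (i, m, a, n)" "f K (i, m, a, n) \<le> 1" unfolding f_def split by (cases "i = 0"; cases "i = 1"; cases "i = 2"; simp only: if_True if_False simp_thms)+
    then show ?thesis unfolding fields by (subst abs_of_nonneg)
  qed
  obtain r where r: "strict_mono r" "\<And>x. convergent (\<lambda>j. f (r j) x)" 
  proof (rule convergent_subsequence[of f, OF f01])
    fix s :: "nat \<Rightarrow> nat" assume "strict_mono s" "\<And>x. convergent (\<lambda>n. f (s n) x)"
    then show ?thesis by (rule that)
  qed
  define F where "F x = lim (\<lambda>j. f (r j) x)" for x
  have lim: "(\<lambda>j. f (r j) x) \<longlonglongrightarrow> F x" for x using r(2)[of x] by (simp add: F_def convergent_LIMSEQ_iff)
  have rj: "j \<le> r j" for j by (rule strict_mono_imp_increasing[OF r(1)])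
  have limA: "(\<lambda>j. PH (r j) (\<lambda>\<omega>. arm (r j) \<omega> org m n)) \<longlonglongrightarrow> F (0, m, 0, n)" for m n
    using lim[of "(0, m, 0, n)"] by (simp add: f_def)
  have limU: "(\<lambda>j. UU (r j) m a n) \<longlonglongrightarrow> F (1, m, a, n)" for m a n
    using lim[of "(1, m, a, n)"] by (simp add: f_def)
  define T where "T k n = F (2, k, 0, n)" for k n
  have limT: "(\<lambda>j. th (qs k) (r j) n) \<longlonglongrightarrow> T k n" for k n
    using lim[of "(2, k, 0, n)"] by (simp add: f_def T_def)
  define R where "R n = F (3, 0, 0, n)" for n
  have limR: "(\<lambda>j. th q1 (r j) n) \<longlonglongrightarrow> R n" for n
    using lim[of "(3, 0, 0, n)"] by (simp add: f_def R_def)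
  obtain C where C: "C > 0" "\<And>K n q q'. K \<ge> 2 \<Longrightarrow> n \<ge> 1 \<Longrightarrow> 1/4 \<le> q \<Longrightarrow> q \<le> q' \<Longrightarrow> q' \<le> 1/2 \<Longrightarrow> th q' K n \<le> 1/2 \<Longrightarrow>
     th q K n \<le> th q' K n * exp (- (C * (q' - q) * real n / sumth q' K n))" using sharpness by blast
  have limS: "(\<lambda>j. sumth (qs k) (r j) n) \<longlonglongrightarrow> (\<Sum>i\<le>n. T k i)" for k n
    unfolding sumth_def by (intro tendsto_sum limT)
  have S1: "1 \<le> (\<Sum>i\<le>n. T k i)" for k n
    by (rule limit_le_of_eventually[OF tendsto_const limS, of 0]) (simp add: sumth_ge_1 q01)
  have T01: "0 \<le> T k n" "T k n \<le> 1" for k n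
  proof -
    show "0 \<le> T k n"
      by (rule limit_le_of_eventually[OF tendsto_const limT, of 0]) (simp add: th_nonneg q01)
    show "T k n \<le> 1"
      by (rule limit_le_of_eventually[OF limT tendsto_const, of 0]) (simp add: th_le_1 q01)
  qed
  have sharp: "x \<le> exp (- (C * (qs k - q) * real n / (\<Sum>i\<le>n. T k i)))"
    if x: "(\<lambda>j. th q (r j) n) \<longlonglongrightarrow> x" and q: "1/4 \<le> q" "q \<le> qs k" and n: "n \<ge> 1" and h: "T k n < 1/2" for x q k n
  proof -
    have "eventually (\<lambda>j. th (qs k) (r j) n < 1/2) sequentially" using h by (intro order_tendstoD(2)[OF limT])
    then obtain J where J: "\<And>j. j \<ge> J \<Longrightarrow> th (qs k) (r j) n < 1/2" by (auto simp: eventually_sequentially)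
    have "x \<le> T k n * exp (- (C * (qs k - q) * real n / (\<Sum>i\<le>n. T k i)))"
    proof (rule limit_le_of_eventually[OF x, of _ _ "max J 2"])
      show "(\<lambda>j. th (qs k) (r j) n * exp (- (C * (qs k - q) * real n / sumth (qs k) (r j) n)))
         \<longlonglongrightarrow> T k n * exp (- (C * (qs k - q) * real n / (\<Sum>i\<le>n. T k i)))"
        using S1[of k n] by (intro tendsto_intros limT limS) auto
      fix j assume j: "max J 2 \<le> j"
      show "th q (r j) n \<le> th (qs k) (r j) n * exp (- (C * (qs k - q) * real n / sumth (qs k) (r j) n))"
      proof (rule C(2)[OF _ n q qs(2)])
        show "2 \<le> r j" using j rj[of j] by simp
        show "th (qs k) (r j) n \<le> 1/2" using J[of j] j by simp
      qed
    qed
    also have "\<dots> \<le> 1 * exp (- (C * (qs k - q) * real n / (\<Sum>i\<le>n. T k i)))"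
      using T01 by (intro mult_right_mono) auto
    finally show ?thesis by simp
  qed
  have Ranti: "R n' \<le> R n" if n: "1 \<le> n" "n \<le> n'" for n n'
  proof (rule limit_le_of_eventually[OF limR limR, of 0])
    fix j
    have "PP q1 (r j) (\<lambda>\<omega>. arm (r j) \<omega> org 1 n') \<le> PP q1 (r j) (\<lambda>\<omega>. arm (r j) \<omega> org 1 n)"
      using n q01(3,4) by (intro prb_mono weights_pw loc_arm) (blast intro: arm_antimono)+
    then show "th q1 (r j) n' \<le> th q1 (r j) n" using n by (simp add: th_def)
  qed
  have Rlow: "c \<le> real g * R (7 * g)" if g: "g \<ge> g0" for g
  proof (rule ccontr)
    assume "\<not> ?thesis"
    then have lt: "real g * R (7 * g) < c" by simp
    have "(\<lambda>j. real g * th q1 (r j) (7 * g)) \<longlonglongrightarrow> real g * R (7 * g)" by (intro tendsto_intros limR)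
    then have "eventually (\<lambda>j. real g * th q1 (r j) (7 * g) < c) sequentially"
      using lt by (rule order_tendstoD(2))
    then obtain J where J: "\<And>j. j \<ge> J \<Longrightarrow> real g * th q1 (r j) (7 * g) < c" by (auto simp: eventually_sequentially)
    have "strict_mono (\<lambda>j. r (j + J))" using r(1) by (simp add: strict_mono_def)
    moreover have "\<forall>j. real g * th q1 (r (j + J)) (7 * g) \<le> c" using J by (simp add: less_imp_le)
    ultimately show False using contra g by blast
  qed
  define B where "B = C * \<Delta> / 2"
  have B: "B > 0" using C(1) \<Delta>(1) by (simp add: B_def)
  show False
  proof (rule tower_contradiction[of T B c "7 * (g0 + 1)"])
    show "0 \<le> T k n" "T k n \<le> 1" for k n by (rule T01)+
    show "T (Suc k) n \<le> T k n" for k n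
      by (rule limit_le_of_eventually[OF limT limT, of 0]) (simp add: th_mono q01 qsd)
    show "T k 0 = 1" for k
      using LIMSEQ_unique[OF limT[of k 0], of 1] by (simp add: th_def)
    have "F (0, 1, 0, n) = T 0 n" if n: "n \<ge> 1" for n
    proof -
      have "(\<lambda>j. th (qs 0) (r j) n) \<longlonglongrightarrow> F (0, 1, 0, n)"
        using limA[of 1 n] n unfolding th_def qs0 by simp
      then show ?thesis using LIMSEQ_unique limT by blast
    qed
    moreover have "(\<lambda>n. F (0, 1, 0, n)) \<longlonglongrightarrow> 0"
      by (rule arm_limit_zero[OF r(1), of "\<lambda>m n. F (0, m, 0, n)" "\<lambda>m a n. F (1, m, a, n)"]) (rule limA limU)+
    ultimately show "(\<lambda>n. T 0 n) \<longlonglongrightarrow> 0"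
      by (elim Lim_transform_eventually) (auto simp: eventually_sequentially)
    show "B > 0" "c > 0" by (fact B c)+
    fix k n :: nat assume n: "n \<ge> 1" and h: "T k n < 1/2"
    have "T (Suc k) n \<le> exp (- (C * (qs k - qs (Suc k)) * real n / (\<Sum>i\<le>n. T k i)))"
      by (rule sharp[OF limT qs(1) qsd n h])
    moreover have "C * (qs k - qs (Suc k)) = B / 2 ^ k" by (simp add: qs(5) B_def)
    ultimately show "T (Suc k) n \<le> exp (- (B / 2 ^ k * real n / (\<Sum>i\<le>n. T k i)))" by simp
    assume N0: "7 * (g0 + 1) \<le> n"
    \<comment> \<open>This \<open>g\<close> satisfies \<open>n \<le> 7 * g\<close> and
      \<open>g \<le> n\<close>, so the lower bound at scales \<open>7 * g\<close> transfers to every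
      \<open>n\<close>.\<close>
    define g where "g = n div 7 + 1"
    have g: "g \<ge> g0" "n \<le> 7 * g" "g \<le> n" using N0 by (auto simp: g_def)
    have g1: "g \<ge> 1" by (simp add: g_def)
    have "c \<le> real g * R (7 * g)" by (rule Rlow[OF g(1)])
    also have "\<dots> \<le> real n * R n"
    proof (rule mult_mono)
      show "R (7 * g) \<le> R n" by (rule Ranti[OF n g(2)])
      show "0 \<le> R (7 * g)"
        by (rule limit_le_of_eventually[OF tendsto_const limR, of 0]) (simp add: th_nonneg q01)
    qed (use g in auto)
    finally have "c / real n \<le> R n" using n by (simp add: field_simps)
    also have "R n \<le> exp (- (C * (qs k - q1) * real n / (\<Sum>i\<le>n. T k i)))"
      by (rule sharp[OF limR q1(1) qs(3) n h])
    also have "\<dots> \<le> exp (- (B * real n / (\<Sum>i\<le>n. T k i)))"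
    proof -
      have "B \<le> C * (qs k - q1)"
      proof -
        have "C * \<Delta> \<le> C * (qs k - q1)" using qs(4)[of k] C(1) by (intro mult_left_mono) auto
        moreover have "0 \<le> C * \<Delta>" using C(1) \<Delta>(1) by simp
        ultimately show ?thesis unfolding B_def by linarith
      qed
      then have "B * real n / (\<Sum>i\<le>n. T k i) \<le> C * (qs k - q1) * real n / (\<Sum>i\<le>n. T k i)"
        using S1[of k n] by (intro divide_right_mono mult_right_mono) auto
      then show ?thesis by simp
    qed
    finally show "c / real n \<le> exp (- (B * real n / (\<Sum>i\<le>n. T k i)))" .
  qed
qed

end

section \<open>Black crossings of the discretised model\<close>

context planar_metric
begin

text \<open>The weak counterpart of \<open>wh\<close>: a cell with a black point is at most as far
  as every occupied cell of either colour. The bound \<open>R\<close> confines the nucleus and makes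
  the event finite.\<close>

definition cb :: "nat \<Rightarrow> coord set \<Rightarrow> site \<Rightarrow> bool" where
  "cb R \<omega> x \<longleftrightarrow> (\<exists>b. (b, False) \<notin> \<omega> \<and> dd x b \<le> real R \<and>
     (\<forall>z. (z, False) \<notin> \<omega> \<or> (z, True) \<in> \<omega> \<longrightarrow> dd x b \<le> dd x z))"

lemma loc_cb: "loc (\<lambda>\<omega>. cb R \<omega> x)"
proof -
  define S where "S = {z. dd x z \<le> real R}"
  have eq: "cb R \<omega> x \<longleftrightarrow> (\<exists>b\<in>S. \<not> (b, False) \<in> \<omega> \<and> (\<forall>z\<in>S. \<not> (\<not> (z, False) \<in> \<omega> \<or> (z, True) \<in> \<omega>) \<or> dd x b \<le> dd x z))"
    (is "_ \<longleftrightarrow> ?R \<omega>") for \<omega>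
  proof
    assume "cb R \<omega> x"
    then show "?R \<omega>" unfolding cb_def S_def by blast
  next
    assume "?R \<omega>"
    then obtain b where b: "b \<in> S" "(b, False) \<notin> \<omega>"
      "\<And>z. z \<in> S \<Longrightarrow> (z, False) \<notin> \<omega> \<or> (z, True) \<in> \<omega> \<Longrightarrow> dd x b \<le> dd x z" by blast
    have "dd x b \<le> dd x z" if "(z, False) \<notin> \<omega> \<or> (z, True) \<in> \<omega>" for z
    proof (cases "z \<in> S")
      case True then show ?thesis using b(3) that by blast
    next
      case False then show ?thesis using b(1) by (simp add: S_def)
    qed
    then show "cb R \<omega> x" unfolding cb_def using b(1,2) S_def by blast
  qed
  have "finite S" unfolding S_def by (rule finite_ball)
  then show ?thesis unfolding eq by (intro loc_bex loc_conj loc_ball loc_disj loc_not loc_member loc_const)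
qed

text \<open>If a nearest black cell is beaten by a white one, that white cell is nearer than
  \<open>g * K\<close>, hence within the cut-off of \<open>wh\<close> because
  \<open>g \<le> K\<close>.\<close>

lemma cb_or_wh:
  assumes "g \<le> K" and b: "(b, False) \<notin> \<omega>" "dd x b \<le> real (g * K)"
  shows "cb (g * K) \<omega> x \<or> wh K \<omega> x"
proof (rule disjCI)
  assume nw: "\<not> wh K \<omega> x"
  let ?S = "{b. dd x b \<le> real (g * K)} \<inter> {b. (b, False) \<notin> \<omega>}"
  have "finite ?S" "?S \<noteq> {}" using b finite_ball by auto
  then obtain m where "is_arg_min (dd x) (\<lambda>z. z \<in> ?S) m" using ex_is_arg_min_if_finite by blast
  then have m: "m \<in> ?S" "\<And>z. z \<in> ?S \<Longrightarrow> dd x m \<le> dd x z" by (auto simp: is_arg_min_linorder)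
  have mb: "dd x m \<le> dd x z" if "(z, False) \<notin> \<omega>" for z
    using m(2)[of z] m(1) that by (cases "dd x z \<le> real (g * K)") auto
  have mw: "dd x m \<le> dd x w" if w: "(w, True) \<in> \<omega>" for w
  proof (rule ccontr)
    assume lt: "\<not> dd x m \<le> dd x w"
    have "dd x w \<le> real (K * K)"
    proof -
      have "real (g * K) \<le> real (K * K)" using assms(1) by (simp only: of_nat_le_iff mult_le_mono1)
      then show ?thesis using lt m(1) by simp
    qed
    moreover have "dd x w < dd x z" if "(z, False) \<notin> \<omega>" for z using mb[OF that] lt by simp
    ultimately show False using nw w unfolding wh_def by blast
  qed
  show "cb (g * K) \<omega> x" unfolding cb_def using m(1) mb mw by blast
qed

text \<open>The strip from height \<open>g\<close> to \<open>9 * g\<close> leaves a margin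
  \<open>g\<close> below and above: in the continuum, connections inside a cell may leave the strip
  by the radius \<open>g\<close>.\<close>

definition window :: "nat \<Rightarrow> nat \<Rightarrow> nat \<Rightarrow> site set" where
  "window g L K = {0..int (L * K)} \<times> {int (g * K)..int (9 * g * K)}"

definition cross :: "nat \<Rightarrow> nat \<Rightarrow> nat \<Rightarrow> coord set \<Rightarrow> bool" where
  "cross g L K \<omega> \<longleftrightarrow> (\<exists>x x'. fst x = 0 \<and> fst x' = int (L * K) \<and> reach adj8 {x \<in> window g L K. cb (g * K) \<omega> x} x x')"

lemma loc_cross: "loc (cross g L K)"
proof -
  have fin: "finite (window g L K)" by (simp add: window_def)
  have iff: "loc (\<lambda>\<omega>. (x \<in> S) = A \<omega>)" if "loc A" for x :: site and S A
    using that loc_not[OF that] by (cases "x \<in> S") auto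
  \<comment> \<open>Finite support: a disjunction over the possible sets of black sites of the
    window.\<close>
  have "cross g L K \<omega> \<longleftrightarrow> (\<exists>S\<in>Pow (window g L K).
      (\<exists>x x'. fst x = 0 \<and> fst x' = int (L * K) \<and> reach adj8 S x x') \<and> (\<forall>x\<in>window g L K. x \<in> S \<longleftrightarrow> cb (g * K) \<omega> x))"
    (is "_ \<longleftrightarrow> ?R \<omega>") for \<omega>
  proof
    assume "cross g L K \<omega>"
    then show "?R \<omega>" unfolding cross_def by (intro bexI[of _ "{x \<in> window g L K. cb (g * K) \<omega> x}"]) auto
  next
    assume "?R \<omega>"
    then obtain S where S: "S \<subseteq> window g L K" "\<exists>x x'. fst x = 0 \<and> fst x' = int (L * K) \<and> reach adj8 S x x'"
      "\<forall>x\<in>window g L K. x \<in> S \<longleftrightarrow> cb (g * K) \<omega> x" by blast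
    have "S = {x \<in> window g L K. cb (g * K) \<omega> x}" using S(1,3) by blast
    then show "cross g L K \<omega>" using S(2) unfolding cross_def by simp
  qed
  then have e: "cross g L K = ?R" by (intro ext)
  show ?thesis unfolding e
  proof (rule loc_bex)
    show "finite (Pow (window g L K))" using fin by simp
    show "loc (\<lambda>\<omega>. (\<exists>x x'. fst x = 0 \<and> fst x' = int (L * K) \<and> reach adj8 S x x') \<and> (\<forall>x\<in>window g L K. x \<in> S \<longleftrightarrow> cb (g * K) \<omega> x))" for S
      by (rule loc_conj[OF loc_const loc_ball[OF fin]]) (rule iff[OF loc_cb])
  qed
qed

lemma twice_abs_leD: "2 * abs y \<le> k \<Longrightarrow> 2 * y \<le> k \<and> 2 * (- y) \<le> k" for y k :: int
  by arith

lemma close_mult: "2 * abs (x - K * m) \<le> K \<Longrightarrow> K * a \<le> x \<Longrightarrow> x \<le> K * b \<Longrightarrow> 0 < K \<Longrightarrow> a \<le> m \<and> m \<le> b"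
  for x K m a b :: int
proof -
  assume h: "2 * abs (x - K * m) \<le> K" "K * a \<le> x" "x \<le> K * b" and K: "0 < K"
  have "2 * (x - K * m) \<le> K" "2 * (- (x - K * m)) \<le> K" using twice_abs_leD[OF h(1)] by blast+
  then have "2 * (K * (a - m)) \<le> K" "2 * (K * (m - b)) \<le> K" using h by (simp_all add: right_diff_distrib)
  then have "a - m < 1" "m - b < 1" using twice_mult_le K by blast+
  then show ?thesis by simp
qed

text \<open>Without a black 8-crossing, Hex gives a vertical 4-path of non-black sites. Unless a
  black hole of radius about \<open>g / 3\<close> occurs (\<open>3 * r + 1 \<le> g\<close>), all its
  sites are white. Its height \<open>8 * g\<close> exceeds \<open>7 * g\<close>, so it is an arm
  from one of the \<open>L + 1\<close> macroscopic cells of the bottom line.\<close>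

lemma not_cross_bound:
  assumes K: "K \<ge> 1" "g \<le> K" and g: "g \<ge> 1" and q: "0 \<le> q" "q \<le> 1"
  shows "1 - PP q K (cross g L K) \<le> real ((L + 1) * (8 * g + 1)) * exp (- (1 - q) * real ((g - 1) div 3))
     + real (L + 1) * th q K (7 * g)"
proof -
  note wt = weights_pw[OF q, of K]
  define r where "r = (g - 1) div 3"
  define U where "U = {0..int L} \<times> {int g..int (9 * g)}"
  define V where "V = {0..int L} \<times> {int g}"
  have finU: "finite U" and finV: "finite V" by (auto simp: U_def V_def)
  have cU: "card U = (L + 1) * (8 * g + 1)" and cV: "card V = L + 1" 
  proof -
    have "nat (int L + 1) = L + 1" "nat (8 * int g + 1) = 8 * g + 1" by linarith+
    then show "card U = (L + 1) * (8 * g + 1)" "card V = L + 1" by (simp_all add: U_def V_def card_cartesian_product)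
  qed
  have Kint: "0 < int K" using K by simp
  have mc: "mcell K x \<in> U" if "x \<in> window g L K" for x
  proof -
    have x: "int K * 0 \<le> fst x" "fst x \<le> int K * int L" "int K * int g \<le> snd x" "snd x \<le> int K * int (9 * g)"
      using that by (auto simp: window_def mult_ac)
    show ?thesis
      using close_mult[OF mcell(1)[OF K(1)] x(1,2) Kint] close_mult[OF mcell(2)[OF K(1)] x(3,4) Kint]
      unfolding U_def by (cases "mcell K x") auto
  qed
  have main: "(\<exists>u\<in>U. noB \<omega> (cube K u r)) \<or> (\<exists>u\<in>V. arm K \<omega> u 1 (7 * g))" if nc: "\<not> cross g L K \<omega>" for \<omega>
  proof (rule disjCI)
    assume na: "\<not> (\<exists>u\<in>V. arm K \<omega> u 1 (7 * g))"
    show "\<exists>u\<in>U. noB \<omega> (cube K u r)"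
    proof (rule ccontr)
      assume nh: "\<not> (\<exists>u\<in>U. noB \<omega> (cube K u r))"
      define Bk where "Bk = {x \<in> window g L K. cb (g * K) \<omega> x}"
      have "\<exists>x x'. snd x = int (g * K) \<and> snd x' = int (9 * g * K) \<and>
         reach adj4 ({0..int (L * K)} \<times> {int (g * K)..int (9 * g * K)} - Bk) x x'"
      proof (rule hex)
        show "Bk \<subseteq> {0..int (L * K)} \<times> {int (g * K)..int (9 * g * K)}" by (auto simp: Bk_def window_def)
        show "\<not> (\<exists>x x'. fst x = 0 \<and> fst x' = int (L * K) \<and> reach adj8 Bk x x')" using nc by (simp add: cross_def Bk_def)
      qed auto
      then obtain x x' where x: "snd x = int (g * K)" "snd x' = int (9 * g * K)" and re: "reach adj4 (window g L K - Bk) x x'"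
        unfolding window_def by blast
      have sub: "window g L K - Bk \<subseteq> {x. wh K \<omega> x}"
      proof
        fix y assume y: "y \<in> window g L K - Bk"
        then have "\<not> noB \<omega> (cube K (mcell K y) r)" using nh mc by blast
        then obtain b where b: "b \<in> cube K (mcell K y) r" "(b, False) \<notin> \<omega>" by (auto simp: noB_def)
        have "dd y b < real ((3 * r + 1) * K)" by (rule cube_in_ball[OF K(1) b(1)])
        also have "\<dots> \<le> real (g * K)"
        proof -
          have "3 * r + 1 \<le> g" using g unfolding r_def by linarith
          then show ?thesis by (simp only: of_nat_le_iff mult_le_mono1)
        qed
        finally have "cb (g * K) \<omega> y \<or> wh K \<omega> y" using cb_or_wh[OF K(2) b(2)] by simp
        then show "y \<in> {x. wh K \<omega> x}" using y by (auto simp: Bk_def)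
      qed
      define u where "u = mcell K x"
      have m: "2 * \<bar>fst x - K * fst u\<bar> \<le> K" "2 * \<bar>snd x - K * snd u\<bar> \<le> K" unfolding u_def by (rule mcell[OF K(1)])+
      have xw: "x \<in> window g L K" using reach_in(1)[OF re] by simp
      have xx: "int K * 0 \<le> fst x" "fst x \<le> int K * int L" "int K * int g \<le> snd x" "snd x \<le> int K * int g"
        using xw x(1) by (auto simp: window_def mult_ac)
      have uV: "u \<in> V"
        using close_mult[OF m(1) xx(1,2) Kint] close_mult[OF m(2) xx(3,4) Kint]
        unfolding V_def by (cases u) auto
      then have su: "snd u = int g" by (auto simp: V_def)
      have xl: "x \<in> lbox K u 1" using m unfolding lbox_def by simp
      have "int (7 * g * K) < snd x' - int K * snd u"
      proof -
        have "snd x' - int K * snd u = int (7 * g * K) + int (g * K)" by (simp add: x(2) su)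
        moreover have "0 < int (g * K)" using g K by simp
        ultimately show ?thesis by linarith
      qed
      then have "x' \<notin> lbox K u (7 * g)" unfolding lbox_def by simp
      then have "arm K \<omega> u 1 (7 * g)" using g by (intro arm_of_reach[OF re sub xl]) auto
      then show False using na uV by blast
    qed
  qed
  have "1 - PP q K (cross g L K) = PP q K (\<lambda>\<omega>. \<not> cross g L K \<omega>)" by (simp add: prb_not[OF wt loc_cross])
  also have "\<dots> \<le> PP q K (\<lambda>\<omega>. (\<exists>u\<in>U. noB \<omega> (cube K u r)) \<or> (\<exists>u\<in>V. arm K \<omega> u 1 (7 * g)))"
    by (rule prb_mono[OF wt]) (use finU finV main in \<open>auto intro!: loc_not loc_cross loc_disj loc_bex loc_noB loc_arm\<close>)
  also have "\<dots> \<le> PP q K (\<lambda>\<omega>. \<exists>u\<in>U. noB \<omega> (cube K u r)) + PP q K (\<lambda>\<omega>. \<exists>u\<in>V. arm K \<omega> u 1 (7 * g))"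
    by (rule prb_disj_le[OF wt]) (use finU finV in \<open>auto intro!: loc_bex loc_noB loc_arm\<close>)
  also have "PP q K (\<lambda>\<omega>. \<exists>u\<in>U. noB \<omega> (cube K u r)) \<le> (\<Sum>u\<in>U. exp (- (1 - q) * real r))"
    by (rule PP_bex_noB[OF finU K(1) q])
  also have "\<dots> = real (card U) * exp (- (1 - q) * real r)" by simp
  also have "PP q K (\<lambda>\<omega>. \<exists>u\<in>V. arm K \<omega> u 1 (7 * g)) \<le> (\<Sum>u\<in>V. PP q K (\<lambda>\<omega>. arm K \<omega> u 1 (7 * g)))"
    by (rule prb_bex_le[OF wt finV loc_arm])
  also have "\<dots> = (\<Sum>u\<in>V. th q K (7 * g))"
  proof (intro sum.cong refl)
    show "PP q K (\<lambda>\<omega>. arm K \<omega> u 1 (7 * g)) = th q K (7 * g)" for u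
      using PP_arm_trans[of q K u 1 "7 * g"] g by (simp add: th_def)
  qed
  also have "\<dots> = real (card V) * th q K (7 * g)" by simp
  finally show ?thesis unfolding cU cV r_def by simp
qed

text \<open>The length \<open>10 * g * m\<close> is proportional to \<open>g\<close>, so the number
  of starting cells costs a factor \<open>g\<close>, which the bound on
  \<open>g * th q1 K (7 * g)\<close> absorbs; the hole term is \<open>g ^ 2\<close> times an
  exponential.\<close>

lemma cross_likely:
  assumes q: "0 \<le> q" "q < 1/2" and \<delta>: "0 < \<delta>"
  shows "\<exists>g>g0. \<exists>\<kappa>. strict_mono (\<kappa> :: nat \<Rightarrow> nat) \<and> (\<forall>j. 1 - \<delta> \<le> PP q (\<kappa> j) (cross g (10 * g * m) (\<kappa> j)))"
proof -
  define A where "A = real (10 * m + 1)"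
  have A: "A \<ge> 1" by (simp add: A_def)
  obtain n0 where n0: "\<And>g. g \<ge> n0 \<Longrightarrow> A * 9 * 288 * exp (1/2 - (1/12) * real g) \<le> \<delta> / 2"
    using scaled_exp_small[of "1/12" "\<delta> / 2" "A * 9 * 288" "1/2"] \<delta> by auto
  define q1 where "q1 = max (1/4) q"
  have q1: "1/4 \<le> q1" "q1 < 1/2" "q \<le> q1" using q by (auto simp: q1_def)
  have c: "0 < \<delta> / (2 * A)" using \<delta> A by simp
  obtain g \<kappa> where g: "g \<ge> max n0 (g0 + 1)" and \<kappa>: "strict_mono (\<kappa> :: nat \<Rightarrow> nat)"
    "\<And>j. real g * th q1 (\<kappa> j) (7 * g) \<le> \<delta> / (2 * A)"
    using arm_decay[OF q1(1,2) c, of "max n0 (g0 + 1)"] by blast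
  have g1: "g \<ge> 1" "g > g0" "g \<ge> n0" using g by auto
  have L: "real (10 * g * m + 1) \<le> A * real g"
  proof -
    have "10 * g * m + 1 \<le> (10 * m + 1) * g" using g1 by (simp add: algebra_simps)
    then have "real (10 * g * m + 1) \<le> real ((10 * m + 1) * g)" by (simp only: of_nat_le_iff)
    then show ?thesis by (simp only: A_def of_nat_mult)
  qed
  \<comment> \<open>Shifting the sequence ensures \<open>g \<le> \<kappa>' j\<close>, as
    \<open>not_cross_bound\<close> requires.\<close>
  define \<kappa>' where "\<kappa>' j = \<kappa> (j + g)" for j
  have "1 - \<delta> \<le> PP q (\<kappa>' j) (cross g (10 * g * m) (\<kappa>' j))" for j
  proof -
    have K: "\<kappa>' j \<ge> 1" "g \<le> \<kappa>' j"
      using strict_mono_imp_increasing[OF \<kappa>(1), of "j + g"] g1 unfolding \<kappa>'_def by linarith+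
    have q01: "0 \<le> q" "q \<le> 1" using q by auto
    have t: "0 \<le> th q (\<kappa>' j) (7 * g)" by (rule th_nonneg[OF q01])
    have "real (10 * g * m + 1) * th q (\<kappa>' j) (7 * g) \<le> (A * real g) * th q1 (\<kappa>' j) (7 * g)"
      using L t q01 q1 A by (intro mult_mono th_mono) auto
    also have "\<dots> \<le> A * (\<delta> / (2 * A))"
      using \<kappa>(2)[of "j + g"] A unfolding mult.assoc \<kappa>'_def by (intro mult_left_mono) auto
    finally have a: "real (10 * g * m + 1) * th q (\<kappa>' j) (7 * g) \<le> \<delta> / 2" using A by simp
    have ex: "exp (- (1 - q) * real ((g - 1) div 3)) \<le> exp (1/2 - (1/6) * real g)"
    proof -
      have "g \<le> 3 * ((g - 1) div 3) + 3" using g1 by linarith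
      then have "real g \<le> real (3 * ((g - 1) div 3) + 3)" by (simp only: of_nat_le_iff)
      then have "(1/6) * real g - 1/2 \<le> 1/2 * real ((g - 1) div 3)" by simp
      also have "\<dots> \<le> (1 - q) * real ((g - 1) div 3)" using q by (intro mult_right_mono) auto
      finally show ?thesis unfolding mult_minus_left exp_le_cancel_iff by linarith
    qed
    have gg: "real g * real g \<le> 288 * exp ((1/12) * real g)"
      using exp_lower_Taylor_quadratic[of "(1/12) * real g"] by (simp add: power2_eq_square)
    have "real ((10 * g * m + 1) * (8 * g + 1)) * exp (- (1 - q) * real ((g - 1) div 3))
       \<le> ((A * real g) * (9 * real g)) * exp (1/2 - (1/6) * real g)"
    proof (intro mult_mono ex)
      have "real (8 * g + 1) \<le> 9 * real g" using g1 by simp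
      then show "real ((10 * g * m + 1) * (8 * g + 1)) \<le> A * real g * (9 * real g)"
        unfolding of_nat_mult[of _ "8 * g + 1"] using L A by (intro mult_mono) auto
    qed (use A in auto)
    also have "\<dots> = A * 9 * (real g * real g) * exp (1/2 - (1/6) * real g)" by (simp add: mult_ac)
    also have "\<dots> \<le> A * 9 * (288 * exp ((1/12) * real g)) * exp (1/2 - (1/6) * real g)"
      using gg A by (intro mult_right_mono mult_left_mono) auto
    also have "\<dots> = A * 9 * 288 * (exp ((1/12) * real g) * exp (1/2 - (1/6) * real g))" by (simp only: mult.assoc)
    also have "exp ((1/12) * real g) * exp (1/2 - (1/6) * real g) = exp (1/2 - (1/12) * real g)"
      by (simp add: exp_add[symmetric] field_simps)
    also have "A * 9 * 288 * exp (1/2 - (1/12) * real g) \<le> \<delta> / 2" by (rule n0[OF g1(3)])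
    finally show ?thesis using a not_cross_bound[OF K g1(1) q01, of "10 * g * m"] by linarith
  qed
  moreover have "strict_mono \<kappa>'" using \<kappa>(1) by (simp add: strict_mono_def \<kappa>'_def)
  ultimately show ?thesis using g1(2) by blast
qed

end

section \<open>Discretising the Poisson process\<close>

definition pcell :: "nat \<Rightarrow> site \<times> nat \<Rightarrow> pt3 set" where
  "pcell K z = {real_of_int (fst (fst z)) / real K..<(real_of_int (fst (fst z)) + 1) / real K}
     \<times> {real_of_int (snd (fst z)) / real K..<(real_of_int (snd (fst z)) + 1) / real K}
     \<times> {real (snd z) / real K..<(real (snd z) + 1) / real K}"

definition cellof :: "nat \<Rightarrow> pt3 \<Rightarrow> site \<times> nat" where
  "cellof K p = ((\<lfloor>real K * fst p\<rfloor>, \<lfloor>real K * fst (snd p)\<rfloor>), nat \<lfloor>real K * snd (snd p)\<rfloor>)"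

text \<open>One formula for both kinds of bits: marks \<open>True\<close> are black, so bit
  \<open>(z, True)\<close> asks for a point marked \<open>False\<close>, and bit
  \<open>(z, False)\<close> for the absence of points marked \<open>True\<close>.\<close>

definition cfg :: "nat \<Rightarrow> (pt3 \<times> bool) set \<Rightarrow> coord set" where
  "cfg K Q = {i. (\<exists>p\<in>pcell K (fst i). (p, \<not> snd i) \<in> Q) = snd i}"

lemma grid_interval:
  fixes a :: int and x :: real
  assumes "K \<ge> (1::nat)"
  shows "x \<in> {real_of_int a / real K..<(real_of_int a + 1) / real K} \<longleftrightarrow> \<lfloor>real K * x\<rfloor> = a"
  using assms by (auto simp: floor_eq_iff field_simps)

lemma pcell_iff:
  assumes "K \<ge> 1" "0 \<le> snd (snd p)"
  shows "p \<in> pcell K z \<longleftrightarrow> z = cellof K p"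
proof -
  obtain a b t where z: "z = ((a, b), t)" by (metis prod.collapse)
  have "0 \<le> \<lfloor>real K * snd (snd p)\<rfloor>" using assms by simp
  then have n: "\<lfloor>real K * snd (snd p)\<rfloor> = int t \<longleftrightarrow> t = nat \<lfloor>real K * snd (snd p)\<rfloor>" by auto
  have "p \<in> pcell K z \<longleftrightarrow> fst p \<in> {real_of_int a / real K..<(real_of_int a + 1) / real K}
     \<and> fst (snd p) \<in> {real_of_int b / real K..<(real_of_int b + 1) / real K}
     \<and> snd (snd p) \<in> {real_of_int (int t) / real K..<(real_of_int (int t) + 1) / real K}"
    unfolding pcell_def z by (cases p) auto
  also have "\<dots> \<longleftrightarrow> \<lfloor>real K * fst p\<rfloor> = a \<and> \<lfloor>real K * fst (snd p)\<rfloor> = b \<and> \<lfloor>real K * snd (snd p)\<rfloor> = int t"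
    by (simp only: grid_interval[OF assms(1)])
  finally show ?thesis unfolding n cellof_def z by auto
qed

lemma pcell_halfspace: "pcell K z \<subseteq> halfspace"
proof
  fix p assume "p \<in> pcell K z"
  then have "real (snd z) / real K \<le> snd (snd p)" by (auto simp: pcell_def)
  moreover have "0 \<le> real (snd z) / real K" by simp
  ultimately have "0 \<le> snd (snd p)" by (rule order_trans[rotated])
  then show "p \<in> halfspace" unfolding halfspace_def by simp
qed

lemma pcell_disjoint: "K \<ge> 1 \<Longrightarrow> z \<noteq> z' \<Longrightarrow> pcell K z \<inter> pcell K z' = {}"
proof -
  assume K: "K \<ge> 1" and ne: "z \<noteq> z'"
  have False if "p \<in> pcell K z" "p \<in> pcell K z'" for p
  proof -
    have "0 \<le> snd (snd p)" using that(1) pcell_halfspace[of K z] by (auto simp: halfspace_def)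
    then show False using that ne by (simp add: pcell_iff[OF K])
  qed
  then show ?thesis by blast
qed

lemma sets_pcell: "pcell K z \<in> sets borel"
  unfolding pcell_def by (intro borel_Times) auto

lemma bounded_pcell: "bounded (pcell K z)"
proof -
  have "bounded {a..<b}" for a b :: real by (rule bounded_subset[OF bounded_closed_interval[of a b]]) auto
  then show ?thesis unfolding pcell_def by (intro bounded_Times)
qed

lemma measure_pcell: "K \<ge> 1 \<Longrightarrow> measure lborel (pcell K z) = 1 / real K ^ 3"
proof -
  assume K: "K \<ge> 1"
  have T: "emeasure lborel (A \<times> B) = emeasure lborel A * emeasure lborel B"
    if "A \<in> sets borel" "B \<in> sets borel" for A :: "real set" and B :: "'b::euclidean_space set"
    unfolding lborel_prod[symmetric] using that by (intro lborel.emeasure_pair_measure_Times) auto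
  have i: "emeasure lborel {a / real K..<(a + 1) / real K} = ennreal (1 / real K)" for a :: real
  proof -
    have "a / real K \<le> (a + 1) / real K" by (intro divide_right_mono) auto
    then have "emeasure lborel {a / real K..<(a + 1) / real K} = ennreal ((a + 1) / real K - a / real K)" by simp
    then show ?thesis by (simp add: add_divide_distrib)
  qed
  have "emeasure lborel (pcell K z) = ennreal (1 / real K) * (ennreal (1 / real K) * ennreal (1 / real K))"
    unfolding pcell_def by (subst T, simp, intro borel_Times, simp, simp, subst T, simp, simp, simp only: i)
  also have "\<dots> = ennreal (1 / real K * (1 / real K * (1 / real K)))" by (simp add: ennreal_mult[symmetric])
  finally show ?thesis unfolding measure_def by (simp add: power3_eq_cube)
qed

definition cellset :: "nat \<Rightarrow> coord \<Rightarrow> (pt3 \<times> bool) set" where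
  "cellset K i = pcell K (fst i) \<times> {\<not> snd i}"

lemma intensity_cellset:
  assumes "K \<ge> 1"
  shows "mark_intensity p (cellset K i) = (if snd i then 1 - p else p) / real K ^ 3"
proof -
  have "pcell K (fst i) \<inter> halfspace = pcell K (fst i)" using pcell_halfspace by blast
  then show ?thesis
    using measure_pcell[OF assms, of "fst i"] by (cases "snd i") (simp_all add: mark_intensity_def cellset_def)
qed

lemma cfg_cellset: "i \<in> cfg K Q \<longleftrightarrow> (Q \<inter> cellset K i \<noteq> {}) = snd i"
proof -
  have "(\<exists>p\<in>pcell K (fst i). (p, \<not> snd i) \<in> Q) \<longleftrightarrow> Q \<inter> cellset K i \<noteq> {}"
    unfolding cellset_def by blast
  then show ?thesis unfolding cfg_def by simp
qed

text \<open>The counts in finitely many disjoint marked cells are independent Poisson variables, and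
  the bits record only whether they vanish. White has density \<open>1 - p\<close>.\<close>

lemma (in planar_metric) cfg_probability:
  assumes mpp: "marked_poisson_process M p Q" and K: "K \<ge> 1" and loc: "loc \<Phi>"
  shows "{\<omega> \<in> space M. \<Phi> (cfg K (Q \<omega>))} \<in> sets M"
    and "measure M {\<omega> \<in> space M. \<Phi> (cfg K (Q \<omega>))} = PP (1 - p) K \<Phi>"
proof -
  interpret M: prob_space M using mpp by (simp add: marked_poisson_process_def)
  obtain I0 where "finite I0" "dep I0 \<Phi>" using loc by (auto simp: loc_def)
  \<comment> \<open>An arbitrary extra coordinate makes the index set nonempty, as the product
    formula for independent variables demands.\<close>
  then obtain I where I: "finite I" "dep I \<Phi>" "I \<noteq> {}"
    using dep_mono[of I0 \<Phi> "insert undefined I0"] by blast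
  obtain h where h: "bij_betw h {0..<card I} I" using ex_bij_betw_nat_finite[OF I(1)] by blast
  define n where "n = card I"
  have n0: "{..<n} \<noteq> {}" using I by (auto simp: n_def card_gt_0_iff lessThan_empty_iff)
  have h: "bij_betw h {..<n} I" using h by (simp add: n_def lessThan_atLeast0)
  have hI: "h ` {..<n} = I" using h by (simp add: bij_betw_def)
  have inj: "inj_on h {..<n}" using h by (simp add: bij_betw_def)
  define X where "X k \<omega> = card (Q \<omega> \<inter> cellset K (h k))" for k \<omega>
  have mark: "{z. (z, b) \<in> cellset K i} = (if b = snd i then {} else pcell K (fst i))" for b i
    by (auto simp: cellset_def)
  have disj: "disjoint_family_on (\<lambda>k. cellset K (h k)) {..<n}"
  proof (unfold disjoint_family_on_def, intro ballI impI)
    fix k l assume kl: "k \<in> {..<n}" "l \<in> {..<n}" "k \<noteq> l"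
    then have "h k \<noteq> h l" using inj by (auto dest: inj_onD)
    then have "fst (h k) \<noteq> fst (h l) \<or> snd (h k) \<noteq> snd (h l)" by (auto simp: prod_eq_iff)
    then show "cellset K (h k) \<inter> cellset K (h l) = {}"
      using pcell_disjoint[OF K, of "fst (h k)" "fst (h l)"] unfolding cellset_def by blast
  qed
  have "M.indep_vars (\<lambda>_. count_space UNIV) (\<lambda>k \<omega>. card (Q \<omega> \<inter> cellset K (h k))) {..<n} \<and>
      (\<forall>k<n. \<forall>m. measure M {\<omega>\<in>space M. card (Q \<omega> \<inter> cellset K (h k)) = m}
         = mark_intensity p (cellset K (h k)) ^ m / fact m * exp (- mark_intensity p (cellset K (h k))))"
  proof (rule mpp[unfolded marked_poisson_process_def, THEN conjunct2, THEN conjunct2, THEN conjunct2,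
        THEN spec, THEN spec, of n "\<lambda>k. cellset K (h k)", THEN mp], intro conjI allI impI)
    show "{z. (z, b) \<in> cellset K (h i)} \<in> sets borel" "bounded {z. (z, b) \<in> cellset K (h i)}" for i b
      by (simp_all add: mark sets_pcell bounded_pcell)
  qed (rule disj)
  then have ind: "M.indep_vars (\<lambda>_. count_space UNIV) X {..<n}"
    and pr: "\<And>k. k < n \<Longrightarrow> measure M {\<omega>\<in>space M. X k \<omega> = 0} = exp (- mark_intensity p (cellset K (h k)))"
    unfolding X_def by auto
  have rv: "X k \<in> measurable M (count_space UNIV)" if "k < n" for k
    using ind that by (auto simp: M.indep_vars_def)
  have fin: "finite (Q \<omega> \<inter> cellset K i)" if "\<omega> \<in> space M" for \<omega> i
  proof -
    have "finite (Q \<omega> \<inter> (pcell K (fst i) \<times> UNIV))"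
      by (rule mpp[unfolded marked_poisson_process_def, THEN conjunct2, THEN conjunct2, THEN conjunct1,
            THEN bspec, OF that, THEN spec, THEN mp, OF bounded_pcell])
    then show ?thesis by (rule finite_subset[rotated]) (auto simp: cellset_def)
  qed
  have bit: "h k \<in> cfg K (Q \<omega>) \<longleftrightarrow> (X k \<omega> \<noteq> 0) = snd (h k)" if "\<omega> \<in> space M" for \<omega> k
    using fin[OF that] unfolding cfg_cellset X_def by simp
  define E where "E J i = (if (i \<in> J) = snd i then {m::nat. m \<noteq> 0} else {0})" for J and i :: coord
  have pE: "measure M (X k -` E J (h k) \<inter> space M) = (if h k \<in> J then pw (1 - p) K (h k) else 1 - pw (1 - p) K (h k))"
    if k: "k < n" for k J
  proof -
    have z: "X k -` {0} \<inter> space M = {\<omega>\<in>space M. X k \<omega> = 0}" by auto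
    have zm: "{\<omega>\<in>space M. X k \<omega> = 0} \<in> sets M" using measurable_sets[OF rv[OF k], of "{0}"] z by simp
    have nz: "X k -` {m. m \<noteq> 0} \<inter> space M = space M - {\<omega>\<in>space M. X k \<omega> = 0}" by auto
    have mi: "mark_intensity p (cellset K (h k)) = (if snd (h k) then 1 - p else p) / real K ^ 3"
      by (rule intensity_cellset[OF K])
    have p0: "measure M (X k -` {0} \<inter> space M) = exp (- mark_intensity p (cellset K (h k)))"
      unfolding z by (rule pr[OF k])
    have pn: "measure M (X k -` {m. m \<noteq> 0} \<inter> space M) = 1 - exp (- mark_intensity p (cellset K (h k)))"
      unfolding nz M.prob_compl[OF zm] pr[OF k] ..
    have pp: "1 - (1 - p) = p" by simp
    have pwk: "pw (1 - p) K (h k) = (if snd (h k) then 1 - exp (- mark_intensity p (cellset K (h k)))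
        else exp (- mark_intensity p (cellset K (h k))))"
      unfolding pw_def mi minus_divide_left pp by (cases "snd (h k)") (simp_all only: if_True if_False)
    show ?thesis
    proof (cases "(h k \<in> J) = snd (h k)")
      case True
      then have "E J (h k) = {m. m \<noteq> 0}" unfolding E_def by (rule if_P)
      then show ?thesis using True pn by (cases "snd (h k)") (simp_all add: pwk del: neq0_conv)
    next
      case False
      then have "E J (h k) = {0}" unfolding E_def by (rule if_not_P)
      then show ?thesis using False p0 by (cases "snd (h k)") (simp_all add: pwk)
    qed
  qed
  define EV where "EV J = {\<omega>\<in>space M. cfg K (Q \<omega>) \<inter> I = J}" for J
  have EV: "EV J = (\<Inter>k\<in>{..<n}. X k -` E J (h k) \<inter> space M)" if J: "J \<subseteq> I" for J
  proof -
    have "cfg K (Q \<omega>) \<inter> I = J \<longleftrightarrow> (\<forall>k\<in>{..<n}. X k \<omega> \<in> E J (h k))" if w: "\<omega> \<in> space M" for \<omega>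
    proof -
      have "cfg K (Q \<omega>) \<inter> I = J \<longleftrightarrow> (\<forall>i\<in>I. i \<in> cfg K (Q \<omega>) \<longleftrightarrow> i \<in> J)" using J by blast
      also have "\<dots> \<longleftrightarrow> (\<forall>k\<in>{..<n}. h k \<in> cfg K (Q \<omega>) \<longleftrightarrow> h k \<in> J)" unfolding hI[symmetric] by blast
      also have "\<dots> \<longleftrightarrow> (\<forall>k\<in>{..<n}. X k \<omega> \<in> E J (h k))"
        unfolding bit[OF w] E_def by (intro ball_cong refl) auto
      finally show ?thesis .
    qed
    then show ?thesis unfolding EV_def using n0 by auto
  qed
  have EVs: "EV J \<in> sets M" if "J \<subseteq> I" for J
    unfolding EV[OF that] using n0 by (intro sets.finite_INT measurable_sets[OF rv]) auto
  have EVp: "measure M (EV J) = (\<Prod>i\<in>I. if i \<in> J then pw (1 - p) K i else 1 - pw (1 - p) K i)" if "J \<subseteq> I" for J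
  proof -
    have "measure M (EV J) = (\<Prod>k\<in>{..<n}. measure M (X k -` E J (h k) \<inter> space M))"
      unfolding EV[OF that] by (rule M.indep_varsD_finite[OF ind n0]) auto
    also have "\<dots> = (\<Prod>k\<in>{..<n}. if h k \<in> J then pw (1 - p) K (h k) else 1 - pw (1 - p) K (h k))"
      by (intro prod.cong refl pE) auto
    also have "\<dots> = (\<Prod>i\<in>I. if i \<in> J then pw (1 - p) K i else 1 - pw (1 - p) K i)"
      by (rule prod.reindex_bij_betw[OF h])
    finally show ?thesis .
  qed
  define P where "P = {J \<in> Pow I. \<Phi> J}"
  have finP: "finite P" using I(1) by (simp add: P_def)
  have eq: "{\<omega> \<in> space M. \<Phi> (cfg K (Q \<omega>))} = (\<Union>J\<in>P. EV J)"
  proof -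
    have "\<Phi> (cfg K (Q \<omega>)) = \<Phi> (cfg K (Q \<omega>) \<inter> I)" for \<omega> using depD[OF I(2)] by simp
    then show ?thesis unfolding EV_def P_def by auto
  qed
  show "{\<omega> \<in> space M. \<Phi> (cfg K (Q \<omega>))} \<in> sets M"
    unfolding eq using finP EVs by (intro sets.finite_UN) (auto simp: P_def)
  have "measure M (\<Union>J\<in>P. EV J) = (\<Sum>J\<in>P. measure M (EV J))"
  proof (rule M.finite_measure_finite_Union[OF finP])
    show "EV ` P \<subseteq> sets M" using EVs by (auto simp: P_def)
    show "disjoint_family_on EV P" by (auto simp: disjoint_family_on_def EV_def)
  qed
  also have "\<dots> = (\<Sum>J\<in>P. \<Prod>i\<in>I. if i \<in> J then pw (1 - p) K i else 1 - pw (1 - p) K i)"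
    by (intro sum.cong refl EVp) (auto simp: P_def)
  also have "\<dots> = (\<Sum>J\<in>Pow I. (\<Prod>i\<in>I. if i \<in> J then pw (1 - p) K i else 1 - pw (1 - p) K i) * of_bool (\<Phi> J))"
    unfolding P_def using I(1) by (intro sum.mono_neutral_cong_left) auto
  also have "\<dots> = PP (1 - p) K \<Phi>" by (simp add: prb_eq[OF I(1,2)] bexp_def)
  finally show "measure M {\<omega> \<in> space M. \<Phi> (cfg K (Q \<omega>))} = PP (1 - p) K \<Phi>" unfolding eq .
qed

section \<open>Polygonal paths\<close>

text \<open>Connection by a polygonal line inside \<open>S\<close>. The closure relates every point
  to itself, hence the hypothesis \<open>x \<in> S\<close> when a list of vertices is
  extracted.\<close>

abbreviation pl :: "pt2 set \<Rightarrow> pt2 \<Rightarrow> pt2 \<Rightarrow> bool" where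
  "pl S \<equiv> (\<lambda>a b. closed_segment a b \<subseteq> S)\<^sup>*\<^sup>*"

lemma pl_mono: "pl S x y \<Longrightarrow> S \<subseteq> T \<Longrightarrow> pl T x y"
  by (erule rtranclp_mono[THEN predicate2D, rotated]) blast

lemma pl_list:
  assumes "pl S x y" "x \<in> S"
  shows "\<exists>vs. vs \<noteq> [] \<and> hd vs = x \<and> last vs = y \<and> set vs \<subseteq> S \<and>
    (\<forall>i<length vs - 1. closed_segment (vs ! i) (vs ! Suc i) \<subseteq> S)"
  using assms
proof (induction rule: rtranclp_induct)
  case base
  then show ?case by (intro exI[of _ "[x]"]) auto
next
  case (step y z)
  then obtain vs where vs: "vs \<noteq> []" "hd vs = x" "last vs = y" "set vs \<subseteq> S"
    "\<And>i. i < length vs - 1 \<Longrightarrow> closed_segment (vs ! i) (vs ! Suc i) \<subseteq> S" by blast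
  have "closed_segment ((vs @ [z]) ! i) ((vs @ [z]) ! Suc i) \<subseteq> S" if i: "i < length (vs @ [z]) - 1" for i
  proof (cases "i < length vs - 1")
    case True
    then have "i < length vs" "Suc i < length vs" by auto
    then show ?thesis using vs(5)[of i] True by (simp add: nth_append)
  next
    case False
    then have ii: "i = length vs - 1" "Suc i = length vs" using i vs(1) by (auto simp: Suc_diff_1)
    then have "(vs @ [z]) ! i = y" "(vs @ [z]) ! Suc i = z" using vs(1,3) by (auto simp: nth_append last_conv_nth)
    then show ?thesis using step.hyps(2) by simp
  qed
  moreover have "z \<in> S" using step.hyps(2) by auto
  ultimately show ?case using vs by (intro exI[of _ "vs @ [z]"]) auto
qed

lemma segment_fst:
  fixes x y :: pt2
  assumes "fst x \<le> a" "a \<le> fst y"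
  obtains w where "w \<in> closed_segment x y" "fst w = a"
proof -
  have "connected (fst ` closed_segment x y)" by (intro connected_continuous_image continuous_intros connected_segment)
  then have "a \<in> fst ` closed_segment x y"
    by (rule connectedD_interval[of _ "fst x" "fst y"]) (use assms in auto)
  then show ?thesis using that by blast
qed

text \<open>Walk along the line and remember either that it is left of the strip, or a start on the
  line \<open>fst = 0\<close> from which the current point is reached within the strip. Falling back
  to the left forgets the start; first passing \<open>fst = a\<close> ends the walk.\<close>

lemma pl_clip:
  assumes "pl B x y" "fst x \<le> 0" "a \<le> fst y" "0 < a" "x \<in> B"
  shows "\<exists>x' y'. x' \<in> B \<and> fst x' = 0 \<and> fst y' = a \<and> pl (B \<inter> {w. 0 \<le> fst w \<and> fst w \<le> a}) x' y'"
proof -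
  let ?S = "B \<inter> {w. 0 \<le> fst w \<and> fst w \<le> a}"
  let ?goal = "\<exists>x' y'. x' \<in> B \<and> fst x' = 0 \<and> fst y' = a \<and> pl ?S x' y'"
  have strip: "closed_segment u v \<subseteq> {w. 0 \<le> fst w \<and> fst w \<le> a}"
    if "0 \<le> fst u" "fst u \<le> a" "0 \<le> fst v" "fst v \<le> a" for u v :: pt2
  proof -
    have "{w::pt2. 0 \<le> fst w \<and> fst w \<le> a} = {0..a} \<times> UNIV" by auto
    then have "convex {w::pt2. 0 \<le> fst w \<and> fst w \<le> a}" by (simp add: convex_Times)
    then show ?thesis using that by (intro closed_segment_subset) auto
  qed
  have advance: "?goal \<or> fst z \<le> 0 \<or> (fst z \<le> a \<and> (\<exists>x'\<in>B. fst x' = 0 \<and> pl ?S x' z))"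
    if y: "0 \<le> fst y" "fst y \<le> a" and x': "x' \<in> B" "fst x' = 0" "pl ?S x' y" and s: "closed_segment y z \<subseteq> B" for x' y z
  proof -
    consider "fst z \<le> 0" | "0 < fst z" "fst z \<le> a" | "a < fst z" by linarith
    then show ?thesis
    proof cases
      case 2
      have "closed_segment y z \<subseteq> ?S" using s strip[of y z] y 2 by auto
      then have "pl ?S x' z" using x'(3) by (rule rtranclp.rtrancl_into_rtrancl[rotated])
      then show ?thesis using 2 x' by blast
    next
      case 3
      obtain w where w: "w \<in> closed_segment y z" "fst w = a" using segment_fst[of y a z] y 3 by auto
      have "closed_segment y w \<subseteq> closed_segment y z" using w(1) by (simp add: subset_closed_segment)
      then have "closed_segment y w \<subseteq> ?S" using s strip[of y w] y w(2) by auto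
      then have "pl ?S x' w" using x'(3) by (rule rtranclp.rtrancl_into_rtrancl[rotated])
      then show ?thesis using x' w(2) by blast
    qed blast
  qed
  have "?goal \<or> fst y \<le> 0 \<or> (fst y \<le> a \<and> (\<exists>x'\<in>B. fst x' = 0 \<and> pl ?S x' y))"
    using assms(1)
  proof (induction rule: rtranclp_induct)
    case base
    then show ?case using assms(2) by blast
  next
    case (step y z)
    from step.IH consider "?goal" | "fst y \<le> 0" "fst z \<le> 0" | "fst y \<le> 0" "0 < fst z"
      | "0 < fst y" "fst y \<le> a" "\<exists>x'\<in>B. fst x' = 0 \<and> pl ?S x' y"
      using not_le[of "fst z" 0] not_le[of "fst y" 0] by blast
    then show ?case
    proof cases
      case 3
      obtain w where w: "w \<in> closed_segment y z" "fst w = 0" using segment_fst[of y 0 z] 3 by auto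
      have "closed_segment w z \<subseteq> closed_segment y z" using w(1) by (simp add: subset_closed_segment)
      then have s: "closed_segment w z \<subseteq> B" using step.hyps(2) by blast
      have "w \<in> B" using w(1) step.hyps(2) by blast
      then show ?thesis using advance[of w w z] w(2) s assms(4) by auto
    next
      case 4
      then obtain x' where "x' \<in> B" "fst x' = 0" "pl ?S x' y" by blast
      then show ?thesis using advance[of y x' z] 4 step.hyps(2) by auto
    qed blast+
  qed
  moreover have "\<not> fst y \<le> 0" using assms(3,4) by linarith
  moreover have "fst y = a" if "fst y \<le> a" using assms(3) that by linarith
  ultimately show ?thesis by blast
qed

section \<open>From discrete to continuous crossings\<close>

text \<open>Homogeneity compares the lattice with true distances, and the Lipschitz bound in the sum
  norm controls all rounding.\<close>

locale cell_norm =
  fixes N :: "real \<Rightarrow> real \<Rightarrow> real \<Rightarrow> real"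
  assumes N_neg1: "N (- u) v t = N u v t" and N_neg2: "N u (- v) t = N u v t"
    and N_swap: "N v u t = N u v t"
    and N_lb1: "\<bar>u\<bar> \<le> N u v t" and N_lb3: "\<bar>t\<bar> \<le> N u v t"
    and N_hom: "0 \<le> c \<Longrightarrow> N (c * u) (c * v) (c * t) = c * N u v t"
    and N_lip: "N (u + u') (v + v') (t + t') \<le> N u v t + (\<bar>u'\<bar> + \<bar>v'\<bar> + \<bar>t'\<bar>)"
begin

lemma N_zero: "N 0 0 0 = 0"
  using N_hom[of 0 0 0 0] by simp

sublocale planar_metric "\<lambda>u v t. N (real_of_int u) (real_of_int v) (real t)"
proof
  show "N (real_of_int u) (real_of_int v) (real t) \<le> \<bar>real_of_int u\<bar> + \<bar>real_of_int v\<bar> + real t" for u v t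
    using N_lip[of 0 "real_of_int u" 0 "real_of_int v" 0 "real t"] by (simp add: N_zero)
  show "real t \<le> N (real_of_int u) (real_of_int v) (real t)" for u v t
    using N_lb3[of "real t"] by simp
qed (simp_all add: N_neg1 N_neg2 N_lb1 N_swap)

definition dn :: "pt2 \<Rightarrow> pt3 \<Rightarrow> real" where
  "dn x z = N (fst x - fst z) (snd x - fst (snd z)) (snd (snd z))"

lemma dn_lip: "dn x z \<le> dn x' z + (\<bar>fst x - fst x'\<bar> + \<bar>snd x - snd x'\<bar>)"
  using N_lip[of "fst x' - fst z" "fst x - fst x'" "snd x' - fst (snd z)" "snd x - snd x'" "snd (snd z)" 0]
  unfolding dn_def by simp

lemma dn_lb: "\<bar>fst x - fst z\<bar> \<le> dn x z" "\<bar>snd x - fst (snd z)\<bar> \<le> dn x z" "\<bar>snd (snd z)\<bar> \<le> dn x z"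
  unfolding dn_def using N_lb1[of "snd x - fst (snd z)" "fst x - fst z"] by (simp_all add: N_lb1 N_lb3 N_swap)

lemma continuous_dn: "continuous_on S (\<lambda>x. dn x z)"
proof (rule continuous_onI)
  fix x and e :: real assume "0 < e"
  have "dist (dn x' z) (dn x z) \<le> e" if "dist x' x < e / 2" for x'
  proof -
    have "\<bar>fst x' - fst x\<bar> \<le> dist x' x" "\<bar>snd x' - snd x\<bar> \<le> dist x' x"
      using dist_fst_le[of x' x] dist_snd_le[of x' x] by (simp_all add: dist_real_def)
    moreover have "\<bar>fst x - fst x'\<bar> = \<bar>fst x' - fst x\<bar>" "\<bar>snd x - snd x'\<bar> = \<bar>snd x' - snd x\<bar>" by simp_all
    ultimately have "dn x z \<le> dn x' z + e" "dn x' z \<le> dn x z + e"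
      using dn_lip[of x z x'] dn_lip[of x' z x] that by linarith+
    then show ?thesis by (simp add: dist_real_def abs_le_iff)
  qed
  then show "\<exists>d>0. \<forall>x'\<in>S. dist x' x < d \<longrightarrow> dist (dn x' z) (dn x z) \<le> e"
    using \<open>0 < e\<close> by (intro exI[of _ "e / 2"]) auto
qed

text \<open>For \<open>\<epsilon> = 0\<close>, \<open>x\<close> lies in the cell of \<open>z\<close>
  at distance at most \<open>g\<close>. A positive \<open>\<epsilon>\<close> is the closed
  relaxation that a discrete crossing provides; the bound \<open>g\<close> restricts attention to
  boundedly many nuclei.\<close>

definition near :: "pt3 set \<Rightarrow> real \<Rightarrow> real \<Rightarrow> pt2 \<Rightarrow> pt3 \<Rightarrow> bool" where
  "near P g \<epsilon> x z \<longleftrightarrow> dn x z \<le> g + \<epsilon> \<and> (\<forall>z'\<in>P. dn x z \<le> dn x z' + \<epsilon>)"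

lemma near_mono: "near P g \<epsilon> x z \<Longrightarrow> \<epsilon> \<le> \<epsilon>' \<Longrightarrow> near P g \<epsilon>' x z"
  unfolding near_def by force

text \<open>Moving the point changes each distance by at most \<open>2 * \<delta>\<close>, and two
  distances are compared.\<close>

lemma near_shift:
  assumes "near P g \<epsilon> x z" "\<bar>fst x - fst x'\<bar> \<le> \<delta>" "\<bar>snd x - snd x'\<bar> \<le> \<delta>"
  shows "near P g (\<epsilon> + 4 * \<delta>) x' z"
proof -
  have sym: "\<bar>fst x' - fst x\<bar> \<le> \<delta>" "\<bar>snd x' - snd x\<bar> \<le> \<delta>" using assms(2,3) by (simp_all add: abs_minus_commute)
  have d: "0 \<le> \<delta>" using assms(2) abs_ge_zero order_trans by blast
  have a: "dn x' z \<le> dn x z + 2 * \<delta>" using dn_lip[of x' z x] sym by linarith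
  have b: "dn x z' \<le> dn x' z' + 2 * \<delta>" for z' using dn_lip[of x z' x'] assms(2,3) by linarith
  show ?thesis unfolding near_def
  proof (intro conjI ballI)
    show "dn x' z \<le> g + (\<epsilon> + 4 * \<delta>)" using a assms(1) d unfolding near_def by linarith
    fix z' assume "z' \<in> P"
    then have "dn x z \<le> dn x z' + \<epsilon>" using assms(1) unfolding near_def by blast
    then show "dn x' z \<le> dn x' z' + (\<epsilon> + 4 * \<delta>)" using a b[of z'] by linarith
  qed
qed

text \<open>The points of \<open>S\<close> that are nearly common to both cells form a decreasing
  sequence of compact sets whose intersection is the set of exact common points; if that is empty,
  so is some member.\<close>

lemma near_compact:
  assumes "compact S"
  shows "eventually (\<lambda>n. (\<exists>x\<in>S. near P g (1 / real (Suc n)) x z \<and> near P g (1 / real (Suc n)) x z') \<longrightarrow>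
     (\<exists>x\<in>S. near P g 0 x z \<and> near P g 0 x z')) sequentially"
proof (cases "\<exists>x\<in>S. near P g 0 x z \<and> near P g 0 x z'")
  case False
  define F where "F n = {x\<in>S. near P g (1 / real (Suc n)) x z \<and> near P g (1 / real (Suc n)) x z'}" for n
  have cl: "closed {x. near P g \<epsilon> x y}" for \<epsilon> y
  proof -
    have "{x. near P g \<epsilon> x y} = {x. dn x y \<le> g + \<epsilon>} \<inter> (\<Inter>z'\<in>P. {x. dn x y \<le> dn x z' + \<epsilon>})"
      unfolding near_def by blast
    also have "closed \<dots>" by (intro closed_Int closed_INT ballI closed_Collect_le continuous_intros continuous_dn)
    finally show ?thesis .
  qed
  have "F n = S \<inter> ({x. near P g (1 / real (Suc n)) x z} \<inter> {x. near P g (1 / real (Suc n)) x z'})" for n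
    unfolding F_def by blast
  then have comp: "compact (F n)" for n using assms cl by (simp add: compact_Int_closed closed_Int)
  have mono: "F n \<subseteq> F m" if "m \<le> n" for m n
  proof -
    have "1 / real (Suc n) \<le> 1 / real (Suc m)" using that by (intro divide_left_mono) auto
    then show ?thesis unfolding F_def using near_mono by blast
  qed
  have lim0: "near P g 0 x y" if "\<And>n. near P g (1 / real (Suc n)) x y" for x y
  proof -
    have t: "(\<lambda>n. c + 1 / real (Suc n)) \<longlonglongrightarrow> c + 0" for c :: real
      by (intro tendsto_add tendsto_const LIMSEQ_Suc[OF lim_inverse_n'])
    have "a \<le> c + 0" if "\<And>n. a \<le> c + 1 / real (Suc n)" for a c :: real
      by (rule LIMSEQ_le_const[OF t]) (use that in blast)
    then show ?thesis using that unfolding near_def by blast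
  qed
  have "\<exists>n. F n = {}"
  proof (rule ccontr)
    assume "\<not> ?thesis"
    then have "\<Inter> (range F) \<noteq> {}" using compact_nest[of F] comp mono by blast
    then obtain x where x: "\<And>n. x \<in> F n" by blast
    then have "x \<in> S" "near P g 0 x z" "near P g 0 x z'" unfolding F_def by (blast intro: lim0)+
    then show False using False by blast
  qed
  then obtain n0 where n0: "F n0 = {}" by blast
  have "F n = {}" if "n \<ge> n0" for n using mono[OF that] n0 by blast
  then show ?thesis unfolding eventually_sequentially F_def by blast
qed simp

text \<open>A point of a cell differs from its lower corner by at most \<open>1 / K\<close> in each
  of three coordinates.\<close>

lemma dn_dd:
  fixes x :: site
  assumes K: "K \<ge> 1" and p: "p \<in> pcell K b"
  defines "xr \<equiv> (real_of_int (fst x) / real K, real_of_int (snd x) / real K)"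
  shows "dn xr p \<le> dd x b / real K + 3 / real K" "dd x b / real K \<le> dn xr p + 3 / real K"
proof -
  define k where "k = 1 / real K"
  have k: "k \<ge> 0" by (simp add: k_def)
  let ?u = "real_of_int (fst x - fst (fst b))" and ?v = "real_of_int (snd x - snd (fst b))" and ?t = "real (snd b)"
  let ?u' = "fst xr - fst p" and ?v' = "snd xr - fst (snd p)" and ?t' = "snd (snd p)"
  have e: "dd x b / real K = N (k * ?u) (k * ?v) (k * ?t)"
    using N_hom[OF k, of ?u ?v ?t] unfolding dd_def k_def by simp
  have c: "real_of_int (fst (fst b)) / real K \<le> fst p" "fst p < (real_of_int (fst (fst b)) + 1) / real K"
    "real_of_int (snd (fst b)) / real K \<le> fst (snd p)" "fst (snd p) < (real_of_int (snd (fst b)) + 1) / real K"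
    "real (snd b) / real K \<le> snd (snd p)" "snd (snd p) < (real (snd b) + 1) / real K"
    using p unfolding pcell_def by auto
  have d: "\<bar>?u' - k * ?u\<bar> \<le> k" "\<bar>?v' - k * ?v\<bar> \<le> k" "\<bar>?t' - k * ?t\<bar> \<le> k"
    using c unfolding xr_def k_def abs_le_iff by (simp_all add: diff_divide_distrib add_divide_distrib)
  have d': "\<bar>k * ?u - ?u'\<bar> \<le> k" "\<bar>k * ?v - ?v'\<bar> \<le> k" "\<bar>k * ?t - ?t'\<bar> \<le> k"
    using d by (simp_all only: abs_minus_commute)
  have "N ?u' ?v' ?t' \<le> N (k * ?u) (k * ?v) (k * ?t) + (\<bar>?u' - k * ?u\<bar> + \<bar>?v' - k * ?v\<bar> + \<bar>?t' - k * ?t\<bar>)"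
    using N_lip[of "k * ?u" "?u' - k * ?u" "k * ?v" "?v' - k * ?v" "k * ?t" "?t' - k * ?t"] by simp
  moreover have "N (k * ?u) (k * ?v) (k * ?t) \<le> N ?u' ?v' ?t' + (\<bar>k * ?u - ?u'\<bar> + \<bar>k * ?v - ?v'\<bar> + \<bar>k * ?t - ?t'\<bar>)"
    using N_lip[of ?u' "k * ?u - ?u'" ?v' "k * ?v - ?v'" ?t' "k * ?t - ?t'"] by simp
  moreover have "3 / real K = k + k + k" by (simp add: k_def)
  ultimately show "dn xr p \<le> dd x b / real K + 3 / real K" "dd x b / real K \<le> dn xr p + 3 / real K"
    unfolding e dn_def using d d' by linarith+
qed

text \<open>The error \<open>6 / K\<close> is twice that of \<open>dn_dd\<close>, once for the
  chosen nucleus and once for its competitor.\<close>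

lemma cb_near:
  assumes K: "K \<ge> 1" and Q: "Q \<subseteq> halfspace \<times> UNIV" and cb: "cb (g * K) (cfg K Q) x"
  shows "\<exists>z. (z, True) \<in> Q \<and> near (fst ` Q) (real g) (6 / real K) (real_of_int (fst x) / real K, real_of_int (snd x) / real K) z"
proof -
  obtain b where b: "(b, False) \<notin> cfg K Q" "dd x b \<le> real (g * K)"
    "\<And>z. (z, False) \<notin> cfg K Q \<or> (z, True) \<in> cfg K Q \<Longrightarrow> dd x b \<le> dd x z"
    using cb unfolding cb_def by blast
  obtain p where p: "p \<in> pcell K b" "(p, True) \<in> Q" using b(1) by (auto simp: cfg_def)
  let ?x = "(real_of_int (fst x) / real K, real_of_int (snd x) / real K)"
  have up: "dn ?x p \<le> dd x b / real K + 3 / real K" by (rule dn_dd(1)[OF K p(1)])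
  have six: "6 / real K = 3 / real K + 3 / real K" by simp
  have "near (fst ` Q) (real g) (6 / real K) ?x p" unfolding near_def
  proof (intro conjI ballI)
    have "dd x b / real K \<le> real g" using b(2) K by (simp add: divide_le_eq)
    moreover have "0 \<le> 3 / real K" by simp
    ultimately show "dn ?x p \<le> real g + 6 / real K" using up six by linarith
    fix z' assume "z' \<in> fst ` Q"
    then obtain c where c: "(z', c) \<in> Q" by auto
    then have "0 \<le> snd (snd z')" using Q by (auto simp: halfspace_def)
    then have z': "z' \<in> pcell K (cellof K z')" by (simp add: pcell_iff[OF K])
    have "(cellof K z', False) \<notin> cfg K Q \<or> (cellof K z', True) \<in> cfg K Q"
      using c z' unfolding cfg_def by (cases c) auto
    then have "dd x b / real K \<le> dd x (cellof K z') / real K" using b(3) by (intro divide_right_mono) auto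
    then show "dn ?x p \<le> dn ?x z' + 6 / real K" using up dn_dd(2)[OF K z', of x] six by linarith
  qed
  then show ?thesis using p(2) by blast
qed

end

text \<open>The only geometric input that differs between the two metrics: two points of a strip in
  one cell are joined inside the cell by a polygonal line that leaves the strip by at most
  \<open>g\<close>.\<close>

locale crossing_norm = cell_norm +
  assumes cell_conn: "\<lbrakk>near P g 0 x z; near P g 0 y z; l \<le> snd x; snd x \<le> r; l \<le> snd y; snd y \<le> r\<rbrakk> \<Longrightarrow>
     pl {w. near P g 0 w z \<and> l - g \<le> snd w \<and> snd w \<le> r + g} x y"
begin

text \<open>Local finiteness leaves finitely many relevant black nuclei, so one tolerance works for
  all pairs: nuclei whose cells nearly meet in the window do meet there. For \<open>K\<close> fine
  enough this turns consecutive sites of the discrete path into cells with an exact common point,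
  and these points are joined inside the cells.\<close>

lemma crossing_of_cross:
  fixes d :: "pt3 \<Rightarrow> pt3 \<Rightarrow> real"
  assumes d: "\<And>x z. d (fst x, snd x, 0) z = dn x z"
    and Q: "Q \<subseteq> halfspace \<times> UNIV" and fin: "\<And>S. bounded S \<Longrightarrow> finite (Q \<inter> (S \<times> UNIV))"
    and inf: "\<And>n. \<exists>K\<ge>n. cross g L K (cfg K Q)" and a: "0 < a" "a \<le> real L"
  shows "black_crossing d Q a (10 * real g)"
proof -
  define R where "R = {0..real L} \<times> {real g..9 * real g}"
  \<comment> \<open>The two vertical sides are treated like the window, so that the first and the
    last cell really reach them.\<close>
  define E0 where "E0 = {0..0::real} \<times> {real g..9 * real g}"
  define E1 where "E1 = {real L..real L} \<times> {real g..9 * real g}"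
  have comp: "compact R" "compact E0" "compact E1" unfolding R_def E0_def E1_def by (intro compact_Times compact_Icc)+
  have ER: "E0 \<subseteq> R" "E1 \<subseteq> R" by (auto simp: R_def E0_def E1_def)
  let ?near = "near (fst ` Q) (real g)"
  define F where "F = {z. (z, True) \<in> Q \<and> (\<exists>x\<in>R. ?near 1 x z)}"
  define Z where "Z = {- (real g + 1)..real L + real g + 1} \<times> {-1..10 * real g + 1} \<times> {- (real g + 1)..real g + 1}"
  have "bounded Z" unfolding Z_def by (intro bounded_Times bounded_closed_interval)
  then have "finite (fst ` (Q \<inter> (Z \<times> UNIV)))" using fin by blast
  moreover have "F \<subseteq> fst ` (Q \<inter> (Z \<times> UNIV))"
  proof
    fix z assume "z \<in> F"
    then obtain x where x: "(z, True) \<in> Q" "x \<in> R" "dn x z \<le> real g + 1" unfolding F_def near_def by blast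
    have "\<bar>fst x - fst z\<bar> \<le> real g + 1" "\<bar>snd x - fst (snd z)\<bar> \<le> real g + 1" "\<bar>snd (snd z)\<bar> \<le> real g + 1"
      using dn_lb[where x=x and z=z] x(3) by linarith+
    then have "z \<in> Z" using x(2) unfolding R_def Z_def by (cases z; cases x) auto
    then show "z \<in> fst ` (Q \<inter> (Z \<times> UNIV))" using x(1) by force
  qed
  ultimately have finF: "finite F" by (rule finite_subset[rotated])
  define ok where "ok S n \<longleftrightarrow> (\<forall>zz\<in>F \<times> F. (\<exists>x\<in>S. ?near (1 / real (Suc n)) x (fst zz) \<and> ?near (1 / real (Suc n)) x (snd zz)) \<longrightarrow>
     (\<exists>x\<in>S. ?near 0 x (fst zz) \<and> ?near 0 x (snd zz)))" for S n
  have ev: "eventually (ok S) sequentially" if "compact S" for S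
    unfolding ok_def using finF by (intro eventually_ball_finite ballI near_compact[OF that]) auto
  have "eventually (\<lambda>n. ok R n \<and> ok E0 n \<and> ok E1 n) sequentially"
    using ev[OF comp(1)] ev[OF comp(2)] ev[OF comp(3)] by (intro eventually_conj)
  then obtain n where n: "ok R n" "ok E0 n" "ok E1 n" by (auto simp: eventually_sequentially)
  \<comment> \<open>The 10 is 6 from \<open>cb_near\<close> plus 4 from moving to a neighbouring
    site by \<open>near_shift\<close>.\<close>
  obtain K where K: "K \<ge> 10 * Suc n" "cross g L K (cfg K Q)" using inf by blast
  have K1: "K \<ge> 1" using K(1) by simp
  have K0: "0 < real K" using K1 by simp
  have eps: "10 / real K \<le> 1 / real (Suc n)"
  proof -
    have "real (10 * Suc n) \<le> real K" using K(1) by (simp only: of_nat_le_iff)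
    then show ?thesis using K0 by (simp add: field_simps)
  qed
  have eps1: "1 / real (Suc n) \<le> 1" by simp
  have six: "6 / real K \<le> 1 / real (Suc n)" 
  proof -
    have "6 / real K \<le> 10 / real K" using K0 by (simp add: divide_right_mono)
    then show ?thesis using eps by linarith
  qed
  define S0 where "S0 = {x \<in> window g L K. cb (g * K) (cfg K Q) x}"
  obtain x x' where xx: "fst x = 0" "fst x' = int (L * K)" and re: "reach adj8 S0 x x'"
    using K(2) unfolding cross_def S0_def by blast
  define sc where "sc y = (real_of_int (fst y) / real K, real_of_int (snd y) / real K)" for y :: site
  have scR: "sc y \<in> R" if "y \<in> S0" for y
  proof -
    have "0 \<le> fst y" "fst y \<le> int (L * K)" "int (g * K) \<le> snd y" "snd y \<le> int (9 * g * K)"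
      using that by (auto simp: S0_def window_def)
    then have "0 \<le> real_of_int (fst y)" "real_of_int (fst y) \<le> real_of_int (int (L * K))"
      "real_of_int (int (g * K)) \<le> real_of_int (snd y)" "real_of_int (snd y) \<le> real_of_int (int (9 * g * K))"
      by (simp_all only: of_int_le_iff of_int_0_le_iff)
    then show ?thesis using K0 unfolding sc_def R_def by (simp add: divide_le_eq le_divide_eq)
  qed
  have pick: "\<exists>z. (z, True) \<in> Q \<and> ?near (6 / real K) (sc y) z" if "y \<in> S0" for y
    using cb_near[OF K1 Q, of g y] that unfolding S0_def sc_def by blast
  have inF: "z \<in> F" if "(z, True) \<in> Q" "y \<in> S0" "?near (6 / real K) (sc y) z" for z y
    unfolding F_def using that scR[OF that(2)] near_mono[OF that(3), of 1] six eps1 by force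
  define B where "B = {w. black_point d Q w \<and> 0 \<le> snd w \<and> snd w \<le> 10 * real g}"
  have black: "black_point d Q w" if "(z, True) \<in> Q" "?near 0 w z" for w z
  proof -
    have zQ: "z \<in> fst ` Q" using that(1) by force
    have "(INF z'\<in>fst ` Q. dn w z') = dn w z"
      by (rule cInf_eq_minimum) (use zQ that(2) in \<open>auto simp: near_def\<close>)
    then have "w \<in> voronoi_cell d (fst ` Q) z" unfolding voronoi_cell_def by (simp add: d)
    then show ?thesis using that(1) unfolding black_point_def by blast
  qed
  have conn: "pl B u v" if "(z, True) \<in> Q" "u \<in> R" "v \<in> R" "?near 0 u z" "?near 0 v z" for u v z
  proof -
    have "real g \<le> snd u" "snd u \<le> 9 * real g" "real g \<le> snd v" "snd v \<le> 9 * real g"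
      using that(2,3) by (auto simp: R_def)
    then have "pl {w. ?near 0 w z \<and> real g - real g \<le> snd w \<and> snd w \<le> 9 * real g + real g} u v"
      by (intro cell_conn[OF that(4,5)])
    moreover have "{w. ?near 0 w z \<and> real g - real g \<le> snd w \<and> snd w \<le> 9 * real g + real g} \<subseteq> B"
      unfolding B_def using black[OF that(1)] by auto
    ultimately show ?thesis by (rule pl_mono)
  qed
  have xS: "x \<in> S0" "x' \<in> S0" using reach_in[OF re] by auto
  obtain z0 where z0: "(z0, True) \<in> Q" "?near (6 / real K) (sc x) z0" using pick[OF xS(1)] by blast
  have "sc x \<in> E0" using scR[OF xS(1)] xx(1) unfolding R_def E0_def sc_def by auto
  then have "\<exists>w\<in>E0. ?near 0 w z0"
    using n(2) inF[OF z0(1) xS(1) z0(2)] near_mono[OF z0(2) six] unfolding ok_def by fastforce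
  then obtain x0 where x0: "x0 \<in> E0" "?near 0 x0 z0" by blast
  have "\<exists>z w. (z, True) \<in> Q \<and> ?near (6 / real K) (sc x') z \<and> w \<in> R \<and> ?near 0 w z \<and> pl B x0 w"
    using re
  proof (induction rule: reach_induct)
    case refl
    then show ?case using z0 x0 ER by blast
  next
    case (step y y')
    then obtain z w where zw: "(z, True) \<in> Q" "?near (6 / real K) (sc y) z" "w \<in> R" "?near 0 w z" "pl B x0 w" by blast
    have yS: "y \<in> S0" using reach_in(2)[OF step(1)] .
    obtain z' where z': "(z', True) \<in> Q" "?near (6 / real K) (sc y') z'" using pick[OF step(3)] by blast
    have "\<bar>fst y' - fst y\<bar> \<le> 1" "\<bar>snd y' - snd y\<bar> \<le> 1" using step(2) by (auto simp: adj8_def)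
    then have "\<bar>real_of_int (fst y') - real_of_int (fst y)\<bar> \<le> 1" "\<bar>real_of_int (snd y') - real_of_int (snd y)\<bar> \<le> 1" by linarith+
    then have "\<bar>fst (sc y') - fst (sc y)\<bar> \<le> 1 / real K" "\<bar>snd (sc y') - snd (sc y)\<bar> \<le> 1 / real K"
      unfolding sc_def using K0 by (simp_all add: diff_divide_distrib[symmetric] divide_right_mono)
    then have "?near (6 / real K + 4 * (1 / real K)) (sc y) z'" by (rule near_shift[OF z'(2)])
    then have "?near (10 / real K) (sc y) z'" by (simp add: add_divide_distrib[symmetric])
    then have nz': "?near (1 / real (Suc n)) (sc y) z'" using eps by (rule near_mono)
    have nz: "?near (1 / real (Suc n)) (sc y) z" by (rule near_mono[OF zw(2) six])
    have "(z, z') \<in> F \<times> F" using inF[OF zw(1) yS zw(2)] inF[OF z'(1) step(3) z'(2)] by blast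
    then have "\<exists>v\<in>R. ?near 0 v z \<and> ?near 0 v z'"
      using n(1) scR[OF yS] nz nz' unfolding ok_def by fastforce
    then obtain v where v: "v \<in> R" "?near 0 v z" "?near 0 v z'" by blast
    have "pl B w v" by (rule conn[OF zw(1,3) v(1) zw(4) v(2)])
    then have "pl B x0 v" using zw(5) by (rule rtranclp_trans[rotated])
    then show ?case using z' v by blast
  qed
  then obtain z w where zw: "(z, True) \<in> Q" "?near (6 / real K) (sc x') z" "w \<in> R" "?near 0 w z" "pl B x0 w" by blast
  have "sc x' \<in> E1" using scR[OF xS(2)] xx(2) K0 unfolding R_def E1_def sc_def by auto
  then have "\<exists>v\<in>E1. ?near 0 v z"
    using n(3) inF[OF zw(1) xS(2) zw(2)] near_mono[OF zw(2) six] unfolding ok_def by fastforce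
  then obtain x1 where x1: "x1 \<in> E1" "?near 0 x1 z" by blast
  have "pl B w x1" using conn[OF zw(1,3) _ zw(4) x1(2)] x1(1) ER by blast
  then have pl: "pl B x0 x1" using zw(5) by (rule rtranclp_trans[rotated])
  have "fst x0 \<le> 0" "a \<le> fst x1" using x0(1) x1(1) a(2) by (auto simp: E0_def E1_def)
  moreover have "x0 \<in> B" using black[OF z0(1) x0(2)] x0(1) unfolding B_def E0_def by auto
  ultimately obtain u v where uv: "u \<in> B" "fst u = 0" "fst v = a" "pl (B \<inter> {w. 0 \<le> fst w \<and> fst w \<le> a}) u v"
    using pl_clip[OF pl _ _ a(1)] by blast
  let ?T = "B \<inter> {w. 0 \<le> fst w \<and> fst w \<le> a}"
  have "u \<in> ?T" using uv(1,2) a by simp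
  then obtain vs where vs: "vs \<noteq> []" "hd vs = u" "last vs = v" "set vs \<subseteq> ?T"
    "\<And>i. i < length vs - 1 \<Longrightarrow> closed_segment (vs ! i) (vs ! Suc i) \<subseteq> ?T"
    using pl_list[OF uv(4)] by blast
  have T: "?T \<subseteq> {0..a} \<times> {0..10 * real g}" "\<And>w. w \<in> ?T \<Longrightarrow> black_point d Q w"
    unfolding B_def by auto
  show ?thesis unfolding black_crossing_def
  proof (intro exI[of _ vs] conjI allI impI ballI)
    show "vs \<noteq> []" "fst (hd vs) = 0" "fst (last vs) = a" using vs(1-3) uv(2,3) by auto
    show "closed_segment (vs ! i) (vs ! Suc i) \<subseteq> {0..a} \<times> {0..10 * real g}" if "i < length vs - 1" for i
      using vs(5)[OF that] T(1) by (rule subset_trans)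
    show "black_point d Q w" if "i < length vs - 1" "w \<in> closed_segment (vs ! i) (vs ! Suc i)" for i w
      by (rule T(2)) (use vs(5)[OF that(1)] that(2) in blast)
    show "v \<in> {0..a} \<times> {0..10 * real g}" if "v \<in> set vs" for v using vs(4) T(1) that by blast
    show "black_point d Q v" if "v \<in> set vs" for v by (rule T(2)) (use vs(4) that in blast)
  qed
qed

text \<open>The set exhibited is the limit superior of the discrete crossing events. Each has
  probability at least \<open>1 - \<delta>\<close>, so continuity from above gives the same for the
  limit superior, and each of its configurations satisfies \<open>crossing_of_cross\<close>. A
  measurable subset is produced, so measurability of the crossing event itself is not at
  stake.\<close>

lemma likely_crossing:
  fixes d :: "pt3 \<Rightarrow> pt3 \<Rightarrow> real" and c\<^sub>1 s\<^sub>1 \<rho> :: real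
  assumes d: "\<And>x z. d (fst x, snd x, 0) z = dn x z"
    and mpp: "marked_poisson_process M p Q"
    and \<rho>: "\<rho> > 1" and p: "p > 1/2" "p \<le> 1" and c1: "c\<^sub>1 < 1"
  shows "\<exists>s > s\<^sub>1. \<exists>A \<in> sets M. A \<subseteq> {\<omega> \<in> space M. black_crossing d (Q \<omega>) (\<rho> * s) s} \<and> measure M A > c\<^sub>1"
proof -
  interpret M: prob_space M using mpp by (simp add: marked_poisson_process_def)
  define \<delta> where "\<delta> = (1 - c\<^sub>1) / 2"
  have \<delta>: "0 < \<delta>" "c\<^sub>1 < 1 - \<delta>" using c1 by (auto simp: \<delta>_def field_simps)
  define m where "m = nat \<lceil>\<rho>\<rceil>"
  have m: "\<rho> \<le> real m" unfolding m_def by (rule real_nat_ceiling_ge)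
  have q: "0 \<le> 1 - p" "1 - p < 1/2" using p by auto
  obtain g \<kappa> where g: "g > nat \<lceil>s\<^sub>1\<rceil>" and \<kappa>: "strict_mono (\<kappa> :: nat \<Rightarrow> nat)"
    "\<And>j. 1 - \<delta> \<le> PP (1 - p) (\<kappa> j) (cross g (10 * g * m) (\<kappa> j))"
    using cross_likely[OF q \<delta>(1), of "nat \<lceil>s\<^sub>1\<rceil>" m] by blast
  define s where "s = 10 * real g"
  have "s\<^sub>1 < real g" using g real_nat_ceiling_ge[of s\<^sub>1] by linarith
  then have s: "s > s\<^sub>1" "s > 0" using g unfolding s_def by linarith+
  \<comment> \<open>The index \<open>Suc j\<close> guarantees a positive number of cells per
    unit.\<close>
  define C where "C j = {\<omega> \<in> space M. cross g (10 * g * m) (\<kappa> (Suc j)) (cfg (\<kappa> (Suc j)) (Q \<omega>))}" for j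
  have \<kappa>j: "j \<le> \<kappa> j" for j by (rule strict_mono_imp_increasing[OF \<kappa>(1)])
  have \<kappa>1: "\<kappa> (Suc j) \<ge> 1" for j using \<kappa>j[of "Suc j"] by simp
  have Cs: "C j \<in> sets M" for j unfolding C_def by (rule cfg_probability(1)[OF mpp \<kappa>1 loc_cross])
  have Cp: "1 - \<delta> \<le> measure M (C j)" for j
    unfolding C_def cfg_probability(2)[OF mpp \<kappa>1 loc_cross] by (rule \<kappa>(2))
  define U where "U k = (\<Union>j\<in>{k..}. C j)" for k
  have Us: "U k \<in> sets M" for k unfolding U_def using Cs by (intro sets.countable_UN') auto
  have "1 - \<delta> \<le> measure M (U k)" for k
    using Cp[of k] M.finite_measure_mono[of "C k" "U k"] Us by (force simp: U_def)
  moreover have "(\<lambda>k. measure M (U k)) \<longlonglongrightarrow> measure M (\<Inter>k. U k)"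
  proof (rule M.finite_Lim_measure_decseq)
    show "range U \<subseteq> sets M" using Us by blast
    show "decseq U" unfolding decseq_def U_def by (intro allI impI UN_mono) auto
  qed
  ultimately have mA: "1 - \<delta> \<le> measure M (\<Inter>k. U k)" by (intro LIMSEQ_le_const[of "\<lambda>k. measure M (U k)"]) auto
  have As: "(\<Inter>k. U k) \<in> sets M" using Us by (intro sets.countable_INT) auto
  have "black_crossing d (Q \<omega>) (\<rho> * s) s" if w: "\<omega> \<in> space M" "\<omega> \<in> (\<Inter>k. U k)" for \<omega>
    unfolding s_def
  proof (rule crossing_of_cross[OF d])
    show "Q \<omega> \<subseteq> halfspace \<times> UNIV"
      by (rule mpp[unfolded marked_poisson_process_def, THEN conjunct2, THEN conjunct1, THEN bspec, OF w(1)])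
    show "finite (Q \<omega> \<inter> (S \<times> UNIV))" if "bounded S" for S
      by (rule mpp[unfolded marked_poisson_process_def, THEN conjunct2, THEN conjunct2, THEN conjunct1,
            THEN bspec, OF w(1), THEN spec, THEN mp, OF that])
    show "\<exists>K\<ge>n. cross g (10 * g * m) K (cfg K (Q \<omega>))" for n
    proof -
      have "\<omega> \<in> U n" using w(2) by blast
      then obtain j where j: "j \<ge> n" "\<omega> \<in> C j" unfolding U_def by blast
      then have "n \<le> \<kappa> (Suc j)" using \<kappa>j[of "Suc j"] by linarith
      then show ?thesis using j(2) unfolding C_def by blast
    qed
    show "0 < \<rho> * (10 * real g)" using \<rho> s(2) unfolding s_def by simp
    show "\<rho> * (10 * real g) \<le> real (10 * g * m)"
    proof -
      have "\<rho> * (10 * real g) \<le> real m * (10 * real g)" using m by (intro mult_right_mono) auto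
      then show ?thesis by (simp add: mult_ac)
    qed
  qed
  moreover have "(\<Inter>k. U k) \<subseteq> space M" using sets.sets_into_space[OF As] .
  ultimately have "(\<Inter>k. U k) \<subseteq> {\<omega> \<in> space M. black_crossing d (Q \<omega>) (\<rho> * s) s}" by blast
  then show ?thesis using s(1) As mA \<delta>(2) by (intro exI[of _ s] conjI bexI[of _ "\<Inter>k. U k"]) auto
qed

end

section \<open>The Euclidean and the Johnson-Mehl norm\<close>

lemma norm_swap: "norm (v, u, t) = norm (u, v, t)" for u v t :: real
  by (simp add: norm_Pair add_ac)

lemma norm_Pair3_le: "norm (u, v, t) \<le> \<bar>u\<bar> + \<bar>v\<bar> + \<bar>t\<bar>" for u v t :: real
  using norm_Pair_le[of u "(v, t)"] norm_Pair_le[of v t] by simp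

interpretation E: cell_norm "\<lambda>u v t. norm (u, v, t)"
proof
  fix u v t u' v' t' c :: real
  show "norm (- u, v, t) = norm (u, v, t)" "norm (u, - v, t) = norm (u, v, t)" by (simp_all add: norm_Pair)
  show "norm (v, u, t) = norm (u, v, t)" by (rule norm_swap)
  show "\<bar>u\<bar> \<le> norm (u, v, t)" using norm_fst_le[of u "(v, t)"] by simp
  show "\<bar>t\<bar> \<le> norm (u, v, t)" using norm_snd_le[of "(v, t)" u] norm_snd_le[of t v] by simp
  show "norm (c * u, c * v, c * t) = c * norm (u, v, t)" if "0 \<le> c"
    using norm_scaleR[of c "(u, v, t)"] that by simp
  show "norm (u + u', v + v', t + t') \<le> norm (u, v, t) + (\<bar>u'\<bar> + \<bar>v'\<bar> + \<bar>t'\<bar>)"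
    using norm_triangle_ineq[of "(u, v, t)" "(u', v', t')"] norm_Pair3_le[of u' v' t'] by simp
qed

interpretation J: cell_norm "\<lambda>u v t. norm (u, v) + \<bar>t\<bar>"
proof
  fix u v t u' v' t' c :: real
  show "norm (- u, v) + \<bar>t\<bar> = norm (u, v) + \<bar>t\<bar>" "norm (u, - v) + \<bar>t\<bar> = norm (u, v) + \<bar>t\<bar>"
    "norm (v, u) + \<bar>t\<bar> = norm (u, v) + \<bar>t\<bar>" by (simp_all add: norm_Pair add_ac)
  show "\<bar>u\<bar> \<le> norm (u, v) + \<bar>t\<bar>" using norm_fst_le[of u v] by simp
  show "\<bar>t\<bar> \<le> norm (u, v) + \<bar>t\<bar>" by simp
  show "norm (c * u, c * v) + \<bar>c * t\<bar> = c * (norm (u, v) + \<bar>t\<bar>)" if "0 \<le> c"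
    using norm_scaleR[of c "(u, v)"] that by (simp add: abs_mult distrib_left)
  show "norm (u + u', v + v') + \<bar>t + t'\<bar> \<le> norm (u, v) + \<bar>t\<bar> + (\<bar>u'\<bar> + \<bar>v'\<bar> + \<bar>t'\<bar>)"
    using norm_triangle_ineq[of "(u, v)" "(u', v')"] norm_Pair_le[of u' v'] abs_triangle_ineq[of t t'] by simp
qed

lemma E_dn: "E.dn x z = dist (fst x, snd x, 0) z"
  unfolding E.dn_def dist_norm by (cases z) (simp add: norm_Pair)

lemma J_dn: "J.dn x z = dist x (fst z, fst (snd z)) + \<bar>snd (snd z)\<bar>"
  unfolding J.dn_def dist_norm by (cases x) simp

text \<open>Euclidean cells are convex: the plane is embedded linearly, and balls and the
  half-spaces between two nuclei are convex in space. The straight segment therefore serves as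
  connection.\<close>

interpretation E: crossing_norm "\<lambda>u v t. norm (u, v, t)"
proof
  fix P g x z y l r
  assume n: "E.near P g 0 x z" "E.near P g 0 y z" and lr: "l \<le> snd x" "snd x \<le> r" "l \<le> snd y" "snd y \<le> r"
  define e :: "pt2 \<Rightarrow> pt3" where "e w = (fst w, snd w, 0)" for w
  have lin: "linear e" by (rule linearI) (auto simp: e_def)
  have g0: "0 \<le> g" using n(1) E.dn_lb(1)[of x z] abs_ge_zero[of "fst x - fst z"] unfolding E.near_def by linarith
  have half: "convex {p :: pt3. dist p z \<le> dist p z'}" for z'
  proof -
    have "dist p z \<le> dist p z' \<longleftrightarrow> inner (z' - z) p \<le> (inner z' z' - inner z z) / 2" for p :: pt3
    proof -
      have "dist p z \<le> dist p z' \<longleftrightarrow> (dist p z)\<^sup>2 \<le> (dist p z')\<^sup>2" by (simp add: power2_le_iff_abs_le)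
      also have "\<dots> \<longleftrightarrow> inner (p - z) (p - z) \<le> inner (p - z') (p - z')" by (simp only: dist_norm power2_norm_eq_inner)
      also have "\<dots> \<longleftrightarrow> inner (z' - z) p \<le> (inner z' z' - inner z z) / 2"
        by (simp add: inner_diff_left inner_diff_right inner_commute field_simps)
      finally show ?thesis .
    qed
    then have "{p. dist p z \<le> dist p z'} = {p. inner (z' - z) p \<le> (inner z' z' - inner z z) / 2}" by blast
    then show ?thesis by (simp only: convex_halfspace_le)
  qed
  have seg: "e w \<in> closed_segment (e x) (e y)" if "w \<in> closed_segment x y" for w
    using closed_segment_linear_image[OF lin, of x y] that by blast
  have nw: "E.near P g 0 w z" if w: "w \<in> closed_segment x y" for w
    unfolding E.near_def
  proof (intro conjI ballI)
    have "closed_segment (e x) (e y) \<subseteq> cball z g"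
      using n by (intro closed_segment_subset) (auto simp: E.near_def E_dn e_def dist_commute)
    then show "E.dn w z \<le> g + 0" using seg[OF w] by (auto simp: E_dn e_def dist_commute)
    fix z' assume "z' \<in> P"
    then have "closed_segment (e x) (e y) \<subseteq> {p. dist p z \<le> dist p z'}"
      using n by (intro closed_segment_subset half) (auto simp: E.near_def E_dn e_def)
    then show "E.dn w z \<le> E.dn w z' + 0" using seg[OF w] by (auto simp: E_dn e_def)
  qed
  have "{w :: pt2. l \<le> snd w \<and> snd w \<le> r} = UNIV \<times> {l..r}" by auto
  then have "convex {w :: pt2. l \<le> snd w \<and> snd w \<le> r}" by (simp add: convex_Times)
  then have "closed_segment x y \<subseteq> {w. l \<le> snd w \<and> snd w \<le> r}" using lr by (intro closed_segment_subset) auto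
  then have "closed_segment x y \<subseteq> {w. E.near P g 0 w z \<and> l - g \<le> snd w \<and> snd w \<le> r + g}" using nw g0 by force
  then show "pl {w. E.near P g 0 w z \<and> l - g \<le> snd w \<and> snd w \<le> r + g} x y" by (rule r_into_rtranclp)
qed

text \<open>For the Johnson--Mehl norm the cells need not be convex, but they are star-shaped about the projection
  of their nucleus.\<close>
interpretation J: crossing_norm "\<lambda>u v t. norm (u, v) + \<bar>t\<bar>"
proof
  fix P g x z y l r
  assume n: "J.near P g 0 x z" "J.near P g 0 y z" and lr: "l \<le> snd x" "snd x \<le> r" "l \<le> snd y" "snd y \<le> r"
  define c where "c = (fst z, fst (snd z))"
  let ?S = "{w. J.near P g 0 w z \<and> l - g \<le> snd w \<and> snd w \<le> r + g}"
  have star: "closed_segment v c \<subseteq> ?S" if v: "J.near P g 0 v z" "l \<le> snd v" "snd v \<le> r" for v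
  proof
    fix w assume "w \<in> closed_segment v c"
    then have b: "dist v c = dist v w + dist w c" by (simp add: between_mem_segment[symmetric] between)
    \<comment> \<open>Moving towards the projection of the nucleus reduces the own distance by
      exactly the length moved, while any other distance falls by at most that much.\<close>
    have z: "J.dn w z = J.dn v z - dist v w" using b by (simp add: J_dn c_def)
    have z': "J.dn v y' \<le> J.dn w y' + dist v w" for y'
      using dist_triangle[of v "(fst y', fst (snd y'))" w] by (simp add: J_dn)
    have "J.near P g 0 w z" unfolding J.near_def
    proof (intro conjI ballI)
      show "J.dn w z \<le> g + 0" using z v(1) zero_le_dist[of v w] unfolding J.near_def by linarith
      fix y' assume "y' \<in> P"
      then have "J.dn v z \<le> J.dn v y' + 0" using v(1) unfolding J.near_def by blast
      then show "J.dn w z \<le> J.dn w y' + 0" using z z'[of y'] by linarith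
    qed
    moreover have "\<bar>snd v - snd w\<bar> \<le> g"
    proof -
      have "\<bar>snd v - snd w\<bar> \<le> dist v w" using dist_snd_le[of v w] by (simp add: dist_real_def)
      also have "\<dots> \<le> dist v c" using b zero_le_dist[of w c] by linarith
      also have "\<dots> \<le> J.dn v z" by (simp add: J_dn c_def)
      also have "\<dots> \<le> g" using v(1) unfolding J.near_def by simp
      finally show ?thesis .
    qed
    ultimately show "w \<in> ?S" using v(2,3) by auto
  qed
  have "closed_segment x c \<subseteq> ?S" "closed_segment c y \<subseteq> ?S"
    using star[OF n(1) lr(1,2)] star[OF n(2) lr(3,4)] by (simp_all add: closed_segment_commute)
  then show "pl ?S x y" by (intro rtranclp.rtrancl_into_rtrancl[OF r_into_rtranclp, of _ x c y]) auto
qed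

theorem theorem3p3:
  fixes M :: "'w measure" and Q :: "'w \<Rightarrow> (pt3 \<times> bool) set"
    and d :: "pt3 \<Rightarrow> pt3 \<Rightarrow> real"
    and p \<rho> c\<^sub>1 s\<^sub>1 :: real
  assumes "d = dist_JM \<or> d = dist"
    and "marked_poisson_process M p Q"
    and "\<rho> > 1" and "p > 1/2" and "p \<le> 1" and "c\<^sub>1 < 1"
  shows "\<exists>s > s\<^sub>1. \<exists>A \<in> sets M.
           A \<subseteq> {\<omega> \<in> space M. black_crossing d (Q \<omega>) (\<rho> * s) s} \<and>
           measure M A > c\<^sub>1"
  using assms(1)
proof
  assume d: "d = dist_JM"
  show ?thesis
  proof (rule J.likely_crossing[OF _ assms(2-6)])
    show "d (fst x, snd x, 0) z = J.dn x z" for x z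
      by (cases z; cases x) (simp add: d dist_JM_def J_dn dist_prod_def dist_real_def)
  qed
next
  assume d: "d = dist"
  show ?thesis
    by (rule E.likely_crossing[OF _ assms(2-6)]) (simp add: d E_dn)
qed

end
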